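(* Let $(H,\mu,u,\Delta,\epsilon,S)$ be a proper Hopf $(\Gamma,\omega)$-algebra over $\mathbb{K}$ with bijective antipode, let $(H^0,\mu_0,u_0,\Delta_0,\epsilon_0,S_0)$ be the opposite of its finite dual, and put $D(H)=H\otimes_{\mathbb{K}}H^0$. The $\Gamma$-graded $\mathbb{K}$-module $D(H)$ can be endowed with an associative $(\Gamma,\omega)$-algebra structure with unit map $\bar u:\mathbb{K}\to D(H)$, $a\mapsto a\,1_{D(H)}=a\,1\otimes\epsilon$, and multiplication $\bar\mu:D(H)\otimes D(H)\to D(H)$ defined by the composition $$H\otimes H^0\otimes H\otimes H^0\xrightarrow{\ \mathrm{id}\otimes\psi\otimes\mathrm{id}\ }H\otimes H\otimes H^0\otimes H^0\xrightarrow{\ \mu\otimes\mu_0\ }H\otimes H^0,$$ where $\psi:H^0\otimes H\to H\otimes H^0$ is the map $\psi(f\otimes x)=\sum\omega(d f_{(2)},d x_{(1)})\,(f_{(1)}\blacktriangleright x_{(1)})\otimes(f_{(2)}\lhd x_{(2)})$.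
   Context: $\Gamma$ is an additive abelian group with commutative factor $\omega$ ($\omega(\alpha,\beta)=\omega(\beta,\alpha)^{-1}$, multiplicative in each argument; no other condition), $\mathbb{K}$ a commutative ring with identity (over which the values of $\omega$ act as units). $d x$ is the degree of a homogeneous $x$; formulas with $\omega$ are for homogeneous elements and extended linearly. Tensor products of $(\Gamma,\omega)$-algebras (i.e. $\Gamma$-graded associative algebras) have multiplication $(a\otimes b)(c\otimes e)=\omega(d b,d c)ac\otimes be$. A Hopf $(\Gamma,\omega)$-algebra $(H,\mu,u,\Delta,\epsilon,S)$ is a $(\Gamma,\omega)$-algebra with coassociative co-multiplication $\Delta:H\to H\otimes H$ and co-unit $\epsilon$, both degree $0$ algebra homomorphisms, and degree $0$ antipode $S$ with $S(xy)=\omega(d x,d y)S(y)S(x)$ and $\sum S(x_{(1)})x_{(2)}=\sum x_{(1)}S(x_{(2)})=\epsilon(x)1$. Sweedler notation $\Delta(x)=\sum x_{(1)}\otimes x_{(2)}$ is used. $H^*$ is the $\Gamma$-graded dual; pairings on tensor squares are $\langle f\otimes g,x\otimes y\rangle=\omega(d g,d x)\langle f,x\rangle\langle g,y\rangle$. The finite dual $H^0$ is the set of $f\in H^*$ such that $\ker f$ contains a homogeneous two-sided ideal $\mathcal{J}$ with $H/\mathcal{J}$ a finitely generated $\mathbb{K}$-module. $H$ is proper if for every non-zero $x\in H$ there is $f\in H^0$ with $\langle f,x\rangle\neq0$. When $S$ is bijective, $H^0$ is given the (opposite) Hopf structure: $\langle\mu_0(f\otimes g),x\rangle=\langle f\otimes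 g,\Delta(x)\rangle$, unit $\epsilon$, $\langle\Delta_0(f),x\otimes y\rangle=\omega(d x,d y)\langle f,yx\rangle$, $\epsilon_0(f)=f(1)$, $\langle S_0(f),x\rangle=\langle f,S^{-1}(x)\rangle$; write $\Delta_0(f)=\sum f_{(1)}\otimes f_{(2)}$. For $f\in H^0$, $x\in H$: $f\blacktriangleright x=\sum\langle S_0(f),x_{(1)}\rangle x_{(2)}$ and $f\lhd x=\sum f_{(1)}\langle f_{(2)},x\rangle$. *)

theory Defs
  imports "HOL-Algebra.Module" "HOL-Algebra.Ideal" "HOL.Hull"
begin

section \<open>Modules: spans, linear maps, quotients\<close>

definition module_span :: "('k, 'q) ring_scheme \<Rightarrow> ('k, 'a, 'm) module_scheme \<Rightarrow> 'a set \<Rightarrow> 'a set" where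
  "module_span K M X = (\<lambda>N. submodule N K M) hull X"

definition finitely_generated :: "('k, 'q) ring_scheme \<Rightarrow> ('k, 'a, 'm) module_scheme \<Rightarrow> bool" where
  "finitely_generated K M \<longleftrightarrow>
     (\<exists>X. finite X \<and> X \<subseteq> carrier M \<and> module_span K M X = carrier M)"

definition linear_map ::
  "('k, 'q) ring_scheme \<Rightarrow> ('k, 'a, 'm) module_scheme \<Rightarrow> ('k, 'b, 'n) module_scheme \<Rightarrow> ('a \<Rightarrow> 'b) \<Rightarrow> bool"
where
  "linear_map K M N f \<longleftrightarrow>
     f \<in> carrier M \<rightarrow> carrier N \<and>
     (\<forall>x\<in>carrier M. \<forall>y\<in>carrier M. f (x \<oplus>\<^bsub>M\<^esub> y) = f x \<oplus>\<^bsub>N\<^esub> f y) \<and>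
     (\<forall>k\<in>carrier K. \<forall>x\<in>carrier M. f (k \<odot>\<^bsub>M\<^esub> x) = k \<odot>\<^bsub>N\<^esub> f x)"

text \<open>
  ``Extended linearly'': the linear map that is determined by its prescribed values \<open>Q\<close> on a
  spanning set. Extensionality only serves to make the map unique as a total function.
\<close>

definition the_linear ::
  "('k, 'q) ring_scheme \<Rightarrow> ('k, 'a, 'm) module_scheme \<Rightarrow> ('k, 'b, 'n) module_scheme \<Rightarrow>
   (('a \<Rightarrow> 'b) \<Rightarrow> bool) \<Rightarrow> 'a \<Rightarrow> 'b" where
  "the_linear K M N Q = (THE f. f \<in> extensional (carrier M) \<and> linear_map K M N f \<and> Q f)"

text \<open>The fields \<open>mult\<close> and \<open>one\<close> of a \<open>module\<close> record are irrelevant for mere modules.\<close>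

definition quotient_module :: "('k, 'a, 'm) module_scheme \<Rightarrow> 'a set \<Rightarrow> ('k, 'a set) module" where
  "quotient_module M N =
     \<lparr>carrier = a_rcosets\<^bsub>M\<^esub> N, mult = undefined, one = undefined,
      zero = N, add = set_add M,
      smult = (\<lambda>k X. \<Union>x\<in>X. N +>\<^bsub>M\<^esub> (k \<odot>\<^bsub>M\<^esub> x))\<rparr>"

definition free_module :: "('k, 'q) ring_scheme \<Rightarrow> 's set \<Rightarrow> ('k, 's \<Rightarrow> 'k) module" where
  "free_module K S =
     \<lparr>carrier = {\<phi>. (\<forall>s\<in>S. \<phi> s \<in> carrier K) \<and> (\<forall>s. s \<notin> S \<longrightarrow> \<phi> s = \<zero>\<^bsub>K\<^esub>) \<and>
                     finite {s. \<phi> s \<noteq> \<zero>\<^bsub>K\<^esub>}},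
      mult = undefined, one = undefined,
      zero = (\<lambda>s. \<zero>\<^bsub>K\<^esub>), add = (\<lambda>\<phi> \<chi> s. \<phi> s \<oplus>\<^bsub>K\<^esub> \<chi> s),
      smult = (\<lambda>k \<phi> s. k \<otimes>\<^bsub>K\<^esub> \<phi> s)\<rparr>"

definition basis_vector :: "('k, 'q) ring_scheme \<Rightarrow> 's \<Rightarrow> 's \<Rightarrow> 'k" where
  "basis_vector K s = (\<lambda>t. if t = s then \<one>\<^bsub>K\<^esub> else \<zero>\<^bsub>K\<^esub>)"


section \<open>Graded modules and algebras\<close>

locale commutative_factor = cring K for K (structure) +
  fixes \<omega> :: "'g::ab_group_add \<Rightarrow> 'g \<Rightarrow> 'k"
  assumes factor_unit: "\<omega> \<alpha> \<beta> \<in> Units K"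
    and factor_skew: "\<omega> \<alpha> \<beta> = inv (\<omega> \<beta> \<alpha>)"
    and factor_add_left: "\<omega> (\<alpha> + \<beta>) \<gamma> = \<omega> \<alpha> \<gamma> \<otimes> \<omega> \<beta> \<gamma>"
    and factor_add_right: "\<omega> \<alpha> (\<beta> + \<gamma>) = \<omega> \<alpha> \<beta> \<otimes> \<omega> \<alpha> \<gamma>"

record ('k, 'a, 'g) graded_module = "('k, 'a) module" +
  homog :: "'g \<Rightarrow> 'a set"

definition decomposition :: "('k, 'a, 'g, 'm) graded_module_scheme \<Rightarrow> 'a \<Rightarrow> ('g \<Rightarrow> 'a) \<Rightarrow> bool" where
  "decomposition M x c \<longleftrightarrow>
     (\<forall>\<alpha>. c \<alpha> \<in> homog M \<alpha>) \<and> finite {\<alpha>. c \<alpha> \<noteq> \<zero>\<^bsub>M\<^esub>} \<and>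
     x = (\<Oplus>\<^bsub>M\<^esub>\<alpha>\<in>{\<alpha>. c \<alpha> \<noteq> \<zero>\<^bsub>M\<^esub>}. c \<alpha>)"

locale graded_module = module K M
  for K (structure) and M :: "('k, 'a, 'g::ab_group_add, 'm) graded_module_scheme" (structure) +
  assumes homog_submodule: "submodule (homog M \<alpha>) K M"
    and direct_sum: "x \<in> carrier M \<Longrightarrow> \<exists>!c. decomposition M x c"

locale graded_algebra = graded_module K A + ring A
  for K (structure) and A :: "('k, 'a, 'g::ab_group_add, 'm) graded_module_scheme" (structure) +
  assumes smult_mult_left:
      "\<lbrakk>k \<in> carrier K; x \<in> carrier A; y \<in> carrier A\<rbrakk> \<Longrightarrow>
         (k \<odot>\<^bsub>A\<^esub> x) \<otimes>\<^bsub>A\<^esub> y = k \<odot>\<^bsub>A\<^esub> (x \<otimes>\<^bsub>A\<^esub> y)"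
    and smult_mult_right:
      "\<lbrakk>k \<in> carrier K; x \<in> carrier A; y \<in> carrier A\<rbrakk> \<Longrightarrow>
         x \<otimes>\<^bsub>A\<^esub> (k \<odot>\<^bsub>A\<^esub> y) = k \<odot>\<^bsub>A\<^esub> (x \<otimes>\<^bsub>A\<^esub> y)"
    and one_homog: "\<one>\<^bsub>A\<^esub> \<in> homog A 0"
    and mult_homog:
      "\<lbrakk>x \<in> homog A \<alpha>; y \<in> homog A \<beta>\<rbrakk> \<Longrightarrow> x \<otimes>\<^bsub>A\<^esub> y \<in> homog A (\<alpha> + \<beta>)"

definition degree0_map ::
  "('k, 'q) ring_scheme \<Rightarrow> ('k, 'a, 'g, 'm) graded_module_scheme \<Rightarrow>
   ('k, 'b, 'g, 'n) graded_module_scheme \<Rightarrow> ('a \<Rightarrow> 'b) \<Rightarrow> bool" where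
  "degree0_map K M N f \<longleftrightarrow>
     linear_map K M N f \<and> (\<forall>\<alpha>. f ` homog M \<alpha> \<subseteq> homog N \<alpha>)"

definition ground_algebra :: "('k, 'q) ring_scheme \<Rightarrow> ('k, 'k, 'g::ab_group_add) graded_module" where
  "ground_algebra K =
     \<lparr>carrier = carrier K, mult = mult K, one = \<one>\<^bsub>K\<^esub>, zero = \<zero>\<^bsub>K\<^esub>, add = add K,
      smult = mult K, homog = (\<lambda>\<alpha>. if \<alpha> = 0 then carrier K else {\<zero>\<^bsub>K\<^esub>})\<rparr>"


section \<open>Tensor products\<close>

text \<open>\<open>M \<otimes> N\<close> is the free module on \<open>M \<times> N\<close> modulo the bilinearity relations.\<close>

definition bilinearity_relations ::
  "('k, 'q) ring_scheme \<Rightarrow> ('k, 'a, 'm) module_scheme \<Rightarrow> ('k, 'b, 'n) module_scheme \<Rightarrow>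
   ('a \<times> 'b \<Rightarrow> 'k) set" where
  "bilinearity_relations K M N =
    (let F = free_module K (carrier M \<times> carrier N); e = basis_vector K in
     module_span K F
      ({e (x \<oplus>\<^bsub>M\<^esub> x', y) \<ominus>\<^bsub>F\<^esub> (e (x, y) \<oplus>\<^bsub>F\<^esub> e (x', y)) | x x' y.
          x \<in> carrier M \<and> x' \<in> carrier M \<and> y \<in> carrier N} \<union>
       {e (x, y \<oplus>\<^bsub>N\<^esub> y') \<ominus>\<^bsub>F\<^esub> (e (x, y) \<oplus>\<^bsub>F\<^esub> e (x, y')) | x y y'.
          x \<in> carrier M \<and> y \<in> carrier N \<and> y' \<in> carrier N} \<union>
       {e (k \<odot>\<^bsub>M\<^esub> x, y) \<ominus>\<^bsub>F\<^esub> k \<odot>\<^bsub>F\<^esub> e (x, y) | k x y.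
          k \<in> carrier K \<and> x \<in> carrier M \<and> y \<in> carrier N} \<union>
       {e (x, k \<odot>\<^bsub>N\<^esub> y) \<ominus>\<^bsub>F\<^esub> k \<odot>\<^bsub>F\<^esub> e (x, y) | k x y.
          k \<in> carrier K \<and> x \<in> carrier M \<and> y \<in> carrier N}))"

type_synonym ('k, 'a, 'b) tens = "('a \<times> 'b \<Rightarrow> 'k) set"

definition pure_tensor ::
  "('k, 'q) ring_scheme \<Rightarrow> ('k, 'a, 'm) module_scheme \<Rightarrow> ('k, 'b, 'n) module_scheme \<Rightarrow>
   'a \<Rightarrow> 'b \<Rightarrow> ('k, 'a, 'b) tens" where
  "pure_tensor K M N x y =
     bilinearity_relations K M N +>\<^bsub>free_module K (carrier M \<times> carrier N)\<^esub> basis_vector K (x, y)"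

definition tensor ::
  "('k, 'q) ring_scheme \<Rightarrow> ('k, 'a, 'g::ab_group_add, 'm) graded_module_scheme \<Rightarrow>
   ('k, 'b, 'g, 'n) graded_module_scheme \<Rightarrow> ('k, ('k, 'a, 'b) tens, 'g) graded_module" where
  "tensor K M N =
    (let T = quotient_module (free_module K (carrier M \<times> carrier N)) (bilinearity_relations K M N) in
     module.extend T (graded_module.fields
       (\<lambda>\<gamma>. module_span K T
          {pure_tensor K M N x y | x y \<alpha> \<beta>. x \<in> homog M \<alpha> \<and> y \<in> homog N \<beta> \<and> \<alpha> + \<beta> = \<gamma>})))"

definition tensor_map ::
  "('k, 'q) ring_scheme \<Rightarrow>
   ('k, 'a, 'g::ab_group_add, 'm1) graded_module_scheme \<Rightarrow> ('k, 'b, 'g, 'm2) graded_module_scheme \<Rightarrow>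
   ('k, 'c, 'g, 'm3) graded_module_scheme \<Rightarrow> ('k, 'd, 'g, 'm4) graded_module_scheme \<Rightarrow>
   ('a \<Rightarrow> 'c) \<Rightarrow> ('b \<Rightarrow> 'd) \<Rightarrow> ('k, 'a, 'b) tens \<Rightarrow> ('k, 'c, 'd) tens" where
  "tensor_map K A B C D f g =
     the_linear K (tensor K A B) (tensor K C D)
       (\<lambda>L. \<forall>a\<in>carrier A. \<forall>b\<in>carrier B.
          L (pure_tensor K A B a b) = pure_tensor K C D (f a) (g b))"

text \<open>\<open>x \<otimes> y \<mapsto> \<langle>\<phi>, x\<rangle> y\<close> and \<open>x \<otimes> y \<mapsto> \<langle>\<phi>, y\<rangle> x\<close>\<close>

definition contract_left ::
  "('k, 'q) ring_scheme \<Rightarrow> ('k, 'a, 'g::ab_group_add, 'm) graded_module_scheme \<Rightarrow>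
   ('k, 'b, 'g, 'n) graded_module_scheme \<Rightarrow> ('a \<Rightarrow> 'k) \<Rightarrow> ('k, 'a, 'b) tens \<Rightarrow> 'b" where
  "contract_left K M N \<phi> =
     the_linear K (tensor K M N) N
       (\<lambda>L. \<forall>x\<in>carrier M. \<forall>y\<in>carrier N. L (pure_tensor K M N x y) = \<phi> x \<odot>\<^bsub>N\<^esub> y)"

definition contract_right ::
  "('k, 'q) ring_scheme \<Rightarrow> ('k, 'a, 'g::ab_group_add, 'm) graded_module_scheme \<Rightarrow>
   ('k, 'b, 'g, 'n) graded_module_scheme \<Rightarrow> ('b \<Rightarrow> 'k) \<Rightarrow> ('k, 'a, 'b) tens \<Rightarrow> 'a" where
  "contract_right K M N \<phi> =
     the_linear K (tensor K M N) M
       (\<lambda>L. \<forall>x\<in>carrier M. \<forall>y\<in>carrier N. L (pure_tensor K M N x y) = \<phi> y \<odot>\<^bsub>M\<^esub> x)"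

definition mult_map ::
  "('k, 'q) ring_scheme \<Rightarrow> ('k, 'a, 'g::ab_group_add, 'm) graded_module_scheme \<Rightarrow>
   ('k, 'a, 'a) tens \<Rightarrow> 'a" where
  "mult_map K A =
     the_linear K (tensor K A A) A
       (\<lambda>L. \<forall>x\<in>carrier A. \<forall>y\<in>carrier A. L (pure_tensor K A A x y) = x \<otimes>\<^bsub>A\<^esub> y)"

text \<open>\<open>(a \<otimes> b) \<otimes> c \<mapsto> a \<otimes> (b \<otimes> c)\<close>\<close>

definition assoc_map ::
  "('k, 'q) ring_scheme \<Rightarrow> ('k, 'a, 'g::ab_group_add, 'm1) graded_module_scheme \<Rightarrow>
   ('k, 'b, 'g, 'm2) graded_module_scheme \<Rightarrow> ('k, 'c, 'g, 'm3) graded_module_scheme \<Rightarrow>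
   ('k, ('k, 'a, 'b) tens, 'c) tens \<Rightarrow> ('k, 'a, ('k, 'b, 'c) tens) tens" where
  "assoc_map K A B C =
     the_linear K (tensor K (tensor K A B) C) (tensor K A (tensor K B C))
       (\<lambda>L. \<forall>a\<in>carrier A. \<forall>b\<in>carrier B. \<forall>c\<in>carrier C.
          L (pure_tensor K (tensor K A B) C (pure_tensor K A B a b) c) =
          pure_tensor K A (tensor K B C) a (pure_tensor K B C b c))"

text \<open>\<open>(a \<otimes> b) \<otimes> (c \<otimes> d) \<mapsto> a \<otimes> ((b \<otimes> c) \<otimes> d)\<close> and its inverse\<close>

definition group_middle ::
  "('k, 'q) ring_scheme \<Rightarrow>
   ('k, 'a, 'g::ab_group_add, 'm1) graded_module_scheme \<Rightarrow> ('k, 'b, 'g, 'm2) graded_module_scheme \<Rightarrow>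
   ('k, 'c, 'g, 'm3) graded_module_scheme \<Rightarrow> ('k, 'd, 'g, 'm4) graded_module_scheme \<Rightarrow>
   ('k, ('k, 'a, 'b) tens, ('k, 'c, 'd) tens) tens \<Rightarrow>
   ('k, 'a, ('k, ('k, 'b, 'c) tens, 'd) tens) tens" where
  "group_middle K A B C D =
     the_linear K (tensor K (tensor K A B) (tensor K C D)) (tensor K A (tensor K (tensor K B C) D))
       (\<lambda>L. \<forall>a\<in>carrier A. \<forall>b\<in>carrier B. \<forall>c\<in>carrier C. \<forall>d\<in>carrier D.
          L (pure_tensor K (tensor K A B) (tensor K C D) (pure_tensor K A B a b) (pure_tensor K C D c d)) =
          pure_tensor K A (tensor K (tensor K B C) D) a
            (pure_tensor K (tensor K B C) D (pure_tensor K B C b c) d))"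

definition group_pairs ::
  "('k, 'q) ring_scheme \<Rightarrow>
   ('k, 'a, 'g::ab_group_add, 'm1) graded_module_scheme \<Rightarrow> ('k, 'b, 'g, 'm2) graded_module_scheme \<Rightarrow>
   ('k, 'c, 'g, 'm3) graded_module_scheme \<Rightarrow> ('k, 'd, 'g, 'm4) graded_module_scheme \<Rightarrow>
   ('k, 'a, ('k, ('k, 'b, 'c) tens, 'd) tens) tens \<Rightarrow>
   ('k, ('k, 'a, 'b) tens, ('k, 'c, 'd) tens) tens" where
  "group_pairs K A B C D =
     the_linear K (tensor K A (tensor K (tensor K B C) D)) (tensor K (tensor K A B) (tensor K C D))
       (\<lambda>L. \<forall>a\<in>carrier A. \<forall>b\<in>carrier B. \<forall>c\<in>carrier C. \<forall>d\<in>carrier D.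
          L (pure_tensor K A (tensor K (tensor K B C) D) a
               (pure_tensor K (tensor K B C) D (pure_tensor K B C b c) d)) =
          pure_tensor K (tensor K A B) (tensor K C D) (pure_tensor K A B a b) (pure_tensor K C D c d))"

text \<open>
  For \<open>\<psi> : B \<otimes> A \<rightarrow> A \<otimes> B\<close>, the product on \<open>A \<otimes> B\<close> given by
  \<open>A \<otimes> B \<otimes> A \<otimes> B \<rightarrow> A \<otimes> A \<otimes> B \<otimes> B \<rightarrow> A \<otimes> B\<close>, that is by \<open>id \<otimes> \<psi> \<otimes> id\<close> followed by the
  multiplications of \<open>A\<close> and \<open>B\<close>.
\<close>

definition twisted_mult ::
  "('k, 'q) ring_scheme \<Rightarrow> ('k, 'a, 'g::ab_group_add, 'm) graded_module_scheme \<Rightarrow>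
   ('k, 'b, 'g, 'n) graded_module_scheme \<Rightarrow> (('k, 'b, 'a) tens \<Rightarrow> ('k, 'a, 'b) tens) \<Rightarrow>
   ('k, 'a, 'b) tens \<Rightarrow> ('k, 'a, 'b) tens \<Rightarrow> ('k, 'a, 'b) tens" where
  "twisted_mult K A B \<psi> X Y =
     tensor_map K (tensor K A A) (tensor K B B) A B (mult_map K A) (mult_map K B)
      (group_pairs K A A B B
        (tensor_map K A (tensor K (tensor K B A) B) A (tensor K (tensor K A B) B)
          (\<lambda>a. a) (tensor_map K (tensor K B A) B (tensor K A B) B \<psi> (\<lambda>b. b))
          (group_middle K A B A B
            (pure_tensor K (tensor K A B) (tensor K A B) X Y))))"

definition twisted_tensor_algebra ::
  "('k, 'q) ring_scheme \<Rightarrow> ('k, 'a, 'g::ab_group_add, 'm) graded_module_scheme \<Rightarrow>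
   ('k, 'b, 'g, 'n) graded_module_scheme \<Rightarrow> (('k, 'b, 'a) tens \<Rightarrow> ('k, 'a, 'b) tens) \<Rightarrow>
   ('k, ('k, 'a, 'b) tens, 'g) graded_module" where
  "twisted_tensor_algebra K A B \<psi> =
     (tensor K A B)\<lparr>mult := twisted_mult K A B \<psi>,
                    one := pure_tensor K A B \<one>\<^bsub>A\<^esub> \<one>\<^bsub>B\<^esub>\<rparr>"

definition braiding ::
  "('k, 'q) ring_scheme \<Rightarrow> ('g::ab_group_add \<Rightarrow> 'g \<Rightarrow> 'k) \<Rightarrow>
   ('k, 'a, 'g, 'm) graded_module_scheme \<Rightarrow> ('k, 'b, 'g, 'n) graded_module_scheme \<Rightarrow>
   ('k, 'a, 'b) tens \<Rightarrow> ('k, 'b, 'a) tens" where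
  "braiding K \<omega> M N =
     the_linear K (tensor K M N) (tensor K N M)
       (\<lambda>L. \<forall>\<alpha> \<beta>. \<forall>x\<in>homog M \<alpha>. \<forall>y\<in>homog N \<beta>.
          L (pure_tensor K M N x y) = \<omega> \<alpha> \<beta> \<odot>\<^bsub>tensor K N M\<^esub> pure_tensor K N M y x)"

text \<open>\<open>(a \<otimes> b)(c \<otimes> e) = \<omega>(b,c) ac \<otimes> be\<close>\<close>

definition tensor_algebra ::
  "('k, 'q) ring_scheme \<Rightarrow> ('g::ab_group_add \<Rightarrow> 'g \<Rightarrow> 'k) \<Rightarrow>
   ('k, 'a, 'g, 'm) graded_module_scheme \<Rightarrow> ('k, 'b, 'g, 'n) graded_module_scheme \<Rightarrow>
   ('k, ('k, 'a, 'b) tens, 'g) graded_module" where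
  "tensor_algebra K \<omega> A B = twisted_tensor_algebra K A B (braiding K \<omega> B A)"


section \<open>Hopf algebras\<close>

record ('k, 'a, 'g) hopf_algebra = "('k, 'a, 'g) graded_module" +
  comult :: "'a \<Rightarrow> ('k, 'a, 'a) tens"
  counit :: "'a \<Rightarrow> 'k"
  antipode :: "'a \<Rightarrow> 'a"

locale hopf_algebra = commutative_factor K \<omega> + graded_algebra K H
  for K (structure) and \<omega> :: "'g::ab_group_add \<Rightarrow> 'g \<Rightarrow> 'k"
    and H :: "('k, 'a, 'g, 'm) hopf_algebra_scheme" (structure) +
  assumes comult_degree0: "degree0_map K H (tensor K H H) (comult H)"
    and comult_hom: "comult H \<in> ring_hom H (tensor_algebra K \<omega> H H)"
    and coassoc: "x \<in> carrier H \<Longrightarrow>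
      assoc_map K H H H (tensor_map K H H (tensor K H H) H (comult H) (\<lambda>y. y) (comult H x)) =
      tensor_map K H H H (tensor K H H) (\<lambda>y. y) (comult H) (comult H x)"
    and counit_degree0: "degree0_map K H (ground_algebra K) (counit H)"
    and counit_hom: "counit H \<in> ring_hom H (ground_algebra K :: (_, _, 'g) graded_module)"
    and counit_left: "x \<in> carrier H \<Longrightarrow> contract_left K H H (counit H) (comult H x) = x"
    and counit_right: "x \<in> carrier H \<Longrightarrow> contract_right K H H (counit H) (comult H x) = x"
    and antipode_degree0: "degree0_map K H H (antipode H)"
    and antipode_mult: "\<lbrakk>x \<in> homog H \<alpha>; y \<in> homog H \<beta>\<rbrakk> \<Longrightarrow>
      antipode H (x \<otimes>\<^bsub>H\<^esub> y) = \<omega> \<alpha> \<beta> \<odot>\<^bsub>H\<^esub> (antipode H y \<otimes>\<^bsub>H\<^esub> antipode H x)"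
    and antipode_left: "x \<in> carrier H \<Longrightarrow>
      mult_map K H (tensor_map K H H H H (antipode H) (\<lambda>y. y) (comult H x)) = counit H x \<odot>\<^bsub>H\<^esub> \<one>\<^bsub>H\<^esub>"
    and antipode_right: "x \<in> carrier H \<Longrightarrow>
      mult_map K H (tensor_map K H H H H (\<lambda>y. y) (antipode H) (comult H x)) = counit H x \<odot>\<^bsub>H\<^esub> \<one>\<^bsub>H\<^esub>"


section \<open>The finite dual\<close>

text \<open>
  Functionals are extensional on \<open>carrier M\<close>. The graded dual is the direct sum of its homogeneous
  parts, so a functional belongs to it iff it vanishes on all but finitely many \<open>homog M \<alpha>\<close>.
  With \<open>K\<close> in degree \<open>0\<close>, a functional of degree \<open>\<alpha>\<close> is supported on \<open>homog M (- \<alpha>)\<close>.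
\<close>

definition functionals ::
  "('k, 'q) ring_scheme \<Rightarrow> ('k, 'a, 'g::ab_group_add, 'm) graded_module_scheme \<Rightarrow> ('a \<Rightarrow> 'k) set" where
  "functionals K M =
     {f \<in> extensional (carrier M). linear_map K M (ground_algebra K :: (_, _, 'g) graded_module) f}"

definition graded_dual ::
  "('k, 'q) ring_scheme \<Rightarrow> ('k, 'a, 'g::ab_group_add, 'm) graded_module_scheme \<Rightarrow>
   ('k, 'a \<Rightarrow> 'k, 'g) graded_module" where
  "graded_dual K M =
     \<lparr>carrier = {f \<in> functionals K M. finite {\<alpha>. \<exists>x\<in>homog M \<alpha>. f x \<noteq> \<zero>\<^bsub>K\<^esub>}},
      mult = undefined, one = undefined,
      zero = (\<lambda>x\<in>carrier M. \<zero>\<^bsub>K\<^esub>),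
      add = (\<lambda>f g. \<lambda>x\<in>carrier M. f x \<oplus>\<^bsub>K\<^esub> g x),
      smult = (\<lambda>k f. \<lambda>x\<in>carrier M. k \<otimes>\<^bsub>K\<^esub> f x),
      homog = (\<lambda>\<alpha>. {f \<in> functionals K M. \<forall>\<beta>. \<beta> \<noteq> - \<alpha> \<longrightarrow> (\<forall>x\<in>homog M \<beta>. f x = \<zero>\<^bsub>K\<^esub>)})\<rparr>"

definition homogeneous_ideal :: "('k, 'a, 'g, 'm) graded_module_scheme \<Rightarrow> 'a set \<Rightarrow> bool" where
  "homogeneous_ideal A J \<longleftrightarrow>
     ideal J A \<and> (\<forall>x\<in>J. \<forall>c. decomposition A x c \<longrightarrow> (\<forall>\<alpha>. c \<alpha> \<in> J))"

definition finite_dual ::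
  "('k, 'q) ring_scheme \<Rightarrow> ('k, 'a, 'g::ab_group_add, 'm) graded_module_scheme \<Rightarrow>
   ('k, 'a \<Rightarrow> 'k, 'g) graded_module" where
  "finite_dual K A =
    (let H0 = {f \<in> carrier (graded_dual K A).
                \<exists>J. homogeneous_ideal A J \<and> finitely_generated K (quotient_module A J) \<and>
                    (\<forall>x\<in>J. f x = \<zero>\<^bsub>K\<^esub>)} in
     (graded_dual K A)\<lparr>carrier := H0, homog := (\<lambda>\<alpha>. homog (graded_dual K A) \<alpha> \<inter> H0)\<rparr>)"

definition proper ::
  "('k, 'q) ring_scheme \<Rightarrow> ('k, 'a, 'g::ab_group_add, 'm) graded_module_scheme \<Rightarrow> bool" where
  "proper K A \<longleftrightarrow>
     (\<forall>x\<in>carrier A. x \<noteq> \<zero>\<^bsub>A\<^esub> \<longrightarrow> (\<exists>f\<in>carrier (finite_dual K A). f x \<noteq> \<zero>\<^bsub>K\<^esub>))"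

text \<open>\<open>\<langle>f \<otimes> g, x \<otimes> y\<rangle> = \<omega>(g,x) \<langle>f,x\<rangle> \<langle>g,y\<rangle>\<close>\<close>

definition tensor_pairing ::
  "('k, 'q) ring_scheme \<Rightarrow> ('g::ab_group_add \<Rightarrow> 'g \<Rightarrow> 'k) \<Rightarrow>
   ('k, 'a, 'g, 'm) graded_module_scheme \<Rightarrow>
   ('k, 'a \<Rightarrow> 'k, 'a \<Rightarrow> 'k) tens \<Rightarrow> ('k, 'a, 'a) tens \<Rightarrow> 'k" where
  "tensor_pairing K \<omega> A F X =
    (let A0 = finite_dual K A; T = tensor K A A; T0 = tensor K A0 A0 in
     the_linear K (tensor K T0 T) (ground_algebra K :: (_, _, 'g) graded_module)
       (\<lambda>L. \<forall>\<alpha> \<beta>. \<forall>f\<in>carrier A0. \<forall>g\<in>homog A0 \<beta>. \<forall>x\<in>homog A \<alpha>. \<forall>y\<in>carrier A.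
          L (pure_tensor K T0 T (pure_tensor K A0 A0 f g) (pure_tensor K A A x y)) =
          \<omega> \<beta> \<alpha> \<otimes>\<^bsub>K\<^esub> (f x \<otimes>\<^bsub>K\<^esub> g y))
       (pure_tensor K T0 T F X))"

text \<open>
  Over a ring \<open>K\<close> that is not a field, the pairing need not separate the elements of
  \<open>H\<^sup>0 \<otimes> H\<^sup>0\<close>, so that the pairing formula for the comultiplication need not determine it.
  The comultiplication \<open>\<Delta>\<^sub>0\<close> is therefore a parameter; all other operations are
  determined by \<open>H\<close>.
\<close>

definition opposite_dual_structure ::
  "('k, 'q) ring_scheme \<Rightarrow> ('g::ab_group_add \<Rightarrow> 'g \<Rightarrow> 'k) \<Rightarrow>
   ('k, 'a, 'g, 'm) hopf_algebra_scheme \<Rightarrow>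
   (('a \<Rightarrow> 'k) \<Rightarrow> ('k, 'a \<Rightarrow> 'k, 'a \<Rightarrow> 'k) tens) \<Rightarrow> ('k, 'a \<Rightarrow> 'k, 'g) hopf_algebra" where
  "opposite_dual_structure K \<omega> H \<Delta>\<^sub>0 =
    (let H0 = finite_dual K H in
     graded_module.extend
       (H0\<lparr>mult := (\<lambda>f g. \<lambda>x\<in>carrier H.
                     tensor_pairing K \<omega> H (pure_tensor K H0 H0 f g) (comult H x)),
           one := restrict (counit H) (carrier H)\<rparr>)
       (hopf_algebra.fields
          \<Delta>\<^sub>0
          (\<lambda>f. f \<one>\<^bsub>H\<^esub>)
          (\<lambda>f. \<lambda>x\<in>carrier H. f (inv_into (carrier H) (antipode H) x))))"

definition opposite_finite_dual ::
  "('k, 'q) ring_scheme \<Rightarrow> ('g::ab_group_add \<Rightarrow> 'g \<Rightarrow> 'k) \<Rightarrow>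
   ('k, 'a, 'g, 'm) hopf_algebra_scheme \<Rightarrow> ('k, 'a \<Rightarrow> 'k, 'g) hopf_algebra \<Rightarrow> bool" where
  "opposite_finite_dual K \<omega> H H0 \<longleftrightarrow>
     hopf_algebra K \<omega> H0 \<and>
     H0 = opposite_dual_structure K \<omega> H (comult H0) \<and>
     (\<forall>f\<in>carrier H0. \<forall>\<alpha> \<beta>. \<forall>x\<in>homog H \<alpha>. \<forall>y\<in>homog H \<beta>.
        tensor_pairing K \<omega> H (comult H0 f) (pure_tensor K H H x y) =
        \<omega> \<alpha> \<beta> \<otimes>\<^bsub>K\<^esub> f (y \<otimes>\<^bsub>H\<^esub> x))"


section \<open>The double\<close>

definition dual_left_action ::
  "('k, 'q) ring_scheme \<Rightarrow> ('k, 'a, 'g::ab_group_add, 'm) hopf_algebra_scheme \<Rightarrow>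
   ('k, 'a \<Rightarrow> 'k, 'g, 'n) hopf_algebra_scheme \<Rightarrow> ('a \<Rightarrow> 'k) \<Rightarrow> 'a \<Rightarrow> 'a" where
  "dual_left_action K H H0 f x = contract_left K H H (antipode H0 f) (comult H x)"

definition dual_right_action ::
  "('k, 'q) ring_scheme \<Rightarrow> ('k, 'a \<Rightarrow> 'k, 'g::ab_group_add, 'n) hopf_algebra_scheme \<Rightarrow>
   ('a \<Rightarrow> 'k) \<Rightarrow> 'a \<Rightarrow> ('a \<Rightarrow> 'k)" where
  "dual_right_action K H0 f x = contract_right K H0 H0 (\<lambda>g. g x) (comult H0 f)"

text \<open>
  \<open>f \<otimes> x \<mapsto> \<Sum> \<omega>(f\<^sub>2,x\<^sub>1) (f\<^sub>1 \<cdot> x\<^sub>1) \<otimes> (f\<^sub>2 \<cdot> x\<^sub>2)\<close> with the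
  left and the right action above: the comultiplications of \<open>H\<^sup>0\<close> and \<open>H\<close>, followed by a linear map
  on \<open>(H\<^sup>0 \<otimes> H\<^sup>0) \<otimes> (H \<otimes> H)\<close>.
\<close>

definition double_exchange ::
  "('k, 'q) ring_scheme \<Rightarrow> ('g::ab_group_add \<Rightarrow> 'g \<Rightarrow> 'k) \<Rightarrow>
   ('k, 'a, 'g, 'm) hopf_algebra_scheme \<Rightarrow> ('k, 'a \<Rightarrow> 'k, 'g, 'n) hopf_algebra_scheme \<Rightarrow>
   ('k, 'a \<Rightarrow> 'k, 'a) tens \<Rightarrow> ('k, 'a, 'a \<Rightarrow> 'k) tens" where
  "double_exchange K \<omega> H H0 X =
    (let T = tensor K H H; T0 = tensor K H0 H0 in
     the_linear K (tensor K T0 T) (tensor K H H0)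
       (\<lambda>L. \<forall>\<alpha> \<beta>. \<forall>f1\<in>carrier H0. \<forall>f2\<in>homog H0 \<beta>. \<forall>x1\<in>homog H \<alpha>. \<forall>x2\<in>carrier H.
          L (pure_tensor K T0 T (pure_tensor K H0 H0 f1 f2) (pure_tensor K H H x1 x2)) =
          \<omega> \<beta> \<alpha> \<odot>\<^bsub>tensor K H H0\<^esub>
            pure_tensor K H H0 (dual_left_action K H H0 f1 x1) (dual_right_action K H0 f2 x2))
       (tensor_map K H0 H T0 T (comult H0) (comult H) X))"

definition drinfeld_double ::
  "('k, 'q) ring_scheme \<Rightarrow> ('g::ab_group_add \<Rightarrow> 'g \<Rightarrow> 'k) \<Rightarrow>
   ('k, 'a, 'g, 'm) hopf_algebra_scheme \<Rightarrow> ('k, 'a \<Rightarrow> 'k, 'g, 'n) hopf_algebra_scheme \<Rightarrow>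
   ('k, ('k, 'a, 'a \<Rightarrow> 'k) tens, 'g) graded_module" where
  "drinfeld_double K \<omega> H H0 = twisted_tensor_algebra K H H0 (double_exchange K \<omega> H H0)"

end

(*
  Write R_a f = f(- a) and L_c f = f(c -) for the translates of a functional f. The comultiplication of the
  opposite dual enters the exchange map psi only through contractions with elements of H, and these are
  translations, so that for f homogeneous of degree phi, with the coproduct components x_i of degree d_i,

    psi(f (x) x) = sum omega(phi + d_1, d_1 + d_2)  x_2 (x) L_{x_3} R_{S^{-1} x_1} f.

  On H (x) H^0 let l_a and r_g multiply by a on the left of the first factor and by g on the right of the
  second one, and put sigma_f(b (x) g) = r_g psi(f (x) b), so that (a (x) f) Y = l_a sigma_f Y. Associativity
  follows from psi(f g (x) b) = sigma_f(psi(g (x) b)) and from the dual compatibility of psi with products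
  in H. With the above formula the latter is the multiplicativity of the coproduct of H together with the
  antimultiplicativity of S^{-1}, and the former follows from coassociativity and the formulas for the
  translates of a product f g; that for R_{S^{-1} x} uses S_0(f g) = omega(f, g) S_0(g) S_0(f), which replaces
  anticomultiplicativity of S^{-1}. Two bicharacter identities show that the signs agree.
*)

theory Submission
  imports Defs
begin

section \<open>Linear maps, spans and quotients\<close>

text \<open>Over a ring that is not a field the pairing need not separate the elements of
  \<open>H0 \<otimes> H0\<close>, so an identity for the comultiplication of \<open>H0\<close>
  cannot be proved by evaluating it. After one leg is contracted with an element of
  \<open>H\<close>, a functional on \<open>H\<close> remains, and functionals with equal values are
  equal. This is why \<psi> is expressed by translates before anything is compared.

  The signs depend on degrees, so the summands of Sweedler sums are linear only on each homogeneous
  part, and bilinear maps are too narrow a notion. The preparations provide a graded universal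
  property: a family of maps that is bilinear on each pair of homogeneous parts has a unique linear
  extension to the tensor product. It yields Sweedler sums with signs, the interchange of nested
  sums, and the replacement of signs that agree in the degrees that occur.

  Degrees of functionals are controlled by one principle: f(x) is nonzero only if the degrees of f
  and x are opposite. So the degree of a leg of \<Delta>_0(f) is known where its contraction does
  not vanish, and the signs come to depend on the degrees of f and of the legs of x alone.\<close>

lemma linear_mapI:
  assumes "\<And>x. x \<in> carrier M \<Longrightarrow> f x \<in> carrier N"
    and "\<And>x y. \<lbrakk>x \<in> carrier M; y \<in> carrier M\<rbrakk> \<Longrightarrow> f (x \<oplus>\<^bsub>M\<^esub> y) = f x \<oplus>\<^bsub>N\<^esub> f y"
    and "\<And>k x. \<lbrakk>k \<in> carrier K; x \<in> carrier M\<rbrakk> \<Longrightarrow> f (k \<odot>\<^bsub>M\<^esub> x) = k \<odot>\<^bsub>N\<^esub> f x"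
  shows "linear_map K M N f"
  using assms by (auto simp: linear_map_def)

lemma linear_map_closed: "\<lbrakk>linear_map K M N f; x \<in> carrier M\<rbrakk> \<Longrightarrow> f x \<in> carrier N"
  by (auto simp: linear_map_def)

lemma linear_map_add:
  "\<lbrakk>linear_map K M N f; x \<in> carrier M; y \<in> carrier M\<rbrakk> \<Longrightarrow> f (x \<oplus>\<^bsub>M\<^esub> y) = f x \<oplus>\<^bsub>N\<^esub> f y"
  by (auto simp: linear_map_def)

lemma linear_map_smult:
  "\<lbrakk>linear_map K M N f; k \<in> carrier K; x \<in> carrier M\<rbrakk> \<Longrightarrow> f (k \<odot>\<^bsub>M\<^esub> x) = k \<odot>\<^bsub>N\<^esub> f x"
  by (auto simp: linear_map_def)

lemma module_abelian_group: "module K M \<Longrightarrow> abelian_group M"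
  by (simp add: module_def)

lemma module_abelian_monoid: "module K M \<Longrightarrow> abelian_monoid M"
  by (simp add: module_def abelian_group_def)

lemma linear_map_zero:
  assumes "module K M" "module K N" "linear_map K M N f"
  shows "f \<zero>\<^bsub>M\<^esub> = \<zero>\<^bsub>N\<^esub>"
proof -
  interpret M: module K M by fact
  interpret N: module K N by fact
  have "f \<zero>\<^bsub>M\<^esub> = f (\<zero>\<^bsub>K\<^esub> \<odot>\<^bsub>M\<^esub> \<zero>\<^bsub>M\<^esub>)" by simp
  also have "\<dots> = \<zero>\<^bsub>K\<^esub> \<odot>\<^bsub>N\<^esub> f \<zero>\<^bsub>M\<^esub>"
    using assms(3) by (intro linear_map_smult) auto
  also have "\<dots> = \<zero>\<^bsub>N\<^esub>"
    using linear_map_closed[OF assms(3)] by simp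
  finally show ?thesis .
qed

lemma linear_map_neg:
  assumes "module K M" "module K N" "linear_map K M N f" "x \<in> carrier M"
  shows "f (\<ominus>\<^bsub>M\<^esub> x) = \<ominus>\<^bsub>N\<^esub> f x"
proof -
  interpret M: module K M by fact
  interpret N: module K N by fact
  have "f (\<ominus>\<^bsub>M\<^esub> x) \<oplus>\<^bsub>N\<^esub> f x = f (\<ominus>\<^bsub>M\<^esub> x \<oplus>\<^bsub>M\<^esub> x)"
    using assms by (simp add: linear_map_add)
  also have "\<dots> = \<zero>\<^bsub>N\<^esub>"
    using assms by (simp add: M.M.l_neg linear_map_zero)
  finally show ?thesis
    using assms linear_map_closed[OF assms(3)]
    by (intro N.M.minus_equality[symmetric]) auto
qed

lemma linear_map_finsum:
  assumes "module K M" "module K N" "linear_map K M N f" "finite A" "g \<in> A \<rightarrow> carrier M"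
  shows "f (finsum M g A) = finsum N (\<lambda>a. f (g a)) A"
proof -
  interpret M: module K M by fact
  interpret N: module K N by fact
  show ?thesis
    using assms(4,5)
  proof (induction A)
    case empty
    then show ?case using linear_map_zero[OF assms(1-3)] by simp
  next
    case (insert a A)
    then have g: "g a \<in> carrier M" "g \<in> A \<rightarrow> carrier M" by auto
    then show ?case
      using insert linear_map_closed[OF assms(3)]
      by (simp add: linear_map_add[OF assms(3)] Pi_def)
  qed
qed

lemma linear_map_comp:
  assumes "linear_map K N P g" "linear_map K M N f"
  shows "linear_map K M P (\<lambda>x. g (f x))"
  using assms by (auto simp: linear_map_def Pi_def)

lemma linear_map_cong:
  assumes "module K M" "linear_map K M N f" "\<And>x. x \<in> carrier M \<Longrightarrow> f x = g x"
  shows "linear_map K M N g"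
proof -
  interpret M: module K M by fact
  show ?thesis
    using assms(2,3) by (auto simp: linear_map_def Pi_def)
qed

lemma submodule_zero: "submodule N K M \<Longrightarrow> \<zero>\<^bsub>M\<^esub> \<in> N"
  using subgroup.one_closed[OF submodule.axioms(1)] by force

lemma submodule_add: "\<lbrakk>submodule N K M; x \<in> N; y \<in> N\<rbrakk> \<Longrightarrow> x \<oplus>\<^bsub>M\<^esub> y \<in> N"
  using subgroup.m_closed[OF submodule.axioms(1)] by force

lemma submodule_subset: "submodule N K M \<Longrightarrow> N \<subseteq> carrier M"
  using subgroup.subset[OF submodule.axioms(1)] by force

lemma submodule_vimage:
  assumes "module K M" "module K P" "linear_map K M P f" "submodule N K P"
  shows "submodule {x \<in> carrier M. f x \<in> N} K M"
proof -
  interpret M: module K M by fact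
  interpret P: module K P by fact
  show ?thesis
    using assms submodule_zero[OF assms(4)] submodule_add[OF assms(4)] P.submoduleE(3,4)[OF assms(4)]
    by (intro M.submoduleI)
      (auto simp: linear_map_zero linear_map_neg linear_map_add linear_map_smult)
qed

lemma submodule_equalizer:
  assumes "module K M" "module K P" "linear_map K M P f" "linear_map K M P g"
  shows "submodule {x \<in> carrier M. f x = g x} K M"
proof -
  interpret M: module K M by fact
  show ?thesis
    using assms
    by (intro M.submoduleI)
      (auto simp: linear_map_zero linear_map_neg linear_map_add linear_map_smult)
qed

lemma module_span_submodule:
  assumes "module K M" "X \<subseteq> carrier M"
  shows "submodule (module_span K M X) K M"
proof -
  interpret M: module K M by fact
  have sub: "submodule (carrier M) K M" by (rule M.carrier_is_submodule)
  show ?thesis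
    unfolding module_span_def hull_def
    using assms(2) sub
    by (intro M.submoduleI) (auto simp: submodule_zero submodule_add M.submoduleE(3,4))
qed

lemma module_span_minimal: "\<lbrakk>submodule N K M; X \<subseteq> N\<rbrakk> \<Longrightarrow> module_span K M X \<subseteq> N"
  unfolding module_span_def by (rule hull_minimal)

lemma module_span_superset: "X \<subseteq> module_span K M X"
  unfolding module_span_def by (rule hull_subset)

definition bilinear_map ::
  "('k, 'q) ring_scheme \<Rightarrow> ('k, 'a, 'm) module_scheme \<Rightarrow> ('k, 'b, 'n) module_scheme \<Rightarrow>
   ('k, 'c, 'p) module_scheme \<Rightarrow> ('a \<Rightarrow> 'b \<Rightarrow> 'c) \<Rightarrow> bool" where
  "bilinear_map K M N P B \<longleftrightarrow>
     (\<forall>y\<in>carrier N. linear_map K M P (\<lambda>x. B x y)) \<and> (\<forall>x\<in>carrier M. linear_map K N P (B x))"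

lemma bilinear_mapI:
  assumes "\<And>y. y \<in> carrier N \<Longrightarrow> linear_map K M P (\<lambda>x. B x y)"
    and "\<And>x. x \<in> carrier M \<Longrightarrow> linear_map K N P (\<lambda>y. B x y)"
  shows "bilinear_map K M N P B"
  using assms by (auto simp: bilinear_map_def)

lemma bilinear_mapD:
  assumes "bilinear_map K M N P B"
  shows "y \<in> carrier N \<Longrightarrow> linear_map K M P (\<lambda>x. B x y)"
    and "x \<in> carrier M \<Longrightarrow> linear_map K N P (\<lambda>y. B x y)"
    and "\<lbrakk>x \<in> carrier M; y \<in> carrier N\<rbrakk> \<Longrightarrow> B x y \<in> carrier P"
  using assms by (auto simp: bilinear_map_def linear_map_def)

text \<open>Sums over supports have index sets that vary with the argument; passing to a common
  finite superset makes additivity provable. The general summand \<open>g s (c s)\<close> covers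
  scalar multiples of basis images as well as degreewise linear maps, and \<open>z\<close> is the
  zero of the place where \<open>c\<close> takes its values, which may differ from
  \<open>P\<close>.\<close>

lemma finsum_support:
  assumes "abelian_monoid P" "finite S" "{s. c s \<noteq> z} \<subseteq> S"
    and "\<And>s. s \<in> S \<Longrightarrow> g s (c s) \<in> carrier P" "\<And>s. s \<in> S \<Longrightarrow> g s z = \<zero>\<^bsub>P\<^esub>"
  shows "finsum P (\<lambda>s. g s (c s)) {s. c s \<noteq> z} = finsum P (\<lambda>s. g s (c s)) S"
proof -
  interpret P: abelian_monoid P by fact
  show ?thesis
    using assms by (intro P.add.finprod_mono_neutral_cong_left) auto
qed

section \<open>Free modules and linear extension from a basis\<close>

lemma free_module_module:
  fixes K :: "('k, 'q) ring_scheme" and S :: "'s set"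
  assumes "cring K"
  shows "module K (free_module K S)"
proof -
  interpret K: cring K by fact
  have fin: "finite {s. \<phi> s \<oplus>\<^bsub>K\<^esub> \<chi> s \<noteq> \<zero>\<^bsub>K\<^esub>}"
    if "finite {s. \<phi> s \<noteq> \<zero>\<^bsub>K\<^esub>}" "finite {s. \<chi> s \<noteq> \<zero>\<^bsub>K\<^esub>}" for \<phi> \<chi> :: "'s \<Rightarrow> 'k"
    by (rule finite_subset[OF _ finite_UnI[OF that]]) auto
  have car: "\<phi> s \<in> carrier K" if "\<phi> \<in> carrier (free_module K S)" for \<phi> s
    using that by (cases "s \<in> S") (auto simp: free_module_def)
  have finm: "finite {s. k \<otimes>\<^bsub>K\<^esub> \<phi> s \<noteq> \<zero>\<^bsub>K\<^esub>}"
    if "finite {s. \<phi> s \<noteq> \<zero>\<^bsub>K\<^esub>}" "k \<in> carrier K" for k and \<phi> :: "'s \<Rightarrow> 'k"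
    by (rule finite_subset[OF _ that(1)]) (use that(2) in auto)
  have clo: "(\<lambda>s. \<phi> s \<oplus>\<^bsub>K\<^esub> \<chi> s) \<in> carrier (free_module K S)"
    if "\<phi> \<in> carrier (free_module K S)" "\<chi> \<in> carrier (free_module K S)" for \<phi> \<chi>
    using that by (simp add: free_module_def fin)
  have clom: "(\<lambda>s. k \<otimes>\<^bsub>K\<^esub> \<phi> s) \<in> carrier (free_module K S)"
    if "\<phi> \<in> carrier (free_module K S)" "k \<in> carrier K" for k \<phi>
    using that by (simp add: free_module_def finm)
  have zero: "(\<lambda>s. \<zero>\<^bsub>K\<^esub>) \<in> carrier (free_module K S)"
    by (simp add: free_module_def)
  have add: "add (free_module K S) = (\<lambda>\<phi> \<chi> s. \<phi> s \<oplus>\<^bsub>K\<^esub> \<chi> s)"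
    and smult: "smult (free_module K S) = (\<lambda>k \<phi> s. k \<otimes>\<^bsub>K\<^esub> \<phi> s)"
    and Zero: "\<zero>\<^bsub>free_module K S\<^esub> = (\<lambda>s. \<zero>\<^bsub>K\<^esub>)"
    by (simp_all add: free_module_def)
  show ?thesis
  proof (rule moduleI)
    show "abelian_group (free_module K S)"
    proof (rule abelian_groupI, unfold add Zero)
      fix \<phi> assume \<phi>: "\<phi> \<in> carrier (free_module K S)"
      have "{s. \<ominus>\<^bsub>K\<^esub> \<phi> s \<noteq> \<zero>\<^bsub>K\<^esub>} \<subseteq> {s. \<phi> s \<noteq> \<zero>\<^bsub>K\<^esub>}"
        by auto
      then have "finite {s. \<ominus>\<^bsub>K\<^esub> \<phi> s \<noteq> \<zero>\<^bsub>K\<^esub>}"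
        by (rule finite_subset) (use \<phi> in \<open>simp add: free_module_def\<close>)
      then have "(\<lambda>s. \<ominus>\<^bsub>K\<^esub> \<phi> s) \<in> carrier (free_module K S)"
        using \<phi> by (simp add: free_module_def)
      then show "\<exists>\<chi>\<in>carrier (free_module K S). (\<lambda>s. \<chi> s \<oplus>\<^bsub>K\<^esub> \<phi> s) = (\<lambda>s. \<zero>\<^bsub>K\<^esub>)"
        using car[OF \<phi>]
        by (intro bexI[of _ "\<lambda>s. \<ominus>\<^bsub>K\<^esub> \<phi> s"]) (simp_all add: K.l_neg)
    qed (simp_all add: clo zero car K.a_assoc K.a_comm[OF car car])
  qed (simp_all add: add smult car assms clom K.l_distr K.r_distr K.m_assoc)
qed

lemma basis_vector_carrier:
  assumes "cring K" "s \<in> S"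
  shows "basis_vector K s \<in> carrier (free_module K S)"
proof -
  interpret K: cring K by fact
  have "finite {t. basis_vector K s t \<noteq> \<zero>\<^bsub>K\<^esub>}"
    by (rule finite_subset[of _ "{s}"]) (auto simp: basis_vector_def)
  then show ?thesis
    using assms(2) by (auto simp: free_module_def basis_vector_def)
qed

definition free_lift ::
  "('k, 'q) ring_scheme \<Rightarrow> ('k, 'c, 'p) module_scheme \<Rightarrow> ('s \<Rightarrow> 'c) \<Rightarrow> ('s \<Rightarrow> 'k) \<Rightarrow> 'c" where
  "free_lift K P B \<phi> = (\<Oplus>\<^bsub>P\<^esub>s\<in>{s. \<phi> s \<noteq> \<zero>\<^bsub>K\<^esub>}. \<phi> s \<odot>\<^bsub>P\<^esub> B s)"

lemma free_lift_support:
  assumes "module K P" "B \<in> S \<rightarrow> carrier P" "\<phi> \<in> carrier (free_module K S)"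
    and "finite U" "{s. \<phi> s \<noteq> \<zero>\<^bsub>K\<^esub>} \<subseteq> U" "U \<subseteq> S"
  shows "free_lift K P B \<phi> = (\<Oplus>\<^bsub>P\<^esub>s\<in>U. \<phi> s \<odot>\<^bsub>P\<^esub> B s)"
proof -
  interpret P: module K P by fact
  show ?thesis
    unfolding free_lift_def
    using assms
    by (intro finsum_support[where g = "\<lambda>s k. k \<odot>\<^bsub>P\<^esub> B s"] P.M.abelian_monoid_axioms)
      (auto simp: free_module_def Pi_def subset_iff)
qed

lemma free_lift_linear:
  assumes "module K P" "B \<in> S \<rightarrow> carrier P"
  shows "linear_map K (free_module K S) P (free_lift K P B)"
proof -
  interpret P: module K P by fact
  interpret F: module K "free_module K S"
    using P.R.cring_axioms by (rule free_module_module)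
  have supp: "finite {s. \<phi> s \<noteq> \<zero>\<^bsub>K\<^esub>}" "{s. \<phi> s \<noteq> \<zero>\<^bsub>K\<^esub>} \<subseteq> S" "\<And>s. s \<in> S \<Longrightarrow> \<phi> s \<in> carrier K"
    if "\<phi> \<in> carrier (free_module K S)" for \<phi>
    using that by (auto simp: free_module_def)
  show ?thesis
  proof (rule linear_mapI)
    fix \<phi> assume "\<phi> \<in> carrier (free_module K S)"
    then show "free_lift K P B \<phi> \<in> carrier P"
      unfolding free_lift_def using supp[of \<phi>] assms(2)
      by (intro P.M.finsum_closed) (auto simp: Pi_def)
  next
    fix \<phi> \<chi>
    assume \<phi>: "\<phi> \<in> carrier (free_module K S)" and \<chi>: "\<chi> \<in> carrier (free_module K S)"
    define U where "U = {s. \<phi> s \<noteq> \<zero>\<^bsub>K\<^esub>} \<union> {s. \<chi> s \<noteq> \<zero>\<^bsub>K\<^esub>}"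
    have U: "finite U" "U \<subseteq> S" using supp \<phi> \<chi> by (auto simp: U_def)
    have eq: "(\<phi> \<oplus>\<^bsub>free_module K S\<^esub> \<chi>) = (\<lambda>s. \<phi> s \<oplus>\<^bsub>K\<^esub> \<chi> s)"
      by (simp add: free_module_def)
    let ?l = "free_lift K P B (\<phi> \<oplus>\<^bsub>free_module K S\<^esub> \<chi>)"
      and ?r = "free_lift K P B \<phi> \<oplus>\<^bsub>P\<^esub> free_lift K P B \<chi>"
    have "?l = (\<Oplus>\<^bsub>P\<^esub>s\<in>U. (\<phi> \<oplus>\<^bsub>free_module K S\<^esub> \<chi>) s \<odot>\<^bsub>P\<^esub> B s)"
      using \<phi> \<chi> U assms by (intro free_lift_support[where S = S] F.M.a_closed) (auto simp: eq U_def)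
    also have "\<dots> = (\<Oplus>\<^bsub>P\<^esub>s\<in>U. \<phi> s \<odot>\<^bsub>P\<^esub> B s \<oplus>\<^bsub>P\<^esub> \<chi> s \<odot>\<^bsub>P\<^esub> B s)"
    proof (rule P.M.finsum_cong')
      have *: "B s \<in> carrier P" "\<phi> s \<in> carrier K" "\<chi> s \<in> carrier K" if "s \<in> U" for s
        using that U(2) supp(3)[OF \<phi>] supp(3)[OF \<chi>] assms(2) by auto
      show "(\<lambda>s. \<phi> s \<odot>\<^bsub>P\<^esub> B s \<oplus>\<^bsub>P\<^esub> \<chi> s \<odot>\<^bsub>P\<^esub> B s) \<in> U \<rightarrow> carrier P"
        using * by auto
      show "(\<phi> \<oplus>\<^bsub>free_module K S\<^esub> \<chi>) s \<odot>\<^bsub>P\<^esub> B s = \<phi> s \<odot>\<^bsub>P\<^esub> B s \<oplus>\<^bsub>P\<^esub> \<chi> s \<odot>\<^bsub>P\<^esub> B s"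
        if "s \<in> U" for s
        using *[OF that] by (simp add: eq P.smult_l_distr)
    qed simp
    also have "\<dots> = (\<Oplus>\<^bsub>P\<^esub>s\<in>U. \<phi> s \<odot>\<^bsub>P\<^esub> B s) \<oplus>\<^bsub>P\<^esub> (\<Oplus>\<^bsub>P\<^esub>s\<in>U. \<chi> s \<odot>\<^bsub>P\<^esub> B s)"
      using U supp \<phi> \<chi> assms(2) by (intro P.M.finsum_addf) (auto simp: Pi_def subset_iff)
    also have "\<dots> = ?r"
      using \<phi> \<chi> U assms by (subst (1 2) free_lift_support[where S = S and U = U]) (auto simp: U_def)
    finally show "?l = ?r" .
  next
    fix k \<phi>
    assume k: "k \<in> carrier K" and \<phi>: "\<phi> \<in> carrier (free_module K S)"
    define U where "U = {s. \<phi> s \<noteq> \<zero>\<^bsub>K\<^esub>}"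
    have U: "finite U" "U \<subseteq> S" using supp \<phi> by (auto simp: U_def)
    have eq: "(k \<odot>\<^bsub>free_module K S\<^esub> \<phi>) = (\<lambda>s. k \<otimes>\<^bsub>K\<^esub> \<phi> s)"
      by (simp add: free_module_def)
    have * : "B s \<in> carrier P" "\<phi> s \<in> carrier K" if "s \<in> U" for s
      using that U(2) supp(3)[OF \<phi>] assms(2) by auto
    let ?l = "free_lift K P B (k \<odot>\<^bsub>free_module K S\<^esub> \<phi>)"
      and ?r = "k \<odot>\<^bsub>P\<^esub> free_lift K P B \<phi>"
    have "?l = (\<Oplus>\<^bsub>P\<^esub>s\<in>U. (k \<odot>\<^bsub>free_module K S\<^esub> \<phi>) s \<odot>\<^bsub>P\<^esub> B s)"
      using k \<phi> U assms
      by (intro free_lift_support[where S = S] F.smult_closed) (auto simp: eq U_def)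
    also have "\<dots> = (\<Oplus>\<^bsub>P\<^esub>s\<in>U. k \<odot>\<^bsub>P\<^esub> (\<phi> s \<odot>\<^bsub>P\<^esub> B s))"
      using * k by (intro P.M.finsum_cong') (auto simp: eq P.smult_assoc1)
    also have "\<dots> = k \<odot>\<^bsub>P\<^esub> (\<Oplus>\<^bsub>P\<^esub>s\<in>U. \<phi> s \<odot>\<^bsub>P\<^esub> B s)"
      using * U k by (intro P.finsum_smult_ldistr[symmetric]) auto
    also have "\<dots> = ?r"
      by (simp add: free_lift_def U_def)
    finally show "?l = ?r" .
  qed
qed

lemma free_lift_basis_vector:
  assumes "module K P" "B \<in> S \<rightarrow> carrier P" "s \<in> S"
  shows "free_lift K P B (basis_vector K s) = B s"
proof -
  interpret P: module K P by fact
  have B: "B s \<in> carrier P" using assms by auto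
  have "free_lift K P B (basis_vector K s) = (\<Oplus>\<^bsub>P\<^esub>t\<in>{s}. basis_vector K s t \<odot>\<^bsub>P\<^esub> B t)"
    using assms basis_vector_carrier[OF P.R.cring_axioms assms(3)]
    by (intro free_lift_support[where S = S]) (auto simp: basis_vector_def)
  also have "\<dots> = B s"
    using B by (simp add: basis_vector_def)
  finally show ?thesis .
qed

text \<open>Induction on the support. The scalar stays inside the generator case because in a tensor
  product it will be absorbed by a factor of a pure tensor.\<close>

lemma free_module_induct [consumes 2, case_names zero basis_vector add]:
  assumes "cring K" "\<phi> \<in> carrier (free_module K S)"
    and zero: "P \<zero>\<^bsub>free_module K S\<^esub>"
    and bv: "\<And>k s. \<lbrakk>k \<in> carrier K; s \<in> S\<rbrakk> \<Longrightarrow> P (k \<odot>\<^bsub>free_module K S\<^esub> basis_vector K s)"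
    and add: "\<And>\<phi> \<chi>. \<lbrakk>\<phi> \<in> carrier (free_module K S); \<chi> \<in> carrier (free_module K S); P \<phi>; P \<chi>\<rbrakk>
        \<Longrightarrow> P (\<phi> \<oplus>\<^bsub>free_module K S\<^esub> \<chi>)"
  shows "P \<phi>"
proof -
  interpret K: cring K by fact
  interpret F: module K "free_module K S"
    using assms(1) by (rule free_module_module)
  have "finite {s. \<phi> s \<noteq> \<zero>\<^bsub>K\<^esub>}" using assms(2) by (simp add: free_module_def)
  moreover have "P \<phi>" if "finite U" "{s. \<phi> s \<noteq> \<zero>\<^bsub>K\<^esub>} = U" "\<phi> \<in> carrier (free_module K S)" for U \<phi>
    using that
  proof (induction U arbitrary: \<phi>)
    case empty
    then have "\<phi> = \<zero>\<^bsub>free_module K S\<^esub>" by (auto simp: free_module_def)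
    then show ?case using zero by simp
  next
    case (insert s U)
    \<comment> \<open>\<open>\<chi>\<close> is \<open>\<phi>\<close> with the coordinate
      \<open>s\<close> erased, so its support is exactly \<open>U\<close>, and \<open>\<phi>\<close>
      is recovered by adding one multiple of a basis vector.\<close>
    define \<chi> where "\<chi> = (\<lambda>t. if t = s then \<zero>\<^bsub>K\<^esub> else \<phi> t)"
    have s: "s \<in> S" "\<phi> s \<in> carrier K" using insert.prems by (auto simp: free_module_def)
    have supp: "{t. \<chi> t \<noteq> \<zero>\<^bsub>K\<^esub>} = U" using insert.prems(1) insert.hyps(2) by (auto simp: \<chi>_def)
    have \<chi>: "\<chi> \<in> carrier (free_module K S)"
      using insert.prems(2) supp insert.hyps(1) by (auto simp: free_module_def \<chi>_def)
    have car: "\<phi> t \<in> carrier K" for t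
      using insert.prems(2) by (cases "t \<in> S") (auto simp: free_module_def)
    have b: "basis_vector K s \<in> carrier (free_module K S)"
      using assms(1) s(1) by (rule basis_vector_carrier)
    have "\<phi> = \<phi> s \<odot>\<^bsub>free_module K S\<^esub> basis_vector K s \<oplus>\<^bsub>free_module K S\<^esub> \<chi>"
      using car by (auto simp: free_module_def basis_vector_def \<chi>_def fun_eq_iff)
    moreover have "P \<dots>"
      using s b \<chi> supp by (intro add bv insert.IH F.smult_closed) auto
    ultimately show ?case by simp
  qed
  ultimately show ?thesis using assms(2) by blast
qed

section \<open>Quotient modules and maps that descend to them\<close>

lemma submodule_abelian_subgroup:
  assumes "module K M" "submodule N K M"
  shows "abelian_subgroup N M"
  using assms
  by (intro abelian_subgroupI3) (auto simp: additive_subgroup_def submodule_def module_def)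

lemma quotient_module_simps:
  "carrier (quotient_module M N) = a_rcosets\<^bsub>M\<^esub> N"
  "zero (quotient_module M N) = N"
  "add (quotient_module M N) = set_add M"
  by (simp_all add: quotient_module_def)

text \<open>Scalar multiplication is encoded as a union over all representatives of a coset. All
  members of that union are the same coset since \<open>N\<close> is closed under scalars, and the
  union is not empty, so it collapses.\<close>

lemma quotient_module_smult_coset:
  assumes "module K M" "submodule N K M" "k \<in> carrier K" "x \<in> carrier M"
  shows "k \<odot>\<^bsub>quotient_module M N\<^esub> (N +>\<^bsub>M\<^esub> x) = N +>\<^bsub>M\<^esub> (k \<odot>\<^bsub>M\<^esub> x)"
proof -
  interpret M: module K M by fact
  interpret N: abelian_subgroup N M using assms(1,2) by (rule submodule_abelian_subgroup)
  have eq: "N +>\<^bsub>M\<^esub> (k \<odot>\<^bsub>M\<^esub> y) = N +>\<^bsub>M\<^esub> (k \<odot>\<^bsub>M\<^esub> x)" if y: "y \<in> N +>\<^bsub>M\<^esub> x" for y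
  proof -
    obtain n where n: "n \<in> N" "y = n \<oplus>\<^bsub>M\<^esub> x" using y by (auto simp: a_r_coset_def')
    have nc: "n \<in> carrier M" using n(1) N.a_subset by auto
    have "k \<odot>\<^bsub>M\<^esub> y = k \<odot>\<^bsub>M\<^esub> n \<oplus>\<^bsub>M\<^esub> k \<odot>\<^bsub>M\<^esub> x"
      using n nc assms by (simp add: M.smult_r_distr)
    moreover have "k \<odot>\<^bsub>M\<^esub> n \<in> N"
      using n(1) assms M.submoduleE(4)[OF assms(2)] by blast
    ultimately have "k \<odot>\<^bsub>M\<^esub> y \<in> N +>\<^bsub>M\<^esub> (k \<odot>\<^bsub>M\<^esub> x)"
      by (auto simp: a_r_coset_def')
    then show ?thesis
      using M.a_repr_independence[OF _ _ N.a_subgroup] assms by simp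
  qed
  have "x \<in> N +>\<^bsub>M\<^esub> x"
    using assms by (intro N.a_rcos_self) auto
  then have "(\<Union>y\<in>N +>\<^bsub>M\<^esub> x. N +>\<^bsub>M\<^esub> (k \<odot>\<^bsub>M\<^esub> x)) = N +>\<^bsub>M\<^esub> (k \<odot>\<^bsub>M\<^esub> x)"
    by (intro UN_constant_eq) auto
  moreover have "(\<Union>y\<in>N +>\<^bsub>M\<^esub> x. N +>\<^bsub>M\<^esub> (k \<odot>\<^bsub>M\<^esub> y)) = (\<Union>y\<in>N +>\<^bsub>M\<^esub> x. N +>\<^bsub>M\<^esub> (k \<odot>\<^bsub>M\<^esub> x))"
    using eq by (rule SUP_cong[OF refl])
  ultimately show ?thesis
    by (simp add: quotient_module_def)
qed

lemma quotient_module_add_coset: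
  assumes "module K M" "submodule N K M" "x \<in> carrier M" "y \<in> carrier M"
  shows "(N +>\<^bsub>M\<^esub> x) \<oplus>\<^bsub>quotient_module M N\<^esub> (N +>\<^bsub>M\<^esub> y) = N +>\<^bsub>M\<^esub> (x \<oplus>\<^bsub>M\<^esub> y)"
proof -
  interpret N: abelian_subgroup N M using assms(1,2) by (rule submodule_abelian_subgroup)
  show ?thesis
    using assms by (simp add: quotient_module_simps N.a_rcos_sum)
qed

lemma quotient_module_module:
  assumes "module K M" "submodule N K M"
  shows "module K (quotient_module M N)"
proof -
  interpret M: module K M by fact
  interpret N: abelian_subgroup N M using assms(1,2) by (rule submodule_abelian_subgroup)
  let ?Q = "quotient_module M N"
  note add = quotient_module_add_coset[OF assms] and smult = quotient_module_smult_coset[OF assms]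
  have car: "carrier ?Q = (\<lambda>x. N +>\<^bsub>M\<^esub> x) ` carrier M"
    by (auto simp: quotient_module_simps A_RCOSETS_def')
  have zero: "\<zero>\<^bsub>?Q\<^esub> = N +>\<^bsub>M\<^esub> \<zero>\<^bsub>M\<^esub>"
    using N.a_subset by (simp add: quotient_module_simps)
  show ?thesis
  proof (rule moduleI)
    show "abelian_group ?Q"
    proof (rule abelian_groupI)
      fix X assume "X \<in> carrier ?Q"
      then obtain x where x: "x \<in> carrier M" "X = N +>\<^bsub>M\<^esub> x" by (auto simp: car)
      then show "\<exists>Y\<in>carrier ?Q. Y \<oplus>\<^bsub>?Q\<^esub> X = \<zero>\<^bsub>?Q\<^esub>"
        by (intro bexI[of _ "N +>\<^bsub>M\<^esub> (\<ominus>\<^bsub>M\<^esub> x)"]) (auto simp: car add zero M.M.l_neg)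
    next
      show "\<And>x y. x \<in> carrier ?Q \<Longrightarrow> y \<in> carrier ?Q \<Longrightarrow> x \<oplus>\<^bsub>?Q\<^esub> y = y \<oplus>\<^bsub>?Q\<^esub> x"
        by (auto simp: car add M.M.a_comm)
    qed (auto simp: car add zero M.M.a_assoc)
  qed (auto simp: car add smult M.R.cring_axioms M.smult_l_distr M.smult_r_distr M.smult_assoc1)
qed

lemma quotient_module_lift:
  assumes "module K M" "submodule N K M" "module K P" "linear_map K M P f"
    and "\<And>x. x \<in> N \<Longrightarrow> f x = \<zero>\<^bsub>P\<^esub>"
  obtains g where "linear_map K (quotient_module M N) P g"
    and "\<And>x. x \<in> carrier M \<Longrightarrow> g (N +>\<^bsub>M\<^esub> x) = f x"
proof -
  interpret M: module K M by fact
  interpret P: module K P by fact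
  interpret N: abelian_subgroup N M using assms(1,2) by (rule submodule_abelian_subgroup)
  \<comment> \<open>The value at a coset is that of \<open>f\<close> at a chosen representative; as
    \<open>f\<close> vanishes on \<open>N\<close>, any other representative gives the same
    value.\<close>
  define g where "g X = f (SOME x. x \<in> X)" for X
  have g: "g (N +>\<^bsub>M\<^esub> x) = f x" if x: "x \<in> carrier M" for x
  proof -
    have "x \<in> N +>\<^bsub>M\<^esub> x"
      using x by (intro N.a_rcos_self) auto
    then have "(SOME y. y \<in> N +>\<^bsub>M\<^esub> x) \<in> N +>\<^bsub>M\<^esub> x"
      by (rule someI)
    then obtain n where n: "n \<in> N" "(SOME y. y \<in> N +>\<^bsub>M\<^esub> x) = n \<oplus>\<^bsub>M\<^esub> x"
      by (auto simp: a_r_coset_def')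
    then show ?thesis
      using x N.a_subset assms(4,5) linear_map_closed[OF assms(4) x]
      by (auto simp: g_def linear_map_add)
  qed
  have car: "carrier (quotient_module M N) = (\<lambda>x. N +>\<^bsub>M\<^esub> x) ` carrier M"
    by (auto simp: quotient_module_simps A_RCOSETS_def')
  have "linear_map K (quotient_module M N) P g"
    using linear_map_closed[OF assms(4)]
    by (intro linear_mapI)
      (auto simp: car g quotient_module_add_coset[OF assms(1,2)] quotient_module_smult_coset[OF assms(1,2)]
        linear_map_add[OF assms(4)] linear_map_smult[OF assms(4)])
  then show thesis
    using g that by blast
qed

section \<open>Tensor products\<close>

text \<open>The module axioms see only these four fields. This transfers them between records of
  different types, such as a quotient module and its extension by a grading, and to records whose
  \<open>mult\<close> and \<open>one\<close> are overridden.\<close>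

lemma module_cong:
  assumes "module K M" "carrier N = carrier M" "add N = add M" "zero N = zero M" "smult N = smult M"
  shows "module K N"
proof -
  interpret M: module K M by fact
  show ?thesis
  proof (rule moduleI)
    show "abelian_group N"
      by (rule abelian_groupI)
        (use M.M.add.l_inv_ex in \<open>auto simp: assms(2-5) M.M.a_assoc intro: M.M.a_comm\<close>)
  qed (auto simp: assms(2-5) M.R.cring_axioms M.smult_l_distr M.smult_r_distr M.smult_assoc1)
qed

lemma linear_map_record_cong:
  assumes "carrier M' = carrier M" "add M' = add M" "smult M' = smult M"
    and "carrier N' = carrier N" "add N' = add N" "smult N' = smult N"
  shows "linear_map K M' N' f = linear_map K M N f"
  using assms by (simp add: linear_map_def)

lemma submodule_cong:
  assumes "module K M" "carrier M' = carrier M" "add M' = add M" "zero M' = zero M" "smult M' = smult M"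
  shows "submodule N K M' = submodule N K M"
  using assms
  by (simp add: submodule_def submodule_axioms_def subgroup_def m_inv_def)

lemma coset_eqI:
  assumes "module K M" "submodule N K M" "x \<in> carrier M" "y \<in> carrier M" "x \<ominus>\<^bsub>M\<^esub> y \<in> N"
  shows "N +>\<^bsub>M\<^esub> x = N +>\<^bsub>M\<^esub> y"
proof -
  interpret M: module K M by fact
  interpret N: abelian_subgroup N M using assms(1,2) by (rule submodule_abelian_subgroup)
  have "x = (x \<ominus>\<^bsub>M\<^esub> y) \<oplus>\<^bsub>M\<^esub> y"
    using assms(3,4) by (simp add: a_minus_def M.M.a_assoc M.M.l_neg)
  then have "x \<in> N +>\<^bsub>M\<^esub> y"
    using assms(5) by (auto simp: a_r_coset_def')
  then show ?thesis
    using M.a_repr_independence[OF _ _ N.a_subgroup] assms by simp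
qed

lemma tensor_simps:
  fixes K :: "('k, 'q) ring_scheme"
    and M :: "('k, 'a, 'g::ab_group_add, 'm) graded_module_scheme"
    and N :: "('k, 'b, 'g, 'n) graded_module_scheme"
  defines "Q \<equiv> quotient_module (free_module K (carrier M \<times> carrier N)) (bilinearity_relations K M N)"
  shows "carrier (tensor K M N) = carrier Q"
    and "add (tensor K M N) = add Q"
    and "zero (tensor K M N) = zero Q"
    and "smult (tensor K M N) = smult Q"
  by (simp_all add: tensor_def Q_def Let_def module.defs)

text \<open>The definition takes the spans in the quotient module, before the record is extended by
  the grading. Both records have the same submodules, hence the same spans.\<close>

lemma tensor_homog:
  fixes M :: "('k, 'a, 'g::ab_group_add, 'm) graded_module_scheme"
    and N :: "('k, 'b, 'g, 'n) graded_module_scheme"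
  assumes "module K (tensor K M N)"
  shows "homog (tensor K M N) \<gamma> = module_span K (tensor K M N)
    {pure_tensor K M N x y | x y \<alpha> \<beta>. x \<in> homog M \<alpha> \<and> y \<in> homog N \<beta> \<and> \<alpha> + \<beta> = \<gamma>}"
proof -
  let ?Q = "quotient_module (free_module K (carrier M \<times> carrier N)) (bilinearity_relations K M N)"
  have "module K ?Q"
    by (rule module_cong[OF assms]) (simp_all add: tensor_simps)
  then have "submodule S K ?Q = submodule S K (tensor K M N)" for S
    by (intro submodule_cong[OF assms]) (simp_all add: tensor_simps)
  then have span: "module_span K ?Q X = module_span K (tensor K M N) X" for X
    by (simp only: module_span_def)
  have "homog (tensor K M N) \<gamma> = module_span K ?Q
      {pure_tensor K M N x y | x y \<alpha> \<beta>. x \<in> homog M \<alpha> \<and> y \<in> homog N \<beta> \<and> \<alpha> + \<beta> = \<gamma>}"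
    by (simp add: tensor_def Let_def module.defs graded_module.defs)
  then show ?thesis
    by (simp only: span)
qed

context
  fixes K :: "('k, 'q) ring_scheme"
    and M :: "('k, 'a, 'g::ab_group_add, 'm) graded_module_scheme"
    and N :: "('k, 'b, 'g, 'n) graded_module_scheme"
  assumes M: "module K M" and N: "module K N"
begin

interpretation M: module K M by (rule M)
interpretation N: module K N by (rule N)
interpretation F: module K "free_module K (carrier M \<times> carrier N)"
  by (rule free_module_module) (rule M.R.cring_axioms)

private abbreviation "F \<equiv> free_module K (carrier M \<times> carrier N)"
private abbreviation "T \<equiv> tensor K M N"
private abbreviation "p \<equiv> pure_tensor K M N"

private lemma e_carrier:
  "\<lbrakk>x \<in> carrier M; y \<in> carrier N\<rbrakk> \<Longrightarrow> basis_vector K (x, y) \<in> carrier F"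
  using M.R.cring_axioms by (intro basis_vector_carrier) auto

private lemma relations_submodule: "submodule (bilinearity_relations K M N) K F"
  unfolding bilinearity_relations_def Let_def
  by (intro module_span_submodule F.module_axioms) (auto simp: e_carrier)

lemma tensor_module: "module K (tensor K M N)"
  using quotient_module_module[OF F.module_axioms relations_submodule]
  by (rule module_cong) (simp_all add: tensor_simps)

lemma pure_tensor_closed: "\<lbrakk>x \<in> carrier M; y \<in> carrier N\<rbrakk> \<Longrightarrow> pure_tensor K M N x y \<in> carrier (tensor K M N)"
  unfolding pure_tensor_def tensor_simps quotient_module_simps
  using submodule_subset[OF relations_submodule] by (intro F.a_rcosetsI e_carrier) auto

private lemma coset_add:
  "\<lbrakk>\<phi> \<in> carrier F; \<chi> \<in> carrier F\<rbrakk> \<Longrightarrow>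
     bilinearity_relations K M N +>\<^bsub>F\<^esub> (\<phi> \<oplus>\<^bsub>F\<^esub> \<chi>) =
     (bilinearity_relations K M N +>\<^bsub>F\<^esub> \<phi>) \<oplus>\<^bsub>T\<^esub> (bilinearity_relations K M N +>\<^bsub>F\<^esub> \<chi>)"
  using quotient_module_add_coset[OF F.module_axioms relations_submodule] by (simp add: tensor_simps)

private lemma coset_smult:
  "\<lbrakk>k \<in> carrier K; \<phi> \<in> carrier F\<rbrakk> \<Longrightarrow>
     bilinearity_relations K M N +>\<^bsub>F\<^esub> (k \<odot>\<^bsub>F\<^esub> \<phi>) = k \<odot>\<^bsub>T\<^esub> (bilinearity_relations K M N +>\<^bsub>F\<^esub> \<phi>)"
  using quotient_module_smult_coset[OF F.module_axioms relations_submodule] by (simp add: tensor_simps)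

lemma pure_tensor_bilinear: "bilinear_map K M N (tensor K M N) (pure_tensor K M N)"
proof -
  note eqI = coset_eqI[OF F.module_axioms relations_submodule]
  let ?e = "basis_vector K" and ?R = "bilinearity_relations K M N"
  have rel: "z \<in> ?R" if
    "z \<in> {?e (x \<oplus>\<^bsub>M\<^esub> x', y) \<ominus>\<^bsub>F\<^esub> (?e (x, y) \<oplus>\<^bsub>F\<^esub> ?e (x', y)) | x x' y.
          x \<in> carrier M \<and> x' \<in> carrier M \<and> y \<in> carrier N} \<union>
       {?e (x, y \<oplus>\<^bsub>N\<^esub> y') \<ominus>\<^bsub>F\<^esub> (?e (x, y) \<oplus>\<^bsub>F\<^esub> ?e (x, y')) | x y y'.
          x \<in> carrier M \<and> y \<in> carrier N \<and> y' \<in> carrier N} \<union>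
       {?e (k \<odot>\<^bsub>M\<^esub> x, y) \<ominus>\<^bsub>F\<^esub> k \<odot>\<^bsub>F\<^esub> ?e (x, y) | k x y.
          k \<in> carrier K \<and> x \<in> carrier M \<and> y \<in> carrier N} \<union>
       {?e (x, k \<odot>\<^bsub>N\<^esub> y) \<ominus>\<^bsub>F\<^esub> k \<odot>\<^bsub>F\<^esub> ?e (x, y) | k x y.
          k \<in> carrier K \<and> x \<in> carrier M \<and> y \<in> carrier N}" for z
    unfolding bilinearity_relations_def Let_def
    by (rule subsetD[OF module_span_superset that])
  have r1: "p (x \<oplus>\<^bsub>M\<^esub> x') y = p x y \<oplus>\<^bsub>T\<^esub> p x' y"
    if xy: "x \<in> carrier M" "x' \<in> carrier M" "y \<in> carrier N" for x x' y
  proof -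
    have "?e (x \<oplus>\<^bsub>M\<^esub> x', y) \<ominus>\<^bsub>F\<^esub> (?e (x, y) \<oplus>\<^bsub>F\<^esub> ?e (x', y)) \<in> ?R"
      by (intro rel UnI1) (use xy in blast)
    then have "?R +>\<^bsub>F\<^esub> ?e (x \<oplus>\<^bsub>M\<^esub> x', y) = ?R +>\<^bsub>F\<^esub> (?e (x, y) \<oplus>\<^bsub>F\<^esub> ?e (x', y))"
      by (intro eqI) (simp_all add: e_carrier xy)
    then show ?thesis
      unfolding pure_tensor_def by (simp add: coset_add e_carrier xy)
  qed
  have r2: "p x (y \<oplus>\<^bsub>N\<^esub> y') = p x y \<oplus>\<^bsub>T\<^esub> p x y'"
    if xy: "x \<in> carrier M" "y \<in> carrier N" "y' \<in> carrier N" for x y y'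
  proof -
    have "?e (x, y \<oplus>\<^bsub>N\<^esub> y') \<ominus>\<^bsub>F\<^esub> (?e (x, y) \<oplus>\<^bsub>F\<^esub> ?e (x, y')) \<in> ?R"
      by (rule rel, rule UnI1, rule UnI1, rule UnI2) (use xy in blast)
    then have "?R +>\<^bsub>F\<^esub> ?e (x, y \<oplus>\<^bsub>N\<^esub> y') = ?R +>\<^bsub>F\<^esub> (?e (x, y) \<oplus>\<^bsub>F\<^esub> ?e (x, y'))"
      by (intro eqI) (simp_all add: e_carrier xy)
    then show ?thesis
      unfolding pure_tensor_def by (simp add: coset_add e_carrier xy)
  qed
  have r3: "p (k \<odot>\<^bsub>M\<^esub> x) y = k \<odot>\<^bsub>T\<^esub> p x y"
    if xy: "k \<in> carrier K" "x \<in> carrier M" "y \<in> carrier N" for k x y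
  proof -
    have "?e (k \<odot>\<^bsub>M\<^esub> x, y) \<ominus>\<^bsub>F\<^esub> k \<odot>\<^bsub>F\<^esub> ?e (x, y) \<in> ?R"
      by (rule rel, rule UnI1, rule UnI2) (use xy in blast)
    then have "?R +>\<^bsub>F\<^esub> ?e (k \<odot>\<^bsub>M\<^esub> x, y) = ?R +>\<^bsub>F\<^esub> (k \<odot>\<^bsub>F\<^esub> ?e (x, y))"
      by (intro eqI) (simp_all add: e_carrier xy)
    then show ?thesis
      unfolding pure_tensor_def by (simp add: coset_smult e_carrier xy)
  qed
  have r4: "p x (k \<odot>\<^bsub>N\<^esub> y) = k \<odot>\<^bsub>T\<^esub> p x y"
    if xy: "k \<in> carrier K" "x \<in> carrier M" "y \<in> carrier N" for k x y
  proof -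
    have "?e (x, k \<odot>\<^bsub>N\<^esub> y) \<ominus>\<^bsub>F\<^esub> k \<odot>\<^bsub>F\<^esub> ?e (x, y) \<in> ?R"
      by (rule rel, rule UnI2) (use xy in blast)
    then have "?R +>\<^bsub>F\<^esub> ?e (x, k \<odot>\<^bsub>N\<^esub> y) = ?R +>\<^bsub>F\<^esub> (k \<odot>\<^bsub>F\<^esub> ?e (x, y))"
      by (intro eqI) (simp_all add: e_carrier xy)
    then show ?thesis
      unfolding pure_tensor_def by (simp add: coset_smult e_carrier xy)
  qed
  show ?thesis
    by (intro bilinear_mapI linear_mapI r1 r2 r3 r4 pure_tensor_closed) auto
qed

text \<open>Two cases suffice: zero is the pure tensor of two zeros, and a scalar multiple of a pure
  tensor is pure, the scalar moving into the left factor.\<close>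

lemma tensor_induct [consumes 1, case_names pure add]:
  assumes "t \<in> carrier (tensor K M N)"
    and pure: "\<And>x y. \<lbrakk>x \<in> carrier M; y \<in> carrier N\<rbrakk> \<Longrightarrow> P (pure_tensor K M N x y)"
    and add: "\<And>t u. \<lbrakk>t \<in> carrier (tensor K M N); u \<in> carrier (tensor K M N); P t; P u\<rbrakk>
        \<Longrightarrow> P (t \<oplus>\<^bsub>tensor K M N\<^esub> u)"
  shows "P t"
proof -
  let ?R = "bilinearity_relations K M N"
  interpret T: module K T by (rule tensor_module)
  have cos: "?R +>\<^bsub>F\<^esub> \<phi> \<in> carrier T" if "\<phi> \<in> carrier F" for \<phi>
    using submodule_subset[OF relations_submodule] that
    by (simp add: tensor_simps quotient_module_simps F.a_rcosetsI)
  have "P (?R +>\<^bsub>F\<^esub> \<phi>)" if "\<phi> \<in> carrier F" for \<phi>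
    using M.R.cring_axioms that
  proof (induction rule: free_module_induct)
    have "?R +>\<^bsub>F\<^esub> \<zero>\<^bsub>F\<^esub> = \<zero>\<^bsub>T\<^esub>"
      using submodule_subset[OF relations_submodule]
      by (simp add: tensor_simps quotient_module_simps)
    also have "\<dots> = p \<zero>\<^bsub>M\<^esub> \<zero>\<^bsub>N\<^esub>"
      using linear_map_zero[OF M tensor_module bilinear_mapD(1)[OF pure_tensor_bilinear N.M.zero_closed]]
      by simp
    finally show "P (?R +>\<^bsub>F\<^esub> \<zero>\<^bsub>F\<^esub>)" by (simp add: pure)
  next
    case (basis_vector k s)
    obtain x y where s: "s = (x, y)" "x \<in> carrier M" "y \<in> carrier N" using basis_vector by auto
    have "?R +>\<^bsub>F\<^esub> (k \<odot>\<^bsub>F\<^esub> basis_vector K s) = k \<odot>\<^bsub>T\<^esub> p x y"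
      using s basis_vector by (simp add: coset_smult e_carrier pure_tensor_def)
    also have "\<dots> = p (k \<odot>\<^bsub>M\<^esub> x) y"
      using s basis_vector linear_map_smult[OF bilinear_mapD(1)[OF pure_tensor_bilinear]] by simp
    finally show ?case using s basis_vector by (simp add: pure)
  next
    case (add \<phi> \<chi>)
    then show ?case by (simp add: coset_add assms(3) cos)
  qed
  moreover have "\<exists>\<phi>\<in>carrier F. t = ?R +>\<^bsub>F\<^esub> \<phi>"
    using assms(1) by (auto simp: tensor_simps quotient_module_simps A_RCOSETS_def')
  ultimately show ?thesis by blast
qed

lemma tensor_linear_ext:
  assumes "linear_map K (tensor K M N) P f" "linear_map K (tensor K M N) P g"
    and "\<And>x y. \<lbrakk>x \<in> carrier M; y \<in> carrier N\<rbrakk> \<Longrightarrow> f (pure_tensor K M N x y) = g (pure_tensor K M N x y)"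
    and "t \<in> carrier (tensor K M N)"
  shows "f t = g t"
  using assms(4)
  by (induction rule: tensor_induct) (simp_all add: assms(3) linear_map_add[OF assms(1)] linear_map_add[OF assms(2)])

text \<open>The extension of \<open>B\<close> to the free module annihilates the four families of
  relations, which are the four laws of bilinearity. Its zero set is a submodule, hence contains
  their span, and the extension descends to the quotient.\<close>

lemma tensor_lift_exists:
  assumes "module K P" "bilinear_map K M N P B"
  shows "\<exists>L. linear_map K (tensor K M N) P L \<and>
    (\<forall>x\<in>carrier M. \<forall>y\<in>carrier N. L (pure_tensor K M N x y) = B x y)"
proof -
  interpret P: module K P by fact
  define f where "f = free_lift K P (\<lambda>(x, y). B x y)"
  have B: "(\<lambda>(x, y). B x y) \<in> carrier M \<times> carrier N \<rightarrow> carrier P"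
    using bilinear_mapD(3)[OF assms(2)] by auto
  have f: "linear_map K F P f"
    unfolding f_def using assms(1) B by (rule free_lift_linear)
  have fe: "f (basis_vector K (x, y)) = B x y" if "x \<in> carrier M" "y \<in> carrier N" for x y
    unfolding f_def using free_lift_basis_vector[OF assms(1) B, of "(x, y)"] that by simp
  have z: "linear_map K F P (\<lambda>_. \<zero>\<^bsub>P\<^esub>)"
    by (intro linear_mapI) auto
  note Bl = linear_map_add[OF bilinear_mapD(1)[OF assms(2)]] linear_map_smult[OF bilinear_mapD(1)[OF assms(2)]]
    linear_map_add[OF bilinear_mapD(2)[OF assms(2)]] linear_map_smult[OF bilinear_mapD(2)[OF assms(2)]]
  have "bilinearity_relations K M N \<subseteq> {\<phi> \<in> carrier F. f \<phi> = \<zero>\<^bsub>P\<^esub>}"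
    unfolding bilinearity_relations_def Let_def
    by (rule module_span_minimal[OF submodule_equalizer[OF F.module_axioms assms(1) f z]])
      (auto simp: e_carrier a_minus_def linear_map_add[OF f] linear_map_smult[OF f]
        linear_map_neg[OF F.module_axioms assms(1) f] fe Bl bilinear_mapD(3)[OF assms(2)] P.M.r_neg)
  then obtain g where g: "linear_map K (quotient_module F (bilinearity_relations K M N)) P g"
    "\<And>\<phi>. \<phi> \<in> carrier F \<Longrightarrow> g (bilinearity_relations K M N +>\<^bsub>F\<^esub> \<phi>) = f \<phi>"
    using quotient_module_lift[OF F.module_axioms relations_submodule assms(1) f] by blast
  have "linear_map K T P g"
    using g(1) by (simp add: linear_map_record_cong[OF tensor_simps(1,2,4) refl refl refl])
  then show ?thesis
    using g(2) fe by (intro exI[of _ g]) (auto simp: pure_tensor_def e_carrier)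
qed

end

text \<open>Every map introduced by definite description is reached in this way: existence of some
  linear map with the prescribed values, and uniqueness on the carrier. Outside the carrier
  extensionality fixes the values, so the described map is the restriction of \<open>L\<close>, and
  \<open>Q\<close> has to hold for that restriction.\<close>

lemma the_linear_eq:
  assumes "module K M" "linear_map K M N L" "Q (restrict L (carrier M))"
    and "\<And>L' x. \<lbrakk>linear_map K M N L'; Q L'; x \<in> carrier M\<rbrakk> \<Longrightarrow> L' x = L x"
  shows "the_linear K M N Q = restrict L (carrier M)"
  unfolding the_linear_def
proof (rule the_equality)
  have "linear_map K M N (restrict L (carrier M))"
    using assms(1,2) by (rule linear_map_cong) simp
  then show "restrict L (carrier M) \<in> extensional (carrier M) \<and>
      linear_map K M N (restrict L (carrier M)) \<and> Q (restrict L (carrier M))"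
    using assms(3) by simp
next
  fix f assume f: "f \<in> extensional (carrier M) \<and> linear_map K M N f \<and> Q f"
  then show "f = restrict L (carrier M)"
    using assms(4)[of f] by (intro extensionalityI[of _ "carrier M"]) auto
qed

text \<open>Common shape of \<open>tensor_map\<close>, \<open>contract_left\<close>,
  \<open>contract_right\<close> and \<open>mult_map\<close>, which are instances by
  unfolding.\<close>

definition tensor_lift ::
  "('k, 'q) ring_scheme \<Rightarrow> ('k, 'a, 'g::ab_group_add, 'm) graded_module_scheme \<Rightarrow>
   ('k, 'b, 'g, 'n) graded_module_scheme \<Rightarrow> ('k, 'c, 'p) module_scheme \<Rightarrow>
   ('a \<Rightarrow> 'b \<Rightarrow> 'c) \<Rightarrow> ('k, 'a, 'b) tens \<Rightarrow> 'c" where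
  "tensor_lift K M N P B =
     the_linear K (tensor K M N) P
       (\<lambda>L. \<forall>x\<in>carrier M. \<forall>y\<in>carrier N. L (pure_tensor K M N x y) = B x y)"

lemma tensor_lift_props:
  assumes "module K M" "module K N" "module K P" "bilinear_map K M N P B"
  shows "linear_map K (tensor K M N) P (tensor_lift K M N P B) \<and>
    (\<forall>x\<in>carrier M. \<forall>y\<in>carrier N. tensor_lift K M N P B (pure_tensor K M N x y) = B x y)"
proof -
  obtain L where L: "linear_map K (tensor K M N) P L"
    "\<forall>x\<in>carrier M. \<forall>y\<in>carrier N. L (pure_tensor K M N x y) = B x y"
    using tensor_lift_exists[OF assms] by blast
  have T: "module K (tensor K M N)" using assms by (intro tensor_module)
  have uniq: "L' t = L t"
    if L': "linear_map K (tensor K M N) P L'"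
      "\<forall>x\<in>carrier M. \<forall>y\<in>carrier N. L' (pure_tensor K M N x y) = B x y"
      and t: "t \<in> carrier (tensor K M N)" for L' t
    by (rule tensor_linear_ext[OF assms(1,2) L'(1) L(1) _ t]) (simp add: L(2) L'(2))
  have "tensor_lift K M N P B = restrict L (carrier (tensor K M N))"
    unfolding tensor_lift_def
  proof (rule the_linear_eq[OF T L(1)])
    show "\<forall>x\<in>carrier M. \<forall>y\<in>carrier N.
        restrict L (carrier (tensor K M N)) (pure_tensor K M N x y) = B x y"
      using L(2) pure_tensor_closed[OF assms(1,2)] by simp
  qed (rule uniq)
  moreover have "linear_map K (tensor K M N) P (restrict L (carrier (tensor K M N)))"
    using T L(1) by (rule linear_map_cong) simp
  ultimately show ?thesis
    using L(2) pure_tensor_closed[OF assms(1,2)] by simp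
qed

lemmas tensor_lift_linear = tensor_lift_props[THEN conjunct1]

lemma tensor_lift_pure:
  "\<lbrakk>module K M; module K N; module K P; bilinear_map K M N P B; x \<in> carrier M; y \<in> carrier N\<rbrakk> \<Longrightarrow>
    tensor_lift K M N P B (pure_tensor K M N x y) = B x y"
  using tensor_lift_props by blast

lemma tensor_lift_unique:
  assumes "module K M" "module K N" "module K P" "bilinear_map K M N P B"
    and "linear_map K (tensor K M N) P L"
    and "\<And>x y. \<lbrakk>x \<in> carrier M; y \<in> carrier N\<rbrakk> \<Longrightarrow> L (pure_tensor K M N x y) = B x y"
    and "t \<in> carrier (tensor K M N)"
  shows "tensor_lift K M N P B t = L t"
  by (rule tensor_linear_ext[OF assms(1,2) tensor_lift_linear[OF assms(1-4)] assms(5) _ assms(7)])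
    (simp add: assms(6) tensor_lift_pure[OF assms(1-4)])

lemma tensor_map_eq: "tensor_map K A B C D f g =
    tensor_lift K A B (tensor K C D) (\<lambda>a b. pure_tensor K C D (f a) (g b))"
  by (simp add: tensor_map_def tensor_lift_def)

lemma contract_left_eq: "contract_left K M N \<phi> = tensor_lift K M N N (\<lambda>x y. \<phi> x \<odot>\<^bsub>N\<^esub> y)"
  by (simp add: contract_left_def tensor_lift_def)

lemma contract_right_eq: "contract_right K M N \<phi> = tensor_lift K M N M (\<lambda>x y. \<phi> y \<odot>\<^bsub>M\<^esub> x)"
  by (simp add: contract_right_def tensor_lift_def)

lemma mult_map_eq: "mult_map K A = tensor_lift K A A A (\<lambda>x y. x \<otimes>\<^bsub>A\<^esub> y)"
  by (simp add: mult_map_def tensor_lift_def)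

section \<open>Graded modules\<close>

lemma graded_module_module: "graded_module K M \<Longrightarrow> module K M"
  by (simp add: graded_module_def)

lemma graded_module_homog_submodule: "graded_module K M \<Longrightarrow> submodule (homog M \<alpha>) K M"
  by (rule graded_module.homog_submodule)

lemma homog_carrier: "\<lbrakk>graded_module K M; x \<in> homog M \<alpha>\<rbrakk> \<Longrightarrow> x \<in> carrier M"
  using submodule_subset[OF graded_module_homog_submodule] by blast

lemma homog_smult: "\<lbrakk>graded_module K M; k \<in> carrier K; x \<in> homog M \<alpha>\<rbrakk> \<Longrightarrow> k \<odot>\<^bsub>M\<^esub> x \<in> homog M \<alpha>"
  by (rule submodule.smult_closed[OF graded_module_homog_submodule])

lemma homog_zero: "graded_module K M \<Longrightarrow> \<zero>\<^bsub>M\<^esub> \<in> homog M \<alpha>"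
  by (rule submodule_zero[OF graded_module_homog_submodule])

text \<open>A homogeneous part as a module in its own right, so that a map which is linear in each
  degree, but given by a formula varying with the degree, can be described by
  \<open>linear_map\<close>.\<close>

definition homog_part :: "('k, 'a, 'g, 'm) graded_module_scheme \<Rightarrow> 'g \<Rightarrow> ('k, 'a, 'g, 'm) graded_module_scheme" where
  "homog_part M \<alpha> = M\<lparr>carrier := homog M \<alpha>\<rparr>"

lemma homog_part_simps:
  "carrier (homog_part M \<alpha>) = homog M \<alpha>"
  "add (homog_part M \<alpha>) = add M"
  "zero (homog_part M \<alpha>) = zero M"
  "smult (homog_part M \<alpha>) = smult M"
  by (simp_all add: homog_part_def)

lemma homog_part_module: "graded_module K M \<Longrightarrow> module K (homog_part M \<alpha>)"
  unfolding homog_part_def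
  by (intro submodule.submodule_is_module graded_module_homog_submodule graded_module_module)

section \<open>Homogeneous components\<close>

lemma decomposition_homog:
  assumes "graded_module K M" "x \<in> homog M \<alpha>"
  shows "decomposition M x (\<lambda>\<beta>. if \<beta> = \<alpha> then x else \<zero>\<^bsub>M\<^esub>)"
proof -
  interpret M: graded_module K M by fact
  have x: "x \<in> carrier M" using assms by (rule homog_carrier)
  have fin: "finite {\<beta>. (if \<beta> = \<alpha> then x else \<zero>\<^bsub>M\<^esub>) \<noteq> \<zero>\<^bsub>M\<^esub>}"
    by (rule finite_subset[of _ "{\<alpha>}"]) auto
  have "finsum M (\<lambda>\<beta>. if \<beta> = \<alpha> then x else \<zero>\<^bsub>M\<^esub>) {\<beta>. (if \<beta> = \<alpha> then x else \<zero>\<^bsub>M\<^esub>) \<noteq> \<zero>\<^bsub>M\<^esub>} =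
      finsum M (\<lambda>\<beta>. if \<beta> = \<alpha> then x else \<zero>\<^bsub>M\<^esub>) {\<alpha>}"
    using x by (intro finsum_support[where g = "\<lambda>_ z. z"] M.M.abelian_monoid_axioms) auto
  also have "\<dots> = x" using x by simp
  finally show ?thesis
    unfolding decomposition_def using assms homog_zero[OF assms(1)] fin by simp
qed

lemma decomposition_finsum:
  assumes "module K M" "\<And>\<alpha>. c \<alpha> \<in> carrier M" "finite S" "{\<alpha>. c \<alpha> \<noteq> \<zero>\<^bsub>M\<^esub>} \<subseteq> S"
  shows "(\<Oplus>\<^bsub>M\<^esub>\<alpha>\<in>{\<alpha>. c \<alpha> \<noteq> \<zero>\<^bsub>M\<^esub>}. c \<alpha>) = (\<Oplus>\<^bsub>M\<^esub>\<alpha>\<in>S. c \<alpha>)"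
  using assms by (intro finsum_support[where g = "\<lambda>_ z. z"] module_abelian_monoid) auto

text \<open>Assumes a module with homogeneous submodules instead of a \<open>graded_module\<close>,
  because it is applied to tensor products while these are being shown to be graded.\<close>

lemma decomposition_add:
  assumes "module K M" "\<And>\<alpha>. submodule (homog M \<alpha>) K M" "decomposition M x c" "decomposition M y d"
  shows "decomposition M (x \<oplus>\<^bsub>M\<^esub> y) (\<lambda>\<alpha>. c \<alpha> \<oplus>\<^bsub>M\<^esub> d \<alpha>)"
proof -
  interpret M: module K M by fact
  define U where "U = {\<alpha>. c \<alpha> \<noteq> \<zero>\<^bsub>M\<^esub>} \<union> {\<alpha>. d \<alpha> \<noteq> \<zero>\<^bsub>M\<^esub>}"
  have hom: "c \<alpha> \<in> homog M \<alpha>" "d \<alpha> \<in> homog M \<alpha>" for \<alpha>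
    using assms(3,4) by (simp_all add: decomposition_def)
  have car: "c \<alpha> \<in> carrier M" "d \<alpha> \<in> carrier M" for \<alpha>
    using hom submodule_subset[OF assms(2)] by blast+
  have U: "finite U" using assms(3,4) by (simp add: decomposition_def U_def)
  have sub: "{\<alpha>. c \<alpha> \<oplus>\<^bsub>M\<^esub> d \<alpha> \<noteq> \<zero>\<^bsub>M\<^esub>} \<subseteq> U"
    by (auto simp: U_def)
  have "x = (\<Oplus>\<^bsub>M\<^esub>\<alpha>\<in>U. c \<alpha>)"
    using assms(3) car U by (subst decomposition_finsum[OF assms(1), symmetric]) (auto simp: decomposition_def U_def)
  moreover have "y = (\<Oplus>\<^bsub>M\<^esub>\<alpha>\<in>U. d \<alpha>)"
    using assms(4) car U by (subst decomposition_finsum[OF assms(1), symmetric]) (auto simp: decomposition_def U_def)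
  ultimately have "x \<oplus>\<^bsub>M\<^esub> y = (\<Oplus>\<^bsub>M\<^esub>\<alpha>\<in>U. c \<alpha> \<oplus>\<^bsub>M\<^esub> d \<alpha>)"
    using car by (simp add: M.M.finsum_addf)
  also have "\<dots> = (\<Oplus>\<^bsub>M\<^esub>\<alpha>\<in>{\<alpha>. c \<alpha> \<oplus>\<^bsub>M\<^esub> d \<alpha> \<noteq> \<zero>\<^bsub>M\<^esub>}. c \<alpha> \<oplus>\<^bsub>M\<^esub> d \<alpha>)"
    using car U sub by (subst decomposition_finsum[OF assms(1)]) auto
  finally show ?thesis
    unfolding decomposition_def
    using finite_subset[OF sub U] submodule_add[OF assms(2) hom] by blast
qed

definition component :: "('k, 'a, 'g, 'm) graded_module_scheme \<Rightarrow> 'a \<Rightarrow> 'g \<Rightarrow> 'a" where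
  "component M x = (THE c. decomposition M x c)"

lemma component_decomposition:
  assumes "graded_module K M" "x \<in> carrier M"
  shows "decomposition M x (component M x)"
  unfolding component_def by (rule theI'[OF graded_module.direct_sum[OF assms]])

lemma component_eqI:
  assumes "graded_module K M" "x \<in> carrier M" "decomposition M x c"
  shows "component M x = c"
  unfolding component_def
  by (rule the1_equality) (rule graded_module.direct_sum assms)+

lemma component_homog_closed:
  "\<lbrakk>graded_module K M; x \<in> carrier M\<rbrakk> \<Longrightarrow> component M x \<alpha> \<in> homog M \<alpha>"
  using component_decomposition by (fastforce simp: decomposition_def)

lemma component_finite:
  "\<lbrakk>graded_module K M; x \<in> carrier M\<rbrakk> \<Longrightarrow> finite {\<alpha>. component M x \<alpha> \<noteq> \<zero>\<^bsub>M\<^esub>}"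
  using component_decomposition by (fastforce simp: decomposition_def)

lemma component_homog:
  assumes "graded_module K M" "x \<in> homog M \<alpha>"
  shows "component M x = (\<lambda>\<beta>. if \<beta> = \<alpha> then x else \<zero>\<^bsub>M\<^esub>)"
  using assms by (intro component_eqI decomposition_homog homog_carrier)

lemma component_add:
  assumes "graded_module K M" "x \<in> carrier M" "y \<in> carrier M"
  shows "component M (x \<oplus>\<^bsub>M\<^esub> y) = (\<lambda>\<alpha>. component M x \<alpha> \<oplus>\<^bsub>M\<^esub> component M y \<alpha>)"
proof -
  interpret M: graded_module K M by fact
  show ?thesis
    using assms decomposition_add[OF M.module_axioms M.homog_submodule]
    by (simp add: component_eqI component_decomposition)
qed

lemma component_smult:
  assumes "graded_module K M" "k \<in> carrier K" "x \<in> carrier M"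
  shows "component M (k \<odot>\<^bsub>M\<^esub> x) = (\<lambda>\<alpha>. k \<odot>\<^bsub>M\<^esub> component M x \<alpha>)"
proof -
  interpret M: graded_module K M by fact
  let ?c = "component M x"
  have hom: "?c \<alpha> \<in> homog M \<alpha>" for \<alpha>
    using assms by (intro component_homog_closed)
  have car: "?c \<alpha> \<in> carrier M" for \<alpha>
    using assms(1) hom by (rule homog_carrier)
  have fin: "finite {\<alpha>. ?c \<alpha> \<noteq> \<zero>\<^bsub>M\<^esub>}" using assms by (intro component_finite)
  have sub: "{\<alpha>. k \<odot>\<^bsub>M\<^esub> ?c \<alpha> \<noteq> \<zero>\<^bsub>M\<^esub>} \<subseteq> {\<alpha>. ?c \<alpha> \<noteq> \<zero>\<^bsub>M\<^esub>}"
    using assms(2) by auto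
  have "x = (\<Oplus>\<^bsub>M\<^esub>\<alpha>\<in>{\<alpha>. ?c \<alpha> \<noteq> \<zero>\<^bsub>M\<^esub>}. ?c \<alpha>)"
    using component_decomposition[OF assms(1,3)] by (simp add: decomposition_def)
  then have "k \<odot>\<^bsub>M\<^esub> x = k \<odot>\<^bsub>M\<^esub> (\<Oplus>\<^bsub>M\<^esub>\<alpha>\<in>{\<alpha>. ?c \<alpha> \<noteq> \<zero>\<^bsub>M\<^esub>}. ?c \<alpha>)"
    by simp
  also have "\<dots> = (\<Oplus>\<^bsub>M\<^esub>\<alpha>\<in>{\<alpha>. ?c \<alpha> \<noteq> \<zero>\<^bsub>M\<^esub>}. k \<odot>\<^bsub>M\<^esub> ?c \<alpha>)"
    using assms(2) car fin by (intro M.finsum_smult_ldistr) auto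
  also have "\<dots> = (\<Oplus>\<^bsub>M\<^esub>\<alpha>\<in>{\<alpha>. k \<odot>\<^bsub>M\<^esub> ?c \<alpha> \<noteq> \<zero>\<^bsub>M\<^esub>}. k \<odot>\<^bsub>M\<^esub> ?c \<alpha>)"
    using assms(2) car fin sub by (intro decomposition_finsum[OF M.module_axioms, symmetric]) auto
  finally have "decomposition M (k \<odot>\<^bsub>M\<^esub> x) (\<lambda>\<alpha>. k \<odot>\<^bsub>M\<^esub> ?c \<alpha>)"
    unfolding decomposition_def
    using finite_subset[OF sub fin] homog_smult[OF assms(1,2) hom] by blast
  then show ?thesis
    using assms by (intro component_eqI) simp_all
qed

lemma graded_module_induct [consumes 2, case_names homog add]:
  assumes "graded_module K M" "x \<in> carrier M"
    and hom: "\<And>\<alpha> x. x \<in> homog M \<alpha> \<Longrightarrow> P x"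
    and add: "\<And>x y. \<lbrakk>x \<in> carrier M; y \<in> carrier M; P x; P y\<rbrakk> \<Longrightarrow> P (x \<oplus>\<^bsub>M\<^esub> y)"
  shows "P x"
proof -
  interpret M: graded_module K M by fact
  let ?c = "component M x"
  have hc: "?c \<alpha> \<in> homog M \<alpha>" for \<alpha>
    using assms by (intro component_homog_closed)
  have car: "?c \<alpha> \<in> carrier M" for \<alpha>
    using assms(1) hc by (rule homog_carrier)
  have "P (finsum M ?c S)" if "finite S" for S
    using that
  proof (induction S)
    case empty
    show ?case using hom[OF homog_zero[OF assms(1)]] by simp
  next
    case (insert \<alpha> S)
    then show ?case using car by (simp add: Pi_def add hom[OF hc])
  qed
  moreover have "x = finsum M ?c {\<alpha>. ?c \<alpha> \<noteq> \<zero>\<^bsub>M\<^esub>}" "finite {\<alpha>. ?c \<alpha> \<noteq> \<zero>\<^bsub>M\<^esub>}"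
    using component_decomposition[OF assms(1,2)] by (simp_all add: decomposition_def)
  ultimately show ?thesis by metis
qed

lemma graded_linear_ext:
  assumes "graded_module K M" "linear_map K M P f" "linear_map K M P g"
    and "\<And>\<alpha> x. x \<in> homog M \<alpha> \<Longrightarrow> f x = g x" "x \<in> carrier M"
  shows "f x = g x"
  using assms(1,5)
  by (induction rule: graded_module_induct)
    (simp_all add: assms(4) linear_map_add[OF assms(2)] linear_map_add[OF assms(3)])

text \<open>The maps \<open>\<pi> \<alpha>\<close> act as projections: applied to a decomposition,
  \<open>\<pi> \<gamma>\<close> leaves only the summand of degree \<open>\<gamma>\<close>. So the
  components are determined by \<open>x\<close>, and uniqueness comes from the mere existence of
  such linear maps.\<close>

lemma graded_moduleI:
  assumes "module K M" "\<And>\<alpha>. submodule (homog M \<alpha>) K M"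
    and lin: "\<And>\<alpha>. linear_map K M M (\<pi> \<alpha>)"
    and proj: "\<And>\<alpha> \<beta> x. x \<in> homog M \<beta> \<Longrightarrow> \<pi> \<alpha> x = (if \<alpha> = \<beta> then x else \<zero>\<^bsub>M\<^esub>)"
    and ex: "\<And>x. x \<in> carrier M \<Longrightarrow> \<exists>c. decomposition M x c"
  shows "graded_module K M"
proof -
  interpret M: module K M by fact
  have eq: "c \<gamma> = \<pi> \<gamma> x" if "decomposition M x c" for x c \<gamma>
  proof -
    let ?S = "{\<alpha>. c \<alpha> \<noteq> \<zero>\<^bsub>M\<^esub>}"
    have hom: "c \<alpha> \<in> homog M \<alpha>" for \<alpha> using that by (simp add: decomposition_def)
    have car: "c \<alpha> \<in> carrier M" for \<alpha> using hom submodule_subset[OF assms(2)] by blast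
    have fin: "finite ?S" and x: "x = finsum M c ?S" using that by (simp_all add: decomposition_def)
    have "\<pi> \<gamma> x = (\<Oplus>\<^bsub>M\<^esub>\<alpha>\<in>?S. \<pi> \<gamma> (c \<alpha>))"
      unfolding x using assms(1) lin fin car by (intro linear_map_finsum[where M = M]) auto
    also have "\<dots> = (\<Oplus>\<^bsub>M\<^esub>\<alpha>\<in>?S. if \<gamma> = \<alpha> then c \<alpha> else \<zero>\<^bsub>M\<^esub>)"
      using proj[OF hom] car by (intro M.M.finsum_cong') auto
    also have "\<dots> = c \<gamma>"
    proof (cases "\<gamma> \<in> ?S")
      case True
      then show ?thesis using fin car by (intro M.M.finsum_singleton) auto
    next
      case False
      then have "(\<Oplus>\<^bsub>M\<^esub>\<alpha>\<in>?S. if \<gamma> = \<alpha> then c \<alpha> else \<zero>\<^bsub>M\<^esub>) = (\<Oplus>\<^bsub>M\<^esub>\<alpha>\<in>?S. \<zero>\<^bsub>M\<^esub>)"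
        by (intro M.M.finsum_cong') auto
      then show ?thesis using False by simp
    qed
    finally show ?thesis by simp
  qed
  have "\<exists>!c. decomposition M x c" if "x \<in> carrier M" for x
    using ex[OF that] eq by (metis ext)
  then show ?thesis
    using assms(1,2) by (simp add: graded_module_def graded_module_axioms_def)
qed

text \<open>The maps \<open>g \<alpha>\<close> on the homogeneous parts are independent of each
  other. This is the precise form of extending linearly a formula whose sign depends on the
  degree.\<close>

definition graded_extension ::
  "('k, 'a, 'g, 'm) graded_module_scheme \<Rightarrow> ('k, 'c, 'p) module_scheme \<Rightarrow> ('g \<Rightarrow> 'a \<Rightarrow> 'c) \<Rightarrow> 'a \<Rightarrow> 'c" where
  "graded_extension M P g x =
     (\<Oplus>\<^bsub>P\<^esub>\<alpha>\<in>{\<alpha>. component M x \<alpha> \<noteq> \<zero>\<^bsub>M\<^esub>}. g \<alpha> (component M x \<alpha>))"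

lemma graded_extension_support:
  assumes "graded_module K M" "module K P" "\<And>\<alpha>. linear_map K (homog_part M \<alpha>) P (g \<alpha>)"
    and "x \<in> carrier M" "finite S" "{\<alpha>. component M x \<alpha> \<noteq> \<zero>\<^bsub>M\<^esub>} \<subseteq> S"
  shows "graded_extension M P g x = (\<Oplus>\<^bsub>P\<^esub>\<alpha>\<in>S. g \<alpha> (component M x \<alpha>))"
  unfolding graded_extension_def
  using linear_map_zero[OF homog_part_module[OF assms(1)] assms(2,3)]
    linear_map_closed[OF assms(3)] component_homog_closed[OF assms(1,4)]
  by (intro finsum_support module_abelian_monoid[OF assms(2)] assms(5,6)) (simp_all add: homog_part_simps)

lemma graded_extension_linear:
  assumes "graded_module K M" "module K P" "\<And>\<alpha>. linear_map K (homog_part M \<alpha>) P (g \<alpha>)"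
  shows "linear_map K M P (graded_extension M P g)"
proof -
  interpret M: graded_module K M by fact
  interpret P: module K P by fact
  note supp = graded_extension_support[OF assms]
  have hom: "component M x \<alpha> \<in> homog M \<alpha>" if "x \<in> carrier M" for x \<alpha>
    using component_homog_closed[OF assms(1) that] .
  have gcl: "g \<alpha> x \<in> carrier P" if "x \<in> homog M \<alpha>" for \<alpha> x
    using linear_map_closed[OF assms(3)] that by (simp add: homog_part_simps)
  have gadd: "g \<alpha> (x \<oplus>\<^bsub>M\<^esub> y) = g \<alpha> x \<oplus>\<^bsub>P\<^esub> g \<alpha> y" if "x \<in> homog M \<alpha>" "y \<in> homog M \<alpha>" for \<alpha> x y
    using linear_map_add[OF assms(3)] that by (simp add: homog_part_simps)
  have gsm: "g \<alpha> (k \<odot>\<^bsub>M\<^esub> x) = k \<odot>\<^bsub>P\<^esub> g \<alpha> x" if "k \<in> carrier K" "x \<in> homog M \<alpha>" for \<alpha> k x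
    using linear_map_smult[OF assms(3)] that by (simp add: homog_part_simps)
  show ?thesis
  proof (rule linear_mapI)
    fix x assume "x \<in> carrier M"
    then show "graded_extension M P g x \<in> carrier P"
      unfolding graded_extension_def using hom gcl by (intro P.M.finsum_closed) auto
  next
    fix x y assume x: "x \<in> carrier M" and y: "y \<in> carrier M"
    define U where "U = {\<alpha>. component M x \<alpha> \<noteq> \<zero>\<^bsub>M\<^esub>} \<union> {\<alpha>. component M y \<alpha> \<noteq> \<zero>\<^bsub>M\<^esub>}"
    have U: "finite U" using component_finite[OF assms(1)] x y by (simp add: U_def)
    have sub: "{\<alpha>. component M (x \<oplus>\<^bsub>M\<^esub> y) \<alpha> \<noteq> \<zero>\<^bsub>M\<^esub>} \<subseteq> U"
      by (auto simp: U_def component_add[OF assms(1) x y])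
    let ?l = "graded_extension M P g (x \<oplus>\<^bsub>M\<^esub> y)"
      and ?r = "graded_extension M P g x \<oplus>\<^bsub>P\<^esub> graded_extension M P g y"
    have "?l = (\<Oplus>\<^bsub>P\<^esub>\<alpha>\<in>U. g \<alpha> (component M (x \<oplus>\<^bsub>M\<^esub> y) \<alpha>))"
      using x y by (intro supp U sub) simp
    also have "\<dots> = (\<Oplus>\<^bsub>P\<^esub>\<alpha>\<in>U. g \<alpha> (component M x \<alpha>) \<oplus>\<^bsub>P\<^esub> g \<alpha> (component M y \<alpha>))"
      by (simp add: component_add[OF assms(1) x y] gadd hom x y)
    also have "\<dots> = (\<Oplus>\<^bsub>P\<^esub>\<alpha>\<in>U. g \<alpha> (component M x \<alpha>)) \<oplus>\<^bsub>P\<^esub> (\<Oplus>\<^bsub>P\<^esub>\<alpha>\<in>U. g \<alpha> (component M y \<alpha>))"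
      using hom gcl x y by (intro P.M.finsum_addf) auto
    also have "\<dots> = ?r"
      using supp[OF x U] supp[OF y U] by (simp add: U_def)
    finally show "?l = ?r" .
  next
    fix k x assume k: "k \<in> carrier K" and x: "x \<in> carrier M"
    let ?U = "{\<alpha>. component M x \<alpha> \<noteq> \<zero>\<^bsub>M\<^esub>}"
    have U: "finite ?U" using component_finite[OF assms(1) x] .
    have sub: "{\<alpha>. component M (k \<odot>\<^bsub>M\<^esub> x) \<alpha> \<noteq> \<zero>\<^bsub>M\<^esub>} \<subseteq> ?U"
      using k by (auto simp: component_smult[OF assms(1) k x])
    let ?l = "graded_extension M P g (k \<odot>\<^bsub>M\<^esub> x)"
      and ?r = "k \<odot>\<^bsub>P\<^esub> graded_extension M P g x"
    have "?l = (\<Oplus>\<^bsub>P\<^esub>\<alpha>\<in>?U. g \<alpha> (component M (k \<odot>\<^bsub>M\<^esub> x) \<alpha>))"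
      using k x by (intro supp U sub) simp
    also have "\<dots> = (\<Oplus>\<^bsub>P\<^esub>\<alpha>\<in>?U. k \<odot>\<^bsub>P\<^esub> g \<alpha> (component M x \<alpha>))"
      by (simp add: component_smult[OF assms(1) k x] gsm hom x k)
    also have "\<dots> = ?r"
      unfolding graded_extension_def using hom gcl x k U by (intro P.finsum_smult_ldistr[symmetric]) auto
    finally show "?l = ?r" .
  qed
qed

lemma graded_extension_homog:
  assumes "graded_module K M" "module K P" "\<And>\<alpha>. linear_map K (homog_part M \<alpha>) P (g \<alpha>)"
    and "x \<in> homog M \<alpha>"
  shows "graded_extension M P g x = g \<alpha> x"
proof -
  interpret P: module K P by fact
  have "graded_extension M P g x = (\<Oplus>\<^bsub>P\<^esub>\<beta>\<in>{\<alpha>}. g \<beta> (component M x \<beta>))"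
    using assms homog_carrier[OF assms(1,4)]
    by (intro graded_extension_support[where K = K]) (auto simp: component_homog[OF assms(1,4)])
  also have "\<dots> = g \<alpha> x"
    using linear_map_closed[OF assms(3)] assms(4)
    by (simp add: component_homog[OF assms(1,4)] homog_part_simps)
  finally show ?thesis .
qed

lemma linear_map_finsum_fun:
  assumes "module K M" "module K P" "finite A" "\<And>a. a \<in> A \<Longrightarrow> linear_map K M P (f a)"
  shows "linear_map K M P (\<lambda>x. \<Oplus>\<^bsub>P\<^esub>a\<in>A. f a x)"
proof -
  interpret M: module K M by fact
  interpret P: module K P by fact
  have cl: "f a x \<in> carrier P" if "a \<in> A" "x \<in> carrier M" for a x
    using linear_map_closed[OF assms(4)] that by blast
  show ?thesis
  proof (rule linear_mapI)
    fix x y assume xy: "x \<in> carrier M" "y \<in> carrier M"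
    have "(\<Oplus>\<^bsub>P\<^esub>a\<in>A. f a (x \<oplus>\<^bsub>M\<^esub> y)) = (\<Oplus>\<^bsub>P\<^esub>a\<in>A. f a x \<oplus>\<^bsub>P\<^esub> f a y)"
      using linear_map_add[OF assms(4)] cl xy by (intro P.M.finsum_cong') auto
    then show "(\<Oplus>\<^bsub>P\<^esub>a\<in>A. f a (x \<oplus>\<^bsub>M\<^esub> y)) = (\<Oplus>\<^bsub>P\<^esub>a\<in>A. f a x) \<oplus>\<^bsub>P\<^esub> (\<Oplus>\<^bsub>P\<^esub>a\<in>A. f a y)"
      using cl xy by (simp add: P.M.finsum_addf Pi_def)
  next
    fix k x assume kx: "k \<in> carrier K" "x \<in> carrier M"
    have "(\<Oplus>\<^bsub>P\<^esub>a\<in>A. f a (k \<odot>\<^bsub>M\<^esub> x)) = (\<Oplus>\<^bsub>P\<^esub>a\<in>A. k \<odot>\<^bsub>P\<^esub> f a x)"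
      using linear_map_smult[OF assms(4)] cl kx by (intro P.M.finsum_cong') auto
    then show "(\<Oplus>\<^bsub>P\<^esub>a\<in>A. f a (k \<odot>\<^bsub>M\<^esub> x)) = k \<odot>\<^bsub>P\<^esub> (\<Oplus>\<^bsub>P\<^esub>a\<in>A. f a x)"
      using cl kx assms(3) by (simp add: P.finsum_smult_ldistr Pi_def)
  qed (use cl in \<open>auto intro: P.M.finsum_closed\<close>)
qed

text \<open>When extensions in two arguments are nested, linearity of the outer one in the inner
  argument is linearity in a parameter of the degreewise maps.\<close>

lemma graded_extension_param_linear:
  assumes "graded_module K M" "module K P" "module K M'" "x \<in> carrier M"
    and "\<And>\<alpha> x. x \<in> homog M \<alpha> \<Longrightarrow> linear_map K M' P (\<lambda>p. g p \<alpha> x)"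
  shows "linear_map K M' P (\<lambda>p. graded_extension M P (g p) x)"
  unfolding graded_extension_def
  using component_finite[OF assms(1,4)] component_homog_closed[OF assms(1,4)]
  by (intro linear_map_finsum_fun assms(2,3)) (auto intro: assms(5))

text \<open>The degrees are arguments of \<open>B\<close>, since they cannot be recovered from the
  elements: zero is homogeneous of every degree. Linearity on each part forces the value zero there,
  whatever degree is named.\<close>

definition graded_bilinear ::
  "('k, 'q) ring_scheme \<Rightarrow> ('k, 'a, 'g, 'm) graded_module_scheme \<Rightarrow> ('k, 'b, 'g, 'n) graded_module_scheme \<Rightarrow>
   ('k, 'c, 'p) module_scheme \<Rightarrow> ('g \<Rightarrow> 'g \<Rightarrow> 'a \<Rightarrow> 'b \<Rightarrow> 'c) \<Rightarrow> bool" where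
  "graded_bilinear K M N P B \<longleftrightarrow>
     (\<forall>\<alpha> \<beta>. \<forall>y\<in>homog N \<beta>. linear_map K (homog_part M \<alpha>) P (\<lambda>x. B \<alpha> \<beta> x y)) \<and>
     (\<forall>\<alpha> \<beta>. \<forall>x\<in>homog M \<alpha>. linear_map K (homog_part N \<beta>) P (\<lambda>y. B \<alpha> \<beta> x y))"

lemma graded_bilinearI:
  assumes "\<And>\<alpha> \<beta> y. y \<in> homog N \<beta> \<Longrightarrow> linear_map K (homog_part M \<alpha>) P (\<lambda>x. B \<alpha> \<beta> x y)"
    and "\<And>\<alpha> \<beta> x. x \<in> homog M \<alpha> \<Longrightarrow> linear_map K (homog_part N \<beta>) P (\<lambda>y. B \<alpha> \<beta> x y)"
  shows "graded_bilinear K M N P B"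
  using assms by (simp add: graded_bilinear_def)

lemma graded_bilinearD:
  assumes "graded_bilinear K M N P B"
  shows "y \<in> homog N \<beta> \<Longrightarrow> linear_map K (homog_part M \<alpha>) P (\<lambda>x. B \<alpha> \<beta> x y)"
    and "x \<in> homog M \<alpha> \<Longrightarrow> linear_map K (homog_part N \<beta>) P (\<lambda>y. B \<alpha> \<beta> x y)"
    and "\<lbrakk>x \<in> homog M \<alpha>; y \<in> homog N \<beta>\<rbrakk> \<Longrightarrow> B \<alpha> \<beta> x y \<in> carrier P"
proof -
  show 1: "y \<in> homog N \<beta> \<Longrightarrow> linear_map K (homog_part M \<alpha>) P (\<lambda>x. B \<alpha> \<beta> x y)" for y \<alpha> \<beta>
    using assms by (simp add: graded_bilinear_def)
  show "x \<in> homog M \<alpha> \<Longrightarrow> linear_map K (homog_part N \<beta>) P (\<lambda>y. B \<alpha> \<beta> x y)" for x \<alpha> \<beta>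
    using assms by (simp add: graded_bilinear_def)
  show "B \<alpha> \<beta> x y \<in> carrier P" if "x \<in> homog M \<alpha>" "y \<in> homog N \<beta>"
    using linear_map_closed[OF 1[OF that(2)]] that(1) by (simp add: homog_part_simps)
qed

lemma linear_map_homog_part:
  assumes "graded_module K M" "linear_map K M P f"
  shows "linear_map K (homog_part M \<alpha>) P f"
  using assms(2) homog_carrier[OF assms(1)]
  by (auto simp: linear_map_def homog_part_simps Pi_def)

lemma bilinear_graded_bilinear:
  assumes "graded_module K M" "graded_module K N" "bilinear_map K M N P B"
  shows "graded_bilinear K M N P (\<lambda>_ _. B)"
  using assms homog_carrier[OF assms(1)] homog_carrier[OF assms(2)] bilinear_mapD(1,2)[OF assms(3)]
  by (intro graded_bilinearI linear_map_homog_part) auto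

section \<open>Linear maps given on homogeneous pure tensors\<close>

definition graded_lift ::
  "('k, 'q) ring_scheme \<Rightarrow> ('k, 'a, 'g::ab_group_add, 'm) graded_module_scheme \<Rightarrow>
   ('k, 'b, 'g, 'n) graded_module_scheme \<Rightarrow> ('k, 'c, 'p) module_scheme \<Rightarrow>
   ('g \<Rightarrow> 'g \<Rightarrow> 'a \<Rightarrow> 'b \<Rightarrow> 'c) \<Rightarrow> ('k, 'a, 'b) tens \<Rightarrow> 'c" where
  "graded_lift K M N P B =
     the_linear K (tensor K M N) P
       (\<lambda>L. \<forall>\<alpha> \<beta>. \<forall>x\<in>homog M \<alpha>. \<forall>y\<in>homog N \<beta>. L (pure_tensor K M N x y) = B \<alpha> \<beta> x y)"

lemma braiding_eq: "braiding K \<omega> M N =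
    graded_lift K M N (tensor K N M) (\<lambda>\<alpha> \<beta> x y. \<omega> \<alpha> \<beta> \<odot>\<^bsub>tensor K N M\<^esub> pure_tensor K N M y x)"
  by (simp add: braiding_def graded_lift_def)

context
  fixes K :: "('k, 'q) ring_scheme"
    and M :: "('k, 'a, 'g::ab_group_add, 'm) graded_module_scheme"
    and N :: "('k, 'b, 'g, 'n) graded_module_scheme"
  assumes M: "graded_module K M" and N: "graded_module K N"
begin

private lemma mods: "module K M" "module K N" "module K (tensor K M N)"
  using M N by (auto intro: graded_module_module tensor_module)

lemma tensor_graded_ext:
  assumes "linear_map K (tensor K M N) P f" "linear_map K (tensor K M N) P g"
    and "\<And>\<alpha> \<beta> x y. \<lbrakk>x \<in> homog M \<alpha>; y \<in> homog N \<beta>\<rbrakk> \<Longrightarrow>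
        f (pure_tensor K M N x y) = g (pure_tensor K M N x y)"
    and "t \<in> carrier (tensor K M N)"
  shows "f t = g t"
proof (rule tensor_linear_ext[OF mods(1,2) assms(1,2) _ assms(4)])
  fix x y assume x: "x \<in> carrier M" and y: "y \<in> carrier N"
  note pt = pure_tensor_bilinear[OF mods(1,2)]
  have *: "f (pure_tensor K M N x y) = g (pure_tensor K M N x y)" if "x \<in> homog M \<alpha>" for x \<alpha>
  proof -
    note l = bilinear_mapD(2)[OF pt homog_carrier[OF M that]]
    show ?thesis
      by (rule graded_linear_ext[OF N linear_map_comp[OF assms(1) l] linear_map_comp[OF assms(2) l] _ y])
        (rule assms(3)[OF that])
  qed
  note l = bilinear_mapD(1)[OF pt y]
  show "f (pure_tensor K M N x y) = g (pure_tensor K M N x y)"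
    by (rule graded_linear_ext[OF M linear_map_comp[OF assms(1) l] linear_map_comp[OF assms(2) l] _ x])
      (rule *)
qed

text \<open>Extend in the second argument for a fixed degree of the first, then in the first
  argument. The order is immaterial for the result, which is determined by its values on homogeneous
  pairs.\<close>

lemma graded_bilinear_extension:
  assumes P: "module K P" and B: "graded_bilinear K M N P B"
  obtains B' where "bilinear_map K M N P B'"
    and "\<And>\<alpha> \<beta> x y. \<lbrakk>x \<in> homog M \<alpha>; y \<in> homog N \<beta>\<rbrakk> \<Longrightarrow> B' x y = B \<alpha> \<beta> x y"
proof
  let ?g = "\<lambda>y \<alpha> x. graded_extension N P (\<lambda>\<beta> y. B \<alpha> \<beta> x y) y"
  let ?B = "\<lambda>x y. graded_extension M P (?g y) x"
  have lin: "linear_map K (homog_part M \<alpha>) P (\<lambda>x. ?g y \<alpha> x)" if "y \<in> carrier N" for y \<alpha>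
    using that by (intro graded_extension_param_linear N P homog_part_module M graded_bilinearD(1)[OF B])
  have lin': "linear_map K N P (\<lambda>y. ?g y \<alpha> x)" if "x \<in> homog M \<alpha>" for x \<alpha>
    using that by (intro graded_extension_linear N P graded_bilinearD(2)[OF B])
  show "bilinear_map K M N P ?B"
    by (intro bilinear_mapI graded_extension_linear graded_extension_param_linear M N P lin lin' mods)
  fix \<alpha> \<beta> x y assume x: "x \<in> homog M \<alpha>" and y: "y \<in> homog N \<beta>"
  show "?B x y = B \<alpha> \<beta> x y"
    using graded_extension_homog[OF M P lin[OF homog_carrier[OF N y]] x]
      graded_extension_homog[OF N P graded_bilinearD(2)[OF B x] y]
    by simp
qed

lemma graded_lift_props:
  assumes P: "module K P" and B: "graded_bilinear K M N P B"
  shows "linear_map K (tensor K M N) P (graded_lift K M N P B) \<and>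
    (\<forall>\<alpha> \<beta>. \<forall>x\<in>homog M \<alpha>. \<forall>y\<in>homog N \<beta>. graded_lift K M N P B (pure_tensor K M N x y) = B \<alpha> \<beta> x y)"
proof -
  obtain B' where B': "bilinear_map K M N P B'"
    "\<And>\<alpha> \<beta> x y. \<lbrakk>x \<in> homog M \<alpha>; y \<in> homog N \<beta>\<rbrakk> \<Longrightarrow> B' x y = B \<alpha> \<beta> x y"
    using graded_bilinear_extension[OF P B] by blast
  let ?L = "tensor_lift K M N P B'"
  note L = tensor_lift_linear[OF mods(1,2) P B'(1)]
  have pure: "?L (pure_tensor K M N x y) = B \<alpha> \<beta> x y" if "x \<in> homog M \<alpha>" "y \<in> homog N \<beta>" for \<alpha> \<beta> x y
    using tensor_lift_pure[OF mods(1,2) P B'(1) homog_carrier[OF M that(1)] homog_carrier[OF N that(2)]]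
      B'(2)[OF that] by simp
  have cl: "pure_tensor K M N x y \<in> carrier (tensor K M N)" if "x \<in> homog M \<alpha>" "y \<in> homog N \<beta>" for \<alpha> \<beta> x y
    using that by (intro pure_tensor_closed mods homog_carrier[OF M] homog_carrier[OF N])
  have uniq: "L' t = ?L t"
    if L': "linear_map K (tensor K M N) P L'"
      "\<forall>\<alpha> \<beta>. \<forall>x\<in>homog M \<alpha>. \<forall>y\<in>homog N \<beta>. L' (pure_tensor K M N x y) = B \<alpha> \<beta> x y"
      and t: "t \<in> carrier (tensor K M N)" for L' t
    by (rule tensor_graded_ext[OF L'(1) L _ t]) (use L'(2) pure in auto)
  have "graded_lift K M N P B = restrict ?L (carrier (tensor K M N))"
    unfolding graded_lift_def
  proof (rule the_linear_eq[OF mods(3) L])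
    show "\<forall>\<alpha> \<beta>. \<forall>x\<in>homog M \<alpha>. \<forall>y\<in>homog N \<beta>.
        restrict ?L (carrier (tensor K M N)) (pure_tensor K M N x y) = B \<alpha> \<beta> x y"
      using pure cl by simp
  qed (rule uniq)
  moreover have "linear_map K (tensor K M N) P (restrict ?L (carrier (tensor K M N)))"
    using mods(3) L by (rule linear_map_cong) simp
  ultimately show ?thesis
    using pure cl by simp
qed

lemmas graded_lift_linear = graded_lift_props[THEN conjunct1]

lemma graded_lift_pure:
  "\<lbrakk>module K P; graded_bilinear K M N P B; x \<in> homog M \<alpha>; y \<in> homog N \<beta>\<rbrakk> \<Longrightarrow>
    graded_lift K M N P B (pure_tensor K M N x y) = B \<alpha> \<beta> x y"
  using graded_lift_props by blast

lemma graded_lift_closed: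
  "\<lbrakk>module K P; graded_bilinear K M N P B; t \<in> carrier (tensor K M N)\<rbrakk> \<Longrightarrow>
    graded_lift K M N P B t \<in> carrier P"
  using linear_map_closed[OF graded_lift_linear] by blast

lemma graded_lift_unique:
  assumes "module K P" "graded_bilinear K M N P B" "linear_map K (tensor K M N) P L"
    and "\<And>\<alpha> \<beta> x y. \<lbrakk>x \<in> homog M \<alpha>; y \<in> homog N \<beta>\<rbrakk> \<Longrightarrow> L (pure_tensor K M N x y) = B \<alpha> \<beta> x y"
    and "t \<in> carrier (tensor K M N)"
  shows "graded_lift K M N P B t = L t"
  by (rule tensor_graded_ext[OF graded_lift_linear[OF assms(1,2)] assms(3) _ assms(5)])
    (simp add: assms(4) graded_lift_pure[OF assms(1,2)])

text \<open>Brings the sign-free maps of the definitions, such as the contractions, into the form in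
  which they can be combined with maps that carry signs.\<close>

lemma tensor_lift_eq_graded_lift:
  assumes "module K P" "bilinear_map K M N P B" "t \<in> carrier (tensor K M N)"
  shows "tensor_lift K M N P B t = graded_lift K M N P (\<lambda>_ _. B) t"
  by (rule graded_lift_unique[symmetric])
    (use assms in \<open>auto intro: bilinear_graded_bilinear M N tensor_lift_linear mods tensor_lift_pure
      homog_carrier[OF M] homog_carrier[OF N]\<close>)

text \<open>The two definite descriptions have the same defining predicate, so they denote the same
  map for arbitrary families; linearity does not enter.\<close>

lemma graded_lift_cong:
  assumes "\<And>\<alpha> \<beta> x y. \<lbrakk>x \<in> homog M \<alpha>; y \<in> homog N \<beta>\<rbrakk> \<Longrightarrow> B \<alpha> \<beta> x y = B' \<alpha> \<beta> x y"
  shows "graded_lift K M N P B t = graded_lift K M N P B' t"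
  using assms by (simp add: graded_lift_def)

lemma graded_lift_comp:
  assumes "module K P" "module K P'" "graded_bilinear K M N P B" "linear_map K P P' F"
    and "t \<in> carrier (tensor K M N)"
  shows "F (graded_lift K M N P B t) = graded_lift K M N P' (\<lambda>\<alpha> \<beta> x y. F (B \<alpha> \<beta> x y)) t"
proof (rule graded_lift_unique[symmetric])
  show "graded_bilinear K M N P' (\<lambda>\<alpha> \<beta> x y. F (B \<alpha> \<beta> x y))"
    by (intro graded_bilinearI linear_map_comp[OF assms(4)] graded_bilinearD[OF assms(3)])
  show "linear_map K (tensor K M N) P' (\<lambda>t. F (graded_lift K M N P B t))"
    by (intro linear_map_comp[OF assms(4)] graded_lift_linear assms(1,3))
qed (use assms in \<open>auto simp: graded_lift_pure\<close>)

text \<open>By uniqueness of lifts: the pointwise sum of two lifts, or a scalar multiple of one, is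
  linear in \<open>t\<close> and has on homogeneous pure tensors the values required of the lift at
  the combined parameter.\<close>

lemma graded_lift_param_linear:
  assumes "module K P" "module K M'" "t \<in> carrier (tensor K M N)"
    and B: "\<And>p. p \<in> carrier M' \<Longrightarrow> graded_bilinear K M N P (B p)"
    and lin: "\<And>\<alpha> \<beta> x y. \<lbrakk>x \<in> homog M \<alpha>; y \<in> homog N \<beta>\<rbrakk> \<Longrightarrow> linear_map K M' P (\<lambda>p. B p \<alpha> \<beta> x y)"
  shows "linear_map K M' P (\<lambda>p. graded_lift K M N P (B p) t)"
proof -
  interpret P: module K P by fact
  interpret M': module K M' by fact
  note gl = graded_lift_linear[OF assms(1) B]
  show ?thesis
  proof (rule linear_mapI)
    fix p assume "p \<in> carrier M'"
    then show "graded_lift K M N P (B p) t \<in> carrier P"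
      by (intro graded_lift_closed assms(1,3) B)
  next
    fix p q assume p: "p \<in> carrier M'" and q: "q \<in> carrier M'"
    have L: "linear_map K (tensor K M N) P (\<lambda>t. graded_lift K M N P (B p) t \<oplus>\<^bsub>P\<^esub> graded_lift K M N P (B q) t)"
      using linear_map_closed[OF gl] p q
      by (intro linear_mapI)
        (simp_all add: linear_map_add[OF gl] linear_map_smult[OF gl] P.smult_r_distr P.M.a_ac)
    show "graded_lift K M N P (B (p \<oplus>\<^bsub>M'\<^esub> q)) t = graded_lift K M N P (B p) t \<oplus>\<^bsub>P\<^esub> graded_lift K M N P (B q) t"
      using p q
      by (intro graded_lift_unique[OF assms(1) B L _ assms(3)])
        (simp_all add: graded_lift_pure[OF assms(1) B] linear_map_add[OF lin])
  next
    fix k p assume k: "k \<in> carrier K" and p: "p \<in> carrier M'"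
    have L: "linear_map K (tensor K M N) P (\<lambda>t. k \<odot>\<^bsub>P\<^esub> graded_lift K M N P (B p) t)"
      using linear_map_closed[OF gl] p k
      by (intro linear_mapI)
        (simp_all add: linear_map_add[OF gl] linear_map_smult[OF gl] P.smult_r_distr
          P.smult_assoc1[symmetric] P.R.m_comm)
    show "graded_lift K M N P (B (k \<odot>\<^bsub>M'\<^esub> p)) t = k \<odot>\<^bsub>P\<^esub> graded_lift K M N P (B p) t"
      using p k
      by (intro graded_lift_unique[OF assms(1) B L _ assms(3)])
        (simp_all add: graded_lift_pure[OF assms(1) B] linear_map_smult[OF lin])
  qed
qed

lemma pure_tensor_homog:
  "\<lbrakk>x \<in> homog M \<alpha>; y \<in> homog N \<beta>\<rbrakk> \<Longrightarrow> pure_tensor K M N x y \<in> homog (tensor K M N) (\<alpha> + \<beta>)"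
  unfolding tensor_homog[OF mods(3)] by (rule subsetD[OF module_span_superset]) blast

lemma tensor_homog_submodule: "submodule (homog (tensor K M N) \<gamma>) K (tensor K M N)"
  unfolding tensor_homog[OF mods(3)]
  by (rule module_span_submodule[OF mods(3)])
    (auto intro: pure_tensor_closed mods homog_carrier[OF M] homog_carrier[OF N])

lemma tensor_homog_minimal:
  assumes "submodule S K (tensor K M N)"
    and "\<And>\<alpha> \<beta> x y. \<lbrakk>x \<in> homog M \<alpha>; y \<in> homog N \<beta>; \<alpha> + \<beta> = \<gamma>\<rbrakk> \<Longrightarrow> pure_tensor K M N x y \<in> S"
  shows "homog (tensor K M N) \<gamma> \<subseteq> S"
  unfolding tensor_homog[OF mods(3)]
  by (rule module_span_minimal[OF assms(1)]) (use assms(2) in blast)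

text \<open>The part of degree \<open>\<gamma>\<close> is spanned by pure tensors whose degrees add
  up to \<open>\<gamma>\<close>, and the equalizer of \<open>f\<close> and \<open>g\<close> is a
  submodule. Hence only those pure tensors have to be compared.\<close>

lemma tensor_homog_ext:
  assumes "module K P" "linear_map K (tensor K M N) P f" "linear_map K (tensor K M N) P g"
    and "\<And>\<alpha> \<beta> x y. \<lbrakk>x \<in> homog M \<alpha>; y \<in> homog N \<beta>; \<alpha> + \<beta> = \<gamma>\<rbrakk> \<Longrightarrow>
        f (pure_tensor K M N x y) = g (pure_tensor K M N x y)"
    and "t \<in> homog (tensor K M N) \<gamma>"
  shows "f t = g t"
proof -
  have "homog (tensor K M N) \<gamma> \<subseteq> {t \<in> carrier (tensor K M N). f t = g t}"
    by (rule tensor_homog_minimal[OF submodule_equalizer[OF mods(3) assms(1-3)]])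
      (auto intro: pure_tensor_closed mods homog_carrier[OF M] homog_carrier[OF N] assms(4))
  then show ?thesis using assms(5) by blast
qed

text \<open>The projection to degree \<open>\<gamma>\<close> is the lift of the family that keeps a
  pure tensor if its degrees add up to \<open>\<gamma>\<close> and replaces it by zero otherwise.
  Such a cut-off is bilinear only degree by degree, which is exactly what graded lifts permit.
  Decompositions exist for homogeneous pure tensors and add up.\<close>

lemma tensor_graded_module: "graded_module K (tensor K M N)"
proof -
  let ?T = "tensor K M N"
  interpret M: graded_module K M by (rule M)
  interpret N: graded_module K N by (rule N)
  interpret T: module K ?T by (rule mods(3))
  have z: "linear_map K ?T ?T (\<lambda>_. \<zero>\<^bsub>?T\<^esub>)" by (intro linear_mapI) simp_all
  have i: "linear_map K ?T ?T (\<lambda>t. t)" by (intro linear_mapI) simp_all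
  define B where "B \<gamma> \<alpha> \<beta> x y = (if \<alpha> + \<beta> = \<gamma> then pure_tensor K M N x y else \<zero>\<^bsub>?T\<^esub>)" for \<gamma> \<alpha> \<beta> :: 'g and x y
  have zM: "linear_map K (homog_part M \<alpha>) ?T (\<lambda>_. \<zero>\<^bsub>?T\<^esub>)" for \<alpha> by (intro linear_mapI) simp_all
  have zN: "linear_map K (homog_part N \<alpha>) ?T (\<lambda>_. \<zero>\<^bsub>?T\<^esub>)" for \<alpha> by (intro linear_mapI) simp_all
  have B: "graded_bilinear K M N ?T (B \<gamma>)" for \<gamma>
  proof (rule graded_bilinearI)
    fix \<alpha> \<beta> y assume "y \<in> homog N \<beta>"
    then have "linear_map K (homog_part M \<alpha>) ?T (\<lambda>x. pure_tensor K M N x y)"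
      by (intro linear_map_homog_part M bilinear_mapD(1)[OF pure_tensor_bilinear] mods homog_carrier[OF N])
    then show "linear_map K (homog_part M \<alpha>) ?T (\<lambda>x. B \<gamma> \<alpha> \<beta> x y)"
      unfolding B_def using zM by (cases "\<alpha> + \<beta> = \<gamma>") simp_all
  next
    fix \<alpha> \<beta> x assume "x \<in> homog M \<alpha>"
    then have "linear_map K (homog_part N \<beta>) ?T (\<lambda>y. pure_tensor K M N x y)"
      by (intro linear_map_homog_part N bilinear_mapD(2)[OF pure_tensor_bilinear] mods homog_carrier[OF M])
    then show "linear_map K (homog_part N \<beta>) ?T (\<lambda>y. B \<gamma> \<alpha> \<beta> x y)"
      unfolding B_def using zN by (cases "\<alpha> + \<beta> = \<gamma>") simp_all
  qed
  note glin = graded_lift_linear[OF mods(3) B]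
  have pure_dec: "\<exists>c. decomposition ?T t c" if "t \<in> homog ?T \<gamma>" for t \<gamma>
  proof -
    let ?c = "\<lambda>\<beta>. if \<beta> = \<gamma> then t else \<zero>\<^bsub>?T\<^esub>"
    have t: "t \<in> carrier ?T" using that submodule_subset[OF tensor_homog_submodule] by blast
    have sub: "{\<alpha>. ?c \<alpha> \<noteq> \<zero>\<^bsub>?T\<^esub>} \<subseteq> {\<gamma>}" by auto
    have "finsum ?T ?c {\<alpha>. ?c \<alpha> \<noteq> \<zero>\<^bsub>?T\<^esub>} = finsum ?T ?c {\<gamma>}"
      using t by (intro decomposition_finsum[OF mods(3) _ _ sub]) simp_all
    then show ?thesis
      unfolding decomposition_def
      using t that finite_subset[OF sub] submodule_zero[OF tensor_homog_submodule]
      by (intro exI[of _ ?c]) simp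
  qed
  have dec_add: "\<exists>c. decomposition ?T (t \<oplus>\<^bsub>?T\<^esub> u) c"
    if "\<exists>c. decomposition ?T t c" "\<exists>c. decomposition ?T u c" for t u
    using that decomposition_add[OF mods(3) tensor_homog_submodule] by blast
  show ?thesis
  proof (rule graded_moduleI[OF mods(3) tensor_homog_submodule glin])
    fix \<alpha> \<beta> t assume t: "t \<in> homog ?T \<beta>"
    show "graded_lift K M N ?T (B \<alpha>) t = (if \<alpha> = \<beta> then t else \<zero>\<^bsub>?T\<^esub>)"
    proof (cases "\<alpha> = \<beta>")
      case True
      then show ?thesis
        using tensor_homog_ext[OF mods(3) glin i _ t, of \<alpha>]
        by (simp add: graded_lift_pure[OF mods(3) B] B_def)
    next
      case False
      then show ?thesis
        using tensor_homog_ext[OF mods(3) glin z _ t, of \<alpha>]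
        by (simp add: graded_lift_pure[OF mods(3) B] B_def)
    qed
  next
    fix t assume "t \<in> carrier ?T"
    then show "\<exists>c. decomposition ?T t c"
    proof (induction rule: tensor_induct[OF mods(1,2), consumes 1, case_names pure add])
      case (pure x y)
      note pt = pure_tensor_bilinear[OF mods(1,2)]
      have h: "\<exists>c. decomposition ?T (pure_tensor K M N x y) c" if x: "x \<in> homog M \<alpha>" for x \<alpha>
        using N pure(2)
      proof (induction rule: graded_module_induct)
        case (homog \<beta> y)
        then show ?case using pure_dec pure_tensor_homog[OF x] by blast
      next
        case (add y y')
        then show ?case
          using linear_map_add[OF bilinear_mapD(2)[OF pt homog_carrier[OF M x]] add(1,2)]
          by (simp add: dec_add)
      qed
      show ?case
        using M pure(1)
      proof (induction rule: graded_module_induct)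
        case (homog \<alpha> x)
        then show ?case using h by blast
      next
        case (add x x')
        then show ?case
          using linear_map_add[OF bilinear_mapD(1)[OF pt pure(2)] add(1,2)] by (simp add: dec_add)
      qed
    next
      case (add t u)
      then show ?case by (simp add: dec_add)
    qed
  qed
qed

text \<open>The place where relations between degrees are exploited: on a homogeneous
  \<open>t\<close> two families need to agree only when the degrees add up to that of
  \<open>t\<close>, so signs may be rewritten accordingly.\<close>

lemma graded_lift_homog_cong:
  assumes "module K P" "graded_bilinear K M N P B" "graded_bilinear K M N P B'" "t \<in> homog (tensor K M N) \<gamma>"
    and "\<And>\<alpha> \<beta> x y. \<lbrakk>x \<in> homog M \<alpha>; y \<in> homog N \<beta>; \<alpha> + \<beta> = \<gamma>\<rbrakk> \<Longrightarrow> B \<alpha> \<beta> x y = B' \<alpha> \<beta> x y"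
  shows "graded_lift K M N P B t = graded_lift K M N P B' t"
  by (rule tensor_homog_ext[OF assms(1) graded_lift_linear[OF assms(1,2)]
      graded_lift_linear[OF assms(1,3)] _ assms(4)])
    (simp add: graded_lift_pure assms)

lemma graded_lift_mem:
  assumes "module K P" "graded_bilinear K M N P B" "t \<in> homog (tensor K M N) \<gamma>" "submodule S K P"
    and "\<And>\<alpha> \<beta> x y. \<lbrakk>x \<in> homog M \<alpha>; y \<in> homog N \<beta>; \<alpha> + \<beta> = \<gamma>\<rbrakk> \<Longrightarrow> B \<alpha> \<beta> x y \<in> S"
  shows "graded_lift K M N P B t \<in> S"
proof -
  have "homog (tensor K M N) \<gamma> \<subseteq> {t \<in> carrier (tensor K M N). graded_lift K M N P B t \<in> S}"
    by (rule tensor_homog_minimal[OF submodule_vimage[OF mods(3) assms(1) graded_lift_linear[OF assms(1,2)] assms(4)]])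
      (auto intro: pure_tensor_closed mods homog_carrier[OF M] homog_carrier[OF N]
        simp: graded_lift_pure[OF assms(1,2)] assms(5))
  then show ?thesis using assms(3) by blast
qed

end

text \<open>Interchange of two independent sums, by uniqueness of the outer lift: with
  \<open>u\<close> fixed, the right-hand side is linear in \<open>t\<close>, and on a pure tensor
  its inner lift evaluates to \<open>T\<close>.\<close>

lemma graded_lift_swap:
  assumes "graded_module K M" "graded_module K N" "graded_module K M'" "graded_module K N'" "module K P"
    and t: "t \<in> carrier (tensor K M N)" and u: "u \<in> carrier (tensor K M' N')"
    and T: "\<And>\<gamma> \<delta> c d. \<lbrakk>c \<in> homog M' \<gamma>; d \<in> homog N' \<delta>\<rbrakk> \<Longrightarrow>
        graded_bilinear K M N P (\<lambda>\<alpha> \<beta> a b. T \<alpha> \<beta> \<gamma> \<delta> a b c d)"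
    and T': "\<And>\<alpha> \<beta> a b. \<lbrakk>a \<in> homog M \<alpha>; b \<in> homog N \<beta>\<rbrakk> \<Longrightarrow>
        graded_bilinear K M' N' P (\<lambda>\<gamma> \<delta> c d. T \<alpha> \<beta> \<gamma> \<delta> a b c d)"
  shows "graded_lift K M N P (\<lambda>\<alpha> \<beta> a b. graded_lift K M' N' P (\<lambda>\<gamma> \<delta> c d. T \<alpha> \<beta> \<gamma> \<delta> a b c d) u) t =
    graded_lift K M' N' P (\<lambda>\<gamma> \<delta> c d. graded_lift K M N P (\<lambda>\<alpha> \<beta> a b. T \<alpha> \<beta> \<gamma> \<delta> a b c d) t) u"
proof -
  have TT: "module K (tensor K M N)"
    using assms(1,2) by (intro tensor_module graded_module_module)
  have par: "graded_bilinear K M' N' P (\<lambda>\<gamma> \<delta> c d. graded_lift K M N P (\<lambda>\<alpha> \<beta> a b. T \<alpha> \<beta> \<gamma> \<delta> a b c d) t)"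
    if "t \<in> carrier (tensor K M N)" for t
    by (intro graded_bilinearI graded_lift_param_linear assms(1,2,5) that homog_part_module assms(3,4))
      (auto simp: homog_part_simps intro: graded_bilinearD[OF T] graded_bilinearD[OF T'])
  show ?thesis
  proof (rule graded_lift_unique[OF assms(1,2,5) _ _ _ t])
    show "graded_bilinear K M N P (\<lambda>\<alpha> \<beta> a b. graded_lift K M' N' P (\<lambda>\<gamma> \<delta> c d. T \<alpha> \<beta> \<gamma> \<delta> a b c d) u)"
      by (intro graded_bilinearI graded_lift_param_linear assms(3-5) u homog_part_module assms(1,2))
        (auto simp: homog_part_simps intro: graded_bilinearD[OF T] graded_bilinearD[OF T'])
    show "linear_map K (tensor K M N) P
        (\<lambda>t. graded_lift K M' N' P (\<lambda>\<gamma> \<delta> c d. graded_lift K M N P (\<lambda>\<alpha> \<beta> a b. T \<alpha> \<beta> \<gamma> \<delta> a b c d) t) u)"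
      by (intro graded_lift_param_linear[OF assms(3-5) TT u] par graded_lift_linear assms(1,2,5) T)
    fix \<alpha> \<beta> a b assume ab: "a \<in> homog M \<alpha>" "b \<in> homog N \<beta>"
    show "graded_lift K M' N' P (\<lambda>\<gamma> \<delta> c d.
          graded_lift K M N P (\<lambda>\<alpha> \<beta> a b. T \<alpha> \<beta> \<gamma> \<delta> a b c d) (pure_tensor K M N a b)) u =
        graded_lift K M' N' P (\<lambda>\<gamma> \<delta> c d. T \<alpha> \<beta> \<gamma> \<delta> a b c d) u"
      by (rule graded_lift_cong[OF assms(3,4)])
        (simp add: graded_lift_pure[OF assms(1,2,5) T _ _] ab)
  qed
qed

text \<open>Serves the maps described by values on iterated pure tensors, which are not of the form
  \<open>tensor_lift\<close>. The described map is a restriction of \<open>L\<close>; therefore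
  \<open>Q\<close> is demanded of every map that agrees with \<open>L\<close> on the
  carrier.\<close>

lemma the_linear_props:
  assumes F: "F = the_linear K M N Q"
    and "module K M" "linear_map K M N L"
    and Q: "\<forall>L'. (\<forall>x\<in>carrier M. L' x = L x) \<longrightarrow> Q L'"
    and uniq: "\<forall>L'. linear_map K M N L' \<and> Q L' \<longrightarrow> (\<forall>x\<in>carrier M. L' x = L x)"
  shows "linear_map K M N F \<and> Q F"
proof -
  have eq: "F = restrict L (carrier M)"
    unfolding F by (rule the_linear_eq[OF assms(2,3)]) (use Q uniq in simp_all)
  have "linear_map K M N (restrict L (carrier M))"
    using assms(2,3) by (rule linear_map_cong) simp
  then show ?thesis using Q by (simp add: eq)
qed

section \<open>Closure rules for linear maps into and out of tensor products\<close>

lemma linear_map_id: "linear_map K M M (\<lambda>x. x)"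
  by (rule linear_mapI) simp_all

lemma linear_map_const_smult:
  assumes "module K P" "linear_map K M P f" "k \<in> carrier K"
  shows "linear_map K M P (\<lambda>x. k \<odot>\<^bsub>P\<^esub> f x)"
proof -
  interpret P: module K P by fact
  show ?thesis
    using assms(3) linear_map_closed[OF assms(2)]
    by (intro linear_mapI)
      (simp_all add: linear_map_add[OF assms(2)] linear_map_smult[OF assms(2)] P.smult_r_distr
        P.smult_assoc1[symmetric] P.R.m_comm)
qed

lemma linear_map_pure_left:
  "\<lbrakk>module K A; module K B; linear_map K M A f; b \<in> carrier B\<rbrakk> \<Longrightarrow>
    linear_map K M (tensor K A B) (\<lambda>x. pure_tensor K A B (f x) b)"
  by (rule linear_map_comp[OF bilinear_mapD(1)[OF pure_tensor_bilinear]])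

lemma linear_map_pure_right:
  "\<lbrakk>module K A; module K B; linear_map K M B f; a \<in> carrier A\<rbrakk> \<Longrightarrow>
    linear_map K M (tensor K A B) (\<lambda>x. pure_tensor K A B a (f x))"
  by (rule linear_map_comp[OF bilinear_mapD(2)[OF pure_tensor_bilinear]])

lemma linear_map_tensor_lift:
  "\<lbrakk>module K A; module K B; module K P; bilinear_map K A B P F; linear_map K M (tensor K A B) f\<rbrakk> \<Longrightarrow>
    linear_map K M P (\<lambda>x. tensor_lift K A B P F (f x))"
  by (rule linear_map_comp[OF tensor_lift_linear])

lemma tensor_lift_closed:
  "\<lbrakk>module K A; module K B; module K P; bilinear_map K A B P F; t \<in> carrier (tensor K A B)\<rbrakk> \<Longrightarrow>
    tensor_lift K A B P F t \<in> carrier P"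
  using linear_map_closed[OF tensor_lift_linear] by blast

lemma tensor_lift_param_linear:
  assumes "graded_module K A" "graded_module K B" "module K P" "module K M" "t \<in> carrier (tensor K A B)"
    and F: "\<And>p. p \<in> carrier M \<Longrightarrow> bilinear_map K A B P (F p)"
    and lin: "\<And>x y. \<lbrakk>x \<in> carrier A; y \<in> carrier B\<rbrakk> \<Longrightarrow> linear_map K M P (\<lambda>p. F p x y)"
  shows "linear_map K M P (\<lambda>p. tensor_lift K A B P (F p) t)"
proof (rule linear_map_cong[OF assms(4)])
  show "linear_map K M P (\<lambda>p. graded_lift K A B P (\<lambda>_ _. F p) t)"
    by (intro graded_lift_param_linear assms(1-5) bilinear_graded_bilinear F lin)
      (auto intro: homog_carrier assms(1,2))
  show "graded_lift K A B P (\<lambda>_ _. F p) t = tensor_lift K A B P (F p) t" if "p \<in> carrier M" for p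
    by (rule tensor_lift_eq_graded_lift[OF assms(1-3) F[OF that] assms(5), symmetric])
qed

lemma tensor_lift_comp:
  assumes "module K A" "module K B" "module K P" "module K P'" "bilinear_map K A B P F" "linear_map K P P' G"
    and "t \<in> carrier (tensor K A B)"
  shows "G (tensor_lift K A B P F t) = tensor_lift K A B P' (\<lambda>x y. G (F x y)) t"
proof (rule tensor_lift_unique[OF assms(1,2,4), symmetric])
  show "bilinear_map K A B P' (\<lambda>x y. G (F x y))"
    by (intro bilinear_mapI linear_map_comp[OF assms(6)] bilinear_mapD[OF assms(5)])
  show "linear_map K (tensor K A B) P' (\<lambda>t. G (tensor_lift K A B P F t))"
    by (intro linear_map_comp[OF assms(6)] tensor_lift_linear assms)
qed (simp_all add: assms(7) tensor_lift_pure[OF assms(1-3,5)])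

lemma tensor_lift_cong:
  assumes "\<And>x y. \<lbrakk>x \<in> carrier A; y \<in> carrier B\<rbrakk> \<Longrightarrow> F x y = G x y"
  shows "tensor_lift K A B P F t = tensor_lift K A B P G t"
  using assms by (simp add: tensor_lift_def)

section \<open>Regrouping iterated tensor products\<close>

context
  fixes K :: "('k, 'q) ring_scheme"
    and A :: "('k, 'a, 'g::ab_group_add, 'm1) graded_module_scheme"
    and B :: "('k, 'b, 'g, 'm2) graded_module_scheme"
    and C :: "('k, 'c, 'g, 'm3) graded_module_scheme"
  assumes A: "graded_module K A" and B: "graded_module K B" and C: "graded_module K C"
begin

private lemma modules3: "module K A" "module K B" "module K C"
  by (rule graded_module_module[OF A] graded_module_module[OF B] graded_module_module[OF C])+

private lemmas rules3 = tensor_module tensor_graded_module A B C modules3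

private lemmas lin3 = bilinear_mapI linear_map_tensor_lift tensor_lift_param_linear
  linear_map_pure_left linear_map_pure_right linear_map_id pure_tensor_closed tensor_lift_closed rules3

text \<open>For fixed \<open>c\<close> the formula lifts over \<open>A \<otimes> B\<close>; the
  result is bilinear in the lifted argument and \<open>c\<close> and is lifted again. Uniqueness is
  checked one tensor level at a time, because the description mentions only pure tensors with pure
  entries.\<close>

lemma assoc_map_props:
  shows "linear_map K (tensor K (tensor K A B) C) (tensor K A (tensor K B C)) (assoc_map K A B C)"
    and "\<lbrakk>a \<in> carrier A; b \<in> carrier B; c \<in> carrier C\<rbrakk> \<Longrightarrow>
      assoc_map K A B C (pure_tensor K (tensor K A B) C (pure_tensor K A B a b) c) =
      pure_tensor K A (tensor K B C) a (pure_tensor K B C b c)"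
proof -
  let ?P = "tensor K A (tensor K B C)"
  let ?F = "\<lambda>c a b. pure_tensor K A (tensor K B C) a (pure_tensor K B C b c)"
  let ?G = "\<lambda>X c. tensor_lift K A B ?P (?F c) X"
  let ?L = "tensor_lift K (tensor K A B) C ?P ?G"
  have F: "bilinear_map K A B ?P (?F c)" if "c \<in> carrier C" for c
    using that by (intro lin3)
  have G: "bilinear_map K (tensor K A B) C ?P ?G"
    by (intro lin3) assumption+
  have L: "linear_map K (tensor K (tensor K A B) C) ?P ?L"
    by (intro tensor_lift_linear G rules3)
  have val: "?L (pure_tensor K (tensor K A B) C (pure_tensor K A B a b) c) = ?F c a b"
    if "a \<in> carrier A" "b \<in> carrier B" "c \<in> carrier C" for a b c
    using that by (simp add: tensor_lift_pure[OF _ _ _ G] tensor_lift_pure[OF _ _ _ F] rules3 pure_tensor_closed)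
  have uniq: "L' t = ?L t"
    if L'v: "linear_map K (tensor K (tensor K A B) C) ?P L' \<and>
        (\<forall>a\<in>carrier A. \<forall>b\<in>carrier B. \<forall>c\<in>carrier C.
          L' (pure_tensor K (tensor K A B) C (pure_tensor K A B a b) c) = ?F c a b)"
      and t: "t \<in> carrier (tensor K (tensor K A B) C)" for L' t
  proof (rule tensor_linear_ext[OF _ _ conjunct1[OF L'v] L _ t])
    note L' = conjunct1[OF L'v] and v = conjunct2[OF L'v]
    fix X c assume X: "X \<in> carrier (tensor K A B)" and c: "c \<in> carrier C"
    have l: "linear_map K (tensor K A B) (tensor K (tensor K A B) C) (\<lambda>X. pure_tensor K (tensor K A B) C X c)"
      using c by (intro lin3)
    show "L' (pure_tensor K (tensor K A B) C X c) = ?L (pure_tensor K (tensor K A B) C X c)"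
      by (rule tensor_linear_ext[OF modules3(1,2) linear_map_comp[OF L' l] linear_map_comp[OF L l] _ X])
        (use v val c in simp)
  qed (rule rules3)+
  have cl: "pure_tensor K (tensor K A B) C (pure_tensor K A B a b) c \<in> carrier (tensor K (tensor K A B) C)"
    if "a \<in> carrier A" "b \<in> carrier B" "c \<in> carrier C" for a b c
    using that by (intro lin3)
  have q: "\<forall>a\<in>carrier A. \<forall>b\<in>carrier B. \<forall>c\<in>carrier C.
      L' (pure_tensor K (tensor K A B) C (pure_tensor K A B a b) c) = ?F c a b"
    if "\<forall>x\<in>carrier (tensor K (tensor K A B) C). L' x = ?L x" for L'
    using bspec[OF that cl] val by simp
  have T: "module K (tensor K (tensor K A B) C)" by (intro rules3)
  have props: "linear_map K (tensor K (tensor K A B) C) ?P (assoc_map K A B C) \<and>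
    (\<forall>a\<in>carrier A. \<forall>b\<in>carrier B. \<forall>c\<in>carrier C.
      assoc_map K A B C (pure_tensor K (tensor K A B) C (pure_tensor K A B a b) c) = ?F c a b)"
    by (rule the_linear_props[OF assoc_map_def[of K A B C] T L])
      (intro allI impI, rule q, assumption, intro allI impI ballI, rule uniq, assumption+)
  show "linear_map K (tensor K (tensor K A B) C) ?P (assoc_map K A B C)"
    by (rule conjunct1[OF props])
  show "\<lbrakk>a \<in> carrier A; b \<in> carrier B; c \<in> carrier C\<rbrakk> \<Longrightarrow>
      assoc_map K A B C (pure_tensor K (tensor K A B) C (pure_tensor K A B a b) c) = ?F c a b"
    using props by simp
qed

end

context
  fixes K :: "('k, 'q) ring_scheme"
    and A :: "('k, 'a, 'g::ab_group_add, 'm1) graded_module_scheme"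
    and B :: "('k, 'b, 'g, 'm2) graded_module_scheme"
    and C :: "('k, 'c, 'g, 'm3) graded_module_scheme"
    and D :: "('k, 'd, 'g, 'm4) graded_module_scheme"
  assumes A: "graded_module K A" and B: "graded_module K B" and C: "graded_module K C" and D: "graded_module K D"
begin

private lemma g: "graded_module K A" "graded_module K B" "graded_module K C" "graded_module K D"
  by (rule A B C D)+

private lemma m: "module K A" "module K B" "module K C" "module K D"
  by (rule graded_module_module[OF A] graded_module_module[OF B] graded_module_module[OF C] graded_module_module[OF D])+

private lemmas rules = tensor_module tensor_graded_module g m

private lemmas lin = bilinear_mapI linear_map_tensor_lift tensor_lift_param_linear
  linear_map_pure_left linear_map_pure_right linear_map_id pure_tensor_closed tensor_lift_closed rules

lemma group_middle_props:
  shows "linear_map K (tensor K (tensor K A B) (tensor K C D)) (tensor K A (tensor K (tensor K B C) D))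
      (group_middle K A B C D)"
    and "\<lbrakk>a \<in> carrier A; b \<in> carrier B; c \<in> carrier C; d \<in> carrier D\<rbrakk> \<Longrightarrow>
      group_middle K A B C D
        (pure_tensor K (tensor K A B) (tensor K C D) (pure_tensor K A B a b) (pure_tensor K C D c d)) =
      pure_tensor K A (tensor K (tensor K B C) D) a (pure_tensor K (tensor K B C) D (pure_tensor K B C b c) d)"
proof -
  let ?P = "tensor K A (tensor K (tensor K B C) D)" and ?M = "tensor K (tensor K A B) (tensor K C D)"
  let ?in = "\<lambda>a b c d. pure_tensor K (tensor K A B) (tensor K C D) (pure_tensor K A B a b) (pure_tensor K C D c d)"
  let ?F = "\<lambda>a b c d. pure_tensor K A (tensor K (tensor K B C) D) a
    (pure_tensor K (tensor K B C) D (pure_tensor K B C b c) d)"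
  let ?G = "\<lambda>Y a b. tensor_lift K C D ?P (?F a b) Y"
  let ?H = "\<lambda>X Y. tensor_lift K A B ?P (?G Y) X"
  let ?L = "tensor_lift K (tensor K A B) (tensor K C D) ?P ?H"
  have F: "bilinear_map K C D ?P (?F a b)" if "a \<in> carrier A" "b \<in> carrier B" for a b
    using that by (intro lin)
  have G: "bilinear_map K A B ?P (?G Y)" if "Y \<in> carrier (tensor K C D)" for Y
    using that by (intro lin) assumption+
  have H: "bilinear_map K (tensor K A B) (tensor K C D) ?P ?H"
    by (intro lin) assumption+
  have L: "linear_map K ?M ?P ?L"
    by (intro tensor_lift_linear H rules)
  have val: "?L (?in a b c d) = ?F a b c d"
    if "a \<in> carrier A" "b \<in> carrier B" "c \<in> carrier C" "d \<in> carrier D" for a b c d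
    using that
    by (simp add: tensor_lift_pure[OF _ _ _ H] tensor_lift_pure[OF _ _ _ G] tensor_lift_pure[OF _ _ _ F]
        rules pure_tensor_closed)
  have uniq: "L' t = ?L t"
    if L'v: "linear_map K ?M ?P L' \<and>
        (\<forall>a\<in>carrier A. \<forall>b\<in>carrier B. \<forall>c\<in>carrier C. \<forall>d\<in>carrier D. L' (?in a b c d) = ?F a b c d)"
      and t: "t \<in> carrier ?M" for L' t
  proof (rule tensor_linear_ext[OF _ _ conjunct1[OF L'v] L _ t])
    note L' = conjunct1[OF L'v] and v = conjunct2[OF L'v]
    fix X Y assume X: "X \<in> carrier (tensor K A B)" and Y: "Y \<in> carrier (tensor K C D)"
    have l: "linear_map K (tensor K A B) ?M (\<lambda>X. pure_tensor K (tensor K A B) (tensor K C D) X Y)"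
      using Y by (intro lin)
    show "L' (pure_tensor K (tensor K A B) (tensor K C D) X Y) =
        ?L (pure_tensor K (tensor K A B) (tensor K C D) X Y)"
    proof (rule tensor_linear_ext[OF m(1,2) linear_map_comp[OF L' l] linear_map_comp[OF L l] _ X])
      fix a b assume ab: "a \<in> carrier A" "b \<in> carrier B"
      have l: "linear_map K (tensor K C D) ?M
          (\<lambda>Y. pure_tensor K (tensor K A B) (tensor K C D) (pure_tensor K A B a b) Y)"
        using ab by (intro lin)
      show "L' (pure_tensor K (tensor K A B) (tensor K C D) (pure_tensor K A B a b) Y) =
          ?L (pure_tensor K (tensor K A B) (tensor K C D) (pure_tensor K A B a b) Y)"
        by (rule tensor_linear_ext[OF m(3,4) linear_map_comp[OF L' l] linear_map_comp[OF L l] _ Y])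
          (use v val ab in simp)
    qed
  qed (rule rules)+
  have cl: "?in a b c d \<in> carrier ?M"
    if "a \<in> carrier A" "b \<in> carrier B" "c \<in> carrier C" "d \<in> carrier D" for a b c d
    using that by (intro lin)
  have q: "\<forall>a\<in>carrier A. \<forall>b\<in>carrier B. \<forall>c\<in>carrier C. \<forall>d\<in>carrier D. L' (?in a b c d) = ?F a b c d"
    if "\<forall>x\<in>carrier ?M. L' x = ?L x" for L'
    using bspec[OF that cl] val by simp
  have T: "module K ?M" by (intro rules)
  have props: "linear_map K ?M ?P (group_middle K A B C D) \<and>
    (\<forall>a\<in>carrier A. \<forall>b\<in>carrier B. \<forall>c\<in>carrier C. \<forall>d\<in>carrier D. group_middle K A B C D (?in a b c d) = ?F a b c d)"
    by (rule the_linear_props[OF group_middle_def[of K A B C D] T L])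
      (intro allI impI, rule q, assumption, intro allI impI ballI, rule uniq, assumption+)
  show "linear_map K ?M ?P (group_middle K A B C D)"
    by (rule conjunct1[OF props])
  show "\<lbrakk>a \<in> carrier A; b \<in> carrier B; c \<in> carrier C; d \<in> carrier D\<rbrakk> \<Longrightarrow>
      group_middle K A B C D (?in a b c d) = ?F a b c d"
    using props by simp
qed

lemma group_pairs_props:
  shows "linear_map K (tensor K A (tensor K (tensor K B C) D)) (tensor K (tensor K A B) (tensor K C D))
      (group_pairs K A B C D)"
    and "\<lbrakk>a \<in> carrier A; b \<in> carrier B; c \<in> carrier C; d \<in> carrier D\<rbrakk> \<Longrightarrow>
      group_pairs K A B C D
        (pure_tensor K A (tensor K (tensor K B C) D) a (pure_tensor K (tensor K B C) D (pure_tensor K B C b c) d)) =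
      pure_tensor K (tensor K A B) (tensor K C D) (pure_tensor K A B a b) (pure_tensor K C D c d)"
proof -
  let ?M = "tensor K A (tensor K (tensor K B C) D)" and ?P = "tensor K (tensor K A B) (tensor K C D)"
  let ?F = "\<lambda>a b c d. pure_tensor K (tensor K A B) (tensor K C D) (pure_tensor K A B a b) (pure_tensor K C D c d)"
  let ?in = "\<lambda>a b c d. pure_tensor K A (tensor K (tensor K B C) D) a
    (pure_tensor K (tensor K B C) D (pure_tensor K B C b c) d)"
  let ?G = "\<lambda>a X d. tensor_lift K B C ?P (\<lambda>b c. ?F a b c d) X"
  let ?H = "\<lambda>a Y. tensor_lift K (tensor K B C) D ?P (?G a) Y"
  let ?L = "tensor_lift K A (tensor K (tensor K B C) D) ?P ?H"
  have F: "bilinear_map K B C ?P (\<lambda>b c. ?F a b c d)" if "a \<in> carrier A" "d \<in> carrier D" for a d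
    using that by (intro lin)
  have G: "bilinear_map K (tensor K B C) D ?P (?G a)" if "a \<in> carrier A" for a
    using that by (intro lin) assumption+
  have H: "bilinear_map K A (tensor K (tensor K B C) D) ?P ?H"
    by (intro lin) assumption+
  have L: "linear_map K ?M ?P ?L"
    by (intro tensor_lift_linear H rules)
  have val: "?L (?in a b c d) = ?F a b c d"
    if "a \<in> carrier A" "b \<in> carrier B" "c \<in> carrier C" "d \<in> carrier D" for a b c d
    using that
    by (simp add: tensor_lift_pure[OF _ _ _ H] tensor_lift_pure[OF _ _ _ G] tensor_lift_pure[OF _ _ _ F]
        rules pure_tensor_closed)
  have uniq: "L' t = ?L t"
    if L'v: "linear_map K ?M ?P L' \<and>
        (\<forall>a\<in>carrier A. \<forall>b\<in>carrier B. \<forall>c\<in>carrier C. \<forall>d\<in>carrier D. L' (?in a b c d) = ?F a b c d)"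
      and t: "t \<in> carrier ?M" for L' t
  proof (rule tensor_linear_ext[OF _ _ conjunct1[OF L'v] L _ t])
    note L' = conjunct1[OF L'v] and v = conjunct2[OF L'v]
    fix a Y assume a: "a \<in> carrier A" and Y: "Y \<in> carrier (tensor K (tensor K B C) D)"
    have l: "linear_map K (tensor K (tensor K B C) D) ?M (\<lambda>Y. pure_tensor K A (tensor K (tensor K B C) D) a Y)"
      using a by (intro lin)
    show "L' (pure_tensor K A (tensor K (tensor K B C) D) a Y) = ?L (pure_tensor K A (tensor K (tensor K B C) D) a Y)"
    proof (rule tensor_linear_ext[OF _ m(4) linear_map_comp[OF L' l] linear_map_comp[OF L l] _ Y])
      fix X d assume X: "X \<in> carrier (tensor K B C)" and d: "d \<in> carrier D"
      have l: "linear_map K (tensor K B C) ?M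
          (\<lambda>X. pure_tensor K A (tensor K (tensor K B C) D) a (pure_tensor K (tensor K B C) D X d))"
        using a d by (intro lin)
      show "L' (pure_tensor K A (tensor K (tensor K B C) D) a (pure_tensor K (tensor K B C) D X d)) =
          ?L (pure_tensor K A (tensor K (tensor K B C) D) a (pure_tensor K (tensor K B C) D X d))"
        by (rule tensor_linear_ext[OF m(2,3) linear_map_comp[OF L' l] linear_map_comp[OF L l] _ X])
          (use v val a d in simp)
    qed (rule rules)+
  qed (rule rules)+
  have cl: "?in a b c d \<in> carrier ?M"
    if "a \<in> carrier A" "b \<in> carrier B" "c \<in> carrier C" "d \<in> carrier D" for a b c d
    using that by (intro lin)
  have q: "\<forall>a\<in>carrier A. \<forall>b\<in>carrier B. \<forall>c\<in>carrier C. \<forall>d\<in>carrier D. L' (?in a b c d) = ?F a b c d"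
    if "\<forall>x\<in>carrier ?M. L' x = ?L x" for L'
    using bspec[OF that cl] val by simp
  have T: "module K ?M" by (intro rules)
  have props: "linear_map K ?M ?P (group_pairs K A B C D) \<and>
    (\<forall>a\<in>carrier A. \<forall>b\<in>carrier B. \<forall>c\<in>carrier C. \<forall>d\<in>carrier D. group_pairs K A B C D (?in a b c d) = ?F a b c d)"
    by (rule the_linear_props[OF group_pairs_def[of K A B C D] T L])
      (intro allI impI, rule q, assumption, intro allI impI ballI, rule uniq, assumption+)
  show "linear_map K ?M ?P (group_pairs K A B C D)"
    by (rule conjunct1[OF props])
  show "\<lbrakk>a \<in> carrier A; b \<in> carrier B; c \<in> carrier C; d \<in> carrier D\<rbrakk> \<Longrightarrow>
      group_pairs K A B C D (?in a b c d) = ?F a b c d"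
    using props by simp
qed

lemma tensor_map_props:
  assumes "linear_map K A C f" "linear_map K B D g"
  shows "linear_map K (tensor K A B) (tensor K C D) (tensor_map K A B C D f g)"
    and "\<lbrakk>a \<in> carrier A; b \<in> carrier B\<rbrakk> \<Longrightarrow>
      tensor_map K A B C D f g (pure_tensor K A B a b) = pure_tensor K C D (f a) (g b)"
proof -
  have F: "bilinear_map K A B (tensor K C D) (\<lambda>a b. pure_tensor K C D (f a) (g b))"
    using linear_map_closed[OF assms(1)] linear_map_closed[OF assms(2)]
    by (intro bilinear_mapI linear_map_pure_left linear_map_pure_right assms m)
  show "linear_map K (tensor K A B) (tensor K C D) (tensor_map K A B C D f g)"
    unfolding tensor_map_eq by (intro tensor_lift_linear F rules)
  show "\<lbrakk>a \<in> carrier A; b \<in> carrier B\<rbrakk> \<Longrightarrow>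
      tensor_map K A B C D f g (pure_tensor K A B a b) = pure_tensor K C D (f a) (g b)"
    unfolding tensor_map_eq by (intro tensor_lift_pure F rules)
qed

end

section \<open>Products of graded algebras as bilinear maps\<close>

lemma graded_algebra_graded_module: "graded_algebra K A \<Longrightarrow> graded_module K A"
  by (simp add: graded_algebra_def)

lemma mult_bilinear:
  assumes "graded_algebra K A"
  shows "bilinear_map K A A A (mult A)"
proof -
  interpret A: graded_algebra K A by fact
  show ?thesis
    by (intro bilinear_mapI linear_mapI)
      (simp_all add: A.l_distr A.r_distr A.smult_mult_left A.smult_mult_right)
qed

lemma mult_map_props:
  assumes "graded_algebra K A"
  shows "linear_map K (tensor K A A) A (mult_map K A)"
    and "\<lbrakk>x \<in> carrier A; y \<in> carrier A\<rbrakk> \<Longrightarrow> mult_map K A (pure_tensor K A A x y) = x \<otimes>\<^bsub>A\<^esub> y"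
  using assms
  by (simp_all add: mult_map_eq tensor_lift_linear tensor_lift_pure mult_bilinear graded_module_module
      graded_algebra_graded_module)

lemma linear_map_mult_left:
  "\<lbrakk>graded_algebra K A; linear_map K M A f; b \<in> carrier A\<rbrakk> \<Longrightarrow> linear_map K M A (\<lambda>x. f x \<otimes>\<^bsub>A\<^esub> b)"
  by (rule linear_map_comp[OF bilinear_mapD(1)[OF mult_bilinear]])

lemma linear_map_mult_right:
  "\<lbrakk>graded_algebra K A; linear_map K M A f; a \<in> carrier A\<rbrakk> \<Longrightarrow> linear_map K M A (\<lambda>x. a \<otimes>\<^bsub>A\<^esub> f x)"
  by (rule linear_map_comp[OF bilinear_mapD(2)[OF mult_bilinear]])

lemma mult_closed:
  "\<lbrakk>graded_algebra K A; x \<in> carrier A; y \<in> carrier A\<rbrakk> \<Longrightarrow> x \<otimes>\<^bsub>A\<^esub> y \<in> carrier A"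
  using bilinear_mapD(3)[OF mult_bilinear] .

section \<open>Twisted tensor products of algebras\<close>

definition left_op ::
  "('k, 'q) ring_scheme \<Rightarrow> ('k, 'a, 'g::ab_group_add, 'm) graded_module_scheme \<Rightarrow>
   ('k, 'b, 'g, 'n) graded_module_scheme \<Rightarrow> 'a \<Rightarrow> ('k, 'a, 'b) tens \<Rightarrow> ('k, 'a, 'b) tens" where
  "left_op K A B a = tensor_lift K A B (tensor K A B) (\<lambda>c b. pure_tensor K A B (a \<otimes>\<^bsub>A\<^esub> c) b)"

definition right_op ::
  "('k, 'q) ring_scheme \<Rightarrow> ('k, 'a, 'g::ab_group_add, 'm) graded_module_scheme \<Rightarrow>
   ('k, 'b, 'g, 'n) graded_module_scheme \<Rightarrow> 'b \<Rightarrow> ('k, 'a, 'b) tens \<Rightarrow> ('k, 'a, 'b) tens" where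
  "right_op K A B d = tensor_lift K A B (tensor K A B) (\<lambda>c b. pure_tensor K A B c (b \<otimes>\<^bsub>B\<^esub> d))"

definition twist_op ::
  "('k, 'q) ring_scheme \<Rightarrow> ('k, 'a, 'g::ab_group_add, 'm) graded_module_scheme \<Rightarrow>
   ('k, 'b, 'g, 'n) graded_module_scheme \<Rightarrow> (('k, 'b, 'a) tens \<Rightarrow> ('k, 'a, 'b) tens) \<Rightarrow>
   'b \<Rightarrow> ('k, 'a, 'b) tens \<Rightarrow> ('k, 'a, 'b) tens" where
  "twist_op K A B \<psi> f =
     tensor_lift K A B (tensor K A B) (\<lambda>a b. right_op K A B b (\<psi> (pure_tensor K B A f a)))"

lemma graded_module_cong:
  assumes "graded_module K M" "carrier N = carrier M" "add N = add M" "zero N = zero M"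
    "smult N = smult M" "homog N = homog M"
  shows "graded_module K N"
proof -
  have m: "module K M" using assms(1) by (rule graded_module_module)
  \<comment> \<open>Decompositions contain finite sums formed in the record itself, so these have to
    be identified before the direct sum property can be transferred.\<close>
  have fs: "finsum N = finsum M"
    unfolding finsum_def finprod_def by (intro ext) (simp add: assms(2-4))
  have "decomposition N = decomposition M"
    by (intro ext) (simp add: decomposition_def fs assms(4,6))
  then show ?thesis
    using assms(1) module_cong[OF m assms(2-5)] submodule_cong[OF m assms(2-5)]
    by (simp add: graded_module_def graded_module_axioms_def assms(2,6))
qed

text \<open>\<open>\<psi>\<close> is only assumed to be linear. This already gives a bilinear
  product and its formula on pure tensors, and it applies both to the exchange map of the double and
  to the braiding in the tensor square of a Hopf algebra.\<close>

locale twisted_pair =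
  fixes K :: "('k, 'q) ring_scheme"
    and A :: "('k, 'a, 'g::ab_group_add, 'm) graded_module_scheme"
    and B :: "('k, 'b, 'g, 'n) graded_module_scheme"
    and \<psi> :: "('k, 'b, 'a) tens \<Rightarrow> ('k, 'a, 'b) tens"
  assumes A: "graded_algebra K A" and B: "graded_algebra K B"
    and \<psi>: "linear_map K (tensor K B A) (tensor K A B) \<psi>"
begin

abbreviation "T \<equiv> tensor K A B"
abbreviation "p \<equiv> pure_tensor K A B"
abbreviation "q \<equiv> pure_tensor K B A"
abbreviation "l \<equiv> left_op K A B"
abbreviation "r \<equiv> right_op K A B"
abbreviation "\<sigma> \<equiv> twist_op K A B \<psi>"

lemma graded: "graded_module K A" "graded_module K B" "graded_module K T"
  using A B by (auto intro: graded_algebra_graded_module tensor_graded_module)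

lemma modules: "module K A" "module K B" "module K T" "module K (tensor K B A)"
  using graded by (auto intro: graded_module_module tensor_module)

lemmas lin = bilinear_mapI linear_map_tensor_lift tensor_lift_param_linear
  linear_map_pure_left linear_map_pure_right linear_map_id pure_tensor_closed tensor_lift_closed
  linear_map_mult_left linear_map_mult_right mult_closed[OF A] mult_closed[OF B] A B modules graded
  linear_map_comp[OF \<psi>] linear_map_closed[OF \<psi>]

lemma left_op_bilinear: "a \<in> carrier A \<Longrightarrow> bilinear_map K A B T (\<lambda>c b. p (a \<otimes>\<^bsub>A\<^esub> c) b)"
  by (intro lin)

lemma right_op_bilinear: "d \<in> carrier B \<Longrightarrow> bilinear_map K A B T (\<lambda>c b. p c (b \<otimes>\<^bsub>B\<^esub> d))"
  by (intro lin)

lemma left_op_linear: "a \<in> carrier A \<Longrightarrow> linear_map K T T (l a)"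
  unfolding left_op_def by (intro tensor_lift_linear modules left_op_bilinear)

lemma right_op_linear: "d \<in> carrier B \<Longrightarrow> linear_map K T T (r d)"
  unfolding right_op_def by (intro tensor_lift_linear modules right_op_bilinear)

lemma left_op_pure:
  "\<lbrakk>a \<in> carrier A; c \<in> carrier A; b \<in> carrier B\<rbrakk> \<Longrightarrow> l a (p c b) = p (a \<otimes>\<^bsub>A\<^esub> c) b"
  unfolding left_op_def by (intro tensor_lift_pure modules left_op_bilinear)

lemma right_op_pure:
  "\<lbrakk>d \<in> carrier B; c \<in> carrier A; b \<in> carrier B\<rbrakk> \<Longrightarrow> r d (p c b) = p c (b \<otimes>\<^bsub>B\<^esub> d)"
  unfolding right_op_def by (intro tensor_lift_pure modules right_op_bilinear)

lemma left_op_param_linear: "t \<in> carrier T \<Longrightarrow> linear_map K A T (\<lambda>a. l a t)"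
  unfolding left_op_def by (intro lin) assumption+

lemma right_op_param_linear: "t \<in> carrier T \<Longrightarrow> linear_map K B T (\<lambda>d. r d t)"
  unfolding right_op_def by (intro lin) assumption+

lemma twist_op_bilinear: "f \<in> carrier B \<Longrightarrow> bilinear_map K A B T (\<lambda>a b. r b (\<psi> (q f a)))"
  by (intro bilinear_mapI right_op_param_linear linear_map_comp[OF right_op_linear] lin)

lemma twist_op_linear: "f \<in> carrier B \<Longrightarrow> linear_map K T T (\<sigma> f)"
  unfolding twist_op_def by (intro tensor_lift_linear modules twist_op_bilinear)

lemma twist_op_pure:
  "\<lbrakk>f \<in> carrier B; a \<in> carrier A; b \<in> carrier B\<rbrakk> \<Longrightarrow> \<sigma> f (p a b) = r b (\<psi> (q f a))"
  unfolding twist_op_def by (intro tensor_lift_pure modules twist_op_bilinear)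

lemma twist_op_param_linear: "t \<in> carrier T \<Longrightarrow> linear_map K B T (\<lambda>f. \<sigma> f t)"
  unfolding twist_op_def
  by (intro tensor_lift_param_linear graded modules twist_op_bilinear linear_map_comp[OF right_op_linear] lin)

lemmas closed = linear_map_closed[OF left_op_linear] linear_map_closed[OF right_op_linear]
  linear_map_closed[OF twist_op_linear] linear_map_closed[OF \<psi>] pure_tensor_closed modules
  mult_closed[OF A] mult_closed[OF B]

lemma ext:
  assumes "linear_map K T P F" "linear_map K T P G"
    and "\<And>a b. \<lbrakk>a \<in> carrier A; b \<in> carrier B\<rbrakk> \<Longrightarrow> F (p a b) = G (p a b)" "t \<in> carrier T"
  shows "F t = G t"
  by (rule tensor_linear_ext[OF modules(1,2) assms])

lemma left_op_mult:
  assumes "a \<in> carrier A" "b \<in> carrier A" "t \<in> carrier T"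
  shows "l (a \<otimes>\<^bsub>A\<^esub> b) t = l a (l b t)"
proof -
  interpret A: graded_algebra K A by (rule A)
  show ?thesis
    by (rule ext[OF left_op_linear linear_map_comp[OF left_op_linear left_op_linear] _ assms(3)])
      (simp_all add: left_op_pure assms A.m_assoc)
qed

lemma left_right_op:
  assumes "a \<in> carrier A" "d \<in> carrier B" "t \<in> carrier T"
  shows "l a (r d t) = r d (l a t)"
proof -
  interpret A: graded_algebra K A by (rule A)
  interpret B: graded_algebra K B by (rule B)
  show ?thesis
    by (rule ext[OF linear_map_comp[OF left_op_linear right_op_linear]
          linear_map_comp[OF right_op_linear left_op_linear] _ assms(3)])
      (simp_all add: left_op_pure right_op_pure assms)
qed

lemma right_op_mult:
  assumes "c \<in> carrier B" "d \<in> carrier B" "t \<in> carrier T"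
  shows "r (c \<otimes>\<^bsub>B\<^esub> d) t = r d (r c t)"
proof -
  interpret B: graded_algebra K B by (rule B)
  show ?thesis
    by (rule ext[OF right_op_linear linear_map_comp[OF right_op_linear right_op_linear] _ assms(3)])
      (simp_all add: right_op_pure assms B.m_assoc)
qed

text \<open>\<open>\<sigma> f\<close> puts the second factor back by a right multiplication after
  \<psi> has acted, and right multiplications compose in the order of the product.\<close>

lemma twist_right_op:
  assumes "f \<in> carrier B" "d \<in> carrier B" "t \<in> carrier T"
  shows "\<sigma> f (r d t) = r d (\<sigma> f t)"
  by (rule ext[OF linear_map_comp[OF twist_op_linear right_op_linear]
        linear_map_comp[OF right_op_linear twist_op_linear] _ assms(3)])
    (simp_all add: twist_op_pure right_op_pure right_op_mult assms closed)

text \<open>The composite of regroupings and tensor maps is linear, so the product is bilinear. Its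
  value is then traced on pure tensors once; afterwards only \<open>l\<close>, \<open>r\<close> and
  \<open>\<sigma>\<close> are used.\<close>

lemma twisted_mult_bilinear: "bilinear_map K T T T (twisted_mult K A B \<psi>)"
  and twisted_mult_pure: "\<lbrakk>a \<in> carrier A; f \<in> carrier B; t \<in> carrier T\<rbrakk> \<Longrightarrow>
    twisted_mult K A B \<psi> (p a f) t = l a (\<sigma> f t)"
proof -
  note rules = tensor_graded_module graded mult_map_props[OF A] mult_map_props[OF B]
  let ?m = "tensor_map K (tensor K A A) (tensor K B B) A B (mult_map K A) (mult_map K B)"
  let ?h = "tensor_map K (tensor K B A) B T B \<psi> (\<lambda>b. b)"
  let ?i = "tensor_map K A (tensor K (tensor K B A) B) A (tensor K T B) (\<lambda>a. a) ?h"
  let ?gp = "group_pairs K A A B B" and ?gm = "group_middle K A B A B"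
  have m: "linear_map K (tensor K (tensor K A A) (tensor K B B)) T ?m"
    "\<lbrakk>X \<in> carrier (tensor K A A); Y \<in> carrier (tensor K B B)\<rbrakk> \<Longrightarrow>
      ?m (pure_tensor K (tensor K A A) (tensor K B B) X Y) = p (mult_map K A X) (mult_map K B Y)" for X Y
    by (intro tensor_map_props rules; assumption)+
  have h: "linear_map K (tensor K (tensor K B A) B) (tensor K T B) ?h"
    "\<lbrakk>X \<in> carrier (tensor K B A); b \<in> carrier B\<rbrakk> \<Longrightarrow>
      ?h (pure_tensor K (tensor K B A) B X b) = pure_tensor K T B (\<psi> X) b" for X b
    by (intro tensor_map_props rules \<psi> linear_map_id; assumption)+
  have i: "linear_map K (tensor K A (tensor K (tensor K B A) B)) (tensor K A (tensor K T B)) ?i"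
    "\<lbrakk>a \<in> carrier A; X \<in> carrier (tensor K (tensor K B A) B)\<rbrakk> \<Longrightarrow>
      ?i (pure_tensor K A (tensor K (tensor K B A) B) a X) = pure_tensor K A (tensor K T B) a (?h X)" for a X
    by (intro tensor_map_props rules h(1) linear_map_id; assumption)+
  have gp: "linear_map K (tensor K A (tensor K T B)) (tensor K (tensor K A A) (tensor K B B)) ?gp"
    by (intro group_pairs_props rules)
  have gm: "linear_map K (tensor K T T) (tensor K A (tensor K (tensor K B A) B)) ?gm"
    by (intro group_middle_props rules)
  note mod = tensor_module modules
  \<comment> \<open>The value of \<psi> is not a pure tensor in general. So the part of the
    composite that follows \<psi> is evaluated for an arbitrary \<open>t\<close> in its place, by
    linearity in \<open>t\<close>.\<close>
  have inner: "?m (?gp (pure_tensor K A (tensor K T B) a (pure_tensor K T B t b))) = l a (r b t)"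
    if a: "a \<in> carrier A" and b: "b \<in> carrier B" and t: "t \<in> carrier T" for a b t
  proof (rule ext[OF _ _ _ t])
    show "linear_map K T T (\<lambda>t. ?m (?gp (pure_tensor K A (tensor K T B) a (pure_tensor K T B t b))))"
      by (intro linear_map_comp[OF m(1)] linear_map_comp[OF gp] linear_map_pure_right linear_map_pure_left
          linear_map_id mod a b)
    show "linear_map K T T (\<lambda>t. l a (r b t))"
      by (intro linear_map_comp[OF left_op_linear] right_op_linear a b)
    fix c d assume cd: "c \<in> carrier A" "d \<in> carrier B"
    have "?gp (pure_tensor K A (tensor K T B) a (pure_tensor K T B (p c d) b)) =
        pure_tensor K (tensor K A A) (tensor K B B) (pure_tensor K A A a c) (pure_tensor K B B d b)"
      by (intro group_pairs_props rules a b cd)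
    then show "?m (?gp (pure_tensor K A (tensor K T B) a (pure_tensor K T B (p c d) b))) = l a (r b (p c d))"
      using a b cd by (simp add: m(2) pure_tensor_closed modules mult_map_props A B
          right_op_pure left_op_pure mult_closed[OF A] mult_closed[OF B])
  qed
  have eq: "twisted_mult K A B \<psi> X Y = ?m (?gp (?i (?gm (pure_tensor K T T X Y))))" for X Y
    by (simp add: twisted_mult_def)
  have F: "linear_map K (tensor K T T) T (\<lambda>Z. ?m (?gp (?i (?gm Z))))"
    by (intro linear_map_comp[OF m(1)] linear_map_comp[OF gp] linear_map_comp[OF i(1)] gm)
  show bil: "bilinear_map K T T T (twisted_mult K A B \<psi>)"
    unfolding eq
    by (intro bilinear_mapI linear_map_comp[OF F] bilinear_mapD[OF pure_tensor_bilinear] modules)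
  show "twisted_mult K A B \<psi> (p a f) t = l a (\<sigma> f t)"
    if a: "a \<in> carrier A" and f: "f \<in> carrier B" and t: "t \<in> carrier T"
  proof (rule ext[OF bilinear_mapD(2)[OF bil] _ _ t])
    show "p a f \<in> carrier T" using a f by (intro pure_tensor_closed modules)
    show "linear_map K T T (\<lambda>t. l a (\<sigma> f t))"
      by (intro linear_map_comp[OF left_op_linear] twist_op_linear a f)
    fix c d assume cd: "c \<in> carrier A" "d \<in> carrier B"
    have "?gm (pure_tensor K T T (p a f) (p c d)) =
        pure_tensor K A (tensor K (tensor K B A) B) a (pure_tensor K (tensor K B A) B (q f c) d)"
      by (intro group_middle_props rules a f cd)
    then have "twisted_mult K A B \<psi> (p a f) (p c d) =
        ?m (?gp (pure_tensor K A (tensor K T B) a (pure_tensor K T B (\<psi> (q f c)) d)))"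
      using a f cd by (simp add: eq i(2) h(2) pure_tensor_closed mod)
    also have "\<dots> = l a (r d (\<psi> (q f c)))"
      using a f cd by (intro inner closed)
    also have "\<dots> = l a (\<sigma> f (p c d))"
      using f cd by (simp add: twist_op_pure)
    finally show "twisted_mult K A B \<psi> (p a f) (p c d) = l a (\<sigma> f (p c d))" .
  qed
qed

end

text \<open>The last two axioms are the compatibilities of a twisting map with the products of
  \<open>B\<close> and of \<open>A\<close>. Where \<open>f\<close> and \<open>g\<close> occur they
  are taken homogeneous: for the double, \<psi> has an explicit formula only at homogeneous
  functionals. Linearity in these arguments then gives the general versions.\<close>

locale twisted_algebra = twisted_pair +
  assumes \<psi>_degree: "\<lbrakk>f \<in> homog B \<alpha>; a \<in> homog A \<beta>\<rbrakk> \<Longrightarrow> \<psi> (q f a) \<in> homog T (\<alpha> + \<beta>)"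
    and \<psi>_one_left: "a \<in> carrier A \<Longrightarrow> \<psi> (q \<one>\<^bsub>B\<^esub> a) = p a \<one>\<^bsub>B\<^esub>"
    and \<psi>_one_right_homog: "f \<in> homog B \<alpha> \<Longrightarrow> \<psi> (q f \<one>\<^bsub>A\<^esub>) = p \<one>\<^bsub>A\<^esub> f"
    and \<psi>_mult_left_homog: "\<lbrakk>f \<in> homog B \<alpha>; g \<in> homog B \<beta>; a \<in> carrier A\<rbrakk> \<Longrightarrow>
      \<psi> (q (f \<otimes>\<^bsub>B\<^esub> g) a) = \<sigma> f (\<psi> (q g a))"
    and \<psi>_mult_right_homog: "\<lbrakk>f \<in> homog B \<alpha>; a \<in> carrier A; b \<in> carrier A\<rbrakk> \<Longrightarrow>
      \<psi> (q f (a \<otimes>\<^bsub>A\<^esub> b)) = tensor_lift K A B T (\<lambda>c g. l c (\<psi> (q g b))) (\<psi> (q f a))"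
begin

lemma \<psi>_left_linear: "a \<in> carrier A \<Longrightarrow> linear_map K B T (\<lambda>f. \<psi> (q f a))"
  by (intro linear_map_comp[OF \<psi>] linear_map_pure_left modules linear_map_id)

lemma \<psi>_one_right: "f \<in> carrier B \<Longrightarrow> \<psi> (q f \<one>\<^bsub>A\<^esub>) = p \<one>\<^bsub>A\<^esub> f"
proof -
  interpret A: graded_algebra K A by (rule A)
  have one: "\<one>\<^bsub>A\<^esub> \<in> carrier A" by simp
  show "f \<in> carrier B \<Longrightarrow> \<psi> (q f \<one>\<^bsub>A\<^esub>) = p \<one>\<^bsub>A\<^esub> f"
    by (rule graded_linear_ext[OF graded(2) \<psi>_left_linear[OF one]
          bilinear_mapD(2)[OF pure_tensor_bilinear[OF modules(1,2)] one] \<psi>_one_right_homog])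
qed

lemma \<psi>_mult_left:
  assumes f: "f \<in> carrier B" and g: "g \<in> carrier B" and a: "a \<in> carrier A"
  shows "\<psi> (q (f \<otimes>\<^bsub>B\<^esub> g) a) = \<sigma> f (\<psi> (q g a))"
proof -
  note lin = linear_map_comp[OF \<psi>_left_linear[OF a]] bilinear_mapD[OF mult_bilinear[OF B]]
  have *: "\<psi> (q (f \<otimes>\<^bsub>B\<^esub> g) a) = \<sigma> f (\<psi> (q g a))" if f: "f \<in> homog B \<alpha>" for f \<alpha>
    by (rule graded_linear_ext[OF graded(2) lin(1)[OF lin(3)[OF homog_carrier[OF graded(2) f]]]
          linear_map_comp[OF twist_op_linear[OF homog_carrier[OF graded(2) f]] \<psi>_left_linear[OF a]] _ g])
      (rule \<psi>_mult_left_homog[OF f _ a])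
  have \<psi>c: "\<psi> (q g a) \<in> carrier T" using g a by (intro closed)
  show ?thesis
    by (rule graded_linear_ext[OF graded(2) lin(1)[OF lin(2)[OF g]] twist_op_param_linear[OF \<psi>c] _ f])
      (rule *)
qed

lemma \<psi>_mult_right:
  assumes f: "f \<in> carrier B" and a: "a \<in> carrier A" and b: "b \<in> carrier A"
  shows "\<psi> (q f (a \<otimes>\<^bsub>A\<^esub> b)) = tensor_lift K A B T (\<lambda>c g. l c (\<psi> (q g b))) (\<psi> (q f a))"
proof (rule graded_linear_ext[OF graded(2) \<psi>_left_linear[OF mult_closed[OF A a b]] _ _ f])
  have "bilinear_map K A B T (\<lambda>c g. l c (\<psi> (q g b)))"
    by (intro bilinear_mapI left_op_param_linear linear_map_comp[OF left_op_linear] \<psi>_left_linear closed b)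
  then show "linear_map K B T (\<lambda>f. tensor_lift K A B T (\<lambda>c g. l c (\<psi> (q g b))) (\<psi> (q f a)))"
    by (intro linear_map_tensor_lift modules \<psi>_left_linear a)
qed (rule \<psi>_mult_right_homog[OF _ a b])

abbreviation "mul \<equiv> twisted_mult K A B \<psi>"

lemmas mul_linear = bilinear_mapD(1,2)[OF twisted_mult_bilinear]
lemmas mul_closed = bilinear_mapD(3)[OF twisted_mult_bilinear]

text \<open>On \<open>p a b\<close> both sides are \<open>r b\<close> applied to the two sides of
  \<open>\<psi>_mult_left\<close>, since \<open>\<sigma> f\<close> commutes with
  \<open>r b\<close>.\<close>

lemma twist_op_mult:
  assumes f: "f \<in> carrier B" and g: "g \<in> carrier B" and t: "t \<in> carrier T"
  shows "\<sigma> (f \<otimes>\<^bsub>B\<^esub> g) t = \<sigma> f (\<sigma> g t)"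
proof (rule ext[OF _ _ _ t])
  show "linear_map K T T (\<sigma> (f \<otimes>\<^bsub>B\<^esub> g))" using f g by (intro twist_op_linear mult_closed[OF B])
  show "linear_map K T T (\<lambda>t. \<sigma> f (\<sigma> g t))" using f g by (intro linear_map_comp[OF twist_op_linear] twist_op_linear)
  show "\<sigma> (f \<otimes>\<^bsub>B\<^esub> g) (p a b) = \<sigma> f (\<sigma> g (p a b))" if "a \<in> carrier A" "b \<in> carrier B" for a b
    using f g that by (simp add: twist_op_pure \<psi>_mult_left twist_right_op closed)
qed

lemma left_op_twisted_mult:
  assumes a: "a \<in> carrier A" and t: "t \<in> carrier T" and u: "u \<in> carrier T"
  shows "mul (l a t) u = l a (mul t u)"
proof (rule ext[OF _ _ _ t])
  show "linear_map K T T (\<lambda>t. mul (l a t) u)"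
    by (rule linear_map_comp[OF mul_linear(1)[OF u] left_op_linear[OF a]])
  show "linear_map K T T (\<lambda>t. l a (mul t u))"
    by (rule linear_map_comp[OF left_op_linear[OF a] mul_linear(1)[OF u]])
  show "mul (l a (p b f)) u = l a (mul (p b f) u)" if "b \<in> carrier A" "f \<in> carrier B" for b f
    using a u that by (simp add: left_op_pure twisted_mult_pure left_op_mult closed)
qed

text \<open>At \<open>t = p b f\<close> the left-hand side contains \<sigma> of the product of
  \<open>f\<close> and \<open>g\<close>, which \<open>twist_op_mult\<close> splits.\<close>

lemma right_op_twisted_mult:
  assumes g: "g \<in> carrier B" and t: "t \<in> carrier T" and u: "u \<in> carrier T"
  shows "mul (r g t) u = mul t (\<sigma> g u)"
proof (rule ext[OF _ _ _ t])
  show "linear_map K T T (\<lambda>t. mul (r g t) u)"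
    by (rule linear_map_comp[OF mul_linear(1)[OF u] right_op_linear[OF g]])
  show "linear_map K T T (\<lambda>t. mul t (\<sigma> g u))"
    using linear_map_closed[OF twist_op_linear[OF g] u] by (rule mul_linear(1))
  show "mul (r g (p b f)) u = mul (p b f) (\<sigma> g u)" if "b \<in> carrier A" "f \<in> carrier B" for b f
    using g u that by (simp add: right_op_pure twisted_mult_pure twist_op_mult closed)
qed

text \<open>Compatibility with products in \<open>A\<close>, read as a statement about the
  multiplication. At \<open>t = p c h\<close> the value \<open>\<psi> (q f a)\<close> is expanded
  into terms \<open>p b g\<close>; each contributes \<open>l b (\<psi> (q g c))\<close> followed by
  \<open>r h\<close>, which is the product of \<open>p b g\<close> with
  \<open>p c h\<close>.\<close>

lemma twist_left_op:
  assumes f: "f \<in> carrier B" and a: "a \<in> carrier A" and t: "t \<in> carrier T"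
  shows "\<sigma> f (l a t) = mul (\<psi> (q f a)) t"
proof (rule ext[OF _ _ _ t])
  have \<psi>c: "\<psi> (q f a) \<in> carrier T" using f a by (intro closed)
  show "linear_map K T T (\<lambda>t. \<sigma> f (l a t))" by (rule linear_map_comp[OF twist_op_linear[OF f] left_op_linear[OF a]])
  show "linear_map K T T (\<lambda>t. mul (\<psi> (q f a)) t)" by (rule mul_linear(2)[OF \<psi>c])
  fix c h assume c: "c \<in> carrier A" and h: "h \<in> carrier B"
  have bil: "bilinear_map K A B T (\<lambda>b g. l b (\<psi> (q g c)))"
    by (intro bilinear_mapI left_op_param_linear linear_map_comp[OF left_op_linear] lin c)
  have "\<sigma> f (l a (p c h)) = r h (\<psi> (q f (a \<otimes>\<^bsub>A\<^esub> c)))"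
    using f a c h by (simp add: left_op_pure twist_op_pure closed)
  also have "\<dots> = r h (tensor_lift K A B T (\<lambda>b g. l b (\<psi> (q g c))) (\<psi> (q f a)))"
    using f a c by (simp add: \<psi>_mult_right)
  also have "\<dots> = tensor_lift K A B T (\<lambda>b g. r h (l b (\<psi> (q g c)))) (\<psi> (q f a))"
    by (intro tensor_lift_comp[OF _ _ _ _ bil] modules right_op_linear h \<psi>c)
  also have "\<dots> = mul (\<psi> (q f a)) (p c h)"
  proof (rule tensor_lift_unique[OF modules(1-3) _ mul_linear(1) _ \<psi>c])
    show "bilinear_map K A B T (\<lambda>b g. r h (l b (\<psi> (q g c))))"
      by (intro bilinear_mapI linear_map_comp[OF right_op_linear] bilinear_mapD[OF bil] h)
    show "p c h \<in> carrier T" using c h by (intro closed)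
    show "mul (p b g) (p c h) = r h (l b (\<psi> (q g c)))" if "b \<in> carrier A" "g \<in> carrier B" for b g
      using that c h by (simp add: twisted_mult_pure twist_op_pure left_right_op closed)
  qed
  finally show "\<sigma> f (l a (p c h)) = mul (\<psi> (q f a)) (p c h)" .
qed

text \<open>For \<open>t = p a f\<close> and \<open>u = p b g\<close> both sides equal
  \<open>l a\<close> applied to the product of \<open>\<psi> (q f b)\<close> and
  \<open>\<sigma> g v\<close>. The third factor remains arbitrary throughout.\<close>

lemma twisted_mult_assoc:
  assumes "t \<in> carrier T" "u \<in> carrier T" "v \<in> carrier T"
  shows "mul (mul t u) v = mul t (mul u v)"
proof (rule ext[OF _ _ _ assms(1)])
  show "linear_map K T T (\<lambda>t. mul (mul t u) v)"
    by (intro linear_map_comp[OF mul_linear(1)] mul_linear(1) assms)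
  show "linear_map K T T (\<lambda>t. mul t (mul u v))"
    by (intro mul_linear(1) mul_closed assms)
  fix a f assume a: "a \<in> carrier A" and f: "f \<in> carrier B"
  have pc: "p a f \<in> carrier T" using a f by (intro closed)
  show "mul (mul (p a f) u) v = mul (p a f) (mul u v)"
  proof (rule ext[OF _ _ _ assms(2)])
    show "linear_map K T T (\<lambda>u. mul (mul (p a f) u) v)"
      by (intro linear_map_comp[OF mul_linear(1)] mul_linear(2) assms pc)
    show "linear_map K T T (\<lambda>u. mul (p a f) (mul u v))"
      by (intro linear_map_comp[OF mul_linear(2)] mul_linear(1) assms pc)
    fix b g assume b: "b \<in> carrier A" and g: "g \<in> carrier B"
    have "mul (mul (p a f) (p b g)) v = mul (l a (r g (\<psi> (q f b)))) v"
      using a b f g by (simp add: twisted_mult_pure twist_op_pure closed)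
    also have "\<dots> = l a (mul (\<psi> (q f b)) (\<sigma> g v))"
      using a b f g assms(3) by (simp add: left_op_twisted_mult right_op_twisted_mult closed)
    also have "\<dots> = l a (\<sigma> f (l b (\<sigma> g v)))"
      using b f g assms(3) by (simp add: twist_left_op closed)
    also have "\<dots> = mul (p a f) (mul (p b g) v)"
      using a b f g assms(3) by (simp add: twisted_mult_pure closed)
    finally show "mul (mul (p a f) (p b g)) v = mul (p a f) (mul (p b g) v)" .
  qed
qed

text \<open>For pure tensors this is the additivity of degrees under \<open>l\<close>,
  \<open>r\<close> and \<psi>. The general case uses that homogeneous parts are spans of pure
  tensors, for the right factor and for the left factor in turn.\<close>

lemma twisted_mult_homog:
  assumes t: "t \<in> homog T \<alpha>" and u: "u \<in> homog T \<beta>"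
  shows "mul t u \<in> homog T (\<alpha> + \<beta>)"
proof -
  interpret A: graded_algebra K A by (rule A)
  interpret B: graded_algebra K B by (rule B)
  note sub = tensor_homog_submodule[OF graded(1,2)]
  note hc = homog_carrier[OF graded(1)] homog_carrier[OF graded(2)] homog_carrier[OF graded(3)]
  have lh: "l a t \<in> homog T (\<alpha> + \<beta>)" if a: "a \<in> homog A \<alpha>" and t: "t \<in> homog T \<beta>" for a t \<alpha> \<beta>
  proof -
    have "homog T \<beta> \<subseteq> {t \<in> carrier T. l a t \<in> homog T (\<alpha> + \<beta>)}"
    proof (rule tensor_homog_minimal[OF graded(1,2)
          submodule_vimage[OF modules(3,3) left_op_linear sub]])
      fix \<gamma> \<delta> x y assume xy: "x \<in> homog A \<gamma>" "y \<in> homog B \<delta>" "\<gamma> + \<delta> = \<beta>"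
      have "p (a \<otimes>\<^bsub>A\<^esub> x) y \<in> homog T ((\<alpha> + \<gamma>) + \<delta>)"
        using a xy by (intro pure_tensor_homog graded A.mult_homog)
      then show "p x y \<in> {t \<in> carrier T. l a t \<in> homog T (\<alpha> + \<beta>)}"
        using a xy by (auto simp: left_op_pure hc add.assoc closed)
    qed (rule hc(1)[OF a])
    then show ?thesis using t by blast
  qed
  have rh: "r b t \<in> homog T (\<beta> + \<alpha>)" if b: "b \<in> homog B \<alpha>" and t: "t \<in> homog T \<beta>" for b t \<alpha> \<beta>
  proof -
    have "homog T \<beta> \<subseteq> {t \<in> carrier T. r b t \<in> homog T (\<beta> + \<alpha>)}"
    proof (rule tensor_homog_minimal[OF graded(1,2)
          submodule_vimage[OF modules(3,3) right_op_linear sub]])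
      fix \<gamma> \<delta> x y assume xy: "x \<in> homog A \<gamma>" "y \<in> homog B \<delta>" "\<gamma> + \<delta> = \<beta>"
      have "p x (y \<otimes>\<^bsub>B\<^esub> b) \<in> homog T (\<gamma> + (\<delta> + \<alpha>))"
        using b xy by (intro pure_tensor_homog graded B.mult_homog)
      then show "p x y \<in> {t \<in> carrier T. r b t \<in> homog T (\<beta> + \<alpha>)}"
        using b xy by (auto simp: right_op_pure hc add.assoc[symmetric] closed)
    qed (rule hc(2)[OF b])
    then show ?thesis using t by blast
  qed
  have pure: "mul (p a f) (p b g) \<in> homog T (\<alpha> + \<gamma> + (\<beta> + \<delta>))"
    if h: "a \<in> homog A \<alpha>" "f \<in> homog B \<gamma>" "b \<in> homog A \<beta>" "g \<in> homog B \<delta>" for a f b g \<alpha> \<beta> \<gamma> \<delta>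
  proof -
    have "l a (r g (\<psi> (q f b))) \<in> homog T (\<alpha> + ((\<gamma> + \<beta>) + \<delta>))"
      using h by (intro lh rh \<psi>_degree)
    then show ?thesis
      using h by (simp add: twisted_mult_pure twist_op_pure hc closed add.assoc)
  qed
  have "homog T \<alpha> \<subseteq> {t \<in> carrier T. mul t u \<in> homog T (\<alpha> + \<beta>)}"
  proof (rule tensor_homog_minimal[OF graded(1,2)
        submodule_vimage[OF modules(3,3) mul_linear(1)[OF hc(3)[OF u]] sub]])
    fix \<gamma> \<delta> a f assume af: "a \<in> homog A \<gamma>" "f \<in> homog B \<delta>" "\<gamma> + \<delta> = \<alpha>"
    have pc: "p a f \<in> carrier T" using af by (intro closed hc)
    have "homog T \<beta> \<subseteq> {u \<in> carrier T. mul (p a f) u \<in> homog T (\<alpha> + \<beta>)}"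
    proof (rule tensor_homog_minimal[OF graded(1,2)
          submodule_vimage[OF modules(3,3) mul_linear(2)[OF pc] sub]])
      fix \<gamma>' \<delta>' b g assume bg: "b \<in> homog A \<gamma>'" "g \<in> homog B \<delta>'" "\<gamma>' + \<delta>' = \<beta>"
      have "p b g \<in> carrier T" using bg by (intro closed hc)
      then show "p b g \<in> {u \<in> carrier T. mul (p a f) u \<in> homog T (\<alpha> + \<beta>)}"
        using pure[OF af(1,2) bg(1,2)] af(3) bg(3) by auto
    qed
    then show "p a f \<in> {t \<in> carrier T. mul t u \<in> homog T (\<alpha> + \<beta>)}"
      using u pc by blast
  qed
  then show ?thesis using t by blast
qed

lemma twisted_mult_one:
  assumes t: "t \<in> carrier T"
  shows "mul (p \<one>\<^bsub>A\<^esub> \<one>\<^bsub>B\<^esub>) t = t" "mul t (p \<one>\<^bsub>A\<^esub> \<one>\<^bsub>B\<^esub>) = t"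
proof -
  interpret A: graded_algebra K A by (rule A)
  interpret B: graded_algebra K B by (rule B)
  have pc: "p \<one>\<^bsub>A\<^esub> \<one>\<^bsub>B\<^esub> \<in> carrier T" by (intro closed) simp_all
  show "mul (p \<one>\<^bsub>A\<^esub> \<one>\<^bsub>B\<^esub>) t = t"
    by (rule ext[OF mul_linear(2)[OF pc] linear_map_id _ t])
      (simp add: twisted_mult_pure twist_op_pure \<psi>_one_left right_op_pure left_op_pure closed)
  show "mul t (p \<one>\<^bsub>A\<^esub> \<one>\<^bsub>B\<^esub>) = t"
    by (rule ext[OF mul_linear(1)[OF pc] linear_map_id _ t])
      (simp add: twisted_mult_pure twist_op_pure \<psi>_one_right right_op_pure left_op_pure closed)
qed

theorem twisted_tensor_algebra: "graded_algebra K (twisted_tensor_algebra K A B \<psi>)"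
proof -
  let ?D = "twisted_tensor_algebra K A B \<psi>"
  interpret A: graded_algebra K A by (rule A)
  interpret B: graded_algebra K B by (rule B)
  interpret T: module K T by (rule modules(3))
  have D: "carrier ?D = carrier T" "add ?D = add T" "zero ?D = zero T" "smult ?D = smult T"
    "homog ?D = homog T" "mult ?D = mul" "one ?D = p \<one>\<^bsub>A\<^esub> \<one>\<^bsub>B\<^esub>"
    by (simp_all add: twisted_tensor_algebra_def)
  have gD: "graded_module K ?D" by (rule graded_module_cong[OF graded(3) D(1-5)])
  have one: "p \<one>\<^bsub>A\<^esub> \<one>\<^bsub>B\<^esub> \<in> carrier T" by (intro closed) simp_all
  have "ring ?D"
  proof (rule ringI)
    show "abelian_group ?D" by (rule module_abelian_group[OF graded_module_module[OF gD]])
    show "monoid ?D"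
      by (rule monoidI) (simp_all add: D mul_closed one twisted_mult_assoc twisted_mult_one)
  qed (simp_all add: D linear_map_add[OF mul_linear(1)] linear_map_add[OF mul_linear(2)])
  moreover have "graded_algebra_axioms K ?D"
    using pure_tensor_homog[OF graded(1,2) A.one_homog B.one_homog]
    by (unfold_locales)
      (simp_all add: D linear_map_smult[OF mul_linear(1)] linear_map_smult[OF mul_linear(2)] twisted_mult_homog)
  ultimately show ?thesis
    using gD by (simp add: graded_algebra_def)
qed

end

section \<open>Sweedler calculus\<close>

lemma linear_map_homog_part_range:
  assumes "linear_map K M N f" "\<And>x. x \<in> carrier M \<Longrightarrow> f x \<in> homog N \<alpha>"
  shows "linear_map K M (homog_part N \<alpha>) f"
  using assms by (auto simp: linear_map_def homog_part_simps)

lemma linear_map_homog_id: "graded_module K M \<Longrightarrow> linear_map K (homog_part M \<alpha>) M (\<lambda>x. x)"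
  by (rule linear_map_homog_part[OF _ linear_map_id])

lemma linear_map_graded_lift:
  "\<lbrakk>graded_module K A; graded_module K B; module K P; graded_bilinear K A B P F;
    linear_map K M (tensor K A B) f\<rbrakk> \<Longrightarrow> linear_map K M P (\<lambda>x. graded_lift K A B P F (f x))"
  by (rule linear_map_comp[OF graded_lift_linear])

lemma ground_algebra_simps:
  "carrier (ground_algebra K) = carrier K" "add (ground_algebra K) = add K"
  "zero (ground_algebra K) = zero K" "smult (ground_algebra K) = mult K" "mult (ground_algebra K) = mult K"
  "one (ground_algebra K) = one K"
  "homog (ground_algebra K) \<alpha> = (if \<alpha> = 0 then carrier K else {zero K})"
  by (simp_all add: ground_algebra_def)

lemma ground_algebra_module:
  assumes "cring K"
  shows "module K (ground_algebra K)"
proof -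
  interpret K: cring K by fact
  show ?thesis
  proof (rule moduleI)
    show "abelian_group (ground_algebra K)"
      by (rule abelian_groupI)
        (use K.add.l_inv_ex in \<open>auto simp: ground_algebra_simps K.a_assoc intro: K.a_comm\<close>)
  qed (simp_all add: ground_algebra_simps assms K.l_distr K.r_distr K.m_assoc)
qed

lemma linear_map_smult_left:
  assumes "module K P" "linear_map K M (ground_algebra K) f" "y \<in> carrier P"
  shows "linear_map K M P (\<lambda>x. f x \<odot>\<^bsub>P\<^esub> y)"
proof -
  interpret P: module K P by fact
  have cl: "f x \<in> carrier K" if "x \<in> carrier M" for x
    using linear_map_closed[OF assms(2) that] by (simp add: ground_algebra_simps)
  show ?thesis
    using cl assms(3) linear_map_add[OF assms(2)] linear_map_smult[OF assms(2)]
    by (intro linear_mapI) (simp_all add: ground_algebra_simps P.smult_l_distr P.smult_assoc1)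
qed

definition graded_trilinear ::
  "('k, 'q) ring_scheme \<Rightarrow> ('k, 'a, 'g, 'm) graded_module_scheme \<Rightarrow> ('k, 'c, 'p) module_scheme \<Rightarrow>
   ('g \<Rightarrow> 'g \<Rightarrow> 'g \<Rightarrow> 'a \<Rightarrow> 'a \<Rightarrow> 'a \<Rightarrow> 'c) \<Rightarrow> bool" where
  "graded_trilinear K M P T \<longleftrightarrow>
     (\<forall>\<alpha> \<beta> \<gamma>. \<forall>y\<in>homog M \<beta>. \<forall>z\<in>homog M \<gamma>. linear_map K (homog_part M \<alpha>) P (\<lambda>x. T \<alpha> \<beta> \<gamma> x y z)) \<and>
     (\<forall>\<alpha> \<beta> \<gamma>. \<forall>x\<in>homog M \<alpha>. \<forall>z\<in>homog M \<gamma>. linear_map K (homog_part M \<beta>) P (\<lambda>y. T \<alpha> \<beta> \<gamma> x y z)) \<and>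
     (\<forall>\<alpha> \<beta> \<gamma>. \<forall>x\<in>homog M \<alpha>. \<forall>y\<in>homog M \<beta>. linear_map K (homog_part M \<gamma>) P (\<lambda>z. T \<alpha> \<beta> \<gamma> x y z))"

lemma graded_trilinearI:
  assumes "\<And>\<alpha> \<beta> \<gamma> y z. \<lbrakk>y \<in> homog M \<beta>; z \<in> homog M \<gamma>\<rbrakk> \<Longrightarrow>
      linear_map K (homog_part M \<alpha>) P (\<lambda>x. T \<alpha> \<beta> \<gamma> x y z)"
    and "\<And>\<alpha> \<beta> \<gamma> x z. \<lbrakk>x \<in> homog M \<alpha>; z \<in> homog M \<gamma>\<rbrakk> \<Longrightarrow>
      linear_map K (homog_part M \<beta>) P (\<lambda>y. T \<alpha> \<beta> \<gamma> x y z)"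
    and "\<And>\<alpha> \<beta> \<gamma> x y. \<lbrakk>x \<in> homog M \<alpha>; y \<in> homog M \<beta>\<rbrakk> \<Longrightarrow>
      linear_map K (homog_part M \<gamma>) P (\<lambda>z. T \<alpha> \<beta> \<gamma> x y z)"
  shows "graded_trilinear K M P T"
  using assms by (simp add: graded_trilinear_def)

lemma graded_trilinearD:
  assumes "graded_trilinear K M P T"
  shows "\<lbrakk>y \<in> homog M \<beta>; z \<in> homog M \<gamma>\<rbrakk> \<Longrightarrow> linear_map K (homog_part M \<alpha>) P (\<lambda>x. T \<alpha> \<beta> \<gamma> x y z)"
    and "\<lbrakk>x \<in> homog M \<alpha>; z \<in> homog M \<gamma>\<rbrakk> \<Longrightarrow> linear_map K (homog_part M \<beta>) P (\<lambda>y. T \<alpha> \<beta> \<gamma> x y z)"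
    and "\<lbrakk>x \<in> homog M \<alpha>; y \<in> homog M \<beta>\<rbrakk> \<Longrightarrow> linear_map K (homog_part M \<gamma>) P (\<lambda>z. T \<alpha> \<beta> \<gamma> x y z)"
  using assms by (simp_all add: graded_trilinear_def)

section \<open>Arithmetic of the commutative factor\<close>

lemma (in commutative_factor) factor_closed: "\<omega> \<alpha> \<beta> \<in> carrier K"
  using factor_unit by (rule Units_closed)

lemma (in commutative_factor) factor_cancel: "\<omega> \<alpha> \<beta> \<otimes> \<omega> \<beta> \<alpha> = \<one>"
  using factor_unit[of \<beta> \<alpha>] by (subst factor_skew) (rule Units_l_inv)

text \<open>Additivity makes the value idempotent, and an idempotent unit is one.\<close>

lemma (in commutative_factor) factor_zero_left: "\<omega> 0 \<beta> = \<one>"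
proof -
  have "\<omega> 0 \<beta> \<otimes> \<omega> 0 \<beta> = \<omega> 0 \<beta> \<otimes> \<one>"
    using factor_add_left[of 0 0 \<beta>] factor_closed by simp
  then show ?thesis
    using Units_l_cancel[OF factor_unit factor_closed one_closed] by simp
qed

lemma (in commutative_factor) factor_zero_right: "\<omega> \<alpha> 0 = \<one>"
  using factor_skew[of \<alpha> 0] by (simp add: factor_zero_left)

text \<open>Both sides are inverse to \<open>\<omega> \<alpha> \<beta>\<close>: the left by
  additivity, the right by skew-symmetry.\<close>

lemma (in commutative_factor) factor_minus_left: "\<omega> (- \<alpha>) \<beta> = \<omega> \<beta> \<alpha>"
proof -
  have "\<omega> (- \<alpha>) \<beta> = \<omega> (- \<alpha>) \<beta> \<otimes> (\<omega> \<alpha> \<beta> \<otimes> \<omega> \<beta> \<alpha>)"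
    by (simp add: factor_cancel factor_closed)
  also have "\<dots> = \<omega> (- \<alpha> + \<alpha>) \<beta> \<otimes> \<omega> \<beta> \<alpha>"
    by (simp only: factor_add_left m_assoc factor_closed)
  finally show ?thesis by (simp add: factor_zero_left factor_closed)
qed

lemma (in commutative_factor) factor_left_cancel:
  "\<lbrakk>x \<in> carrier K; y \<in> carrier K; \<omega> \<alpha> \<beta> \<otimes> x = \<omega> \<alpha> \<beta> \<otimes> y\<rbrakk> \<Longrightarrow> x = y"
  using Units_l_cancel[OF factor_unit] by blast

lemmas (in commutative_factor) scalar_ac = m_assoc m_comm m_lcomm m_closed r_one l_one

text \<open>
  The linear map on \<open>(A \<otimes> B) \<otimes> (C \<otimes> D)\<close> whose values involve the degrees of the two inner factors only.
\<close>

lemma inner_graded_lift: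
  fixes A :: "('k, 'a, 'g::ab_group_add, 'm1) graded_module_scheme"
    and B :: "('k, 'b, 'g, 'm2) graded_module_scheme"
    and C :: "('k, 'c, 'g, 'm3) graded_module_scheme"
    and D :: "('k, 'd, 'g, 'm4) graded_module_scheme"
  assumes A: "graded_module K A" and B: "graded_module K B" and C: "graded_module K C"
    and D: "graded_module K D" and P: "module K P"
    and W1: "\<And>\<alpha> \<beta> b c d. \<lbrakk>b \<in> homog B \<beta>; c \<in> homog C \<alpha>; d \<in> carrier D\<rbrakk> \<Longrightarrow>
        linear_map K A P (\<lambda>a. W \<alpha> \<beta> a b c d)"
    and W2: "\<And>\<alpha> \<beta> a c d. \<lbrakk>a \<in> carrier A; c \<in> homog C \<alpha>; d \<in> carrier D\<rbrakk> \<Longrightarrow>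
        linear_map K (homog_part B \<beta>) P (\<lambda>b. W \<alpha> \<beta> a b c d)"
    and W3: "\<And>\<alpha> \<beta> a b d. \<lbrakk>a \<in> carrier A; b \<in> homog B \<beta>; d \<in> carrier D\<rbrakk> \<Longrightarrow>
        linear_map K (homog_part C \<alpha>) P (\<lambda>c. W \<alpha> \<beta> a b c d)"
    and W4: "\<And>\<alpha> \<beta> a b c. \<lbrakk>a \<in> carrier A; b \<in> homog B \<beta>; c \<in> homog C \<alpha>\<rbrakk> \<Longrightarrow>
        linear_map K D P (\<lambda>d. W \<alpha> \<beta> a b c d)"
  defines "M \<equiv> tensor K (tensor K A B) (tensor K C D)"
  defines "\<Phi> \<equiv> the_linear K M P (\<lambda>L. \<forall>\<alpha> \<beta>. \<forall>a\<in>carrier A. \<forall>b\<in>homog B \<beta>. \<forall>c\<in>homog C \<alpha>. \<forall>d\<in>carrier D.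
      L (pure_tensor K (tensor K A B) (tensor K C D) (pure_tensor K A B a b) (pure_tensor K C D c d)) =
      W \<alpha> \<beta> a b c d)"
  shows "linear_map K M P \<Phi>"
    and "\<lbrakk>X \<in> carrier (tensor K A B); Y \<in> carrier (tensor K C D)\<rbrakk> \<Longrightarrow>
      \<Phi> (pure_tensor K (tensor K A B) (tensor K C D) X Y) =
      graded_lift K A B P (\<lambda>_ \<beta> a b. graded_lift K C D P (\<lambda>\<alpha> _ c d. W \<alpha> \<beta> a b c d) Y) X"
proof -
  let ?AB = "tensor K A B" and ?CD = "tensor K C D"
  let ?in = "\<lambda>a b c d. pure_tensor K ?AB ?CD (pure_tensor K A B a b) (pure_tensor K C D c d)"
  let ?G = "\<lambda>Y. \<lambda>_ \<beta> a b. graded_lift K C D P (\<lambda>\<alpha> _ c d. W \<alpha> \<beta> a b c d) Y"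
  let ?H = "\<lambda>X Y. graded_lift K A B P (?G Y) X"
  have gAB: "graded_module K ?AB" and gCD: "graded_module K ?CD"
    using A B C D by (auto intro: tensor_graded_module)
  note mod = graded_module_module[OF A] graded_module_module[OF B] graded_module_module[OF C]
    graded_module_module[OF D] graded_module_module[OF gAB] graded_module_module[OF gCD]
    homog_part_module[OF A] homog_part_module[OF B] P
  note hc = homog_carrier[OF A] homog_carrier[OF B] homog_carrier[OF C] homog_carrier[OF D]
  have CDb: "graded_bilinear K C D P (\<lambda>\<alpha> _ c d. W \<alpha> \<beta> a b c d)" if "a \<in> carrier A" "b \<in> homog B \<beta>" for a b \<beta>
    using that hc(4) by (intro graded_bilinearI linear_map_homog_part[OF D] W3 W4) auto
  have ABb: "graded_bilinear K A B P (?G Y)" if Y: "Y \<in> carrier ?CD" for Y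
  proof (rule graded_bilinearI)
    fix \<alpha> \<beta> b assume b: "b \<in> homog B \<beta>"
    show "linear_map K (homog_part A \<alpha>) P (\<lambda>a. ?G Y \<alpha> \<beta> a b)"
      using b hc(4)
      by (intro graded_lift_param_linear[OF C D P mod(7) Y] CDb linear_map_homog_part[OF A] W1)
        (auto simp: homog_part_simps hc(1))
  next
    fix \<alpha> \<beta> a assume a: "a \<in> homog A \<alpha>"
    show "linear_map K (homog_part B \<beta>) P (\<lambda>b. ?G Y \<alpha> \<beta> a b)"
      using hc(1)[OF a] hc(4)
      by (intro graded_lift_param_linear[OF C D P mod(8) Y] CDb W2) (auto simp: homog_part_simps)
  qed
  have H: "bilinear_map K ?AB ?CD P ?H"
  proof (rule bilinear_mapI)
    fix X assume X: "X \<in> carrier ?AB"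
    show "linear_map K ?CD P (\<lambda>Y. ?H X Y)"
      using hc(1) by (intro graded_lift_param_linear[OF A B P mod(6) X] ABb graded_lift_linear[OF C D P] CDb) auto
  qed (intro graded_lift_linear A B P ABb)
  let ?L = "tensor_lift K ?AB ?CD P ?H"
  have L: "linear_map K M P ?L"
    unfolding M_def by (intro tensor_lift_linear mod H)
  have Lval: "?L (pure_tensor K ?AB ?CD X Y) = ?H X Y" if "X \<in> carrier ?AB" "Y \<in> carrier ?CD" for X Y
    using that by (intro tensor_lift_pure mod H)
  note pin = bilinear_mapD[OF pure_tensor_bilinear[OF mod(5,6)]]
    bilinear_mapD[OF pure_tensor_bilinear[OF mod(1,2)]] bilinear_mapD[OF pure_tensor_bilinear[OF mod(3,4)]]
  have val: "?L (?in a b c d) = W \<alpha> \<beta> a b c d"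
    if a: "a \<in> carrier A" and b: "b \<in> homog B \<beta>" and c: "c \<in> homog C \<alpha>" and d: "d \<in> carrier D" for a b c d \<alpha> \<beta>
  proof -
    \<comment> \<open>The nested lifts can be evaluated at homogeneous outer entries only, whereas
      the description of \<open>\<Phi>\<close> admits arbitrary \<open>a\<close> and
      \<open>d\<close>. The gap is closed by linearity, for \<open>d\<close> and then for
      \<open>a\<close>.\<close>
    have hom: "?L (?in a b c d) = W \<alpha> \<beta> a b c d" if a: "a \<in> homog A \<gamma>" and d: "d \<in> homog D \<delta>" for a d \<gamma> \<delta>
      using hc(1)[OF a] hc(2)[OF b] hc(3)[OF c] hc(4)[OF d]
      by (simp add: Lval pin graded_lift_pure[OF A B P ABb a b] graded_lift_pure[OF C D P CDb[OF hc(1)[OF a] b] c d])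
    have d': "?L (?in a b c d) = W \<alpha> \<beta> a b c d" if a: "a \<in> homog A \<gamma>" for a \<gamma>
    proof (rule graded_linear_ext[OF D _ _ _ d])
      show "linear_map K D P (\<lambda>d. ?L (?in a b c d))"
        using a b c by (intro linear_map_comp[OF L[unfolded M_def]] linear_map_comp[OF pin(2)] pin hc)
      show "linear_map K D P (\<lambda>d. W \<alpha> \<beta> a b c d)"
        using hc(1)[OF a] b c by (rule W4)
    qed (rule hom[OF a])
    show ?thesis
    proof (rule graded_linear_ext[OF A _ _ _ a])
      show "linear_map K A P (\<lambda>a. ?L (?in a b c d))"
        using b c d by (intro linear_map_comp[OF L[unfolded M_def]] linear_map_comp[OF pin(1)] pin hc(2,3))
      show "linear_map K A P (\<lambda>a. W \<alpha> \<beta> a b c d)"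
        using b c d by (rule W1)
    qed (rule d')
  qed
  have uniq: "L' t = ?L t"
    if L'v: "linear_map K M P L' \<and> (\<forall>\<alpha> \<beta>. \<forall>a\<in>carrier A. \<forall>b\<in>homog B \<beta>. \<forall>c\<in>homog C \<alpha>. \<forall>d\<in>carrier D.
        L' (?in a b c d) = W \<alpha> \<beta> a b c d)"
      and t: "t \<in> carrier M" for L' t
  proof (rule tensor_linear_ext[OF mod(5,6) conjunct1[OF L'v, unfolded M_def] L[unfolded M_def] _ t[unfolded M_def]])
    note L' = conjunct1[OF L'v, unfolded M_def] and v = conjunct2[OF L'v] and L = L[unfolded M_def]
    fix X Y assume X: "X \<in> carrier ?AB" and Y: "Y \<in> carrier ?CD"
    note l = pin(1)[OF Y]
    show "L' (pure_tensor K ?AB ?CD X Y) = ?L (pure_tensor K ?AB ?CD X Y)"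
    proof (rule tensor_graded_ext[OF A B linear_map_comp[OF L' l] linear_map_comp[OF L l] _ X])
      fix \<alpha> \<beta> a b assume ab: "a \<in> homog A \<alpha>" "b \<in> homog B \<beta>"
      note l = pin(2)[OF pin(6)[OF hc(1)[OF ab(1)] hc(2)[OF ab(2)]]]
      show "L' (pure_tensor K ?AB ?CD (pure_tensor K A B a b) Y) = ?L (pure_tensor K ?AB ?CD (pure_tensor K A B a b) Y)"
      proof (rule tensor_graded_ext[OF C D linear_map_comp[OF L' l] linear_map_comp[OF L l] _ Y])
        fix \<gamma> \<delta> c d assume cd: "c \<in> homog C \<gamma>" "d \<in> homog D \<delta>"
        show "L' (?in a b c d) = ?L (?in a b c d)"
          using v hc(1)[OF ab(1)] ab(2) cd(1) hc(4)[OF cd(2)] val by simp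
      qed
    qed
  qed
  have cl: "?in a b c d \<in> carrier M" if "a \<in> carrier A" "b \<in> homog B \<beta>" "c \<in> homog C \<alpha>" "d \<in> carrier D"
    for a b c d \<alpha> \<beta>
    unfolding M_def using that by (intro pin hc(2,3))
  have q: "\<forall>\<alpha> \<beta>. \<forall>a\<in>carrier A. \<forall>b\<in>homog B \<beta>. \<forall>c\<in>homog C \<alpha>. \<forall>d\<in>carrier D. L' (?in a b c d) = W \<alpha> \<beta> a b c d"
    if "\<forall>x\<in>carrier M. L' x = ?L x" for L'
    using bspec[OF that cl] val by simp
  have T: "module K M" unfolding M_def by (intro tensor_module mod)
  have props: "linear_map K M P \<Phi> \<and> (\<forall>\<alpha> \<beta>. \<forall>a\<in>carrier A. \<forall>b\<in>homog B \<beta>. \<forall>c\<in>homog C \<alpha>. \<forall>d\<in>carrier D.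
      \<Phi> (?in a b c d) = W \<alpha> \<beta> a b c d)"
    by (rule the_linear_props[OF \<Phi>_def[THEN meta_eq_to_obj_eq] T L])
      (rule allI, rule impI, rule q, assumption, rule allI, rule impI, rule ballI, rule uniq, assumption+)
  show "linear_map K M P \<Phi>" by (rule conjunct1[OF props])
  show "\<Phi> (pure_tensor K ?AB ?CD X Y) = ?H X Y" if X: "X \<in> carrier ?AB" and Y: "Y \<in> carrier ?CD"
  proof -
    have "pure_tensor K ?AB ?CD X Y \<in> carrier M"
      unfolding M_def using X Y by (rule pin(3))
    then have "\<Phi> (pure_tensor K ?AB ?CD X Y) = ?L (pure_tensor K ?AB ?CD X Y)"
      using uniq[OF props] by simp
    then show ?thesis using Lval[OF X Y] by simp
  qed
qed

text \<open>A separate locale with the assumptions of \<open>hopf_algebra\<close>, to be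
  instantiated once for the Hopf algebra and once for its dual.\<close>

locale sweedler = hopf_algebra K \<omega> H
  for K (structure) and \<omega> :: "'g::ab_group_add \<Rightarrow> 'g \<Rightarrow> 'k"
    and H :: "('k, 'a, 'g, 'm) hopf_algebra_scheme" (structure)
begin

section \<open>Structure maps of a Hopf algebra as Sweedler sums\<close>

lemma gH: "graded_module K H" and aH: "graded_algebra K H"
  by unfold_locales

lemma mH: "module K H" and mHH: "module K (tensor K H H)" and gHH: "graded_module K (tensor K H H)"
  using gH by (auto intro: graded_module_module tensor_module tensor_graded_module)

lemmas hc = homog_carrier[OF gH]

lemma comult_linear: "linear_map K H (tensor K H H) (comult H)"
  using comult_degree0 by (simp add: degree0_map_def)

lemma comult_closed: "x \<in> carrier H \<Longrightarrow> comult H x \<in> carrier (tensor K H H)"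
  by (rule linear_map_closed[OF comult_linear])

lemma comult_homog: "x \<in> homog H \<alpha> \<Longrightarrow> comult H x \<in> homog (tensor K H H) \<alpha>"
  using comult_degree0 by (auto simp: degree0_map_def)

text \<open>
  \<open>sw P B x\<close> is the Sweedler sum of the \<open>B \<alpha> \<beta> x\<^sub>1 x\<^sub>2\<close>, where \<open>\<alpha>\<close> and \<open>\<beta>\<close> are the degrees of \<open>x\<^sub>1\<close> and
  \<open>x\<^sub>2\<close>: since the signs depend on them, the summand is a family indexed by the degrees that only
  has to be linear on each pair of homogeneous parts.
\<close>

definition sw :: "('k, 'c, 'p) module_scheme \<Rightarrow> ('g \<Rightarrow> 'g \<Rightarrow> 'a \<Rightarrow> 'a \<Rightarrow> 'c) \<Rightarrow> 'a \<Rightarrow> 'c" where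
  "sw P B x = graded_lift K H H P B (comult H x)"

lemma sw_linear:
  "\<lbrakk>module K P; graded_bilinear K H H P B; linear_map K M H f\<rbrakk> \<Longrightarrow> linear_map K M P (\<lambda>x. sw P B (f x))"
  unfolding sw_def by (intro linear_map_graded_lift gH linear_map_comp[OF comult_linear])

lemma sw_param_linear:
  assumes "module K P" "module K M" "x \<in> carrier H"
    and "\<And>p. p \<in> carrier M \<Longrightarrow> graded_bilinear K H H P (B p)"
    and "\<And>\<alpha> \<beta> a b. \<lbrakk>a \<in> homog H \<alpha>; b \<in> homog H \<beta>\<rbrakk> \<Longrightarrow> linear_map K M P (\<lambda>p. B p \<alpha> \<beta> a b)"
  shows "linear_map K M P (\<lambda>p. sw P (B p) x)"
  unfolding sw_def by (intro graded_lift_param_linear gH assms comult_closed)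

lemma sw_closed:
  "\<lbrakk>module K P; graded_bilinear K H H P B; x \<in> carrier H\<rbrakk> \<Longrightarrow> sw P B x \<in> carrier P"
  unfolding sw_def by (intro graded_lift_closed gH comult_closed)

lemma sw_cong:
  assumes "\<And>\<alpha> \<beta> a b. \<lbrakk>a \<in> homog H \<alpha>; b \<in> homog H \<beta>\<rbrakk> \<Longrightarrow> B \<alpha> \<beta> a b = B' \<alpha> \<beta> a b"
  shows "sw P B x = sw P B' x"
  unfolding sw_def by (rule graded_lift_cong[OF gH gH assms])

lemma sw_homog_cong:
  assumes "module K P" "graded_bilinear K H H P B" "graded_bilinear K H H P B'" "x \<in> homog H \<gamma>"
    and "\<And>\<alpha> \<beta> a b. \<lbrakk>a \<in> homog H \<alpha>; b \<in> homog H \<beta>; \<alpha> + \<beta> = \<gamma>\<rbrakk> \<Longrightarrow> B \<alpha> \<beta> a b = B' \<alpha> \<beta> a b"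
  shows "sw P B x = sw P B' x"
  unfolding sw_def by (rule graded_lift_homog_cong[OF gH gH assms(1-3) comult_homog[OF assms(4)] assms(5)])

lemma sw_mem:
  assumes "module K P" "graded_bilinear K H H P B" "x \<in> homog H \<gamma>" "submodule S K P"
    and "\<And>\<alpha> \<beta> a b. \<lbrakk>a \<in> homog H \<alpha>; b \<in> homog H \<beta>; \<alpha> + \<beta> = \<gamma>\<rbrakk> \<Longrightarrow> B \<alpha> \<beta> a b \<in> S"
  shows "sw P B x \<in> S"
  unfolding sw_def by (rule graded_lift_mem[OF gH gH assms(1,2) comult_homog[OF assms(3)] assms(4,5)])

lemma sw_comp:
  assumes "module K P" "module K P'" "graded_bilinear K H H P B" "linear_map K P P' F" "x \<in> carrier H"
  shows "F (sw P B x) = sw P' (\<lambda>\<alpha> \<beta> a b. F (B \<alpha> \<beta> a b)) x"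
  unfolding sw_def by (rule graded_lift_comp[OF gH gH assms(1-4) comult_closed[OF assms(5)]])

lemma sw_swap:
  assumes "module K P" "x \<in> carrier H" "y \<in> carrier H"
    and "\<And>\<gamma> \<delta> c d. \<lbrakk>c \<in> homog H \<gamma>; d \<in> homog H \<delta>\<rbrakk> \<Longrightarrow>
        graded_bilinear K H H P (\<lambda>\<alpha> \<beta> a b. T \<alpha> \<beta> \<gamma> \<delta> a b c d)"
    and "\<And>\<alpha> \<beta> a b. \<lbrakk>a \<in> homog H \<alpha>; b \<in> homog H \<beta>\<rbrakk> \<Longrightarrow>
        graded_bilinear K H H P (\<lambda>\<gamma> \<delta> c d. T \<alpha> \<beta> \<gamma> \<delta> a b c d)"
  shows "sw P (\<lambda>\<alpha> \<beta> a b. sw P (\<lambda>\<gamma> \<delta> c d. T \<alpha> \<beta> \<gamma> \<delta> a b c d) y) x =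
    sw P (\<lambda>\<gamma> \<delta> c d. sw P (\<lambda>\<alpha> \<beta> a b. T \<alpha> \<beta> \<gamma> \<delta> a b c d) x) y"
  unfolding sw_def
  by (rule graded_lift_swap[OF gH gH gH gH assms(1) comult_closed[OF assms(2)] comult_closed[OF assms(3)] assms(4,5)])

lemma mult_homog_linear:
  "a \<in> homog H \<alpha> \<Longrightarrow> linear_map K (homog_part H \<gamma>) (homog_part H (\<alpha> + \<gamma>)) (\<lambda>c. a \<otimes>\<^bsub>H\<^esub> c)"
  "a \<in> homog H \<alpha> \<Longrightarrow> linear_map K (homog_part H \<gamma>) (homog_part H (\<gamma> + \<alpha>)) (\<lambda>c. c \<otimes>\<^bsub>H\<^esub> a)"
  by (rule linear_map_homog_part_range[OF linear_map_mult_right[OF aH linear_map_homog_id[OF gH]]];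
      simp add: homog_part_simps hc mult_homog)
    (rule linear_map_homog_part_range[OF linear_map_mult_left[OF aH linear_map_homog_id[OF gH]]];
      simp add: homog_part_simps hc mult_homog)

text \<open>Multiplicativity of the coproduct. The product of the tensor square is twisted by the
  braiding, which moves \<open>b\<close> of degree \<open>\<beta>\<close> past \<open>c\<close> of
  degree \<open>\<gamma>\<close>; this is the origin of the sign
  \<open>\<omega> \<beta> \<gamma>\<close>.\<close>

lemma sw_mult:
  assumes P: "module K P" and B: "graded_bilinear K H H P B" and x: "x \<in> carrier H" and y: "y \<in> carrier H"
  shows "sw P B (x \<otimes>\<^bsub>H\<^esub> y) =
    sw P (\<lambda>\<alpha> \<beta> a b. sw P (\<lambda>\<gamma> \<delta> c d. \<omega> \<beta> \<gamma> \<odot>\<^bsub>P\<^esub> B (\<alpha> + \<gamma>) (\<beta> + \<delta>) (a \<otimes>\<^bsub>H\<^esub> c) (b \<otimes>\<^bsub>H\<^esub> d)) y) x"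
proof -
  let ?b = "braiding K \<omega> H H" and ?HH = "tensor K H H"
  let ?T = "\<lambda>\<alpha> \<beta> a b \<gamma> \<delta> c d. \<omega> \<beta> \<gamma> \<odot>\<^bsub>P\<^esub> B (\<alpha> + \<gamma>) (\<beta> + \<delta>) (a \<otimes>\<^bsub>H\<^esub> c) (b \<otimes>\<^bsub>H\<^esub> d)"
  have brb: "graded_bilinear K H H ?HH (\<lambda>\<alpha> \<beta> x y. \<omega> \<alpha> \<beta> \<odot>\<^bsub>?HH\<^esub> pure_tensor K H H y x)"
    by (intro graded_bilinearI linear_map_const_smult linear_map_pure_left linear_map_pure_right mH mHH
        linear_map_homog_id gH factor_closed hc)
  interpret tw: twisted_pair K H H ?b
    by (unfold_locales) (rule graded_lift_linear[OF gH gH mHH brb, folded braiding_eq])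
  note hp = homog_part_simps
  have Ty: "graded_bilinear K H H P (?T \<alpha> \<beta> a b)" if ab: "a \<in> homog H \<alpha>" "b \<in> homog H \<beta>" for \<alpha> \<beta> a b
    by (intro graded_bilinearI linear_map_const_smult P factor_closed
        linear_map_comp[OF graded_bilinearD(1)[OF B] mult_homog_linear(1)]
        linear_map_comp[OF graded_bilinearD(2)[OF B] mult_homog_linear(1)] mult_homog ab)
  have Tx: "graded_bilinear K H H P (\<lambda>\<alpha> \<beta> a b. ?T \<alpha> \<beta> a b \<gamma> \<delta> c d)" if cd: "c \<in> homog H \<gamma>" "d \<in> homog H \<delta>" for \<gamma> \<delta> c d
    by (intro graded_bilinearI linear_map_const_smult P factor_closed
        linear_map_comp[OF graded_bilinearD(1)[OF B] mult_homog_linear(2)]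
        linear_map_comp[OF graded_bilinearD(2)[OF B] mult_homog_linear(2)] mult_homog cd)
  have Tl: "graded_bilinear K H H P (\<lambda>\<alpha> \<beta> a b. graded_lift K H H P (?T \<alpha> \<beta> a b) u)" if u: "u \<in> carrier ?HH" for u
    by (intro graded_bilinearI graded_lift_param_linear[OF gH gH P homog_part_module[OF gH] u] Ty
        graded_bilinearD[OF Tx]) (simp_all add: hp)
  note Blin = graded_lift_linear[OF gH gH P B]
  \<comment> \<open>Coproducts are not pure tensors, so the formula is proved for arbitrary
    \<open>t\<close> and \<open>u\<close>, by uniqueness of the lift in each of them.\<close>
  have main: "graded_lift K H H P B (twisted_mult K H H ?b t u) =
      graded_lift K H H P (\<lambda>\<alpha> \<beta> a b. graded_lift K H H P (?T \<alpha> \<beta> a b) u) t"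
    if t: "t \<in> carrier ?HH" and u: "u \<in> carrier ?HH" for t u
  proof (rule graded_lift_unique[OF gH gH P Tl[OF u] linear_map_comp[OF Blin bilinear_mapD(1)[OF tw.twisted_mult_bilinear u]] _ t, symmetric])
    fix \<alpha> \<beta> a b assume ab: "a \<in> homog H \<alpha>" "b \<in> homog H \<beta>"
    have pc: "pure_tensor K H H a b \<in> carrier ?HH" using ab by (intro pure_tensor_closed mH hc)
    show "graded_lift K H H P B (twisted_mult K H H ?b (pure_tensor K H H a b) u) = graded_lift K H H P (?T \<alpha> \<beta> a b) u"
    proof (rule graded_lift_unique[OF gH gH P Ty[OF ab] linear_map_comp[OF Blin bilinear_mapD(2)[OF tw.twisted_mult_bilinear pc]] _ u, symmetric])
      fix \<gamma> \<delta> c d assume cd: "c \<in> homog H \<gamma>" "d \<in> homog H \<delta>"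
      have cb: "pure_tensor K H H c b \<in> carrier ?HH" using ab cd by (intro pure_tensor_closed mH hc)
      have "?b (pure_tensor K H H b c) = \<omega> \<beta> \<gamma> \<odot>\<^bsub>?HH\<^esub> pure_tensor K H H c b"
        unfolding braiding_eq using ab cd by (intro graded_lift_pure gH mHH brb)
      then have "twisted_mult K H H ?b (pure_tensor K H H a b) (pure_tensor K H H c d) =
          \<omega> \<beta> \<gamma> \<odot>\<^bsub>?HH\<^esub> pure_tensor K H H (a \<otimes>\<^bsub>H\<^esub> c) (b \<otimes>\<^bsub>H\<^esub> d)"
        using hc[OF ab(1)] hc[OF ab(2)] hc[OF cd(1)] hc[OF cd(2)] cb
        by (simp add: tw.twisted_mult_pure tw.twist_op_pure tw.closed linear_map_smult[OF tw.right_op_linear]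
            linear_map_smult[OF tw.left_op_linear] factor_closed tw.right_op_pure tw.left_op_pure)
      then show "graded_lift K H H P B (twisted_mult K H H ?b (pure_tensor K H H a b) (pure_tensor K H H c d)) =
          ?T \<alpha> \<beta> a b \<gamma> \<delta> c d"
        using ab cd
        by (simp add: linear_map_smult[OF Blin factor_closed] graded_lift_pure[OF gH gH P B mult_homog mult_homog]
            pure_tensor_closed[OF mH mH] hc mult_closed[OF aH])
    qed
  qed
  have "comult H (x \<otimes>\<^bsub>H\<^esub> y) = twisted_mult K H H ?b (comult H x) (comult H y)"
    using ring_hom_mult[OF comult_hom x y] by (simp add: tensor_algebra_def twisted_tensor_algebra_def)
  then show ?thesis
    unfolding sw_def using main[OF comult_closed[OF x] comult_closed[OF y]] by simp
qed

lemma sw_one: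
  assumes "module K P" "graded_bilinear K H H P B"
  shows "sw P B \<one>\<^bsub>H\<^esub> = B 0 0 \<one>\<^bsub>H\<^esub> \<one>\<^bsub>H\<^esub>"
proof -
  have "comult H \<one>\<^bsub>H\<^esub> = pure_tensor K H H \<one>\<^bsub>H\<^esub> \<one>\<^bsub>H\<^esub>"
    using ring_hom_one[OF comult_hom] by (simp add: tensor_algebra_def twisted_tensor_algebra_def)
  then show ?thesis
    unfolding sw_def using graded_lift_pure[OF gH gH assms one_homog one_homog] by simp
qed

text \<open>\<open>\<Theta>\<close> and \<open>\<Xi>\<close> are the linear maps induced by
  \<open>T\<close> on the two bracketings of the triple tensor product. They correspond under
  \<open>assoc_map\<close>, and the two nested sums are their values at the two iterated coproducts
  of \<open>x\<close>, which coassociativity identifies.\<close>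

lemma sw_coassoc:
  assumes P: "module K P" and T: "graded_trilinear K H P T" and x: "x \<in> carrier H"
  shows "sw P (\<lambda>\<alpha> \<beta> a b. sw P (\<lambda>\<gamma> \<delta> c d. T \<gamma> \<delta> \<beta> c d b) a) x =
    sw P (\<lambda>\<alpha> \<beta> a b. sw P (\<lambda>\<gamma> \<delta> c d. T \<alpha> \<gamma> \<delta> a c d) b) x"
proof -
  let ?HH = "tensor K H H"
  note TD = graded_trilinearD[OF T] and pr = homog_part_module[OF gH]
  note lin = graded_lift_linear[OF gH gH P] and par = graded_lift_param_linear[OF gH gH P pr]
  have b1: "graded_bilinear K H H P (\<lambda>\<gamma> \<delta> c d. T \<alpha> \<gamma> \<delta> a c d)" if "a \<in> homog H \<alpha>" for a \<alpha>
    using that by (intro graded_bilinearI TD)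
  have b3: "graded_bilinear K H H P (\<lambda>\<gamma> \<delta> c d. T \<gamma> \<delta> \<beta> c d b)" if "b \<in> homog H \<beta>" for b \<beta>
    using that by (intro graded_bilinearI TD)
  have B1: "graded_bilinear K H ?HH P (\<lambda>\<alpha> _ a u. graded_lift K H H P (\<lambda>\<gamma> \<delta> c d. T \<alpha> \<gamma> \<delta> a c d) u)"
    by (intro graded_bilinearI par lin linear_map_homog_part[OF gHH] TD b1 homog_carrier[OF gHH])
      (simp_all add: homog_part_simps)
  have B3: "graded_bilinear K ?HH H P (\<lambda>_ \<beta> u b. graded_lift K H H P (\<lambda>\<gamma> \<delta> c d. T \<gamma> \<delta> \<beta> c d b) u)"
    by (intro graded_bilinearI par lin linear_map_homog_part[OF gHH] TD b3 homog_carrier[OF gHH])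
      (simp_all add: homog_part_simps)
  define \<Theta> where "\<Theta> = graded_lift K H ?HH P (\<lambda>\<alpha> _ a u. graded_lift K H H P (\<lambda>\<gamma> \<delta> c d. T \<alpha> \<gamma> \<delta> a c d) u)"
  define \<Xi> where "\<Xi> = graded_lift K ?HH H P (\<lambda>_ \<beta> u b. graded_lift K H H P (\<lambda>\<gamma> \<delta> c d. T \<gamma> \<delta> \<beta> c d b) u)"
  have \<Theta>: "linear_map K (tensor K H ?HH) P \<Theta>"
    unfolding \<Theta>_def by (intro graded_lift_linear gH gHH P B1)
  have \<Theta>_pure: "\<Theta> (pure_tensor K H ?HH a u) = graded_lift K H H P (\<lambda>\<gamma> \<delta> c d. T \<alpha> \<gamma> \<delta> a c d) u"
    if "a \<in> homog H \<alpha>" "u \<in> homog ?HH \<beta>" for a u \<alpha> \<beta>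
    unfolding \<Theta>_def using that by (rule graded_lift_pure[OF gH gHH P B1])
  have \<Xi>: "linear_map K (tensor K ?HH H) P \<Xi>"
    unfolding \<Xi>_def by (intro graded_lift_linear gH gHH P B3)
  have \<Xi>_pure: "\<Xi> (pure_tensor K ?HH H u b) = graded_lift K H H P (\<lambda>\<gamma> \<delta> c d. T \<gamma> \<delta> \<beta> c d b) u"
    if "u \<in> homog ?HH \<alpha>" "b \<in> homog H \<beta>" for b u \<alpha> \<beta>
    unfolding \<Xi>_def using that by (rule graded_lift_pure[OF gHH gH P B3])
  note as = assoc_map_props[OF gH gH gH]
  have assoc: "\<Theta> (assoc_map K H H H t) = \<Xi> t" if t: "t \<in> carrier (tensor K ?HH H)" for t
  proof (rule tensor_graded_ext[OF gHH gH linear_map_comp[OF \<Theta> as(1)] \<Xi> _ t])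
    fix \<alpha> \<beta> u b assume u: "u \<in> homog ?HH \<alpha>" and b: "b \<in> homog H \<beta>"
    have l: "linear_map K ?HH (tensor K ?HH H) (\<lambda>u. pure_tensor K ?HH H u b)"
      by (intro linear_map_pure_left mHH mH linear_map_id hc[OF b])
    show "\<Theta> (assoc_map K H H H (pure_tensor K ?HH H u b)) = \<Xi> (pure_tensor K ?HH H u b)"
    proof (rule tensor_homog_ext[OF gH gH P linear_map_comp[OF linear_map_comp[OF \<Theta> as(1)] l] linear_map_comp[OF \<Xi> l] _ u])
      fix \<gamma> \<delta> c d assume cd: "c \<in> homog H \<gamma>" "d \<in> homog H \<delta>"
      let ?l = "\<Theta> (assoc_map K H H H (pure_tensor K ?HH H (pure_tensor K H H c d) b))"
        and ?r = "\<Xi> (pure_tensor K ?HH H (pure_tensor K H H c d) b)"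
      have "?l = \<Theta> (pure_tensor K H ?HH c (pure_tensor K H H d b))"
        using cd b by (simp add: as(2) hc)
      also have "\<dots> = T \<gamma> \<delta> \<beta> c d b"
        using cd b by (simp add: \<Theta>_pure[OF _ pure_tensor_homog[OF gH gH]] graded_lift_pure[OF gH gH P b1])
      also have "\<dots> = ?r"
        using cd b by (simp add: \<Xi>_pure[OF pure_tensor_homog[OF gH gH]] graded_lift_pure[OF gH gH P b3])
      finally show "?l = ?r" .
    qed
  qed
  note tl = tensor_map_props[OF gH gH gHH gH comult_linear linear_map_id]
  note tr = tensor_map_props[OF gH gH gH gHH linear_map_id comult_linear]
  have Rb: "graded_bilinear K H H P (\<lambda>\<alpha> \<beta> a b. sw P (\<lambda>\<gamma> \<delta> c d. T \<alpha> \<gamma> \<delta> a c d) b)"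
    unfolding sw_def
    by (intro graded_bilinearI par linear_map_homog_part[OF gH] linear_map_comp[OF lin] comult_linear comult_closed hc b1 TD)
      (simp_all add: homog_part_simps)
  have Lb: "graded_bilinear K H H P (\<lambda>\<alpha> \<beta> a b. sw P (\<lambda>\<gamma> \<delta> c d. T \<gamma> \<delta> \<beta> c d b) a)"
    unfolding sw_def
    by (intro graded_bilinearI par linear_map_homog_part[OF gH] linear_map_comp[OF lin] comult_linear comult_closed hc b3 TD)
      (simp_all add: homog_part_simps)
  have R: "\<Theta> (tensor_map K H H H ?HH (\<lambda>y. y) (comult H) t) =
      graded_lift K H H P (\<lambda>\<alpha> \<beta> a b. sw P (\<lambda>\<gamma> \<delta> c d. T \<alpha> \<gamma> \<delta> a c d) b) t" if t: "t \<in> carrier ?HH" for t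
    by (rule graded_lift_unique[OF gH gH P Rb linear_map_comp[OF \<Theta> tr(1)] _ t, symmetric])
      (simp add: tr(2) hc \<Theta>_pure[OF _ comult_homog] sw_def)
  have L: "\<Xi> (tensor_map K H H ?HH H (comult H) (\<lambda>y. y) t) =
      graded_lift K H H P (\<lambda>\<alpha> \<beta> a b. sw P (\<lambda>\<gamma> \<delta> c d. T \<gamma> \<delta> \<beta> c d b) a) t" if t: "t \<in> carrier ?HH" for t
    by (rule graded_lift_unique[OF gH gH P Lb linear_map_comp[OF \<Xi> tl(1)] _ t, symmetric])
      (simp add: tl(2) hc \<Xi>_pure[OF comult_homog] sw_def)
  have "\<Theta> (assoc_map K H H H (tensor_map K H H ?HH H (comult H) (\<lambda>y. y) (comult H x))) =
      \<Theta> (tensor_map K H H H ?HH (\<lambda>y. y) (comult H) (comult H x))"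
    using coassoc[OF x] by simp
  then show ?thesis
    using assoc[OF linear_map_closed[OF tl(1) comult_closed[OF x]]] R[OF comult_closed[OF x]] L[OF comult_closed[OF x]]
    by (simp add: sw_def)
qed

abbreviation KK :: "('k, 'k, 'g) graded_module" where "KK \<equiv> ground_algebra K"

lemma mK: "module K KK"
  by (rule ground_algebra_module) (rule is_cring)

lemma counit_linear: "linear_map K H KK (counit H)"
  using counit_degree0 by (simp add: degree0_map_def)

lemma counit_closed: "x \<in> carrier H \<Longrightarrow> counit H x \<in> carrier K"
  using linear_map_closed[OF counit_linear] by (simp add: ground_algebra_simps)

lemma counit_degree: "\<lbrakk>x \<in> homog H \<alpha>; \<alpha> \<noteq> 0\<rbrakk> \<Longrightarrow> counit H x = \<zero>"
  using counit_degree0 by (force simp: degree0_map_def ground_algebra_simps)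

lemma sw_counit_left: "x \<in> carrier H \<Longrightarrow> sw H (\<lambda>_ _ a b. counit H a \<odot>\<^bsub>H\<^esub> b) x = x"
  and sw_counit_right: "x \<in> carrier H \<Longrightarrow> sw H (\<lambda>_ _ a b. counit H b \<odot>\<^bsub>H\<^esub> a) x = x"
proof -
  have l: "bilinear_map K H H H (\<lambda>a b. counit H a \<odot>\<^bsub>H\<^esub> b)"
    by (intro bilinear_mapI linear_map_smult_left[OF mH counit_linear] linear_map_const_smult mH counit_closed linear_map_id)
  have r: "bilinear_map K H H H (\<lambda>a b. counit H b \<odot>\<^bsub>H\<^esub> a)"
    by (intro bilinear_mapI linear_map_smult_left[OF mH counit_linear] linear_map_const_smult mH counit_closed linear_map_id)
  show "sw H (\<lambda>_ _ a b. counit H a \<odot>\<^bsub>H\<^esub> b) x = x" if "x \<in> carrier H"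
    using counit_left[OF that] tensor_lift_eq_graded_lift[OF gH gH mH l comult_closed[OF that]]
    by (simp add: sw_def contract_left_eq)
  show "sw H (\<lambda>_ _ a b. counit H b \<odot>\<^bsub>H\<^esub> a) x = x" if "x \<in> carrier H"
    using counit_right[OF that] tensor_lift_eq_graded_lift[OF gH gH mH r comult_closed[OF that]]
    by (simp add: sw_def contract_right_eq)
qed

lemma antipode_linear: "linear_map K H H (antipode H)"
  using antipode_degree0 by (simp add: degree0_map_def)

lemma antipode_homog: "x \<in> homog H \<alpha> \<Longrightarrow> antipode H x \<in> homog H \<alpha>"
  using antipode_degree0 by (auto simp: degree0_map_def)

text \<open>The antipode identity at the group-like element 1. It is used for \<open>H\<close>, and
  for the dual, where it says that the counit of \<open>H\<close> is invariant under the inverse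
  antipode.\<close>

lemma antipode_one: "antipode H \<one>\<^bsub>H\<^esub> = \<one>\<^bsub>H\<^esub>"
proof -
  note tm = tensor_map_props[OF gH gH gH gH antipode_linear linear_map_id]
  have S1: "antipode H \<one>\<^bsub>H\<^esub> \<in> carrier H" by (rule linear_map_closed[OF antipode_linear]) simp
  have "comult H \<one>\<^bsub>H\<^esub> = pure_tensor K H H \<one>\<^bsub>H\<^esub> \<one>\<^bsub>H\<^esub>"
    using ring_hom_one[OF comult_hom] by (simp add: tensor_algebra_def twisted_tensor_algebra_def)
  then have "antipode H \<one>\<^bsub>H\<^esub> \<otimes>\<^bsub>H\<^esub> \<one>\<^bsub>H\<^esub> = counit H \<one>\<^bsub>H\<^esub> \<odot>\<^bsub>H\<^esub> \<one>\<^bsub>H\<^esub>"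
    using antipode_left[of "\<one>\<^bsub>H\<^esub>"] S1 by (simp add: tm(2) mult_map_props(2)[OF aH])
  moreover have "counit H \<one>\<^bsub>H\<^esub> = \<one>"
    using ring_hom_one[OF counit_hom] by (simp add: ground_algebra_simps)
  ultimately show ?thesis using S1 by simp
qed

end

section \<open>The double\<close>

lemma component_linear:
  assumes "graded_module K M"
  shows "linear_map K M M (\<lambda>x. component M x \<alpha>)"
  using homog_carrier[OF assms component_homog_closed[OF assms]]
  by (intro linear_mapI) (simp_all add: component_add[OF assms] component_smult[OF assms])

text \<open>Checked on homogeneous elements, where both sides are \<open>f y\<close> or zero. It is
  the reason why the inverse of a bijection of degree 0 has degree 0 as well.\<close>

lemma degree0_component:
  assumes M: "graded_module K M" and N: "graded_module K N" and f: "degree0_map K M N f" and x: "x \<in> carrier M"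
  shows "component N (f x) \<alpha> = f (component M x \<alpha>)"
proof -
  have lin: "linear_map K M N f" and deg: "\<And>\<beta> y. y \<in> homog M \<beta> \<Longrightarrow> f y \<in> homog N \<beta>"
    using f by (auto simp: degree0_map_def)
  show ?thesis
  proof (rule graded_linear_ext[OF M linear_map_comp[OF component_linear[OF N] lin]
        linear_map_comp[OF lin component_linear[OF M]] _ x])
    fix \<beta> y assume y: "y \<in> homog M \<beta>"
    show "component N (f y) \<alpha> = f (component M y \<alpha>)"
      using linear_map_zero[OF graded_module_module[OF M] graded_module_module[OF N] lin]
      by (simp add: component_homog[OF M y] component_homog[OF N deg[OF y]])
  qed
qed

text \<open>The construction reads only these fields of its factors. So tensor squares of the finite
  dual as a graded module and of the Hopf algebra on it are the same object.\<close>

lemma tensor_record_cong: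
  assumes "carrier M' = carrier M" "add M' = add M" "smult M' = smult M" "homog M' = homog M"
    and "carrier N' = carrier N" "add N' = add N" "smult N' = smult N" "homog N' = homog N"
  shows "tensor K M' N' = tensor K M N" "pure_tensor K M' N' = pure_tensor K M N"
proof -
  have r: "bilinearity_relations K M' N' = bilinearity_relations K M N"
    unfolding bilinearity_relations_def by (simp only: assms)
  have p: "pure_tensor K M' N' x y = pure_tensor K M N x y" for x y
    unfolding pure_tensor_def by (simp only: assms r)
  show "tensor K M' N' = tensor K M N"
    unfolding tensor_def by (simp only: assms r p)
  show "pure_tensor K M' N' = pure_tensor K M N" using p by blast
qed

text \<open>The dual is itself a Hopf algebra, so the Sweedler calculus is available on both sides,
  under separate prefixes.\<close>

locale dual_pair = H: sweedler K \<omega> H + H0: sweedler K \<omega> H0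
  for K :: "('k, 'q) ring_scheme" (structure) and \<omega> :: "'g::ab_group_add \<Rightarrow> 'g \<Rightarrow> 'k"
    and H :: "('k, 'a, 'g) hopf_algebra" and H0 :: "('k, 'a \<Rightarrow> 'k, 'g) hopf_algebra" +
  assumes bij: "bij_betw (antipode H) (carrier H) (carrier H)"
    and opp: "opposite_finite_dual K \<omega> H H0"
begin

abbreviation "F \<equiv> finite_dual K H"
abbreviation "D \<equiv> tensor K H H0"
abbreviation "p \<equiv> pure_tensor K H H0"
abbreviation "KK \<equiv> H.KK"

lemma H0_eq: "H0 = opposite_dual_structure K \<omega> H (comult H0)"
  using opp by (simp add: opposite_finite_dual_def)

text \<open>\<open>H0_eq\<close> has \<open>H0\<close> on both sides and would loop as a rewrite
  rule; each field is therefore projected from a single use of it.\<close>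

lemma H0_fields:
  "carrier H0 = carrier F" "homog H0 = homog F" "add H0 = add F" "smult H0 = smult F" "zero H0 = zero F"
  "mult H0 = (\<lambda>f g. \<lambda>x\<in>carrier H. tensor_pairing K \<omega> H (pure_tensor K F F f g) (comult H x))"
  "one H0 = restrict (counit H) (carrier H)"
  "counit H0 = (\<lambda>f. f \<one>\<^bsub>H\<^esub>)"
  "antipode H0 = (\<lambda>f. \<lambda>x\<in>carrier H. f (inv_into (carrier H) (antipode H) x))"
  by (rule trans[OF arg_cong[OF H0_eq]],
      simp add: opposite_dual_structure_def Let_def graded_module.defs hopf_algebra.defs)+

lemma H0_add: "x \<in> carrier H \<Longrightarrow> (f \<oplus>\<^bsub>H0\<^esub> g) x = f x \<oplus> g x"
  and H0_smult: "x \<in> carrier H \<Longrightarrow> (k \<odot>\<^bsub>H0\<^esub> f) x = k \<otimes> f x"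
  by (simp_all add: H0_fields finite_dual_def graded_dual_def Let_def)

lemma functional:
  assumes "f \<in> carrier H0"
  shows "f \<in> extensional (carrier H)" and functional_linear: "linear_map K H KK f"
  using assms by (simp_all add: H0_fields finite_dual_def graded_dual_def functionals_def Let_def)

lemma functional_closed: "\<lbrakk>f \<in> carrier H0; x \<in> carrier H\<rbrakk> \<Longrightarrow> f x \<in> carrier K"
  using linear_map_closed[OF functional_linear] by (simp add: ground_algebra_simps)

text \<open>The form in which the grading of the dual enters: where a value is nonzero the degrees
  are opposite and signs may be rewritten; where it is zero the sign does not matter.\<close>

lemma functional_degree:
  assumes "f \<in> homog H0 \<phi>" "x \<in> homog H \<xi>" "f x \<noteq> \<zero>"
  shows "\<phi> + \<xi> = 0"
proof -
  have "\<xi> = - \<phi>"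
    using assms by (auto simp: H0_fields finite_dual_def graded_dual_def Let_def)
  then show ?thesis by simp
qed

lemma functional_homogI:
  assumes "f \<in> carrier H0" "\<And>\<xi> x. \<lbrakk>x \<in> homog H \<xi>; \<xi> \<noteq> - \<phi>\<rbrakk> \<Longrightarrow> f x = \<zero>"
  shows "f \<in> homog H0 \<phi>"
  using assms by (auto simp: H0_fields finite_dual_def graded_dual_def Let_def)

text \<open>Elements of the dual are extensional functions, so testing on homogeneous elements is
  enough. All identities between translates are proved in this way.\<close>

lemma functional_ext:
  assumes "f \<in> carrier H0" "g \<in> carrier H0" "\<And>\<alpha> x. x \<in> homog H \<alpha> \<Longrightarrow> f x = g x"
  shows "f = g"
  by (rule extensionalityI[OF functional(1)[OF assms(1)] functional(1)[OF assms(2)]])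
    (rule graded_linear_ext[OF H.gH functional_linear[OF assms(1)] functional_linear[OF assms(2)] assms(3)])

lemma evaluation_linear: "x \<in> carrier H \<Longrightarrow> linear_map K H0 KK (\<lambda>f. f x)"
  by (intro linear_mapI) (simp_all add: ground_algebra_simps functional_closed H0_add H0_smult)

lemmas hc = H.hc H0.hc
lemmas gr = H.gH H0.gH
lemmas md = H.mH H0.mH H.mHH H0.mHH H.mK

lemma mD: "module K D" and gD: "graded_module K D"
  using gr by (auto intro: tensor_module graded_module_module tensor_graded_module)

section \<open>The inverse antipode\<close>

abbreviation "Sinv \<equiv> inv_into (carrier H) (antipode H)"

lemma Sinv_closed: "x \<in> carrier H \<Longrightarrow> Sinv x \<in> carrier H"
  and S_Sinv: "x \<in> carrier H \<Longrightarrow> antipode H (Sinv x) = x"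
  and Sinv_S: "x \<in> carrier H \<Longrightarrow> Sinv (antipode H x) = x"
  using bij by (auto simp: bij_betw_def inv_into_into f_inv_into_f)

lemma Sinv_eqI: "\<lbrakk>y \<in> carrier H; antipode H y = x\<rbrakk> \<Longrightarrow> Sinv x = y"
  using Sinv_S by blast

lemma Sinv_linear: "linear_map K H H Sinv"
proof (rule linear_mapI)
  show "Sinv (x \<oplus>\<^bsub>H\<^esub> y) = Sinv x \<oplus>\<^bsub>H\<^esub> Sinv y" if "x \<in> carrier H" "y \<in> carrier H" for x y
    using that
    by (intro Sinv_eqI) (simp_all add: linear_map_add[OF H.antipode_linear] Sinv_closed S_Sinv)
  show "Sinv (k \<odot>\<^bsub>H\<^esub> x) = k \<odot>\<^bsub>H\<^esub> Sinv x" if "k \<in> carrier K" "x \<in> carrier H" for k x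
    using that
    by (intro Sinv_eqI) (simp_all add: linear_map_smult[OF H.antipode_linear] Sinv_closed S_Sinv)
qed (rule Sinv_closed)

text \<open>The antipode commutes with taking components. Hence the component of degree
  \<open>\<alpha>\<close> of the preimage of \<open>x\<close> is mapped to the component of
  \<open>x\<close>, which is \<open>x\<close> itself; by injectivity the preimage equals that
  component.\<close>

lemma Sinv_homog:
  assumes x: "x \<in> homog H \<alpha>"
  shows "Sinv x \<in> homog H \<alpha>"
proof -
  let ?c = "component H (Sinv x) \<alpha>"
  have y: "Sinv x \<in> carrier H" using x by (intro Sinv_closed hc)
  have c: "?c \<in> homog H \<alpha>" by (rule component_homog_closed[OF H.gH y])
  have "antipode H ?c = component H (antipode H (Sinv x)) \<alpha>"
    by (rule degree0_component[OF H.gH H.gH H.antipode_degree0 y, symmetric])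
  also have "\<dots> = x"
    using S_Sinv[OF hc(1)[OF x]] by (simp add: component_homog[OF H.gH x])
  finally have "Sinv x = ?c" by (intro Sinv_eqI hc(1)[OF c])
  then show ?thesis using c by simp
qed

text \<open>The antipode turns the right-hand product into \<open>x \<otimes> y\<close> with the
  sign \<open>\<omega> \<beta> \<alpha>\<close>, which is inverse to
  \<open>\<omega> \<alpha> \<beta>\<close>. So the inverse antipode has the same sign rule as the
  antipode.\<close>

lemma Sinv_mult:
  assumes x: "x \<in> homog H \<alpha>" and y: "y \<in> homog H \<beta>"
  shows "Sinv (x \<otimes>\<^bsub>H\<^esub> y) = \<omega> \<alpha> \<beta> \<odot>\<^bsub>H\<^esub> (Sinv y \<otimes>\<^bsub>H\<^esub> Sinv x)"
proof (rule Sinv_eqI)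
  note c = hc(1)[OF x] hc(1)[OF y]
  show "\<omega> \<alpha> \<beta> \<odot>\<^bsub>H\<^esub> (Sinv y \<otimes>\<^bsub>H\<^esub> Sinv x) \<in> carrier H"
    using c by (simp add: Sinv_closed H.factor_closed)
  let ?l = "antipode H (\<omega> \<alpha> \<beta> \<odot>\<^bsub>H\<^esub> (Sinv y \<otimes>\<^bsub>H\<^esub> Sinv x))"
    and ?r = "x \<otimes>\<^bsub>H\<^esub> y"
  have "?l = \<omega> \<alpha> \<beta> \<odot>\<^bsub>H\<^esub> (\<omega> \<beta> \<alpha> \<odot>\<^bsub>H\<^esub> (x \<otimes>\<^bsub>H\<^esub> y))"
    using c x y
    by (simp add: linear_map_smult[OF H.antipode_linear] H.antipode_mult[OF Sinv_homog Sinv_homog] S_Sinv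
        Sinv_closed H.factor_closed)
  also have "\<dots> = ?r"
    using c by (simp add: H.smult_assoc1[symmetric] H.factor_closed H.factor_cancel)
  finally show "?l = ?r" .
qed

lemma Sinv_one: "Sinv \<one>\<^bsub>H\<^esub> = \<one>\<^bsub>H\<^esub>"
  by (rule Sinv_eqI) (simp_all add: H.antipode_one)

text \<open>The unit of the dual is the counit, and \<open>S_0\<close> is composition with the
  inverse antipode; this is \<open>S_0(1) = 1\<close> evaluated at \<open>x\<close>.\<close>

lemma counit_Sinv:
  assumes "x \<in> carrier H"
  shows "counit H (Sinv x) = counit H x"
proof -
  have "antipode H0 \<one>\<^bsub>H0\<^esub> x = \<one>\<^bsub>H0\<^esub> x" by (simp add: H0.antipode_one)
  then show ?thesis using assms by (simp add: H0_fields(7,9) Sinv_closed)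
qed

section \<open>Product and coproduct of the dual in terms of values\<close>

lemma H0_tensor: "tensor K F F = tensor K H0 H0" "pure_tensor K F F = pure_tensor K H0 H0"
  by (rule tensor_record_cong; simp add: H0_fields)+

lemma scalar_mult_linear:
  "\<lbrakk>linear_map K M KK f; k \<in> carrier K\<rbrakk> \<Longrightarrow> linear_map K M KK (\<lambda>x. k \<otimes> f x)"
  "\<lbrakk>linear_map K M KK f; k \<in> carrier K\<rbrakk> \<Longrightarrow> linear_map K M KK (\<lambda>x. f x \<otimes> k)"
  using linear_map_const_smult[OF H.mK, of M f k] linear_map_smult_left[OF H.mK, of M f k]
  by (simp_all add: ground_algebra_simps)

lemma tensor_pairing_pure:
  assumes X: "X \<in> carrier (tensor K H0 H0)" and Y: "Y \<in> carrier (tensor K H H)"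
  shows "tensor_pairing K \<omega> H X Y = graded_lift K H0 H0 KK (\<lambda>_ \<beta> f g.
      graded_lift K H H KK (\<lambda>\<alpha> _ x y. \<omega> \<beta> \<alpha> \<otimes> (f x \<otimes> g y)) Y) X"
proof -
  note r = scalar_mult_linear H.factor_closed evaluation_linear functional_linear functional_closed
    linear_map_homog_part gr
  show ?thesis
    unfolding tensor_pairing_def Let_def H0_tensor unfolding H0_fields(1,2)[symmetric]
  proof (rule inner_graded_lift(2)[OF gr(2,2,1,1) md(5) _ _ _ _ X Y])
    show "linear_map K H0 KK (\<lambda>f. \<omega> \<beta> \<alpha> \<otimes> (f x \<otimes> g y))"
      if "g \<in> homog H0 \<beta>" "x \<in> homog H \<alpha>" "y \<in> carrier H" for \<alpha> \<beta> g x y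
      using hc(1)[OF that(2)] hc(2)[OF that(1)] that by (intro r)
    show "linear_map K (homog_part H0 \<beta>) KK (\<lambda>g. \<omega> \<beta> \<alpha> \<otimes> (f x \<otimes> g y))"
      if "f \<in> carrier H0" "x \<in> homog H \<alpha>" "y \<in> carrier H" for \<alpha> \<beta> f x y
      using hc(1)[OF that(2)] that by (intro r)
    show "linear_map K (homog_part H \<alpha>) KK (\<lambda>x. \<omega> \<beta> \<alpha> \<otimes> (f x \<otimes> g y))"
      if "f \<in> carrier H0" "g \<in> homog H0 \<beta>" "y \<in> carrier H" for \<alpha> \<beta> f g y
      using hc(2)[OF that(2)] that by (intro r)
    show "linear_map K H KK (\<lambda>y. \<omega> \<beta> \<alpha> \<otimes> (f x \<otimes> g y))"
      if "f \<in> carrier H0" "g \<in> homog H0 \<beta>" "x \<in> homog H \<alpha>" for \<alpha> \<beta> f g x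
      using hc(1)[OF that(3)] hc(2)[OF that(2)] that by (intro r)
  qed
qed

text \<open>The sign of the pairing involves only the degree of the second functional and that of
  the first leg of \<open>x\<close>. So \<open>f\<close> may be arbitrary: both sides are linear in
  it and agree for homogeneous \<open>f\<close>.\<close>

lemma dual_mult:
  assumes f: "f \<in> carrier H0" and g: "g \<in> homog H0 \<chi>" and x: "x \<in> carrier H"
  shows "(f \<otimes>\<^bsub>H0\<^esub> g) x = H.sw KK (\<lambda>\<alpha> _ a b. \<omega> \<chi> \<alpha> \<otimes> (f a \<otimes> g b)) x"
proof -
  note r = scalar_mult_linear H.factor_closed evaluation_linear functional_linear functional_closed
    linear_map_homog_part gr
  have W: "graded_bilinear K H H KK (\<lambda>\<alpha> _ a b. \<omega> \<chi> \<alpha> \<otimes> (f a \<otimes> g b))"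
    if "f \<in> carrier H0" "g \<in> carrier H0" for f g \<chi>
    using that by (intro graded_bilinearI r hc(1))
  have l: "linear_map K H0 KK (\<lambda>f. graded_lift K H H KK (\<lambda>\<alpha> _ a b. \<omega> \<chi> \<alpha> \<otimes> (f a \<otimes> g b)) (comult H x))"
    if "g \<in> carrier H0" for g \<chi>
    using that hc(1) by (intro graded_lift_param_linear gr md H.comult_closed x W r) auto
  let ?B = "\<lambda>_ \<chi> f g. graded_lift K H H KK (\<lambda>\<alpha> _ a b. \<omega> \<chi> \<alpha> \<otimes> (f a \<otimes> g b)) (comult H x)"
  have B: "graded_bilinear K H0 H0 KK ?B"
    using hc(1)
    by (intro graded_bilinearI graded_lift_param_linear[OF gr(1,1) md(5)] homog_part_module gr H.comult_closed x
        W r hc(2)) (auto simp: homog_part_simps hc(2))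
  have gc: "g \<in> carrier H0" using g by (rule hc(2))
  have "(f \<otimes>\<^bsub>H0\<^esub> g) x = graded_lift K H0 H0 KK ?B (pure_tensor K H0 H0 f g)"
    using x f gc
    by (simp add: H0_fields(6) H0_tensor(2) tensor_pairing_pure[OF pure_tensor_closed[OF md(2,2)]] H.comult_closed)
  also have "\<dots> = ?B \<chi> \<chi> f g"
    by (rule graded_linear_ext[OF gr(2) linear_map_graded_lift[OF gr(2,2) md(5) B
          linear_map_pure_left[OF md(2,2) linear_map_id gc]] l[OF gc] _ f])
      (rule graded_lift_pure[OF gr(2,2) md(5) B _ g])
  finally show ?thesis by (simp add: H.sw_def)
qed

text \<open>The two signs cancel. Where \<open>f2 y\<close> is nonzero, \<open>f2\<close> has degree
  \<open>- \<beta>\<close>, so the sign \<open>\<omega> (- \<beta>) \<alpha>\<close> of the pairing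
  equals the sign \<open>\<omega> \<alpha> \<beta>\<close> prescribed for the coproduct of the dual.
  The latter is a unit and can be divided out.\<close>

lemma comult_pairing:
  assumes f: "f \<in> carrier H0" and x: "x \<in> carrier H" and y: "y \<in> carrier H"
  shows "H0.sw KK (\<lambda>_ _ f1 f2. f1 x \<otimes> f2 y) f = f (y \<otimes>\<^bsub>H\<^esub> x)"
proof -
  note r = scalar_mult_linear H.factor_closed evaluation_linear functional_linear functional_closed
    linear_map_homog_part gr
  have b: "graded_bilinear K H0 H0 KK (\<lambda>_ _ f1 f2. f1 x \<otimes> f2 y)" if "x \<in> carrier H" "y \<in> carrier H" for x y
    using that by (intro graded_bilinearI r hc(2))
  have bH: "graded_bilinear K H H KK (\<lambda>\<alpha> _ x y. \<omega> \<chi> \<alpha> \<otimes> (f1 x \<otimes> f2 y))"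
    if "f1 \<in> carrier H0" "f2 \<in> carrier H0" for f1 f2 \<chi>
    using that by (intro graded_bilinearI r hc(1))
  have hom: "H0.sw KK (\<lambda>_ _ f1 f2. f1 x \<otimes> f2 y) f = f (y \<otimes>\<^bsub>H\<^esub> x)"
    if x: "x \<in> homog H \<alpha>" and y: "y \<in> homog H \<beta>" for x y \<alpha> \<beta>
  proof -
    note c = hc(1)[OF x] hc(1)[OF y]
    have "\<omega> \<alpha> \<beta> \<otimes> f (y \<otimes>\<^bsub>H\<^esub> x) = tensor_pairing K \<omega> H (comult H0 f) (pure_tensor K H H x y)"
      using opp f x y by (simp add: opposite_finite_dual_def)
    also have "\<dots> = graded_lift K H0 H0 KK (\<lambda>_ \<chi> f1 f2.
        graded_lift K H H KK (\<lambda>\<alpha> _ x y. \<omega> \<chi> \<alpha> \<otimes> (f1 x \<otimes> f2 y)) (pure_tensor K H H x y)) (comult H0 f)"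
      using c f by (intro tensor_pairing_pure H0.comult_closed pure_tensor_closed md)
    also have "\<dots> = graded_lift K H0 H0 KK (\<lambda>_ _ f1 f2. \<omega> \<alpha> \<beta> \<otimes> (f1 x \<otimes> f2 y)) (comult H0 f)"
    proof (rule graded_lift_cong[OF gr(2,2)])
      fix \<phi> \<chi> f1 f2 assume h: "f1 \<in> homog H0 \<phi>" "f2 \<in> homog H0 \<chi>"
      have "\<omega> \<chi> \<alpha> \<otimes> (f1 x \<otimes> f2 y) = \<omega> \<alpha> \<beta> \<otimes> (f1 x \<otimes> f2 y)"
      proof (cases "f2 y = \<zero>")
        case True
        then show ?thesis using functional_closed[OF hc(2)[OF h(1)] c(1)] by (simp add: H.factor_closed)
      next
        case False
        then have "\<chi> = - \<beta>" using functional_degree[OF h(2) y] by (simp add: eq_neg_iff_add_eq_0)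
        then show ?thesis by (simp add: H.factor_minus_left)
      qed
      then show "graded_lift K H H KK (\<lambda>\<alpha> _ x y. \<omega> \<chi> \<alpha> \<otimes> (f1 x \<otimes> f2 y)) (pure_tensor K H H x y) =
          \<omega> \<alpha> \<beta> \<otimes> (f1 x \<otimes> f2 y)"
        using graded_lift_pure[OF gr(1,1) md(5) bH[OF hc(2)[OF h(1)] hc(2)[OF h(2)]] x y] by simp
    qed
    also have "\<dots> = \<omega> \<alpha> \<beta> \<otimes> H0.sw KK (\<lambda>_ _ f1 f2. f1 x \<otimes> f2 y) f"
      unfolding H0.sw_def
      by (rule graded_lift_comp[OF gr(2,2) md(5,5) b[OF c]
            scalar_mult_linear(1)[OF linear_map_id[of K KK] H.factor_closed] H0.comult_closed[OF f], symmetric])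
    finally have eq: "\<omega> \<alpha> \<beta> \<otimes> f (y \<otimes>\<^bsub>H\<^esub> x) = \<omega> \<alpha> \<beta> \<otimes> H0.sw KK (\<lambda>_ _ f1 f2. f1 x \<otimes> f2 y) f" .
    show ?thesis
      using H0.sw_closed[OF md(5) b[OF c] f]
      by (intro H.factor_left_cancel[OF _ functional_closed[OF f H.m_closed[OF c(2,1)]] eq[symmetric]])
        (simp add: ground_algebra_simps)
  qed
  have l1: "linear_map K H KK (\<lambda>x. H0.sw KK (\<lambda>_ _ f1 f2. f1 x \<otimes> f2 y) f)" if "y \<in> carrier H" for y
    using that hc(2) by (intro H0.sw_param_linear md f b r) auto
  have l2: "linear_map K H KK (\<lambda>y. H0.sw KK (\<lambda>_ _ f1 f2. f1 x \<otimes> f2 y) f)" if "x \<in> carrier H" for x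
    using that hc(2) by (intro H0.sw_param_linear md f b r) auto
  note fl = linear_map_comp[OF functional_linear[OF f]] bilinear_mapD[OF mult_bilinear[OF H.aH]]
  have *: "H0.sw KK (\<lambda>_ _ f1 f2. f1 x \<otimes> f2 y) f = f (y \<otimes>\<^bsub>H\<^esub> x)" if x: "x \<in> homog H \<alpha>" for x \<alpha>
    by (rule graded_linear_ext[OF gr(1) l2[OF hc(1)[OF x]] fl(1)[OF fl(2)[OF hc(1)[OF x]]] _ y])
      (rule hom[OF x])
  show ?thesis
    by (rule graded_linear_ext[OF gr(1) l1[OF y] fl(1)[OF fl(3)[OF y]] * x])
qed

section \<open>Translates of functionals\<close>

definition right_translate :: "'a \<Rightarrow> ('a \<Rightarrow> 'k) \<Rightarrow> 'a \<Rightarrow> 'k" where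
  "right_translate a f = (\<lambda>v\<in>carrier H. f (v \<otimes>\<^bsub>H\<^esub> a))"

definition left_translate :: "'a \<Rightarrow> ('a \<Rightarrow> 'k) \<Rightarrow> 'a \<Rightarrow> 'k" where
  "left_translate c f = (\<lambda>v\<in>carrier H. f (c \<otimes>\<^bsub>H\<^esub> v))"

abbreviation "Rt \<equiv> right_translate"
abbreviation "Lt \<equiv> left_translate"

lemma translate_apply:
  "v \<in> carrier H \<Longrightarrow> Rt a f v = f (v \<otimes>\<^bsub>H\<^esub> a)" "v \<in> carrier H \<Longrightarrow> Lt a f v = f (a \<otimes>\<^bsub>H\<^esub> v)"
  by (simp_all add: right_translate_def left_translate_def)

lemma contract_left_translate_bilinear:
  "a \<in> carrier H \<Longrightarrow> bilinear_map K H0 H0 H0 (\<lambda>g h. g a \<odot>\<^bsub>H0\<^esub> h)"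
  "a \<in> carrier H \<Longrightarrow> bilinear_map K H0 H0 H0 (\<lambda>g h. h a \<odot>\<^bsub>H0\<^esub> g)"
  by (intro bilinear_mapI linear_map_smult_left[OF md(2) evaluation_linear] linear_map_const_smult md linear_map_id
      functional_closed; assumption)+

text \<open>Contracting the first leg with \<open>a\<close> leaves a functional, and its value at
  \<open>v\<close> is the fully paired coproduct, which is known. The contraction is thus determined
  although the coproduct itself may not be.\<close>

lemma right_translate_eq:
  assumes f: "f \<in> carrier H0" and a: "a \<in> carrier H"
  shows "H0.sw H0 (\<lambda>_ _ g h. g a \<odot>\<^bsub>H0\<^esub> h) f = Rt a f"
proof -
  note b = bilinear_graded_bilinear[OF gr(2,2) contract_left_translate_bilinear(1)[OF a]]
  show ?thesis
  proof (rule extensionalityI[of _ "carrier H"])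
    show "H0.sw H0 (\<lambda>_ _ g h. g a \<odot>\<^bsub>H0\<^esub> h) f \<in> extensional (carrier H)"
      by (rule functional(1)[OF H0.sw_closed[OF md(2) b f]])
    show "Rt a f \<in> extensional (carrier H)" by (simp add: right_translate_def)
    fix v assume v: "v \<in> carrier H"
    have "H0.sw H0 (\<lambda>_ _ g h. g a \<odot>\<^bsub>H0\<^esub> h) f v = H0.sw KK (\<lambda>_ _ g h. (g a \<odot>\<^bsub>H0\<^esub> h) v) f"
      by (rule H0.sw_comp[OF md(2,5) b evaluation_linear[OF v] f])
    also have "\<dots> = Rt a f v"
      using v by (simp add: H0_smult comult_pairing[OF f a v] translate_apply)
    finally show "H0.sw H0 (\<lambda>_ _ g h. g a \<odot>\<^bsub>H0\<^esub> h) f v = Rt a f v" .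
  qed
qed

lemma left_translate_eq:
  assumes f: "f \<in> carrier H0" and a: "a \<in> carrier H"
  shows "H0.sw H0 (\<lambda>_ _ g h. h a \<odot>\<^bsub>H0\<^esub> g) f = Lt a f"
proof -
  note b = bilinear_graded_bilinear[OF gr(2,2) contract_left_translate_bilinear(2)[OF a]]
  show ?thesis
  proof (rule extensionalityI[of _ "carrier H"])
    show "H0.sw H0 (\<lambda>_ _ g h. h a \<odot>\<^bsub>H0\<^esub> g) f \<in> extensional (carrier H)"
      by (rule functional(1)[OF H0.sw_closed[OF md(2) b f]])
    show "Lt a f \<in> extensional (carrier H)" by (simp add: left_translate_def)
    fix v assume v: "v \<in> carrier H"
    have "H0.sw H0 (\<lambda>_ _ g h. h a \<odot>\<^bsub>H0\<^esub> g) f v = H0.sw KK (\<lambda>_ _ g h. (h a \<odot>\<^bsub>H0\<^esub> g) v) f"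
      by (rule H0.sw_comp[OF md(2,5) b evaluation_linear[OF v] f])
    also have "\<dots> = H0.sw KK (\<lambda>_ _ g h. g v \<otimes> h a) f"
      using v a by (intro H0.sw_cong) (simp add: H0_smult H.m_comm functional_closed hc(2))
    also have "\<dots> = Lt a f v"
      using v by (simp add: comult_pairing[OF f v a] translate_apply)
    finally show "H0.sw H0 (\<lambda>_ _ g h. h a \<odot>\<^bsub>H0\<^esub> g) f v = Lt a f v" .
  qed
qed

text \<open>Membership in the finite dual comes from the contractions, which lie in
  \<open>H0\<close>; no ideal with finitely generated quotient has to be exhibited for a
  translate.\<close>

lemma translate_closed:
  assumes "f \<in> carrier H0" "a \<in> carrier H"
  shows "Rt a f \<in> carrier H0" "Lt a f \<in> carrier H0"
  using H0.sw_closed[OF md(2) bilinear_graded_bilinear[OF gr(2,2) contract_left_translate_bilinear(1)[OF assms(2)]] assms(1)]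
    H0.sw_closed[OF md(2) bilinear_graded_bilinear[OF gr(2,2) contract_left_translate_bilinear(2)[OF assms(2)]] assms(1)]
  by (simp_all add: right_translate_eq left_translate_eq assms)

lemma translate_homog:
  assumes "f \<in> homog H0 \<phi>" "a \<in> homog H \<alpha>"
  shows "Rt a f \<in> homog H0 (\<phi> + \<alpha>)" "Lt a f \<in> homog H0 (\<phi> + \<alpha>)"
proof -
  note c = hc(2)[OF assms(1)] hc(1)[OF assms(2)]
  have "\<phi> + (\<xi> + \<alpha>) = 0 \<Longrightarrow> \<xi> = - (\<phi> + \<alpha>)" for \<xi>
    by (simp add: eq_neg_iff_add_eq_0 algebra_simps)
  then show "Rt a f \<in> homog H0 (\<phi> + \<alpha>)"
    using functional_degree[OF assms(1) H.mult_homog[OF _ assms(2)]]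
    by (intro functional_homogI translate_closed c) (auto simp: translate_apply hc(1))
  have "\<phi> + (\<alpha> + \<xi>) = 0 \<Longrightarrow> \<xi> = - (\<phi> + \<alpha>)" for \<xi>
    by (simp add: eq_neg_iff_add_eq_0 algebra_simps)
  then show "Lt a f \<in> homog H0 (\<phi> + \<alpha>)"
    using functional_degree[OF assms(1) H.mult_homog[OF assms(2)]]
    by (intro functional_homogI translate_closed c) (auto simp: translate_apply hc(1))
qed

lemma translate_linear_left:
  assumes f: "f \<in> carrier H0"
  shows "linear_map K H H0 (\<lambda>a. Rt a f)" "linear_map K H H0 (\<lambda>a. Lt a f)"
  by (intro linear_mapI functional_ext;
      simp add: translate_closed f translate_apply hc(1) H0_add H0_smult H.r_distr H.l_distr H.smult_mult_left
        H.smult_mult_right linear_map_add[OF functional_linear[OF f]] linear_map_smult[OF functional_linear[OF f]]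
        ground_algebra_simps)+

lemma translate_linear_right:
  assumes a: "a \<in> carrier H"
  shows "linear_map K H0 H0 (\<lambda>f. Rt a f)" "linear_map K H0 H0 (\<lambda>f. Lt a f)"
  by (intro linear_mapI functional_ext; simp add: translate_closed a translate_apply hc(1) H0_add H0_smult)+

section \<open>The exchange map at homogeneous functionals\<close>

abbreviation "\<psi> \<equiv> double_exchange K \<omega> H H0"
abbreviation "q \<equiv> pure_tensor K H0 H"

text \<open>Introduction rules that follow a summand from the outside in, so that its linearity in
  one variable, inside nested sums too, reduces to membership in carriers.\<close>

lemmas lin = graded_bilinearI H.sw_linear[OF mD] H.sw_param_linear[OF mD] linear_map_const_smult[OF mD]
  linear_map_pure_left[OF md(1,2)] linear_map_pure_right[OF md(1,2)]
  linear_map_comp[OF translate_linear_left(1)] linear_map_comp[OF translate_linear_left(2)]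
  linear_map_comp[OF translate_linear_right(1)] linear_map_comp[OF translate_linear_right(2)]
  linear_map_comp[OF Sinv_linear] linear_map_mult_left[OF H.aH] linear_map_mult_right[OF H.aH]
  linear_map_mult_left[OF H0.aH] linear_map_mult_right[OF H0.aH]

  linear_map_homog_id[OF gr(1)] linear_map_homog_id[OF gr(2)] linear_map_id
  homog_part_module[OF gr(1)] homog_part_module[OF gr(2)] H.factor_closed mD

lemmas cl = homog_part_simps hc functional_closed translate_closed Sinv_closed pure_tensor_closed[OF md(1,2)]
  H.factor_closed

lemma dual_right_action_eq:
  assumes "f \<in> carrier H0" "x \<in> carrier H"
  shows "dual_right_action K H0 f x = Lt x f"
  unfolding dual_right_action_def contract_right_eq
  using left_translate_eq[OF assms]
    tensor_lift_eq_graded_lift[OF gr(2,2) md(2) contract_left_translate_bilinear(2)[OF assms(2)] H0.comult_closed[OF assms(1)]]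
  by (simp add: H0.sw_def)

lemma left_action_bilinear:
  assumes "f \<in> carrier H0"
  shows "bilinear_map K H H H (\<lambda>u v. f (Sinv u) \<odot>\<^bsub>H\<^esub> v)"
  using assms
  by (intro bilinear_mapI linear_map_smult_left[OF md(1) linear_map_comp[OF functional_linear Sinv_linear]]
      linear_map_const_smult[OF md(1)] linear_map_id functional_closed Sinv_closed)

lemma dual_left_action_eq:
  assumes f: "f \<in> carrier H0" and x: "x \<in> carrier H"
  shows "dual_left_action K H H0 f x = H.sw H (\<lambda>_ _ u v. f (Sinv u) \<odot>\<^bsub>H\<^esub> v) x"
proof -
  have "contract_left K H H (antipode H0 f) (comult H x) =
      tensor_lift K H H H (\<lambda>u v. f (Sinv u) \<odot>\<^bsub>H\<^esub> v) (comult H x)"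
    unfolding contract_left_eq by (rule tensor_lift_cong) (simp add: H0_fields(9))
  then show ?thesis
    using tensor_lift_eq_graded_lift[OF gr(1,1) md(1) left_action_bilinear[OF f] H.comult_closed[OF x]]
    by (simp add: dual_left_action_def H.sw_def)
qed

lemma dual_left_action_linear:
  "f \<in> carrier H0 \<Longrightarrow> linear_map K H H (\<lambda>x. dual_left_action K H H0 f x)"
  "x \<in> carrier H \<Longrightarrow> linear_map K H0 H (\<lambda>f. dual_left_action K H H0 f x)"
proof -
  note b = bilinear_graded_bilinear[OF gr(1,1) left_action_bilinear]
  show "linear_map K H H (\<lambda>x. dual_left_action K H H0 f x)" if "f \<in> carrier H0"
    by (rule linear_map_cong[OF md(1) H.sw_linear[OF md(1) b[OF that] linear_map_id]])
      (simp add: dual_left_action_eq that)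
  show "linear_map K H0 H (\<lambda>f. dual_left_action K H H0 f x)" if x: "x \<in> carrier H"
  proof (rule linear_map_cong[OF md(2) H.sw_param_linear[OF md(1,2) x b]])
    show "linear_map K H0 H (\<lambda>f. f (Sinv u) \<odot>\<^bsub>H\<^esub> v)" if "u \<in> homog H \<alpha>" "v \<in> homog H \<beta>" for u v \<alpha> \<beta>
      using that by (intro linear_map_smult_left[OF md(1) evaluation_linear] Sinv_closed hc(1))
  qed (simp_all add: dual_left_action_eq x)
qed

lemma dual_left_action_closed: "\<lbrakk>f \<in> carrier H0; x \<in> carrier H\<rbrakk> \<Longrightarrow> dual_left_action K H H0 f x \<in> carrier H"
  by (rule linear_map_closed[OF dual_left_action_linear(1)])

lemma dual_right_action_linear:
  assumes x: "x \<in> carrier H"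
  shows "linear_map K H0 H0 (\<lambda>f. dual_right_action K H0 f x)"
  by (rule linear_map_cong[OF md(2) translate_linear_right(2)[OF x]]) (simp add: dual_right_action_eq x)

lemma dual_right_action_linear':
  assumes f: "f \<in> carrier H0"
  shows "linear_map K H H0 (\<lambda>x. dual_right_action K H0 f x)"
  by (rule linear_map_cong[OF md(1) translate_linear_left(2)[OF f]]) (simp add: dual_right_action_eq f)

lemma exchange_linear: "linear_map K (tensor K H0 H) D \<psi>"
  and exchange_pure: "\<lbrakk>f \<in> carrier H0; x \<in> carrier H\<rbrakk> \<Longrightarrow> \<psi> (q f x) =
    H0.sw D (\<lambda>_ \<beta> f1 f2. H.sw D (\<lambda>\<alpha> _ x1 x2. \<omega> \<beta> \<alpha> \<odot>\<^bsub>D\<^esub>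
      p (dual_left_action K H H0 f1 x1) (dual_right_action K H0 f2 x2)) x) f"
proof -
  let ?W = "\<lambda>\<alpha> \<beta> f1 f2 x1 x2. \<omega> \<beta> \<alpha> \<odot>\<^bsub>D\<^esub> p (dual_left_action K H H0 f1 x1) (dual_right_action K H0 f2 x2)"
  note r = linear_map_const_smult[OF mD] H.factor_closed linear_map_pure_left[OF md(1,2)] linear_map_pure_right[OF md(1,2)]
    dual_left_action_linear dual_right_action_linear dual_right_action_linear'
    linear_map_homog_part gr dual_left_action_closed linear_map_closed[OF dual_right_action_linear]
  have W1: "linear_map K H0 D (\<lambda>f1. ?W \<alpha> \<beta> f1 f2 x1 x2)"
    if "f2 \<in> homog H0 \<beta>" "x1 \<in> homog H \<alpha>" "x2 \<in> carrier H" for \<alpha> \<beta> f2 x1 x2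
    using hc(2)[OF that(1)] hc(1)[OF that(2)] that by (intro r)
  have W2: "linear_map K (homog_part H0 \<beta>) D (\<lambda>f2. ?W \<alpha> \<beta> f1 f2 x1 x2)"
    if "f1 \<in> carrier H0" "x1 \<in> homog H \<alpha>" "x2 \<in> carrier H" for \<alpha> \<beta> f1 x1 x2
    using hc(1)[OF that(2)] that by (intro r)
  have W3: "linear_map K (homog_part H \<alpha>) D (\<lambda>x1. ?W \<alpha> \<beta> f1 f2 x1 x2)"
    if "f1 \<in> carrier H0" "f2 \<in> homog H0 \<beta>" "x2 \<in> carrier H" for \<alpha> \<beta> f1 f2 x2
    using hc(2)[OF that(2)] that by (intro r)
  have W4: "linear_map K H D (\<lambda>x2. ?W \<alpha> \<beta> f1 f2 x1 x2)"
    if "f1 \<in> carrier H0" "f2 \<in> homog H0 \<beta>" "x1 \<in> homog H \<alpha>" for \<alpha> \<beta> f1 f2 x1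
    using hc(2)[OF that(2)] hc(1)[OF that(3)] that by (intro r)
  note ig = inner_graded_lift[OF gr(2,2,1,1) mD W1 W2 W3 W4]
  note tm = tensor_map_props[OF gr(2,1) H0.gHH H.gHH H0.comult_linear H.comult_linear]
  show "linear_map K (tensor K H0 H) D \<psi>"
    unfolding double_exchange_def Let_def by (rule linear_map_comp[OF ig(1) tm(1)])
  show "\<psi> (q f x) = H0.sw D (\<lambda>_ \<beta> f1 f2. H.sw D (\<lambda>\<alpha> _ x1 x2. ?W \<alpha> \<beta> f1 f2 x1 x2) x) f"
    if f: "f \<in> carrier H0" and x: "x \<in> carrier H"
    unfolding double_exchange_def Let_def tm(2)[OF f x] H.sw_def H0.sw_def
    by (rule ig(2)) (assumption | rule H0.comult_closed[OF f] H.comult_closed[OF x])+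
qed

text \<open>In the definition the sign pairs the degrees of \<open>f2\<close> and \<open>x1\<close>.
  A term survives only if \<open>f1\<close> has degree \<open>- \<gamma>\<close>, opposite to the
  leg \<open>u\<close> of \<open>x1\<close>; then \<open>f2\<close> has degree
  \<open>\<phi> + \<gamma>\<close>, while \<open>x1\<close> has degree
  \<open>\<gamma> + \<delta>\<close>. The sign no longer depends on how \<open>f\<close> is split,
  and the sum over the coproduct of \<open>f\<close> becomes a translate.\<close>

lemma exchange_homog:
  assumes f: "f \<in> homog H0 \<phi>" and x: "x \<in> carrier H"
  shows "\<psi> (q f x) = H.sw D (\<lambda>\<alpha> \<beta> x1 x2. H.sw D (\<lambda>\<gamma> \<delta> u v.
    \<omega> (\<phi> + \<gamma>) (\<gamma> + \<delta>) \<odot>\<^bsub>D\<^esub> p v (Lt x2 (Rt (Sinv u) f))) x1) x"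
proof -
  note fc = hc(2)[OF f]
  \<comment> \<open>A single term with its sign as the parameter \<open>k\<close>: linearity in each
    element is proved once, and the same rules serve sums in which the sign varies with different
    degrees.\<close>
  define S where "S k f1 f2 x2 u v = k \<odot>\<^bsub>D\<^esub> (f1 (Sinv u) \<odot>\<^bsub>D\<^esub> p v (Lt x2 f2))" for k f1 f2 x2 u v
  note pc = pure_tensor_closed[OF md(1,2)]
  have Su: "linear_map K H D (\<lambda>u. S k f1 f2 x2 u v)" if "k \<in> carrier K" "f1 \<in> carrier H0" "f2 \<in> carrier H0" "x2 \<in> carrier H" "v \<in> carrier H"
    for k f1 f2 x2 v
    unfolding S_def using that
    by (intro linear_map_const_smult[OF mD] linear_map_smult_left[OF mD linear_map_comp[OF functional_linear Sinv_linear]]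
        pc translate_closed)
  have Sv: "linear_map K H D (\<lambda>v. S k f1 f2 x2 u v)" if "k \<in> carrier K" "f1 \<in> carrier H0" "f2 \<in> carrier H0" "x2 \<in> carrier H" "u \<in> carrier H"
    for k f1 f2 x2 u
    unfolding S_def using that functional_closed[OF that(2) Sinv_closed[OF that(5)]]
    by (intro linear_map_const_smult[OF mD] linear_map_pure_left[OF md(1,2)] linear_map_id translate_closed)
  have Sx: "linear_map K H D (\<lambda>x2. S k f1 f2 x2 u v)" if "k \<in> carrier K" "f1 \<in> carrier H0" "f2 \<in> carrier H0" "u \<in> carrier H" "v \<in> carrier H"
    for k f1 f2 u v
    unfolding S_def using that functional_closed[OF that(2) Sinv_closed[OF that(4)]]
    by (intro linear_map_const_smult[OF mD] linear_map_pure_right[OF md(1,2)] translate_linear_left(2))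
  have Sf1: "linear_map K H0 D (\<lambda>f1. S k f1 f2 x2 u v)" if "k \<in> carrier K" "f2 \<in> carrier H0" "x2 \<in> carrier H" "u \<in> carrier H" "v \<in> carrier H"
    for k f2 x2 u v
    unfolding S_def using that
    by (intro linear_map_const_smult[OF mD] linear_map_smult_left[OF mD evaluation_linear] Sinv_closed pc translate_closed)
  have Sf2: "linear_map K H0 D (\<lambda>f2. S k f1 f2 x2 u v)" if "k \<in> carrier K" "f1 \<in> carrier H0" "x2 \<in> carrier H" "u \<in> carrier H" "v \<in> carrier H"
    for k f1 x2 u v
    unfolding S_def using that functional_closed[OF that(2) Sinv_closed[OF that(4)]]
    by (intro linear_map_const_smult[OF mD] linear_map_pure_right[OF md(1,2)] translate_linear_right(2))
  note Slin = Su Sv Sx Sf1 Sf2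
  have Suv: "graded_bilinear K H H D (\<lambda>\<gamma> \<delta> u v. S k f1 f2 x2 u v)"
    if "k \<in> carrier K" "f1 \<in> carrier H0" "f2 \<in> carrier H0" "x2 \<in> carrier H" for k f1 f2 x2
    using that hc(1) by (intro graded_bilinearI linear_map_homog_part gr Slin) auto
  have act: "k \<odot>\<^bsub>D\<^esub> p (dual_left_action K H H0 f1 x1) (dual_right_action K H0 f2 x2) =
      H.sw D (\<lambda>\<gamma> \<delta> u v. S k f1 f2 x2 u v) x1"
    if k: "k \<in> carrier K" and f1: "f1 \<in> carrier H0" and f2: "f2 \<in> carrier H0"
      and x1: "x1 \<in> carrier H" and x2: "x2 \<in> carrier H" for k f1 f2 x1 x2
  proof -
    have G: "linear_map K H D (\<lambda>z. k \<odot>\<^bsub>D\<^esub> p z (Lt x2 f2))"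
      by (intro linear_map_const_smult[OF mD] linear_map_pure_left[OF md(1,2)] linear_map_id translate_closed k f2 x2)
    note G' = linear_map_pure_left[OF md(1,2) linear_map_id translate_closed(2)[OF f2 x2]]
    have "k \<odot>\<^bsub>D\<^esub> p (H.sw H (\<lambda>_ _ u v. f1 (Sinv u) \<odot>\<^bsub>H\<^esub> v) x1) (Lt x2 f2) =
        H.sw D (\<lambda>_ _ u v. k \<odot>\<^bsub>D\<^esub> p (f1 (Sinv u) \<odot>\<^bsub>H\<^esub> v) (Lt x2 f2)) x1"
      by (rule H.sw_comp[OF md(1) mD bilinear_graded_bilinear[OF gr(1,1) left_action_bilinear[OF f1]] G x1])
    also have "\<dots> = H.sw D (\<lambda>\<gamma> \<delta> u v. S k f1 f2 x2 u v) x1"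
      unfolding S_def by (intro H.sw_cong) (simp add: linear_map_smult[OF G'] functional_closed f1 Sinv_closed hc(1))
    finally show ?thesis by (simp add: dual_left_action_eq dual_right_action_eq f1 f2 x1 x2)
  qed
  have Sff: "graded_bilinear K H0 H0 D (\<lambda>_ \<chi> f1 f2. S (\<omega> \<chi> \<alpha>) f1 f2 x2 u v)"
    if "x2 \<in> carrier H" "u \<in> carrier H" "v \<in> carrier H" for \<alpha> x2 u v
    using that hc(2) H.factor_closed by (intro graded_bilinearI linear_map_homog_part gr Slin) auto
  have Qx: "graded_bilinear K H H D (\<lambda>\<alpha> _ x1 x2. H.sw D (\<lambda>\<gamma> \<delta> u v. S (\<omega> \<chi> \<alpha>) f1 f2 x2 u v) x1)"
    if "f1 \<in> carrier H0" "f2 \<in> carrier H0" for f1 f2 \<chi>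
    using that hc(1) H.factor_closed
    by (intro graded_bilinearI H.sw_linear[OF mD Suv] H.sw_param_linear[OF mD _ _ Suv] homog_part_module
        linear_map_homog_part gr linear_map_id Sx) (auto simp: homog_part_simps)
  have Qf: "graded_bilinear K H0 H0 D (\<lambda>_ \<chi> f1 f2. H.sw D (\<lambda>\<gamma> \<delta> u v. S (\<omega> \<chi> \<alpha>) f1 f2 x2 u v) x1)"
    if "x1 \<in> carrier H" "x2 \<in> carrier H" for \<alpha> x1 x2
    using that hc H.factor_closed
    by (intro graded_bilinearI H.sw_param_linear[OF mD _ _ Suv] homog_part_module
        linear_map_homog_part gr Sf1 Sf2) (auto simp: homog_part_simps)
  \<comment> \<open>The sum over the legs of \<open>f\<close> with all legs of \<open>x\<close> held
    fixed. If \<open>f1 (Sinv u)\<close> vanishes the sign is irrelevant; otherwise it is the one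
    computed from \<open>\<phi>\<close> and \<open>\<gamma>\<close>.\<close>
  have inner: "H0.sw D (\<lambda>_ \<chi> f1 f2. S (\<omega> \<chi> \<alpha>) f1 f2 x2 u v) f =
      \<omega> (\<phi> + \<gamma>) \<alpha> \<odot>\<^bsub>D\<^esub> p v (Lt x2 (Rt (Sinv u) f))"
    if x2: "x2 \<in> carrier H" and u: "u \<in> homog H \<gamma>" and v: "v \<in> carrier H" for \<alpha> x2 u \<gamma> v
  proof -
    note uc = hc(1)[OF u]
    let ?G = "\<lambda>h. \<omega> (\<phi> + \<gamma>) \<alpha> \<odot>\<^bsub>D\<^esub> p v (Lt x2 h)"
    have G': "linear_map K H0 D (\<lambda>h. p v (Lt x2 h))"
      by (intro linear_map_pure_right[OF md(1,2)] translate_linear_right x2 v)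
    have G: "linear_map K H0 D ?G"
      by (intro linear_map_const_smult[OF mD] G' H.factor_closed)
    have b: "graded_bilinear K H0 H0 D (\<lambda>_ _ f1 f2. S (\<omega> (\<phi> + \<gamma>) \<alpha>) f1 f2 x2 u v)"
      using hc(2) x2 uc v H.factor_closed by (intro graded_bilinearI linear_map_homog_part gr Slin) auto
    have "H0.sw D (\<lambda>_ \<chi> f1 f2. S (\<omega> \<chi> \<alpha>) f1 f2 x2 u v) f =
        H0.sw D (\<lambda>_ _ f1 f2. S (\<omega> (\<phi> + \<gamma>) \<alpha>) f1 f2 x2 u v) f"
    proof (rule H0.sw_homog_cong[OF mD Sff[OF x2 uc v] b f])
      fix \<phi>1 \<chi> f1 f2 assume h: "f1 \<in> homog H0 \<phi>1" "f2 \<in> homog H0 \<chi>" "\<phi>1 + \<chi> = \<phi>"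
      show "S (\<omega> \<chi> \<alpha>) f1 f2 x2 u v = S (\<omega> (\<phi> + \<gamma>) \<alpha>) f1 f2 x2 u v"
      proof (cases "f1 (Sinv u) = \<zero>")
        case True
        interpret D: module K D by (rule mD)
        show ?thesis
          unfolding S_def True using pc[OF v translate_closed(2)[OF hc(2)[OF h(2)] x2]]
          by (simp add: H.factor_closed)
      next
        case False
        then have "\<phi>1 + \<gamma> = 0" by (rule functional_degree[OF h(1) Sinv_homog[OF u]])
        then have "\<phi>1 = - \<gamma>" by (simp add: eq_neg_iff_add_eq_0)
        then have "\<chi> = \<phi> + \<gamma>" using h(3) by auto
        then show ?thesis by simp
      qed
    qed
    also have "\<dots> = H0.sw D (\<lambda>_ _ f1 f2. ?G (f1 (Sinv u) \<odot>\<^bsub>H0\<^esub> f2)) f"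
      unfolding S_def using uc
      by (intro H0.sw_cong) (simp add: linear_map_smult[OF G'] functional_closed Sinv_closed hc(2))
    also have "\<dots> = ?G (H0.sw H0 (\<lambda>_ _ f1 f2. f1 (Sinv u) \<odot>\<^bsub>H0\<^esub> f2) f)"
      by (rule H0.sw_comp[OF md(2) mD bilinear_graded_bilinear[OF gr(2,2)
              contract_left_translate_bilinear(1)[OF Sinv_closed[OF uc]]] G fc, symmetric])
    also have "\<dots> = ?G (Rt (Sinv u) f)"
      by (simp add: right_translate_eq fc Sinv_closed uc)
    finally show ?thesis .
  qed
  have tb: "graded_bilinear K H H D (\<lambda>\<gamma> \<delta> u v. \<omega> (\<phi> + \<gamma>) (h \<gamma> \<delta>) \<odot>\<^bsub>D\<^esub> p v (Lt x2 (Rt (Sinv u) f)))"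
    if "x2 \<in> carrier H" for x2 h
    using that by (intro lin) (simp_all add: cl fc)
  have "\<psi> (q f x) = H0.sw D (\<lambda>_ \<chi> f1 f2. H.sw D (\<lambda>\<alpha> _ x1 x2.
      H.sw D (\<lambda>\<gamma> \<delta> u v. S (\<omega> \<chi> \<alpha>) f1 f2 x2 u v) x1) x) f"
    unfolding exchange_pure[OF fc x]
    by (intro H0.sw_cong H.sw_cong act H.factor_closed hc)
  \<comment> \<open>The sum over the legs of \<open>f\<close> moves inwards, past the sum over the
    legs of \<open>x\<close> and then past that over the legs of \<open>x1\<close>, until it stands
    where \<open>inner\<close> evaluates it.\<close>
  also have "\<dots> = H.sw D (\<lambda>\<alpha> _ x1 x2. H0.sw D (\<lambda>_ \<chi> f1 f2.
      H.sw D (\<lambda>\<gamma> \<delta> u v. S (\<omega> \<chi> \<alpha>) f1 f2 x2 u v) x1) f) x"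
    unfolding H.sw_def[where x = x] H0.sw_def
    by (rule graded_lift_swap[OF gr(2,2,1,1) mD H0.comult_closed[OF fc] H.comult_closed[OF x]])
      (intro Qf Qx hc; assumption)+
  also have "\<dots> = H.sw D (\<lambda>\<alpha> _ x1 x2. H.sw D (\<lambda>\<gamma> \<delta> u v.
      H0.sw D (\<lambda>_ \<chi> f1 f2. S (\<omega> \<chi> \<alpha>) f1 f2 x2 u v) f) x1) x"
  proof (rule H.sw_cong)
    fix \<alpha> \<beta> x1 x2 assume h: "x1 \<in> homog H \<alpha>" "x2 \<in> homog H \<beta>"
    show "H0.sw D (\<lambda>_ \<chi> f1 f2. H.sw D (\<lambda>\<gamma> \<delta> u v. S (\<omega> \<chi> \<alpha>) f1 f2 x2 u v) x1) f =
        H.sw D (\<lambda>\<gamma> \<delta> u v. H0.sw D (\<lambda>_ \<chi> f1 f2. S (\<omega> \<chi> \<alpha>) f1 f2 x2 u v) f) x1"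
      unfolding H.sw_def H0.sw_def
      by (rule graded_lift_swap[OF gr(2,2,1,1) mD H0.comult_closed[OF fc] H.comult_closed[OF hc(1)[OF h(1)]]])
        (intro Sff Suv H.factor_closed hc(1)[OF h(2)] hc; assumption)+
  qed
  also have "\<dots> = H.sw D (\<lambda>\<alpha> \<beta> x1 x2. H.sw D (\<lambda>\<gamma> \<delta> u v.
      \<omega> (\<phi> + \<gamma>) (\<gamma> + \<delta>) \<odot>\<^bsub>D\<^esub> p v (Lt x2 (Rt (Sinv u) f))) x1) x"
  proof (rule H.sw_cong)
    fix \<alpha> \<beta> x1 x2 assume h: "x1 \<in> homog H \<alpha>" "x2 \<in> homog H \<beta>"
    let ?l = "H.sw D (\<lambda>\<gamma> \<delta> u v. H0.sw D (\<lambda>_ \<chi> f1 f2. S (\<omega> \<chi> \<alpha>) f1 f2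
        x2 u v) f) x1"
      and ?r = "H.sw D (\<lambda>\<gamma> \<delta> u v. \<omega> (\<phi> + \<gamma>) (\<gamma> + \<delta>)
        \<odot>\<^bsub>D\<^esub> p v (Lt x2 (Rt (Sinv u) f))) x1"
    have "?l = H.sw D (\<lambda>\<gamma> \<delta> u v. \<omega> (\<phi> + \<gamma>) \<alpha> \<odot>\<^bsub>D\<^esub> p v (Lt x2 (Rt (Sinv u) f))) x1"
      by (intro H.sw_cong inner hc(1)[OF h(2)] hc(1)) 
    \<comment> \<open>The legs \<open>u\<close> and \<open>v\<close> of the homogeneous
      \<open>x1\<close> have degrees with sum \<open>\<alpha>\<close>, so the sign can be written
      with \<open>\<gamma> + \<delta>\<close>. The free function \<open>h\<close> in
      \<open>tb\<close> covers both forms.\<close>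
    also have "\<dots> = ?r"
      by (rule H.sw_homog_cong[OF mD tb tb h(1)]) (simp_all add: hc(1)[OF h(2)])
    finally show "?l = ?r" .
  qed
  finally show ?thesis .
qed

section \<open>Translates of a product of functionals\<close>

lemma dual_mult_bilinear:
  assumes "f \<in> carrier H0" "g \<in> carrier H0"
  shows "graded_bilinear K H H KK (\<lambda>\<alpha> \<beta> a b. \<omega> \<chi> (h \<alpha> \<beta>) \<otimes> (f a \<otimes> g b))"
  using assms hc(1)
  by (intro graded_bilinearI scalar_mult_linear H.factor_closed linear_map_homog_part gr functional_linear)
    (auto simp: functional_closed)

lemma dual_mult_closed: "\<lbrakk>f \<in> carrier H0; g \<in> carrier H0\<rbrakk> \<Longrightarrow> f \<otimes>\<^bsub>H0\<^esub> g \<in> carrier H0"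
  by (rule H0.m_closed)

lemma scalar_linear: "k \<in> carrier K \<Longrightarrow> linear_map K KK KK (\<lambda>z. k \<otimes> z)"
  by (rule scalar_mult_linear(1)[OF linear_map_id[of K KK]])

text \<open>Multiplicativity of the coproduct at \<open>c \<otimes> v\<close>. Its sign
  \<open>\<omega> \<beta> \<gamma>\<close> combines with a part of
  \<open>\<omega> \<chi> (\<alpha> + \<gamma>)\<close> to
  \<open>\<omega> (\<chi> + \<beta>) \<gamma>\<close>, the sign of a product with second factor
  \<open>Lt b g\<close>, of degree \<open>\<chi> + \<beta>\<close>; what is left is
  \<open>\<omega> \<chi> \<alpha>\<close>.\<close>

lemma left_translate_mult:
  assumes f: "f \<in> carrier H0" and g: "g \<in> homog H0 \<chi>" and c: "c \<in> carrier H"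
  shows "Lt c (f \<otimes>\<^bsub>H0\<^esub> g) = H.sw H0 (\<lambda>\<alpha> _ a b. \<omega> \<chi> \<alpha> \<odot>\<^bsub>H0\<^esub> (Lt a f \<otimes>\<^bsub>H0\<^esub> Lt b g)) c"
proof -
  note gc = hc(2)[OF g]
  have b: "graded_bilinear K H H H0 (\<lambda>\<alpha> _ a b. \<omega> \<chi> \<alpha> \<odot>\<^bsub>H0\<^esub> (Lt a f \<otimes>\<^bsub>H0\<^esub> Lt b g))"
    by (intro graded_bilinearI linear_map_const_smult[OF md(2)] linear_map_mult_left[OF H0.aH]
        linear_map_mult_right[OF H0.aH] linear_map_comp[OF translate_linear_left(2)]
        linear_map_homog_id[OF gr(1)] H.factor_closed) (simp_all add: cl f gc)
  show ?thesis
  proof (rule functional_ext[OF translate_closed(2)[OF dual_mult_closed[OF f gc] c] H.sw_closed[OF md(2) b c]])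
    fix \<xi> v assume "v \<in> homog H \<xi>"
    then have v: "v \<in> carrier H" by (rule hc)
    have "H.sw H0 (\<lambda>\<alpha> _ a b. \<omega> \<chi> \<alpha> \<odot>\<^bsub>H0\<^esub> (Lt a f \<otimes>\<^bsub>H0\<^esub> Lt b g)) c v =
        H.sw KK (\<lambda>\<alpha> _ a b. (\<omega> \<chi> \<alpha> \<odot>\<^bsub>H0\<^esub> (Lt a f \<otimes>\<^bsub>H0\<^esub> Lt b g)) v) c"
      by (rule H.sw_comp[OF md(2,5) b evaluation_linear[OF v] c])
    also have "\<dots> = H.sw KK (\<lambda>\<alpha> \<beta> a b. H.sw KK (\<lambda>\<gamma> \<delta> a' b'.
        \<omega> \<beta> \<gamma> \<odot>\<^bsub>KK\<^esub> (\<omega> \<chi> (\<alpha> + \<gamma>) \<otimes> (f (a \<otimes>\<^bsub>H\<^esub> a') \<otimes> g (b \<otimes>\<^bsub>H\<^esub> b')))) v) c"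
    proof (rule H.sw_cong)
      fix \<alpha> \<beta> a b assume ab: "a \<in> homog H \<alpha>" "b \<in> homog H \<beta>"
      note abc = hc(1)[OF ab(1)] hc(1)[OF ab(2)]
      let ?l = "(\<omega> \<chi> \<alpha> \<odot>\<^bsub>H0\<^esub> (Lt a f \<otimes>\<^bsub>H0\<^esub> Lt b g)) v"
        and ?r = "H.sw KK (\<lambda>\<gamma> \<delta> a' b'. \<omega> \<beta> \<gamma> \<odot>\<^bsub>KK\<^esub> (\<omega>
          \<chi> (\<alpha> + \<gamma>) \<otimes> (f (a \<otimes>\<^bsub>H\<^esub> a') \<otimes> g (b
          \<otimes>\<^bsub>H\<^esub> b')))) v"
      have "?l = \<omega> \<chi> \<alpha> \<otimes> (Lt a f \<otimes>\<^bsub>H0\<^esub> Lt b g) v"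
        using v by (rule H0_smult)
      also have "\<dots> = \<omega> \<chi> \<alpha> \<otimes> H.sw KK (\<lambda>\<gamma> _ a' b'. \<omega> (\<chi> + \<beta>) \<gamma> \<otimes> (Lt a f a' \<otimes> Lt b g b')) v"
        by (simp add: dual_mult[OF translate_closed(2)[OF f abc(1)] translate_homog(2)[OF g ab(2)] v])
      also have "\<dots> = H.sw KK (\<lambda>\<gamma> _ a' b'. \<omega> \<chi> \<alpha> \<otimes> (\<omega> (\<chi> + \<beta>) \<gamma> \<otimes> (Lt a f a' \<otimes> Lt b g b'))) v"
        by (rule H.sw_comp[OF md(5,5) dual_mult_bilinear[OF translate_closed(2)[OF f abc(1)] translate_closed(2)[OF gc abc(2)]]
              scalar_linear[OF H.factor_closed] v])
      also have "\<dots> = ?r"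
      proof (rule H.sw_cong)
        fix \<gamma> \<delta> a' b' assume ab': "a' \<in> homog H \<gamma>" "b' \<in> homog H \<delta>"
        note abc' = hc(1)[OF ab'(1)] hc(1)[OF ab'(2)]
        have "f (a \<otimes>\<^bsub>H\<^esub> a') \<in> carrier K" "g (b \<otimes>\<^bsub>H\<^esub> b') \<in> carrier K"
          using abc abc' f gc by (simp_all add: functional_closed)
        then show "\<omega> \<chi> \<alpha> \<otimes> (\<omega> (\<chi> + \<beta>) \<gamma> \<otimes> (Lt a f a' \<otimes> Lt b g b')) =
            \<omega> \<beta> \<gamma> \<odot>\<^bsub>KK\<^esub> (\<omega> \<chi> (\<alpha> + \<gamma>) \<otimes> (f (a \<otimes>\<^bsub>H\<^esub> a') \<otimes> g (b \<otimes>\<^bsub>H\<^esub> b')))"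
          using abc' by (simp add: translate_apply ground_algebra_simps H.factor_add_left H.factor_add_right
              H.factor_closed H.scalar_ac)
      qed
      finally show "?l = ?r" .
    qed
    also have "\<dots> = (f \<otimes>\<^bsub>H0\<^esub> g) (c \<otimes>\<^bsub>H\<^esub> v)"
      using c v by (simp add: dual_mult[OF f g] H.sw_mult[OF md(5) dual_mult_bilinear[OF f gc] c v])
    finally show "Lt c (f \<otimes>\<^bsub>H0\<^esub> g) v = H.sw H0 (\<lambda>\<alpha> _ a b. \<omega> \<chi> \<alpha> \<odot>\<^bsub>H0\<^esub> (Lt a f \<otimes>\<^bsub>H0\<^esub> Lt b g)) c v"
      using v by (simp add: translate_apply)
  qed
qed

text \<open>By definition the left-hand side is a sum over the legs of \<open>Sinv x\<close>. Read
  as a value of \<open>S_0\<close> at \<open>x\<close> it becomes a sum over the legs of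
  \<open>x\<close>, with \<open>Sinv\<close> applied to each.\<close>

lemma antipode_dual_mult:
  assumes f: "f \<in> homog H0 \<phi>" and g: "g \<in> homog H0 \<chi>" and x: "x \<in> carrier H"
  shows "(f \<otimes>\<^bsub>H0\<^esub> g) (Sinv x) =
    H.sw KK (\<lambda>\<alpha> _ a b. \<omega> \<phi> \<chi> \<otimes> (\<omega> \<phi> \<alpha> \<otimes> (g (Sinv a) \<otimes> f (Sinv b)))) x"
proof -
  let ?S = "antipode H0"
  have Sf: "?S f \<in> homog H0 \<phi>" and Sg: "?S g \<in> homog H0 \<chi>"
    using H0.antipode_homog f g by blast+
  note Sc = hc(2)[OF Sf] hc(2)[OF Sg]
  have "(f \<otimes>\<^bsub>H0\<^esub> g) (Sinv x) = ?S (f \<otimes>\<^bsub>H0\<^esub> g) x"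
    using x by (simp add: H0_fields(9))
  also have "\<dots> = \<omega> \<phi> \<chi> \<otimes> (?S g \<otimes>\<^bsub>H0\<^esub> ?S f) x"
    using x by (simp add: H0.antipode_mult[OF f g] H0_smult)
  also have "\<dots> = \<omega> \<phi> \<chi> \<otimes> H.sw KK (\<lambda>\<alpha> _ a b. \<omega> \<phi> \<alpha> \<otimes> (?S g a \<otimes> ?S f b)) x"
    by (simp add: dual_mult[OF Sc(2) Sf x])
  also have "\<dots> = H.sw KK (\<lambda>\<alpha> _ a b. \<omega> \<phi> \<chi> \<otimes> (\<omega> \<phi> \<alpha> \<otimes> (?S g a \<otimes> ?S f b))) x"
    by (rule H.sw_comp[OF md(5,5) dual_mult_bilinear[OF Sc(2,1)] scalar_linear[OF H.factor_closed] x])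
  also have "\<dots> = H.sw KK (\<lambda>\<alpha> _ a b. \<omega> \<phi> \<chi> \<otimes> (\<omega> \<phi> \<alpha> \<otimes> (g (Sinv a) \<otimes> f (Sinv b)))) x"
    using hc(1) by (intro H.sw_cong) (simp add: H0_fields(9))
  finally show ?thesis .
qed

text \<open>A value at \<open>v\<close> involves the coproduct of \<open>v \<otimes> Sinv x\<close>,
  which is split by multiplicativity. For fixed legs of \<open>v\<close> the remaining sum is a
  product of left translates evaluated at \<open>Sinv x\<close>, and
  \<open>antipode_dual_mult\<close> applies to it.\<close>

lemma right_translate_mult:
  assumes f: "f \<in> homog H0 \<phi>" and g: "g \<in> homog H0 \<chi>" and x: "x \<in> carrier H"
  shows "Rt (Sinv x) (f \<otimes>\<^bsub>H0\<^esub> g) =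
    H.sw H0 (\<lambda>\<alpha> \<beta> a b. \<omega> \<alpha> (\<phi> + \<beta>) \<odot>\<^bsub>H0\<^esub> (Rt (Sinv b) f \<otimes>\<^bsub>H0\<^esub> Rt (Sinv a) g)) x"
proof -
  note fc = hc(2)[OF f] and gc = hc(2)[OF g]
  let ?s = "Sinv x"
  have s: "?s \<in> carrier H" by (rule Sinv_closed[OF x])
  have b: "graded_bilinear K H H H0 (\<lambda>\<alpha> \<beta> a b. \<omega> \<alpha> (\<phi> + \<beta>) \<odot>\<^bsub>H0\<^esub> (Rt (Sinv b) f \<otimes>\<^bsub>H0\<^esub> Rt (Sinv a) g))"
    by (intro graded_bilinearI linear_map_const_smult[OF md(2)] linear_map_mult_left[OF H0.aH]
        linear_map_mult_right[OF H0.aH] linear_map_comp[OF translate_linear_left(1)] linear_map_comp[OF Sinv_linear]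
        linear_map_homog_id[OF gr(1)] H.factor_closed) (simp_all add: cl fc gc)
  \<comment> \<open>The summand common to both sides of the claim; only its scalar \<open>k\<close>
    and the order of summation differ.\<close>
  define T where "T k a b v1 v2 = k \<otimes> (f (v1 \<otimes>\<^bsub>H\<^esub> Sinv b) \<otimes> g (v2 \<otimes>\<^bsub>H\<^esub> Sinv a))" for k a b v1 v2
  have vals: "f (v1 \<otimes>\<^bsub>H\<^esub> Sinv b) \<in> carrier K" "g (v2 \<otimes>\<^bsub>H\<^esub> Sinv a) \<in> carrier K"
    if "a \<in> carrier H" "b \<in> carrier H" "v1 \<in> carrier H" "v2 \<in> carrier H" for a b v1 v2
    using that by (simp_all add: functional_closed fc gc Sinv_closed)
  have Tl: "linear_map K H KK (\<lambda>a. T k a b v1 v2)" if "k \<in> carrier K" "b \<in> carrier H" "v1 \<in> carrier H" "v2 \<in> carrier H" for k b v1 v2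
    unfolding T_def using that
    by (intro scalar_mult_linear linear_map_comp[OF functional_linear[OF gc]] linear_map_mult_right[OF H.aH] Sinv_linear vals)
  have Tl2: "linear_map K H KK (\<lambda>b. T k a b v1 v2)" if "k \<in> carrier K" "a \<in> carrier H" "v1 \<in> carrier H" "v2 \<in> carrier H" for k a v1 v2
    unfolding T_def using that
    by (intro scalar_mult_linear linear_map_comp[OF functional_linear[OF fc]] linear_map_mult_right[OF H.aH] Sinv_linear vals)
  have Tl3: "linear_map K H KK (\<lambda>v1. T k a b v1 v2)" if "k \<in> carrier K" "a \<in> carrier H" "b \<in> carrier H" "v2 \<in> carrier H" for k a b v2
    unfolding T_def using that
    by (intro scalar_mult_linear linear_map_comp[OF functional_linear[OF fc]] linear_map_mult_left[OF H.aH]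
        linear_map_id Sinv_closed vals)
  have Tl4: "linear_map K H KK (\<lambda>v2. T k a b v1 v2)" if "k \<in> carrier K" "a \<in> carrier H" "b \<in> carrier H" "v1 \<in> carrier H" for k a b v1
    unfolding T_def using that
    by (intro scalar_mult_linear linear_map_comp[OF functional_linear[OF gc]] linear_map_mult_left[OF H.aH]
        linear_map_id Sinv_closed vals)
  have Tab: "graded_bilinear K H H KK (\<lambda>\<alpha> \<beta> a b. T (h \<alpha> \<beta>) a b v1 v2)"
    if "v1 \<in> carrier H" "v2 \<in> carrier H" "\<And>\<alpha> \<beta>. h \<alpha> \<beta> \<in> carrier K" for v1 v2 h
    using that hc(1) by (intro graded_bilinearI linear_map_homog_part gr Tl Tl2) auto
  have Tv: "graded_bilinear K H H KK (\<lambda>\<gamma> \<delta> v1 v2. T (h \<gamma> \<delta>) a b v1 v2)"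
    if "a \<in> carrier H" "b \<in> carrier H" "\<And>\<alpha> \<beta>. h \<alpha> \<beta> \<in> carrier K" for a b h
    using that hc(1) by (intro graded_bilinearI linear_map_homog_part gr Tl3 Tl4) auto
  have Tk: "k \<otimes> T k' a b v1 v2 = T (k \<otimes> k') a b v1 v2"
    if "k \<in> carrier K" "k' \<in> carrier K" "a \<in> carrier H" "b \<in> carrier H" "v1 \<in> carrier H" "v2 \<in> carrier H" for k k' a b v1 v2
    unfolding T_def using that vals[OF that(3-6)] by (simp add: H.scalar_ac)
  note oc = H.factor_closed and mc = H.scalar_ac(4)
  show ?thesis
  proof (rule functional_ext[OF translate_closed(1)[OF dual_mult_closed[OF fc gc] s] H.sw_closed[OF md(2) b x]])
    fix \<xi> v assume "v \<in> homog H \<xi>"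
    then have v: "v \<in> carrier H" by (rule hc)
    \<comment> \<open>In \<open>?kL\<close> the first factor remains from the coproduct of the
      product, and the other two come from \<open>antipode_dual_mult\<close> for the left
      translates, of degrees \<open>\<phi> + \<gamma>\<close> and \<open>\<chi> + \<delta>\<close>.
      In \<open>?kR\<close> the first factor is the claimed coefficient, the second the sign of a
      product with second factor \<open>Rt (Sinv a) g\<close>, of degree
      \<open>\<chi> + \<alpha>\<close>.\<close>
    let ?kL = "\<lambda>\<alpha> \<gamma> \<delta>. \<omega> \<chi> \<gamma> \<otimes> (\<omega> (\<phi> + \<gamma>) (\<chi> + \<delta>) \<otimes> \<omega> (\<phi> + \<gamma>) \<alpha>)"
    let ?kR = "\<lambda>\<alpha> \<beta> \<gamma>. \<omega> \<alpha> (\<phi> + \<beta>) \<otimes> \<omega> (\<chi> + \<alpha>) \<gamma>"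
    let ?l = "Rt ?s (f \<otimes>\<^bsub>H0\<^esub> g) v"
      and ?r = "H.sw H0 (\<lambda>\<alpha> \<beta> a b. \<omega> \<alpha> (\<phi> + \<beta>) \<odot>\<^bsub>H0\<^esub> (Rt
        (Sinv b) f \<otimes>\<^bsub>H0\<^esub> Rt (Sinv a) g)) x v"
    have "?l = H.sw KK (\<lambda>\<gamma> \<delta> v1 v2. H.sw KK (\<lambda>\<alpha> \<beta> s1 s2.
        \<omega> \<delta> \<alpha> \<odot>\<^bsub>KK\<^esub> (\<omega> \<chi> (\<gamma> + \<alpha>) \<otimes> (f (v1 \<otimes>\<^bsub>H\<^esub> s1) \<otimes> g (v2 \<otimes>\<^bsub>H\<^esub> s2)))) ?s) v"
      using s v by (simp add: translate_apply dual_mult[OF fc g] H.sw_mult[OF md(5) dual_mult_bilinear[OF fc gc] v s])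
    also have "\<dots> = H.sw KK (\<lambda>\<gamma> \<delta> v1 v2. H.sw KK (\<lambda>\<alpha> \<beta> a b. T (?kL \<alpha> \<gamma> \<delta>) a b v1 v2) x) v"
    proof (rule H.sw_cong)
      fix \<gamma> \<delta> v1 v2 assume h: "v1 \<in> homog H \<gamma>" "v2 \<in> homog H \<delta>"
      note c = hc(1)[OF h(1)] hc(1)[OF h(2)]
      note Lc = translate_closed(2)[OF fc c(1)] translate_closed(2)[OF gc c(2)]
      note Lh = translate_homog(2)[OF f h(1)] translate_homog(2)[OF g h(2)]
      let ?k = "\<lambda>\<alpha>. \<omega> (\<phi> + \<gamma>) (\<chi> + \<delta>) \<otimes> \<omega> (\<phi> + \<gamma>) \<alpha>"
      let ?l = "H.sw KK (\<lambda>\<alpha> \<beta> s1 s2. \<omega> \<delta> \<alpha> \<odot>\<^bsub>KK\<^esub> (\<omega>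
          \<chi> (\<gamma> + \<alpha>) \<otimes> (f (v1 \<otimes>\<^bsub>H\<^esub> s1) \<otimes> g (v2
          \<otimes>\<^bsub>H\<^esub> s2)))) ?s"
        and ?r = "H.sw KK (\<lambda>\<alpha> \<beta> a b. T (?kL \<alpha> \<gamma> \<delta>) a b v1 v2) x"
      \<comment> \<open>The arguments of \<open>f\<close> and \<open>g\<close> are regrouped so that
        the sum over the legs of \<open>?s\<close> becomes a value of the product of
        \<open>Lt v1 f\<close> and \<open>Lt v2 g\<close>; the sign left over is
        \<open>\<omega> \<chi> \<gamma>\<close>.\<close>
      have "?l = H.sw KK (\<lambda>\<alpha> _ s1 s2. \<omega> \<chi> \<gamma> \<otimes> (\<omega> (\<chi> + \<delta>) \<alpha> \<otimes> (Lt v1 f s1 \<otimes> Lt v2 g s2))) ?s"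
      proof (rule H.sw_cong)
        fix \<alpha> \<beta> s1 s2 assume "s1 \<in> homog H \<alpha>" "s2 \<in> homog H \<beta>"
        then have sc: "s1 \<in> carrier H" "s2 \<in> carrier H" by (simp_all add: hc)
        have "f (v1 \<otimes>\<^bsub>H\<^esub> s1) \<in> carrier K" "g (v2 \<otimes>\<^bsub>H\<^esub> s2) \<in> carrier K"
          using c sc fc gc by (simp_all add: functional_closed)
        then show "\<omega> \<delta> \<alpha> \<odot>\<^bsub>KK\<^esub> (\<omega> \<chi> (\<gamma> + \<alpha>) \<otimes> (f (v1 \<otimes>\<^bsub>H\<^esub> s1) \<otimes> g (v2 \<otimes>\<^bsub>H\<^esub> s2))) =
            \<omega> \<chi> \<gamma> \<otimes> (\<omega> (\<chi> + \<delta>) \<alpha> \<otimes> (Lt v1 f s1 \<otimes> Lt v2 g s2))"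
          using sc by (simp add: translate_apply ground_algebra_simps H.factor_add_left H.factor_add_right
              oc H.scalar_ac)
      qed
      also have "\<dots> = \<omega> \<chi> \<gamma> \<otimes> (Lt v1 f \<otimes>\<^bsub>H0\<^esub> Lt v2 g) ?s"
        unfolding dual_mult[OF Lc(1) Lh(2) s]
        by (rule H.sw_comp[OF md(5,5) dual_mult_bilinear[OF Lc] scalar_linear[OF oc] s, symmetric])
      also have "\<dots> = \<omega> \<chi> \<gamma> \<otimes> H.sw KK (\<lambda>\<alpha> _ a b. T (?k \<alpha>) a b v1 v2) x"
      proof -
        have "(Lt v1 f \<otimes>\<^bsub>H0\<^esub> Lt v2 g) ?s = H.sw KK (\<lambda>\<alpha> _ a b. T (?k \<alpha>) a b v1 v2) x"
          unfolding antipode_dual_mult[OF Lh x]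
        proof (rule H.sw_cong)
          fix \<alpha> \<beta> a b assume "a \<in> homog H \<alpha>" "b \<in> homog H \<beta>"
          then have ab: "a \<in> carrier H" "b \<in> carrier H" by (simp_all add: hc)
          show "\<omega> (\<phi> + \<gamma>) (\<chi> + \<delta>) \<otimes> (\<omega> (\<phi> + \<gamma>) \<alpha> \<otimes> (Lt v2 g (Sinv a) \<otimes> Lt v1 f (Sinv b))) = T (?k \<alpha>) a b v1 v2"
            using vals[OF ab c] ab by (simp add: T_def translate_apply Sinv_closed oc H.scalar_ac)
        qed
        then show ?thesis by simp
      qed
      also have "\<dots> = H.sw KK (\<lambda>\<alpha> _ a b. \<omega> \<chi> \<gamma> \<otimes> T (?k \<alpha>) a b v1 v2) x"
        by (rule H.sw_comp[OF md(5,5) Tab[OF c] scalar_linear[OF oc] x]) (intro mc oc)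
      also have "\<dots> = ?r"
        by (intro H.sw_cong Tk oc mc c hc(1))
      finally show "?l = ?r" .
    qed
    also have "\<dots> = H.sw KK (\<lambda>\<gamma> \<delta> v1 v2. H.sw KK (\<lambda>\<alpha> \<beta> a b. T (?kR \<alpha> \<beta> \<gamma>) a b v1 v2) x) v"
    proof (intro H.sw_cong)
      fix \<gamma> \<delta> v1 v2 \<alpha> \<beta> a b
      assume h: "v1 \<in> homog H \<gamma>" "v2 \<in> homog H \<delta>" "a \<in> homog H \<alpha>" "b \<in> homog H \<beta>"
      note c = hc(1)[OF h(3)] hc(1)[OF h(4)] hc(1)[OF h(1)] hc(1)[OF h(2)]
      show "T (?kL \<alpha> \<gamma> \<delta>) a b v1 v2 = T (?kR \<alpha> \<beta> \<gamma>) a b v1 v2"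
      proof (cases "f (v1 \<otimes>\<^bsub>H\<^esub> Sinv b) = \<zero> \<or> g (v2 \<otimes>\<^bsub>H\<^esub> Sinv a) = \<zero>")
        case True
        then show ?thesis
          unfolding T_def using vals[OF c] by (auto simp: oc mc)
      next
        case False
        \<comment> \<open>a nonzero value forces the degrees of functional and argument to cancel\<close>
        then have e: "\<phi> + (\<gamma> + \<beta>) = 0" "\<chi> + (\<delta> + \<alpha>) = 0"
          using functional_degree[OF f H.mult_homog[OF h(1) Sinv_homog[OF h(4)]]]
            functional_degree[OF g H.mult_homog[OF h(2) Sinv_homog[OF h(3)]]] by auto
        \<comment> \<open>Each scalar contains a factor with one argument equal to zero:
          \<open>\<chi> + (\<delta> + \<alpha>)\<close> in \<open>?kL\<close> and
          \<open>\<phi> + (\<gamma> + \<beta>)\<close> in \<open>?kR\<close>. Both scalars reduce to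
          \<open>\<omega> \<chi> \<gamma>\<close>.\<close>
        have "\<omega> (\<phi> + \<gamma>) (\<chi> + \<delta>) \<otimes> \<omega> (\<phi> + \<gamma>) \<alpha> = \<omega> (\<phi> + \<gamma>) (\<chi> + (\<delta> + \<alpha>))"
          by (simp only: H.factor_add_right[symmetric] add.assoc)
        then have 1: "?kL \<alpha> \<gamma> \<delta> = \<omega> \<chi> \<gamma>"
          by (simp add: e H.factor_zero_right oc H.scalar_ac(5))
        have "?kR \<alpha> \<beta> \<gamma> = \<omega> \<alpha> (\<phi> + (\<gamma> + \<beta>)) \<otimes> \<omega> \<chi> \<gamma>"
          by (simp add: H.factor_add_left H.factor_add_right oc H.scalar_ac)
        then have 2: "?kR \<alpha> \<beta> \<gamma> = \<omega> \<chi> \<gamma>"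
          by (simp add: e H.factor_zero_right oc H.scalar_ac(6))
        show ?thesis by (simp only: 1 2)
      qed
    qed
    also have "\<dots> = H.sw KK (\<lambda>\<alpha> \<beta> a b. H.sw KK (\<lambda>\<gamma> \<delta> v1 v2. T (?kR \<alpha> \<beta> \<gamma>) a b v1 v2) v) x"
      by (rule H.sw_swap[OF md(5) v x]) (intro Tab Tv hc(1) mc oc; assumption)+
    also have "\<dots> = H.sw KK (\<lambda>\<alpha> \<beta> a b. (\<omega> \<alpha> (\<phi> + \<beta>) \<odot>\<^bsub>H0\<^esub> (Rt (Sinv b) f \<otimes>\<^bsub>H0\<^esub> Rt (Sinv a) g)) v) x"
    proof (rule H.sw_cong)
      fix \<alpha> \<beta> a b assume h: "a \<in> homog H \<alpha>" "b \<in> homog H \<beta>"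
      note c = hc(1)[OF h(1)] hc(1)[OF h(2)]
      note Rc = translate_closed(1)[OF fc Sinv_closed[OF c(2)]] translate_closed(1)[OF gc Sinv_closed[OF c(1)]]
      note Rh = translate_homog(1)[OF g Sinv_homog[OF h(1)]]
      have "(\<omega> \<alpha> (\<phi> + \<beta>) \<odot>\<^bsub>H0\<^esub> (Rt (Sinv b) f \<otimes>\<^bsub>H0\<^esub> Rt (Sinv a) g)) v =
          \<omega> \<alpha> (\<phi> + \<beta>) \<otimes> H.sw KK (\<lambda>\<gamma> _ v1 v2. \<omega> (\<chi> + \<alpha>) \<gamma> \<otimes> (Rt (Sinv b) f v1 \<otimes> Rt (Sinv a) g v2)) v"
        by (simp add: H0_smult[OF v] dual_mult[OF Rc(1) Rh v])
      also have "\<dots> = H.sw KK (\<lambda>\<gamma> _ v1 v2.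
          \<omega> \<alpha> (\<phi> + \<beta>) \<otimes> (\<omega> (\<chi> + \<alpha>) \<gamma> \<otimes> (Rt (Sinv b) f v1 \<otimes> Rt (Sinv a) g v2))) v"
        by (rule H.sw_comp[OF md(5,5) dual_mult_bilinear[OF Rc] scalar_linear[OF oc] v])
      also have "\<dots> = H.sw KK (\<lambda>\<gamma> \<delta> v1 v2. T (?kR \<alpha> \<beta> \<gamma>) a b v1 v2) v"
      proof (rule H.sw_cong)
        fix \<gamma> \<delta> v1 v2 assume "v1 \<in> homog H \<gamma>" "v2 \<in> homog H \<delta>"
        then have vc: "v1 \<in> carrier H" "v2 \<in> carrier H" by (simp_all add: hc)
        show "\<omega> \<alpha> (\<phi> + \<beta>) \<otimes> (\<omega> (\<chi> + \<alpha>) \<gamma> \<otimes> (Rt (Sinv b) f v1 \<otimes> Rt (Sinv a) g v2)) = T (?kR \<alpha> \<beta> \<gamma>) a b v1 v2"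
          using vals[OF c vc] vc by (simp add: T_def translate_apply oc H.scalar_ac)
      qed
      finally show "H.sw KK (\<lambda>\<gamma> \<delta> v1 v2. T (?kR \<alpha> \<beta> \<gamma>) a b v1 v2) v =
          (\<omega> \<alpha> (\<phi> + \<beta>) \<odot>\<^bsub>H0\<^esub> (Rt (Sinv b) f \<otimes>\<^bsub>H0\<^esub> Rt (Sinv a) g)) v" by simp
    qed
    also have "\<dots> = ?r"
      by (rule H.sw_comp[OF md(2,5) b evaluation_linear[OF v] x, symmetric])
    finally show "?l = ?r" .
  qed
qed

end

text \<open>Here \<open>a\<close>, \<open>b\<close>, \<open>c\<close>, \<open>d\<close> are the
  degrees of the first four legs of \<open>x\<close>. The left side collects the signs of \<psi> at
  the product of \<open>f\<close> and \<open>g\<close> and of the translates of that product, the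
  right side those of two applications of \<psi>. They differ by
  \<open>\<omega> (\<phi> + b) a\<close> and \<open>\<omega> a (\<phi> + b)\<close>, which
  cancel.\<close>

lemma (in commutative_factor) exchange_mult_sign:
  "\<omega> \<chi> d \<otimes> (\<omega> (\<phi> + \<chi> + (a + b)) (a + b + c) \<otimes> \<omega> a (\<phi> + d + b)) =
   \<omega> (\<phi> + b) (b + c) \<otimes> \<omega> (\<chi> + a) (a + (b + c + d))"
proof -
  note oc = factor_closed m_closed
  have 1: "\<omega> (\<phi> + \<chi> + (a + b)) (a + b + c) =
      \<omega> (\<chi> + a) (a + b + c) \<otimes> (\<omega> (\<phi> + b) a \<otimes> \<omega> (\<phi> + b) (b + c))"
  proof -
    have "\<phi> + \<chi> + (a + b) = (\<chi> + a) + (\<phi> + b)" by (simp add: algebra_simps)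
    moreover have "\<omega> (\<phi> + b) (a + b + c) = \<omega> (\<phi> + b) a \<otimes> \<omega> (\<phi> + b) (b + c)"
      by (simp only: factor_add_right[symmetric] add.assoc)
    ultimately show ?thesis by (simp only: factor_add_left[of "\<chi> + a"])
  qed
  have 2: "\<omega> a (\<phi> + d + b) = \<omega> a (\<phi> + b) \<otimes> \<omega> a d"
  proof -
    have "\<phi> + d + b = (\<phi> + b) + d" by (simp add: algebra_simps)
    then show ?thesis by (simp only: factor_add_right)
  qed
  have 3: "\<omega> (\<chi> + a) (a + (b + c + d)) = \<omega> (\<chi> + a) (a + b + c) \<otimes> (\<omega> \<chi> d \<otimes> \<omega> a d)"
  proof -
    have "a + (b + c + d) = (a + b + c) + d" by (simp add: algebra_simps)
    then show ?thesis by (simp only: factor_add_right[of _ "a + b + c"] factor_add_left[of \<chi> a d])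
  qed
  have "\<omega> \<chi> d \<otimes> (\<omega> (\<phi> + \<chi> + (a + b)) (a + b + c) \<otimes> \<omega> a (\<phi> + d + b)) =
      (\<omega> (\<phi> + b) a \<otimes> \<omega> a (\<phi> + b)) \<otimes> (\<omega> (\<phi> + b) (b + c) \<otimes> \<omega> (\<chi> + a) (a + (b + c + d)))"
    by (simp only: 1 2 3 scalar_ac oc)
  then show ?thesis by (simp add: factor_cancel oc)
qed

text \<open>\<open>\<gamma>\<close>, \<open>\<delta>\<close>, \<open>\<beta>\<close> are the degrees
  of the legs \<open>u\<close>, \<open>v\<close>, \<open>x2\<close> of \<open>x\<close>, and
  \<open>\<gamma>'\<close>, \<open>\<delta>'\<close> those of the first two legs of
  \<open>y\<close>. On the left stand the signs of two uses of multiplicativity of the coproduct, of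
  \<psi> and of the inverse antipode; on the right those of two applications of \<psi>. Two skew
  pairs cancel, one for \<open>\<delta>\<close>, \<open>\<gamma>'\<close> and one for
  \<open>\<gamma>\<close>, \<open>\<gamma>'\<close>.\<close>

lemma (in commutative_factor) exchange_comult_sign:
  "\<omega> \<beta> (\<gamma>' + \<delta>') \<otimes> (\<omega> \<delta> \<gamma>' \<otimes> (\<omega> (\<phi> + (\<gamma> + \<gamma>')) (\<gamma> + \<gamma>' + (\<delta> + \<delta>')) \<otimes> \<omega> \<gamma> \<gamma>')) =
   \<omega> (\<phi> + \<gamma> + \<beta> + \<gamma>') (\<gamma>' + \<delta>') \<otimes> \<omega> (\<phi> + \<gamma>) (\<gamma> + \<delta>)"
proof -
  note oc = factor_closed m_closed
  have 1: "\<omega> (\<phi> + (\<gamma> + \<gamma>')) (\<gamma> + \<gamma>' + (\<delta> + \<delta>')) =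
      (\<omega> (\<phi> + \<gamma>) (\<gamma> + \<delta>) \<otimes> (\<omega> \<gamma>' \<gamma> \<otimes> \<omega> \<gamma>' \<delta>)) \<otimes> \<omega> (\<phi> + \<gamma> + \<gamma>') (\<gamma>' + \<delta>')"
  proof -
    have 1: "\<gamma> + \<gamma>' + (\<delta> + \<delta>') = (\<gamma> + \<delta>) + (\<gamma>' + \<delta>')" and 2: "\<phi> + (\<gamma> + \<gamma>') = \<phi> + \<gamma> + \<gamma>'"
      by (simp_all add: algebra_simps)
    have 3: "\<omega> (\<phi> + \<gamma> + \<gamma>') (\<gamma> + \<delta>) = \<omega> (\<phi> + \<gamma>) (\<gamma> + \<delta>) \<otimes> (\<omega> \<gamma>' \<gamma> \<otimes> \<omega> \<gamma>' \<delta>)"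
      by (simp only: factor_add_left[of "\<phi> + \<gamma>"] factor_add_right[of \<gamma>' \<gamma>])
    show ?thesis unfolding 1 2 factor_add_right[of _ "\<gamma> + \<delta>"] 3 ..
  qed
  have 2: "\<omega> (\<phi> + \<gamma> + \<beta> + \<gamma>') (\<gamma>' + \<delta>') = \<omega> (\<phi> + \<gamma> + \<gamma>') (\<gamma>' + \<delta>') \<otimes> \<omega> \<beta> (\<gamma>' + \<delta>')"
  proof -
    have "\<phi> + \<gamma> + \<beta> + \<gamma>' = (\<phi> + \<gamma> + \<gamma>') + \<beta>" by (simp add: algebra_simps)
    then show ?thesis by (simp only: factor_add_left[of _ \<beta>])
  qed
  have "\<omega> \<beta> (\<gamma>' + \<delta>') \<otimes> (\<omega> \<delta> \<gamma>' \<otimes> (\<omega> (\<phi> + (\<gamma> + \<gamma>')) (\<gamma> + \<gamma>' + (\<delta> + \<delta>')) \<otimes> \<omega> \<gamma> \<gamma>')) =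
      (\<omega> \<delta> \<gamma>' \<otimes> \<omega> \<gamma>' \<delta>) \<otimes> ((\<omega> \<gamma> \<gamma>' \<otimes> \<omega> \<gamma>' \<gamma>) \<otimes>
        (\<omega> (\<phi> + \<gamma> + \<beta> + \<gamma>') (\<gamma>' + \<delta>') \<otimes> \<omega> (\<phi> + \<gamma>) (\<gamma> + \<delta>)))"
    by (simp only: 1 2 scalar_ac oc)
  then show ?thesis by (simp add: factor_cancel oc)
qed

context dual_pair
begin

section \<open>The twisting axioms for the exchange map\<close>

lemma left_translate_left:
  assumes "f \<in> carrier H0" "x \<in> carrier H" "y \<in> carrier H"
  shows "Lt (x \<otimes>\<^bsub>H\<^esub> y) f = Lt y (Lt x f)"
  using assms by (intro functional_ext) (simp_all add: translate_closed translate_apply hc(1) H.m_assoc)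

lemma right_translate_right:
  assumes "f \<in> carrier H0" "x \<in> carrier H" "y \<in> carrier H"
  shows "Rt (x \<otimes>\<^bsub>H\<^esub> y) f = Rt x (Rt y f)"
  using assms by (intro functional_ext) (simp_all add: translate_closed translate_apply hc(1) H.m_assoc)

lemma translate_commute:
  assumes "f \<in> carrier H0" "x \<in> carrier H" "y \<in> carrier H"
  shows "Lt x (Rt y f) = Rt y (Lt x f)"
  using assms by (intro functional_ext) (simp_all add: translate_closed translate_apply hc(1) H.m_assoc)

lemma exchange_inner_bilinear:
  assumes "f \<in> carrier H0" "x2 \<in> carrier H"
  shows "graded_bilinear K H H D (\<lambda>\<gamma> \<delta> u v. \<omega> (\<phi> + \<gamma>) (\<gamma> + \<delta>) \<odot>\<^bsub>D\<^esub> p v (Lt x2 (Rt (Sinv u) f)))"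
  using assms by (intro lin) (simp_all add: cl)

lemma exchange_outer_bilinear:
  assumes "f \<in> carrier H0"
  shows "graded_bilinear K H H D (\<lambda>\<alpha> \<beta> x1 x2. H.sw D (\<lambda>\<gamma> \<delta> u v.
    \<omega> (\<phi> + \<gamma>) (\<gamma> + \<delta>) \<odot>\<^bsub>D\<^esub> p v (Lt x2 (Rt (Sinv u) f))) x1)"
  using assms by (intro lin) (simp_all add: cl)

lemma exchange_degree:
  assumes f: "f \<in> homog H0 \<phi>" and x: "x \<in> homog H \<xi>"
  shows "\<psi> (q f x) \<in> homog D (\<phi> + \<xi>)"
  unfolding exchange_homog[OF f hc(1)[OF x]]
proof (rule H.sw_mem[OF mD exchange_outer_bilinear[OF hc(2)[OF f]] x graded_module_homog_submodule[OF gD]])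
  fix \<alpha> \<beta> x1 x2 assume h: "x1 \<in> homog H \<alpha>" "x2 \<in> homog H \<beta>" "\<alpha> + \<beta> = \<xi>"
  show "H.sw D (\<lambda>\<gamma> \<delta> u v. \<omega> (\<phi> + \<gamma>) (\<gamma> + \<delta>) \<odot>\<^bsub>D\<^esub> p v (Lt x2 (Rt (Sinv u) f))) x1 \<in> homog D (\<phi> + \<xi>)"
  proof (rule H.sw_mem[OF mD exchange_inner_bilinear[OF hc(2)[OF f] hc(1)[OF h(2)]] h(1) graded_module_homog_submodule[OF gD]])
    fix \<gamma> \<delta> u v assume uv: "u \<in> homog H \<gamma>" "v \<in> homog H \<delta>" "\<gamma> + \<delta> = \<alpha>"
    have "p v (Lt x2 (Rt (Sinv u) f)) \<in> homog D (\<delta> + ((\<phi> + \<gamma>) + \<beta>))"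
      by (intro pure_tensor_homog gr translate_homog Sinv_homog f uv h)
    moreover have "\<delta> + ((\<phi> + \<gamma>) + \<beta>) = \<phi> + \<xi>"
      using h(3) uv(3) by (auto simp: algebra_simps)
    ultimately show "\<omega> (\<phi> + \<gamma>) (\<gamma> + \<delta>) \<odot>\<^bsub>D\<^esub> p v (Lt x2 (Rt (Sinv u) f)) \<in> homog D (\<phi> + \<xi>)"
      by (simp add: homog_smult[OF gD H.factor_closed])
  qed
qed

text \<open>Both compatibilities apply a linear operator to a value of \<psi>; this carries the
  operator to the individual terms, where the tensors are pure.\<close>

lemma exchange_comp:
  assumes f: "f \<in> homog H0 \<phi>" and x: "x \<in> carrier H" and G: "linear_map K D D G"
  shows "G (\<psi> (q f x)) = H.sw D (\<lambda>\<alpha> \<beta> x1 x2. H.sw D (\<lambda>\<gamma> \<delta> u v.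
    \<omega> (\<phi> + \<gamma>) (\<gamma> + \<delta>) \<odot>\<^bsub>D\<^esub> G (p v (Lt x2 (Rt (Sinv u) f)))) x1) x"
proof -
  note fc = hc(2)[OF f]
  have "G (\<psi> (q f x)) = H.sw D (\<lambda>\<alpha> \<beta> x1 x2. G (H.sw D (\<lambda>\<gamma> \<delta> u v.
      \<omega> (\<phi> + \<gamma>) (\<gamma> + \<delta>) \<odot>\<^bsub>D\<^esub> p v (Lt x2 (Rt (Sinv u) f))) x1)) x"
    unfolding exchange_homog[OF f x] by (rule H.sw_comp[OF mD mD exchange_outer_bilinear[OF fc] G x])
  also have "\<dots> = H.sw D (\<lambda>\<alpha> \<beta> x1 x2. H.sw D (\<lambda>\<gamma> \<delta> u v.
    \<omega> (\<phi> + \<gamma>) (\<gamma> + \<delta>) \<odot>\<^bsub>D\<^esub> G (p v (Lt x2 (Rt (Sinv u) f)))) x1) x"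
  proof (rule H.sw_cong)
    fix \<alpha> \<beta> x1 x2 assume h: "x1 \<in> homog H \<alpha>" "x2 \<in> homog H \<beta>"
    let ?l = "G (H.sw D (\<lambda>\<gamma> \<delta> u v. \<omega> (\<phi> + \<gamma>) (\<gamma> + \<delta>)
        \<odot>\<^bsub>D\<^esub> p v (Lt x2 (Rt (Sinv u) f))) x1)"
      and ?r = "H.sw D (\<lambda>\<gamma> \<delta> u v. \<omega> (\<phi> + \<gamma>) (\<gamma> + \<delta>)
        \<odot>\<^bsub>D\<^esub> G (p v (Lt x2 (Rt (Sinv u) f)))) x1"
    have "?l = H.sw D (\<lambda>\<gamma> \<delta> u v. G (\<omega> (\<phi> + \<gamma>) (\<gamma> + \<delta>) \<odot>\<^bsub>D\<^esub> p v (Lt x2 (Rt (Sinv u) f)))) x1"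
      by (rule H.sw_comp[OF mD mD exchange_inner_bilinear[OF fc hc(1)[OF h(2)]] G hc(1)[OF h(1)]])
    also have "\<dots> = ?r"
      using h by (intro H.sw_cong linear_map_smult[OF G]) (simp_all add: cl fc)
    finally show "?l = ?r" .
  qed
  finally show ?thesis .
qed

lemma dual_one_apply: "x \<in> carrier H \<Longrightarrow> \<one>\<^bsub>H0\<^esub> x = counit H x"
  by (simp add: H0_fields(7))

lemma counit_mult: "\<lbrakk>x \<in> carrier H; y \<in> carrier H\<rbrakk> \<Longrightarrow> counit H (x \<otimes>\<^bsub>H\<^esub> y) = counit H x \<otimes> counit H y"
  using ring_hom_mult[OF H.counit_hom] by (simp add: ground_algebra_simps)

text \<open>Translates of the counit are multiples of it, because it is multiplicative and invariant
  under \<open>Sinv\<close>. The two sums then collapse by the two counit axioms.\<close>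

lemma exchange_one_left:
  assumes x: "x \<in> carrier H"
  shows "\<psi> (q \<one>\<^bsub>H0\<^esub> x) = p x \<one>\<^bsub>H0\<^esub>"
proof -
  let ?e = "\<one>\<^bsub>H0\<^esub>" and ?c = "counit H"
  interpret D: module K D by (rule mD)
  note cc = H.counit_closed
  have ec: "?e \<in> carrier H0" by simp
  have tr: "Lt x2 (Rt (Sinv u) ?e) = (?c x2 \<otimes> ?c u) \<odot>\<^bsub>H0\<^esub> ?e" if "x2 \<in> carrier H" "u \<in> carrier H" for x2 u
    using that
    by (intro functional_ext)
      (simp_all add: translate_closed Sinv_closed cc translate_apply hc(1) H0_smult dual_one_apply counit_mult counit_Sinv
        H.scalar_ac)
  have pe: "linear_map K H D (\<lambda>z. p z ?e)"
    by (intro linear_map_pure_left[OF md(1,2)] linear_map_id ec)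
  have inner: "H.sw D (\<lambda>\<gamma> \<delta> u v. \<omega> (0 + \<gamma>) (\<gamma> + \<delta>) \<odot>\<^bsub>D\<^esub> p v (Lt x2 (Rt (Sinv u) ?e))) x1 = p (?c x2 \<odot>\<^bsub>H\<^esub> x1) ?e"
    if x1: "x1 \<in> carrier H" and x2: "x2 \<in> carrier H" for x1 x2
  proof -
    have G: "linear_map K H D (\<lambda>z. p (?c x2 \<odot>\<^bsub>H\<^esub> z) ?e)"
      by (intro linear_map_pure_left[OF md(1,2)] linear_map_const_smult[OF md(1)] linear_map_id ec cc x2)
    have b: "bilinear_map K H H H (\<lambda>a b. ?c a \<odot>\<^bsub>H\<^esub> b)"
      by (intro bilinear_mapI linear_map_smult_left[OF md(1) H.counit_linear] linear_map_const_smult[OF md(1)] cc linear_map_id)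
    have "H.sw D (\<lambda>\<gamma> \<delta> u v. \<omega> (0 + \<gamma>) (\<gamma> + \<delta>) \<odot>\<^bsub>D\<^esub> p v (Lt x2 (Rt (Sinv u) ?e))) x1 =
        H.sw D (\<lambda>_ _ u v. p (?c x2 \<odot>\<^bsub>H\<^esub> (?c u \<odot>\<^bsub>H\<^esub> v)) ?e) x1"
    proof (rule H.sw_cong)
      fix \<gamma> \<delta> u v assume h: "u \<in> homog H \<gamma>" "v \<in> homog H \<delta>"
      note c = hc(1)[OF h(1)] hc(1)[OF h(2)]
      have "p v (Lt x2 (Rt (Sinv u) ?e)) = (?c x2 \<otimes> ?c u) \<odot>\<^bsub>D\<^esub> p v ?e"
        using c x2 linear_map_smult[OF bilinear_mapD(2)[OF pure_tensor_bilinear[OF md(1,2)] c(2)] _ ec]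
        by (simp add: tr cc H.scalar_ac)
      also have "\<dots> = p (?c x2 \<odot>\<^bsub>H\<^esub> (?c u \<odot>\<^bsub>H\<^esub> v)) ?e"
        using c x2 by (simp add: linear_map_smult[OF pe] cc D.smult_assoc1 pure_tensor_closed[OF md(1,2)])
      finally have e: "p v (Lt x2 (Rt (Sinv u) ?e)) = p (?c x2 \<odot>\<^bsub>H\<^esub> (?c u \<odot>\<^bsub>H\<^esub> v)) ?e" .
      have pc: "p (?c x2 \<odot>\<^bsub>H\<^esub> (?c u \<odot>\<^bsub>H\<^esub> v)) ?e \<in> carrier D"
        using c x2 by (simp add: cc pure_tensor_closed[OF md(1,2)])
      show "\<omega> (0 + \<gamma>) (\<gamma> + \<delta>) \<odot>\<^bsub>D\<^esub> p v (Lt x2 (Rt (Sinv u) ?e)) = p (?c x2 \<odot>\<^bsub>H\<^esub> (?c u \<odot>\<^bsub>H\<^esub> v)) ?e"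
      \<comment> \<open>The counit vanishes in degrees other than zero, so both sides are zero
        there; in degree zero the sign is one.\<close>
      proof (cases "\<gamma> = 0")
        case True
        then show ?thesis using pc by (simp add: e H.factor_zero_left)
      next
        case False
        then have z: "?c u = \<zero>" using H.counit_degree[OF h(1)] by simp
        have "p (?c x2 \<odot>\<^bsub>H\<^esub> (?c u \<odot>\<^bsub>H\<^esub> v)) ?e = \<zero>\<^bsub>D\<^esub>"
          using c x2 by (simp add: z cc linear_map_zero[OF md(1) mD pe])
        then show ?thesis by (simp add: e H.factor_closed)
      qed
    qed
    also have "\<dots> = p (?c x2 \<odot>\<^bsub>H\<^esub> H.sw H (\<lambda>_ _ u v. ?c u \<odot>\<^bsub>H\<^esub> v) x1) ?e"
      by (rule H.sw_comp[OF md(1) mD bilinear_graded_bilinear[OF gr(1,1) b] G x1, symmetric])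
    finally show ?thesis by (simp add: H.sw_counit_left x1)
  qed
  have b: "bilinear_map K H H H (\<lambda>a b. ?c b \<odot>\<^bsub>H\<^esub> a)"
    by (intro bilinear_mapI linear_map_smult_left[OF md(1) H.counit_linear] linear_map_const_smult[OF md(1)] cc linear_map_id)
  have "\<psi> (q ?e x) = H.sw D (\<lambda>_ _ x1 x2. p (?c x2 \<odot>\<^bsub>H\<^esub> x1) ?e) x"
    unfolding exchange_homog[OF H0.one_homog x] by (intro H.sw_cong inner hc(1))
  also have "\<dots> = p (H.sw H (\<lambda>_ _ x1 x2. ?c x2 \<odot>\<^bsub>H\<^esub> x1) x) ?e"
    by (rule H.sw_comp[OF md(1) mD bilinear_graded_bilinear[OF gr(1,1) b] pe x, symmetric])
  finally show ?thesis by (simp add: H.sw_counit_right x)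
qed

text \<open>The coproduct of 1 has a single term, the inverse antipode fixes 1, translations by 1 do
  nothing, and a sign with a zero argument is one.\<close>

lemma exchange_one_right:
  assumes f: "f \<in> homog H0 \<phi>"
  shows "\<psi> (q f \<one>\<^bsub>H\<^esub>) = p \<one>\<^bsub>H\<^esub> f"
proof -
  note fc = hc(2)[OF f]
  interpret D: module K D by (rule mD)
  have "Lt \<one>\<^bsub>H\<^esub> (Rt \<one>\<^bsub>H\<^esub> f) = f"
    using fc by (intro functional_ext) (simp_all add: translate_closed translate_apply hc(1))
  moreover have "\<psi> (q f \<one>\<^bsub>H\<^esub>) = \<omega> (\<phi> + 0) (0 + 0) \<odot>\<^bsub>D\<^esub> p \<one>\<^bsub>H\<^esub> (Lt \<one>\<^bsub>H\<^esub> (Rt (Sinv \<one>\<^bsub>H\<^esub>) f))"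
    unfolding exchange_homog[OF f H.one_closed] H.sw_one[OF mD exchange_outer_bilinear[OF fc]]
      H.sw_one[OF mD exchange_inner_bilinear[OF fc H.one_closed]] ..
  ultimately show ?thesis
    using fc by (simp add: Sinv_one H.factor_zero_right pure_tensor_closed[OF md(1,2)])
qed

lemma twisted_pair_double: "twisted_pair K H H0 \<psi>"
  using H.aH H0.aH exchange_linear by (simp add: twisted_pair_def)

interpretation tw: twisted_pair K H H0 \<psi>
  by (rule twisted_pair_double)

text \<open>Both sides become sums over the legs \<open>u\<close>, \<open>v\<close>,
  \<open>x2\<close> of \<open>x\<close> and \<open>u'\<close>, \<open>v'\<close>, \<open>y2\<close>
  of \<open>y\<close> with the same tensor \<open>N\<close>. What has to be matched is the nesting
  of the sums and the signs.\<close>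

lemma exchange_mult_right:
  assumes f: "f \<in> homog H0 \<phi>" and x: "x \<in> carrier H" and y: "y \<in> carrier H"
  shows "\<psi> (q f (x \<otimes>\<^bsub>H\<^esub> y)) = tensor_lift K H H0 D (\<lambda>c g. left_op K H H0 c (\<psi> (q g y))) (\<psi> (q f x))"
proof -
  note fc = hc(2)[OF f] and oc = H.factor_closed and mc = H.scalar_ac(4)
  interpret D: module K D by (rule mD)
  let ?G = "tensor_lift K H H0 D (\<lambda>c g. left_op K H H0 c (\<psi> (q g y)))"
  have \<psi>y: "linear_map K H0 D (\<lambda>g. \<psi> (q g y))"
    by (intro linear_map_comp[OF exchange_linear] linear_map_pure_left[OF md(2,1)] linear_map_id y)
  have gb: "bilinear_map K H H0 D (\<lambda>c g. left_op K H H0 c (\<psi> (q g y)))"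
    by (intro bilinear_mapI tw.left_op_param_linear linear_map_comp[OF tw.left_op_linear] \<psi>y linear_map_closed[OF \<psi>y])
  have G: "linear_map K D D ?G" by (intro tensor_lift_linear md gb mD)
  have Gp: "?G (p v h) = left_op K H H0 v (\<psi> (q h y))" if "v \<in> carrier H" "h \<in> carrier H0" for v h
    using that by (intro tensor_lift_pure md gb mD)
  \<comment> \<open>The first application of \<psi> translates \<open>f\<close> by \<open>u\<close>
    and \<open>x2\<close>, and the second translates the result by \<open>u'\<close> and
    \<open>y2\<close>.\<close>
  define N where "N u v x2 u' v' y2 = p (v \<otimes>\<^bsub>H\<^esub> v') (Lt y2 (Rt (Sinv u') (Lt x2 (Rt (Sinv u) f))))"
    for u v x2 u' v' y2
  have Nc: "N u v x2 u' v' y2 \<in> carrier D"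
    if "u \<in> carrier H" "v \<in> carrier H" "x2 \<in> carrier H" "u' \<in> carrier H" "v' \<in> carrier H" "y2 \<in> carrier H"
    for u v x2 u' v' y2
    unfolding N_def using that by (simp add: cl fc)
  have b1: "graded_bilinear K H H D (\<lambda>\<gamma>' \<delta>' u' v'. k \<gamma>' \<delta>' \<odot>\<^bsub>D\<^esub> N u v x2 u' v' y2)"
    if "\<And>\<gamma>' \<delta>'. k \<gamma>' \<delta>' \<in> carrier K" "u \<in> carrier H" "v \<in> carrier H" "x2 \<in> carrier H" "y2 \<in> carrier H" for k u v x2 y2
    unfolding N_def using that by (intro lin) (simp_all add: cl fc)
  have b2: "graded_bilinear K H H D (\<lambda>\<gamma> \<delta> u v. H.sw D (\<lambda>\<gamma>' \<delta>' u' v'. k \<gamma> \<delta> \<gamma>' \<delta>' \<odot>\<^bsub>D\<^esub> N u v x2 u' v' y2) y1)"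
    if "\<And>\<gamma> \<delta> \<gamma>' \<delta>'. k \<gamma> \<delta> \<gamma>' \<delta>' \<in> carrier K" "y1 \<in> carrier H" "x2 \<in> carrier H" "y2 \<in> carrier H" for k y1 x2 y2
    unfolding N_def using that by (intro lin) (simp_all add: cl fc)
  have b3: "graded_bilinear K H H D (\<lambda>\<alpha>' \<beta>' y1 y2. H.sw D (\<lambda>\<gamma>' \<delta>' u' v'. k \<alpha>' \<gamma>' \<delta>' \<odot>\<^bsub>D\<^esub> N u v x2 u' v' y2) y1)"
    if "\<And>\<alpha>' \<gamma>' \<delta>'. k \<alpha>' \<gamma>' \<delta>' \<in> carrier K" "u \<in> carrier H" "v \<in> carrier H" "x2 \<in> carrier H" for k u v x2
    unfolding N_def using that by (intro lin) (simp_all add: cl fc)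
  let ?kr = "\<lambda>\<beta> \<gamma> \<delta> \<gamma>' \<delta>'. \<omega> (\<phi> + \<gamma> + \<beta> + \<gamma>') (\<gamma>' + \<delta>') \<otimes> \<omega> (\<phi> + \<gamma>) (\<gamma> + \<delta>)"
  let ?kl = "\<lambda>\<gamma> \<delta> \<gamma>' \<delta>'. \<omega> \<delta> \<gamma>' \<otimes> (\<omega> (\<phi> + (\<gamma> + \<gamma>')) (\<gamma> + \<gamma>' + (\<delta> + \<delta>')) \<otimes> \<omega> \<gamma> \<gamma>')"
  have "?G (\<psi> (q f x)) = H.sw D (\<lambda>\<alpha> \<beta> x1 x2. H.sw D (\<lambda>\<gamma> \<delta> u v.
      \<omega> (\<phi> + \<gamma>) (\<gamma> + \<delta>) \<odot>\<^bsub>D\<^esub> ?G (p v (Lt x2 (Rt (Sinv u) f)))) x1) x"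
    by (rule exchange_comp[OF f x G])
  also have "\<dots> = H.sw D (\<lambda>\<alpha> \<beta> x1 x2. H.sw D (\<lambda>\<gamma> \<delta> u v. H.sw D (\<lambda>\<alpha>' \<beta>' y1 y2. H.sw D (\<lambda>\<gamma>' \<delta>' u' v'.
      ?kr \<beta> \<gamma> \<delta> \<gamma>' \<delta>' \<odot>\<^bsub>D\<^esub> N u v x2 u' v' y2) y1) y) x1) x"
  proof (intro H.sw_cong)
    fix \<alpha> \<beta> x1 x2 \<gamma> \<delta> u v
    assume h: "x1 \<in> homog H \<alpha>" "x2 \<in> homog H \<beta>" "u \<in> homog H \<gamma>" "v \<in> homog H \<delta>"
    note c = hc(1)[OF h(2)] hc(1)[OF h(3)] hc(1)[OF h(4)]
    let ?h = "Lt x2 (Rt (Sinv u) f)"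
    have hh: "?h \<in> homog H0 (\<phi> + \<gamma> + \<beta>)" by (intro translate_homog Sinv_homog f h)
    have F': "linear_map K D D (\<lambda>z. \<omega> (\<phi> + \<gamma>) (\<gamma> + \<delta>) \<odot>\<^bsub>D\<^esub> left_op K H H0 v z)"
      by (intro linear_map_const_smult[OF mD] tw.left_op_linear c oc)
    let ?l = "\<omega> (\<phi> + \<gamma>) (\<gamma> + \<delta>) \<odot>\<^bsub>D\<^esub> ?G (p v ?h)"
      and ?r = "H.sw D (\<lambda>\<alpha>' \<beta>' y1 y2. H.sw D (\<lambda>\<gamma>' \<delta>' u' v'. ?kr \<beta> \<gamma>
        \<delta> \<gamma>' \<delta>' \<odot>\<^bsub>D\<^esub> N u v x2 u' v' y2) y1) y"
    have "?l = \<omega> (\<phi> + \<gamma>) (\<gamma> + \<delta>) \<odot>\<^bsub>D\<^esub> left_op K H H0 v (\<psi> (q ?h y))"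
      by (simp add: Gp c hc(2)[OF hh])
    also have "\<dots> = H.sw D (\<lambda>\<alpha>' \<beta>' y1 y2. H.sw D (\<lambda>\<gamma>' \<delta>' u' v'. \<omega> (\<phi> + \<gamma> + \<beta> + \<gamma>') (\<gamma>' + \<delta>') \<odot>\<^bsub>D\<^esub>
        (\<omega> (\<phi> + \<gamma>) (\<gamma> + \<delta>) \<odot>\<^bsub>D\<^esub> left_op K H H0 v (p v' (Lt y2 (Rt (Sinv u') ?h))))) y1) y"
      by (rule exchange_comp[OF hh y F'])
    also have "\<dots> = ?r"
    proof (intro H.sw_cong)
      fix \<alpha>' \<beta>' y1 y2 \<gamma>' \<delta>' u' v'
      assume h': "y1 \<in> homog H \<alpha>'" "y2 \<in> homog H \<beta>'" "u' \<in> homog H \<gamma>'" "v' \<in> homog H \<delta>'"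
      note c' = hc(1)[OF h'(2)] hc(1)[OF h'(3)] hc(1)[OF h'(4)]
      have "left_op K H H0 v (p v' (Lt y2 (Rt (Sinv u') ?h))) = N u v x2 u' v' y2"
        unfolding N_def using c c' hc(2)[OF hh]
        by (intro tw.left_op_pure) (simp_all add: translate_closed Sinv_closed)
      then show "\<omega> (\<phi> + \<gamma> + \<beta> + \<gamma>') (\<gamma>' + \<delta>') \<odot>\<^bsub>D\<^esub>
          (\<omega> (\<phi> + \<gamma>) (\<gamma> + \<delta>) \<odot>\<^bsub>D\<^esub> left_op K H H0 v (p v' (Lt y2 (Rt (Sinv u') ?h)))) =
          ?kr \<beta> \<gamma> \<delta> \<gamma>' \<delta>' \<odot>\<^bsub>D\<^esub> N u v x2 u' v' y2"
        using Nc[OF c(2,3,1) c'(2,3,1)] by (simp add: D.smult_assoc1 oc)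
    qed
    finally show "?l = ?r" .
  qed
  \<comment> \<open>The sign is prepared for its two sources:
    \<open>\<omega> \<beta> \<alpha>'\<close>, with \<open>\<alpha>' = \<gamma>' + \<delta>'\<close>
    the degree of \<open>y1\<close>, belongs to the coproduct of the product of \<open>x\<close> and
    \<open>y\<close> and must not depend on the legs of \<open>y1\<close>.\<close>
  also have "\<dots> = H.sw D (\<lambda>\<alpha> \<beta> x1 x2. H.sw D (\<lambda>\<gamma> \<delta> u v. H.sw D (\<lambda>\<alpha>' \<beta>' y1 y2. H.sw D (\<lambda>\<gamma>' \<delta>' u' v'.
      (\<omega> \<beta> \<alpha>' \<otimes> ?kl \<gamma> \<delta> \<gamma>' \<delta>') \<odot>\<^bsub>D\<^esub> N u v x2 u' v' y2) y1) y) x1) x"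
  proof (rule H.sw_cong, rule H.sw_cong, rule H.sw_cong)
    fix \<alpha> \<beta> x1 x2 \<gamma> \<delta> u v \<alpha>' \<beta>' y1 y2
    assume h: "x1 \<in> homog H \<alpha>" "x2 \<in> homog H \<beta>" "u \<in> homog H \<gamma>" "v \<in> homog H \<delta>"
      "y1 \<in> homog H \<alpha>'" "y2 \<in> homog H \<beta>'"
    show "H.sw D (\<lambda>\<gamma>' \<delta>' u' v'. ?kr \<beta> \<gamma> \<delta> \<gamma>' \<delta>' \<odot>\<^bsub>D\<^esub> N u v x2 u' v' y2) y1 =
        H.sw D (\<lambda>\<gamma>' \<delta>' u' v'. (\<omega> \<beta> \<alpha>' \<otimes> ?kl \<gamma> \<delta> \<gamma>' \<delta>') \<odot>\<^bsub>D\<^esub> N u v x2 u' v' y2) y1"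
    proof (rule H.sw_homog_cong[OF mD b1 b1 h(5)])
      fix \<gamma>' \<delta>' u' v' assume e: "\<gamma>' + \<delta>' = \<alpha>'"
      show "?kr \<beta> \<gamma> \<delta> \<gamma>' \<delta>' \<odot>\<^bsub>D\<^esub> N u v x2 u' v' y2 = (\<omega> \<beta> \<alpha>' \<otimes> ?kl \<gamma> \<delta> \<gamma>' \<delta>') \<odot>\<^bsub>D\<^esub> N u v x2 u' v' y2"
        unfolding e[symmetric] H.exchange_comult_sign ..
    qed (simp_all add: oc mc hc(1)[OF h(2)] hc(1)[OF h(3)] hc(1)[OF h(4)] hc(1)[OF h(6)])
  qed
  \<comment> \<open>The sums over the legs of \<open>x1\<close> and of \<open>y\<close> change
    places, which brings the sums over the legs of \<open>x1\<close> and \<open>y1\<close> together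
    so that they can be merged into one over the legs of \<open>x1 \<otimes> y1\<close>.\<close>
  also have "\<dots> = H.sw D (\<lambda>\<alpha> \<beta> x1 x2. H.sw D (\<lambda>\<alpha>' \<beta>' y1 y2. H.sw D (\<lambda>\<gamma> \<delta> u v. H.sw D (\<lambda>\<gamma>' \<delta>' u' v'.
      (\<omega> \<beta> \<alpha>' \<otimes> ?kl \<gamma> \<delta> \<gamma>' \<delta>') \<odot>\<^bsub>D\<^esub> N u v x2 u' v' y2) y1) x1) y) x"
    by (rule H.sw_cong, rule H.sw_swap[OF mD hc(1) y]) (assumption | intro b2 b3 oc mc hc(1))+
  also have "\<dots> = H.sw D (\<lambda>\<alpha> \<beta> x1 x2. H.sw D (\<lambda>\<alpha>' \<beta>' y1 y2. \<omega> \<beta> \<alpha>' \<odot>\<^bsub>D\<^esub> H.sw D (\<lambda>\<gamma> \<delta> u v.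
      \<omega> (\<phi> + \<gamma>) (\<gamma> + \<delta>) \<odot>\<^bsub>D\<^esub> p v (Lt (x2 \<otimes>\<^bsub>H\<^esub> y2) (Rt (Sinv u) f))) (x1 \<otimes>\<^bsub>H\<^esub> y1)) y) x"
  proof (intro H.sw_cong)
    fix \<alpha> \<beta> x1 x2 \<alpha>' \<beta>' y1 y2
    assume h: "x1 \<in> homog H \<alpha>" "x2 \<in> homog H \<beta>" "y1 \<in> homog H \<alpha>'" "y2 \<in> homog H \<beta>'"
    note c = hc(1)[OF h(1)] hc(1)[OF h(2)] hc(1)[OF h(3)] hc(1)[OF h(4)]
    have w: "linear_map K D D (\<lambda>z. \<omega> \<beta> \<alpha>' \<odot>\<^bsub>D\<^esub> z)" by (intro linear_map_const_smult[OF mD] linear_map_id oc)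
    have "\<omega> \<beta> \<alpha>' \<odot>\<^bsub>D\<^esub> H.sw D (\<lambda>\<gamma> \<delta> u v.
        \<omega> (\<phi> + \<gamma>) (\<gamma> + \<delta>) \<odot>\<^bsub>D\<^esub> p v (Lt (x2 \<otimes>\<^bsub>H\<^esub> y2) (Rt (Sinv u) f))) (x1 \<otimes>\<^bsub>H\<^esub> y1) =
      \<omega> \<beta> \<alpha>' \<odot>\<^bsub>D\<^esub> H.sw D (\<lambda>\<gamma> \<delta> u v. H.sw D (\<lambda>\<gamma>' \<delta>' u' v'. ?kl \<gamma> \<delta> \<gamma>' \<delta>' \<odot>\<^bsub>D\<^esub> N u v x2 u' v' y2) y1) x1"
      unfolding H.sw_mult[OF mD exchange_inner_bilinear[OF fc H.m_closed[OF c(2,4)]] c(1,3)]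
    proof (intro arg_cong[of _ _ "\<lambda>z. \<omega> \<beta> \<alpha>' \<odot>\<^bsub>D\<^esub> z"] H.sw_cong)
      fix \<gamma> \<delta> u v \<gamma>' \<delta>' u' v'
      assume h': "u \<in> homog H \<gamma>" "v \<in> homog H \<delta>" "u' \<in> homog H \<gamma>'" "v' \<in> homog H \<delta>'"
      note c' = hc(1)[OF h'(1)] hc(1)[OF h'(2)] hc(1)[OF h'(3)] hc(1)[OF h'(4)]
      \<comment> \<open>The inverse antipode reverses the product of \<open>u\<close> and
        \<open>u'\<close> with the sign \<open>\<omega> \<gamma> \<gamma>'\<close>; the reversal
        makes the translation by \<open>u\<close> act first, as in \<open>N\<close>. Left and right
        translations commute.\<close>
      have "Lt (x2 \<otimes>\<^bsub>H\<^esub> y2) (Rt (Sinv (u \<otimes>\<^bsub>H\<^esub> u')) f) =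
          \<omega> \<gamma> \<gamma>' \<odot>\<^bsub>H0\<^esub> Lt y2 (Rt (Sinv u') (Lt x2 (Rt (Sinv u) f)))"
        using c c' fc
        by (simp add: Sinv_mult[OF h'(1,3)] linear_map_smult[OF translate_linear_left(1)[OF fc] oc]
            linear_map_smult[OF translate_linear_right(2) oc] right_translate_right left_translate_left
            translate_closed Sinv_closed translate_commute)
      then have "p (v \<otimes>\<^bsub>H\<^esub> v') (Lt (x2 \<otimes>\<^bsub>H\<^esub> y2) (Rt (Sinv (u \<otimes>\<^bsub>H\<^esub> u')) f)) = \<omega> \<gamma> \<gamma>' \<odot>\<^bsub>D\<^esub> N u v x2 u' v' y2"
        unfolding N_def using c c' fc
        by (simp add: linear_map_smult[OF bilinear_mapD(2)[OF pure_tensor_bilinear[OF md(1,2)]] oc] translate_closed Sinv_closed)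
      then show "\<omega> \<delta> \<gamma>' \<odot>\<^bsub>D\<^esub> (\<omega> (\<phi> + (\<gamma> + \<gamma>')) (\<gamma> + \<gamma>' + (\<delta> + \<delta>')) \<odot>\<^bsub>D\<^esub>
          p (v \<otimes>\<^bsub>H\<^esub> v') (Lt (x2 \<otimes>\<^bsub>H\<^esub> y2) (Rt (Sinv (u \<otimes>\<^bsub>H\<^esub> u')) f))) = ?kl \<gamma> \<delta> \<gamma>' \<delta>' \<odot>\<^bsub>D\<^esub> N u v x2 u' v' y2"
        using Nc[OF c'(1,2) c(2) c'(3,4) c(4)] by (simp add: D.smult_assoc1 oc mc)
    qed
    also have "\<dots> = H.sw D (\<lambda>\<gamma> \<delta> u v. \<omega> \<beta> \<alpha>' \<odot>\<^bsub>D\<^esub> H.sw D (\<lambda>\<gamma>' \<delta>' u' v'. ?kl \<gamma> \<delta> \<gamma>' \<delta>' \<odot>\<^bsub>D\<^esub> N u v x2 u' v' y2) y1) x1"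
      by (rule H.sw_comp[OF mD mD b2 w c(1)]) (intro oc mc c)+
    also have "\<dots> = H.sw D (\<lambda>\<gamma> \<delta> u v. H.sw D (\<lambda>\<gamma>' \<delta>' u' v'.
      (\<omega> \<beta> \<alpha>' \<otimes> ?kl \<gamma> \<delta> \<gamma>' \<delta>') \<odot>\<^bsub>D\<^esub> N u v x2 u' v' y2) y1) x1"
    proof (rule H.sw_cong)
      fix \<gamma> \<delta> u v assume "u \<in> homog H \<gamma>" "v \<in> homog H \<delta>"
      then have uv: "u \<in> carrier H" "v \<in> carrier H" by (simp_all add: hc)
      let ?l = "\<omega> \<beta> \<alpha>' \<odot>\<^bsub>D\<^esub> H.sw D (\<lambda>\<gamma>' \<delta>' u' v'. ?kl \<gamma>
          \<delta> \<gamma>' \<delta>' \<odot>\<^bsub>D\<^esub> N u v x2 u' v' y2) y1"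
        and ?r = "H.sw D (\<lambda>\<gamma>' \<delta>' u' v'. (\<omega> \<beta> \<alpha>' \<otimes> ?kl \<gamma> \<delta>
          \<gamma>' \<delta>') \<odot>\<^bsub>D\<^esub> N u v x2 u' v' y2) y1"
      have "?l = H.sw D (\<lambda>\<gamma>' \<delta>' u' v'. \<omega> \<beta> \<alpha>' \<odot>\<^bsub>D\<^esub> (?kl \<gamma> \<delta> \<gamma>' \<delta>' \<odot>\<^bsub>D\<^esub> N u v x2 u' v' y2)) y1"
        by (rule H.sw_comp[OF mD mD b1 w c(3)]) (intro oc mc c uv)+
      also have "\<dots> = ?r"
        by (intro H.sw_cong D.smult_assoc1[symmetric] oc mc Nc uv c hc(1))
      finally show "?l = ?r" .
    qed
    finally show "H.sw D (\<lambda>\<gamma> \<delta> u v. H.sw D (\<lambda>\<gamma>' \<delta>' u' v'.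
      (\<omega> \<beta> \<alpha>' \<otimes> ?kl \<gamma> \<delta> \<gamma>' \<delta>') \<odot>\<^bsub>D\<^esub> N u v x2 u' v' y2) y1) x1 =
      \<omega> \<beta> \<alpha>' \<odot>\<^bsub>D\<^esub> H.sw D (\<lambda>\<gamma> \<delta> u v.
        \<omega> (\<phi> + \<gamma>) (\<gamma> + \<delta>) \<odot>\<^bsub>D\<^esub> p v (Lt (x2 \<otimes>\<^bsub>H\<^esub> y2) (Rt (Sinv u) f))) (x1 \<otimes>\<^bsub>H\<^esub> y1)" by simp
  qed
  also have "\<dots> = \<psi> (q f (x \<otimes>\<^bsub>H\<^esub> y))"
    unfolding exchange_homog[OF f H.m_closed[OF x y]] H.sw_mult[OF mD exchange_outer_bilinear[OF fc] x y] ..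
  finally show ?thesis by simp
qed

text \<open>Both sides are sums over five legs \<open>u\<close>, \<open>s\<close>, \<open>z\<close>,
  \<open>w\<close>, \<open>e\<close> of \<open>x\<close>, in this order, with the same term
  \<open>U\<close>. Each is rebracketed by coassociativity to \<open>?C\<close>, where the coproduct
  is always applied to the first leg again.\<close>

lemma exchange_mult_left:
  assumes f: "f \<in> homog H0 \<phi>" and g: "g \<in> homog H0 \<chi>" and x: "x \<in> carrier H"
  shows "\<psi> (q (f \<otimes>\<^bsub>H0\<^esub> g) x) = twist_op K H H0 \<psi> f (\<psi> (q g x))"
proof -
  note fc = hc(2)[OF f] and gc = hc(2)[OF g] and oc = H.factor_closed and mc = H.scalar_ac(4)
  interpret D: module K D by (rule mD)
  define U where "U k u s z w e = k \<odot>\<^bsub>D\<^esub> p z (Lt w (Rt (Sinv s) f) \<otimes>\<^bsub>H0\<^esub> Lt e (Rt (Sinv u) g))" for k u s z w e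
  have U1: "linear_map K H D (\<lambda>u. U k u s z w e)"
    if "k \<in> carrier K" "s \<in> carrier H" "z \<in> carrier H" "w \<in> carrier H" "e \<in> carrier H" for k s z w e
    unfolding U_def using that by (intro lin) (simp_all add: cl fc gc)
  have U2: "linear_map K H D (\<lambda>s. U k u s z w e)"
    if "k \<in> carrier K" "u \<in> carrier H" "z \<in> carrier H" "w \<in> carrier H" "e \<in> carrier H" for k u z w e
    unfolding U_def using that by (intro lin) (simp_all add: cl fc gc)
  have U3: "linear_map K H D (\<lambda>z. U k u s z w e)"
    if "k \<in> carrier K" "u \<in> carrier H" "s \<in> carrier H" "w \<in> carrier H" "e \<in> carrier H" for k u s w e
    unfolding U_def using that by (intro lin) (simp_all add: cl fc gc)
  have U4: "linear_map K H D (\<lambda>w. U k u s z w e)"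
    if "k \<in> carrier K" "u \<in> carrier H" "s \<in> carrier H" "z \<in> carrier H" "e \<in> carrier H" for k u s z e
    unfolding U_def using that by (intro lin) (simp_all add: cl fc gc)
  have U5: "linear_map K H D (\<lambda>e. U k u s z w e)"
    if "k \<in> carrier K" "u \<in> carrier H" "s \<in> carrier H" "z \<in> carrier H" "w \<in> carrier H" for k u s z w
    unfolding U_def using that by (intro lin) (simp_all add: cl fc gc)
  note Ulin = graded_bilinearI graded_trilinearI H.sw_linear[OF mD] H.sw_param_linear[OF mD] linear_map_id
    linear_map_homog_part[OF gr(1)] homog_part_module[OF gr(1)] md(1) U1 U2 U3 U4 U5
  note hcs = homog_part_simps hc(1)
  \<comment> \<open>The product of the signs of \<psi> at \<open>f\<close>, applied to the second
    leg \<open>v\<close> of the first part of \<open>x\<close>, and of \<psi> at \<open>g\<close>;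
    the degree of \<open>v\<close> is written as \<open>b + c + d\<close>, the sum over its own
    legs.\<close>
  let ?Z = "\<lambda>a b c d. \<omega> (\<phi> + b) (b + c) \<otimes> \<omega> (\<chi> + a) (a + (b + c + d))"
  let ?C = "H.sw D (\<lambda>\<alpha> _ x1 e. H.sw D (\<lambda>\<beta> d y w. H.sw D (\<lambda>\<gamma> c t z. H.sw D (\<lambda>a b u s.
      U (?Z a b c d) u s z w e) t) y) x1) x"
  have Zc: "?Z a b c d \<in> carrier K" for a b c d by (intro oc mc)
  have "twist_op K H H0 \<psi> f (\<psi> (q g x)) = ?C"
  proof -
    have "twist_op K H H0 \<psi> f (\<psi> (q g x)) = H.sw D (\<lambda>\<alpha> \<beta> x1 e. H.sw D (\<lambda>a \<delta> u v.
        \<omega> (\<chi> + a) (a + \<delta>) \<odot>\<^bsub>D\<^esub> twist_op K H H0 \<psi> f (p v (Lt e (Rt (Sinv u) g)))) x1) x"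
      by (rule exchange_comp[OF g x tw.twist_op_linear[OF fc]])
    also have "\<dots> = H.sw D (\<lambda>\<alpha> \<beta> x1 e. H.sw D (\<lambda>a \<delta> u v. H.sw D (\<lambda>\<alpha>' d v1 w. H.sw D (\<lambda>b c s z.
        U (\<omega> (\<phi> + b) (b + c) \<otimes> \<omega> (\<chi> + a) (a + \<delta>)) u s z w e) v1) v) x1) x"
    proof (rule H.sw_cong, rule H.sw_cong)
      fix \<alpha> \<beta> x1 e a \<delta> u v
      assume h: "x1 \<in> homog H \<alpha>" "e \<in> homog H \<beta>" "u \<in> homog H a" "v \<in> homog H \<delta>"
      note c = hc(1)[OF h(2)] hc(1)[OF h(3)] hc(1)[OF h(4)]
      let ?h = "Lt e (Rt (Sinv u) g)"
      have h': "?h \<in> carrier H0" using c gc by (intro translate_closed Sinv_closed)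
      have F': "linear_map K D D (\<lambda>z. \<omega> (\<chi> + a) (a + \<delta>) \<odot>\<^bsub>D\<^esub> right_op K H H0 ?h z)"
        by (intro linear_map_const_smult[OF mD] tw.right_op_linear h' oc)
      let ?l = "\<omega> (\<chi> + a) (a + \<delta>) \<odot>\<^bsub>D\<^esub> twist_op K H H0 \<psi> f (p v ?h)"
        and ?r = "H.sw D (\<lambda>\<alpha>' d v1 w. H.sw D (\<lambda>b c s z. U (\<omega> (\<phi> + b) (b + c) \<otimes>
          \<omega> (\<chi> + a) (a + \<delta>)) u s z w e) v1) v"
      have "?l = \<omega> (\<chi> + a) (a + \<delta>) \<odot>\<^bsub>D\<^esub> right_op K H H0 ?h (\<psi> (q f v))"
        by (simp add: tw.twist_op_pure[OF fc c(3) h'])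
      also have "\<dots> = H.sw D (\<lambda>\<alpha>' d v1 w. H.sw D (\<lambda>b c s z. \<omega> (\<phi> + b) (b + c) \<odot>\<^bsub>D\<^esub>
          (\<omega> (\<chi> + a) (a + \<delta>) \<odot>\<^bsub>D\<^esub> right_op K H H0 ?h (p z (Lt w (Rt (Sinv s) f))))) v1) v"
        by (rule exchange_comp[OF f c(3) F'])
      also have "\<dots> = ?r"
      proof (rule H.sw_cong, rule H.sw_cong)
        fix \<alpha>' d v1 w b c s z
        assume "v1 \<in> homog H \<alpha>'" "w \<in> homog H d" "s \<in> homog H b" "z \<in> homog H c"
        then have c': "w \<in> carrier H" "s \<in> carrier H" "z \<in> carrier H" by (simp_all add: hc)
        have fw: "Lt w (Rt (Sinv s) f) \<in> carrier H0" using c' fc by (intro translate_closed Sinv_closed)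
        show "\<omega> (\<phi> + b) (b + c) \<odot>\<^bsub>D\<^esub> (\<omega> (\<chi> + a) (a + \<delta>) \<odot>\<^bsub>D\<^esub> right_op K H H0 ?h (p z (Lt w (Rt (Sinv s) f)))) =
            U (\<omega> (\<phi> + b) (b + c) \<otimes> \<omega> (\<chi> + a) (a + \<delta>)) u s z w e"
          unfolding U_def tw.right_op_pure[OF h' c'(3) fw]
          by (intro D.smult_assoc1[symmetric] oc pure_tensor_closed[OF md(1,2)] H0.m_closed fw h' c')
      qed
      finally show "?l = ?r" .
    qed
    \<comment> \<open>The degree \<open>\<delta>\<close> of \<open>v\<close> is replaced by the
      degrees of its legs \<open>s\<close>, \<open>z\<close>, \<open>w\<close>, since
      \<open>v\<close> itself disappears when the sums are rebracketed.\<close>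
    also have "\<dots> = H.sw D (\<lambda>\<alpha> \<beta> x1 e. H.sw D (\<lambda>a \<delta> u v. H.sw D (\<lambda>\<alpha>' d v1 w. H.sw D (\<lambda>b c s z.
        U (?Z a b c d) u s z w e) v1) v) x1) x"
    proof (rule H.sw_cong, rule H.sw_cong)
      fix \<alpha> \<beta> x1 e a \<delta> u v
      assume h: "x1 \<in> homog H \<alpha>" "e \<in> homog H \<beta>" "u \<in> homog H a" "v \<in> homog H \<delta>"
      note c = hc(1)[OF h(2)] hc(1)[OF h(3)]
      have b1: "graded_bilinear K H H D (\<lambda>b c s z. U (k b c) u s z w e)"
        if "\<And>b c. k b c \<in> carrier K" "w \<in> carrier H" for k w
        using that c by (intro Ulin) (simp_all add: hcs)
      have b2: "graded_bilinear K H H D (\<lambda>\<alpha>' d v1 w. H.sw D (\<lambda>b c s z. U (k b c d) u s z w e) v1)"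
        if "\<And>b c d. k b c d \<in> carrier K" for k
        using that c by (intro Ulin) (simp_all add: hcs)
      show "H.sw D (\<lambda>\<alpha>' d v1 w. H.sw D (\<lambda>b c s z. U (\<omega> (\<phi> + b) (b + c) \<otimes> \<omega> (\<chi> + a) (a + \<delta>)) u s z w e) v1) v =
          H.sw D (\<lambda>\<alpha>' d v1 w. H.sw D (\<lambda>b c s z. U (?Z a b c d) u s z w e) v1) v"
      proof (rule H.sw_homog_cong[OF mD b2 b2 h(4)])
        fix \<alpha>' d v1 w assume h': "v1 \<in> homog H \<alpha>'" "w \<in> homog H d" and e1: "\<alpha>' + d = \<delta>"
        show "H.sw D (\<lambda>b c s z. U (\<omega> (\<phi> + b) (b + c) \<otimes> \<omega> (\<chi> + a) (a + \<delta>)) u s z w e) v1 =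
            H.sw D (\<lambda>b c s z. U (?Z a b c d) u s z w e) v1"
        proof (rule H.sw_homog_cong[OF mD b1 b1 h'(1)])
          fix b c s z assume e2: "b + c = \<alpha>'"
          show "U (\<omega> (\<phi> + b) (b + c) \<otimes> \<omega> (\<chi> + a) (a + \<delta>)) u s z w e = U (?Z a b c d) u s z w e"
            unfolding e1[symmetric] e2[symmetric] ..
        qed (intro oc mc hc(1)[OF h'(2)])+
      qed (intro oc mc)+
    qed
    \<comment> \<open>Coassociativity for the three legs of \<open>x1\<close>: splitting off
      \<open>w\<close> now precedes splitting off \<open>u\<close>.\<close>
    also have "\<dots> = H.sw D (\<lambda>\<alpha> \<beta> x1 e. H.sw D (\<lambda>\<alpha>' d y w. H.sw D (\<lambda>a \<delta> u v. H.sw D (\<lambda>b c s z.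
        U (?Z a b c d) u s z w e) v) y) x1) x"
    proof (rule H.sw_cong)
      fix \<alpha> \<beta> x1 e assume "x1 \<in> homog H \<alpha>" "e \<in> homog H \<beta>"
      then have c: "x1 \<in> carrier H" "e \<in> carrier H" by (simp_all add: hc)
      have t: "graded_trilinear K H D (\<lambda>a \<delta> d u v w. H.sw D (\<lambda>b c s z. U (?Z a b c d) u s z w e) v)"
        using c Zc by (intro Ulin) (simp_all add: hcs)
      show "H.sw D (\<lambda>a \<delta> u v. H.sw D (\<lambda>\<alpha>' d v1 w. H.sw D (\<lambda>b c s z. U (?Z a b c d) u s z w e) v1) v) x1 =
          H.sw D (\<lambda>\<alpha>' d y w. H.sw D (\<lambda>a \<delta> u v. H.sw D (\<lambda>b c s z. U (?Z a b c d) u s z w e) v) y) x1"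
        by (rule H.sw_coassoc[OF mD t c(1), symmetric])
    qed
    \<comment> \<open>Coassociativity once more, for the legs \<open>u\<close>, \<open>s\<close>,
      \<open>z\<close> of \<open>y\<close>.\<close>
    also have "\<dots> = ?C"
    proof (rule H.sw_cong, rule H.sw_cong)
      fix \<alpha> \<beta> x1 e \<alpha>' d y w
      assume "x1 \<in> homog H \<alpha>" "e \<in> homog H \<beta>" "y \<in> homog H \<alpha>'" "w \<in> homog H d"
      then have c: "e \<in> carrier H" "y \<in> carrier H" "w \<in> carrier H" by (simp_all add: hc)
      have t: "graded_trilinear K H D (\<lambda>a b c u s z. U (?Z a b c d) u s z w e)"
        using c Zc by (intro Ulin) (simp_all add: hcs)
      show "H.sw D (\<lambda>a \<delta> u v. H.sw D (\<lambda>b c s z. U (?Z a b c d) u s z w e) v) y =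
          H.sw D (\<lambda>\<gamma> c t z. H.sw D (\<lambda>a b u s. U (?Z a b c d) u s z w e) t) y"
        by (rule H.sw_coassoc[OF mD t c(2), symmetric])
    qed
    finally show ?thesis .
  qed
  moreover have "\<psi> (q (f \<otimes>\<^bsub>H0\<^esub> g) x) = ?C"
  proof -
    have fg: "f \<otimes>\<^bsub>H0\<^esub> g \<in> homog H0 (\<phi> + \<chi>)" by (rule H0.mult_homog[OF f g])
    note fgc = hc(2)[OF fg]
    let ?k = "\<lambda>\<gamma> c a b d. \<omega> \<chi> d \<otimes> (\<omega> (\<phi> + \<chi> + \<gamma>) (\<gamma> + c) \<otimes> \<omega> a (\<phi> + d + b))"
    \<comment> \<open>The inner sum of the formula for \<psi> as a linear function of the left
      translate \<open>h\<close>. By \<open>translate_commute\<close> the right translation can act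
      last, so the expansion of a left translate of a product can be inserted for
      \<open>h\<close>.\<close>
    define M where "M x1 h = H.sw D (\<lambda>\<gamma> c u v. \<omega> (\<phi> + \<chi> + \<gamma>) (\<gamma> + c) \<odot>\<^bsub>D\<^esub> p v (Rt (Sinv u) h)) x1" for x1 h
    have Mb: "graded_bilinear K H H D (\<lambda>\<gamma> c u v. \<omega> (\<phi> + \<chi> + \<gamma>) (\<gamma> + c) \<odot>\<^bsub>D\<^esub> p v (Rt (Sinv u) h))"
      if "h \<in> carrier H0" for h
      using that by (intro lin) (simp_all add: cl)
    have M: "linear_map K H0 D (M x1)" if "x1 \<in> carrier H" for x1
      unfolding M_def using that md(2) by (intro lin) (simp_all add: cl)
    have "\<psi> (q (f \<otimes>\<^bsub>H0\<^esub> g) x) = H.sw D (\<lambda>\<alpha> \<beta> x1 x2. M x1 (Lt x2 (f \<otimes>\<^bsub>H0\<^esub> g))) x"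
      unfolding exchange_homog[OF fg x] M_def
      by (intro H.sw_cong) (simp add: translate_commute fgc Sinv_closed hc(1))
    also have "\<dots> = H.sw D (\<lambda>\<alpha> \<beta> x1 x2. H.sw D (\<lambda>d \<beta>' w e. H.sw D (\<lambda>\<gamma> c u v. H.sw D (\<lambda>a b s t.
        U (?k \<gamma> c a b d) s t v w e) u) x1) x2) x"
    proof (rule H.sw_cong)
      fix \<alpha> \<beta> x1 x2 assume "x1 \<in> homog H \<alpha>" "x2 \<in> homog H \<beta>"
      then have c: "x1 \<in> carrier H" "x2 \<in> carrier H" by (simp_all add: hc)
      have lb: "graded_bilinear K H H H0 (\<lambda>d _ w e. \<omega> \<chi> d \<odot>\<^bsub>H0\<^esub> (Lt w f \<otimes>\<^bsub>H0\<^esub> Lt e g))"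
        by (intro graded_bilinearI linear_map_const_smult[OF md(2)] linear_map_mult_left[OF H0.aH]
            linear_map_mult_right[OF H0.aH] linear_map_comp[OF translate_linear_left(2)]
            linear_map_homog_id[OF gr(1)] oc) (simp_all add: cl fc gc)
      let ?l = "M x1 (Lt x2 (f \<otimes>\<^bsub>H0\<^esub> g))"
        and ?r = "H.sw D (\<lambda>d \<beta>' w e. H.sw D (\<lambda>\<gamma> c u v. H.sw D (\<lambda>a b s t. U (?k \<gamma> c a
          b d) s t v w e) u) x1) x2"
      have "?l = H.sw D (\<lambda>d _ w e. M x1 (\<omega> \<chi> d \<odot>\<^bsub>H0\<^esub> (Lt w f \<otimes>\<^bsub>H0\<^esub> Lt e g))) x2"
        unfolding left_translate_mult[OF fc g c(2)] by (rule H.sw_comp[OF md(2) mD lb M[OF c(1)] c(2)])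
      also have "\<dots> = ?r"
      proof (rule H.sw_cong)
        fix d \<beta>' w e assume h: "w \<in> homog H d" "e \<in> homog H \<beta>'"
        note we = hc(1)[OF h(1)] hc(1)[OF h(2)]
        note Lh = translate_homog(2)[OF f h(1)] translate_homog(2)[OF g h(2)]
        note Lc = hc(2)[OF Lh(1)] hc(2)[OF Lh(2)]
        have w': "linear_map K D D (\<lambda>z. \<omega> \<chi> d \<odot>\<^bsub>D\<^esub> z)" by (intro linear_map_const_smult[OF mD] linear_map_id oc)
        let ?l = "M x1 (\<omega> \<chi> d \<odot>\<^bsub>H0\<^esub> (Lt w f \<otimes>\<^bsub>H0\<^esub> Lt e g))"
          and ?r = "H.sw D (\<lambda>\<gamma> c u v. H.sw D (\<lambda>a b s t. U (?k \<gamma> c a b d) s t v w e) u) x1"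
        have "?l = \<omega> \<chi> d \<odot>\<^bsub>D\<^esub> M x1 (Lt w f \<otimes>\<^bsub>H0\<^esub> Lt e g)"
          by (rule linear_map_smult[OF M[OF c(1)] oc H0.m_closed[OF Lc]])
        also have "\<dots> = H.sw D (\<lambda>\<gamma> c u v. \<omega> \<chi> d \<odot>\<^bsub>D\<^esub> (\<omega> (\<phi> + \<chi> + \<gamma>) (\<gamma> + c) \<odot>\<^bsub>D\<^esub>
            p v (Rt (Sinv u) (Lt w f \<otimes>\<^bsub>H0\<^esub> Lt e g)))) x1"
          unfolding M_def by (rule H.sw_comp[OF mD mD Mb[OF H0.m_closed[OF Lc]] w' c(1)])
        also have "\<dots> = ?r"
        proof (rule H.sw_cong)
          fix \<gamma> c u v assume "u \<in> homog H \<gamma>" "v \<in> homog H c"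
          then have uv: "u \<in> carrier H" "v \<in> carrier H" by (simp_all add: hc)
          let ?F = "\<lambda>h. \<omega> \<chi> d \<odot>\<^bsub>D\<^esub> (\<omega> (\<phi> + \<chi> + \<gamma>) (\<gamma> + c) \<odot>\<^bsub>D\<^esub> p v h)"
          have F': "linear_map K H0 D ?F"
            by (intro linear_map_const_smult[OF mD] linear_map_pure_right[OF md(1,2)] linear_map_id oc uv)
          have rb: "graded_bilinear K H H H0 (\<lambda>a b s t. \<omega> a (\<phi> + d + b) \<odot>\<^bsub>H0\<^esub>
              (Rt (Sinv t) (Lt w f) \<otimes>\<^bsub>H0\<^esub> Rt (Sinv s) (Lt e g)))"
            by (intro graded_bilinearI linear_map_const_smult[OF md(2)] linear_map_mult_left[OF H0.aH]
                linear_map_mult_right[OF H0.aH] linear_map_comp[OF translate_linear_left(1)] linear_map_comp[OF Sinv_linear]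
                linear_map_homog_id[OF gr(1)] oc) (simp_all add: cl Lc)
          let ?l = "?F (Rt (Sinv u) (Lt w f \<otimes>\<^bsub>H0\<^esub> Lt e g))"
            and ?r = "H.sw D (\<lambda>a b s t. U (?k \<gamma> c a b d) s t v w e) u"
          have "?l = H.sw D (\<lambda>a b s t. ?F (\<omega> a (\<phi> + d + b) \<odot>\<^bsub>H0\<^esub>
              (Rt (Sinv t) (Lt w f) \<otimes>\<^bsub>H0\<^esub> Rt (Sinv s) (Lt e g)))) u"
            unfolding right_translate_mult[OF Lh uv(1)] by (rule H.sw_comp[OF md(2) mD rb F' uv(1)])
          also have "\<dots> = ?r"
          proof (rule H.sw_cong)
            fix a b s t assume "s \<in> homog H a" "t \<in> homog H b"
            then have st: "s \<in> carrier H" "t \<in> carrier H" by (simp_all add: hc)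
            have m: "Lt w (Rt (Sinv t) f) \<otimes>\<^bsub>H0\<^esub> Lt e (Rt (Sinv s) g) \<in> carrier H0"
              using st we fc gc by (intro H0.m_closed translate_closed Sinv_closed)
            have pc: "p v (Lt w (Rt (Sinv t) f) \<otimes>\<^bsub>H0\<^esub> Lt e (Rt (Sinv s) g)) \<in> carrier D"
              by (intro pure_tensor_closed[OF md(1,2)] uv m)
            show "?F (\<omega> a (\<phi> + d + b) \<odot>\<^bsub>H0\<^esub> (Rt (Sinv t) (Lt w f) \<otimes>\<^bsub>H0\<^esub> Rt (Sinv s) (Lt e g))) =
                U (?k \<gamma> c a b d) s t v w e"
              unfolding U_def translate_commute[OF fc we(1) Sinv_closed[OF st(2)], symmetric]
                translate_commute[OF gc we(2) Sinv_closed[OF st(1)], symmetric]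
                linear_map_smult[OF bilinear_mapD(2)[OF pure_tensor_bilinear[OF md(1,2)] uv(2)] oc m]
              using pc by (simp add: D.smult_assoc1 oc mc)
          qed
          finally show "?l = ?r" .
        qed
        finally show "?l = ?r" .
      qed
      finally show "?l = ?r" .
    qed
    \<comment> \<open>Here the five legs are named \<open>s\<close>, \<open>t\<close>,
      \<open>v\<close>, \<open>w\<close>, \<open>e\<close>. The homogeneous \<open>u\<close> splits
      into \<open>s\<close> and \<open>t\<close>, so \<open>\<gamma> = a + b\<close> and
      \<open>exchange_mult_sign\<close> applies.\<close>
    also have "\<dots> = H.sw D (\<lambda>\<alpha> \<beta> x1 x2. H.sw D (\<lambda>d \<beta>' w e. H.sw D (\<lambda>\<gamma> c u v. H.sw D (\<lambda>a b s t.
        U (?Z a b c d) s t v w e) u) x1) x2) x"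
    proof (rule H.sw_cong, rule H.sw_cong, rule H.sw_cong)
      fix \<alpha> \<beta> x1 x2 d \<beta>' w e \<gamma> c u v
      assume h: "x1 \<in> homog H \<alpha>" "x2 \<in> homog H \<beta>" "w \<in> homog H d" "e \<in> homog H \<beta>'" "u \<in> homog H \<gamma>" "v \<in> homog H c"
      have b: "graded_bilinear K H H D (\<lambda>a b s t. U (k a b) s t v w e)" if "\<And>a b. k a b \<in> carrier K" for k
        using that hc(1)[OF h(3)] hc(1)[OF h(4)] hc(1)[OF h(6)] by (intro Ulin) (simp_all add: hcs)
      show "H.sw D (\<lambda>a b s t. U (?k \<gamma> c a b d) s t v w e) u = H.sw D (\<lambda>a b s t. U (?Z a b c d) s t v w e) u"
      proof (rule H.sw_homog_cong[OF mD b b h(5)])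
        fix a b s t assume e: "a + b = \<gamma>"
        show "U (?k \<gamma> c a b d) s t v w e = U (?Z a b c d) s t v w e"
          unfolding e[symmetric] H.exchange_mult_sign ..
      qed (intro oc mc)+
    qed
    also have "\<dots> = ?C"
    proof -
      \<comment> \<open>The legs \<open>w\<close> and \<open>e\<close> come from the second half of
        \<open>x\<close>; one coassociativity, for the triple \<open>x1\<close>, \<open>w\<close>,
        \<open>e\<close>, gives the bracketing of \<open>?C\<close>.\<close>
      have t: "graded_trilinear K H D (\<lambda>\<alpha> d \<beta>' x1 w e. H.sw D (\<lambda>\<gamma> c u v. H.sw D (\<lambda>a b s t.
        U (?Z a b c d) s t v w e) u) x1)"
        using Zc by (intro Ulin) (simp_all add: hcs)
      show ?thesis by (rule H.sw_coassoc[OF mD t x, symmetric])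
    qed
    finally show ?thesis .
  qed
  ultimately show ?thesis by simp
qed

lemma twisted_algebra_double: "twisted_algebra K H H0 \<psi>"
  using twisted_pair_double
  by (intro twisted_algebra.intro twisted_algebra_axioms.intro exchange_degree exchange_one_left exchange_one_right
      exchange_mult_left exchange_mult_right)

end

theorem theoremA12:
  fixes K :: "('k, 'q) ring_scheme"
    and \<omega> :: "'g::ab_group_add \<Rightarrow> 'g \<Rightarrow> 'k"
    and H :: "('k, 'a, 'g) hopf_algebra"
    and H0 :: "('k, 'a \<Rightarrow> 'k, 'g) hopf_algebra"
  assumes "hopf_algebra K \<omega> H"
    and "proper K H"
    and "bij_betw (antipode H) (carrier H) (carrier H)"
    and "opposite_finite_dual K \<omega> H H0"
  shows "graded_algebra K (drinfeld_double K \<omega> H H0)"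
proof -
  have "hopf_algebra K \<omega> H0" using assms(4) by (simp add: opposite_finite_dual_def)
  then interpret dual_pair K \<omega> H H0
    using assms(1,3,4) by (intro dual_pair.intro sweedler.intro dual_pair_axioms.intro)
  show ?thesis
    unfolding drinfeld_double_def by (rule twisted_algebra.twisted_tensor_algebra[OF twisted_algebra_double])
qed

end
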